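(* Let $0<\varepsilon\le1$ and let $\mathfrak a$, $u$, $f$ be the coefficient, the function and the forcing constructed in the context. Let $E_0$ denote extension by zero in the spatial variable from $(0,\pi)$ to $\mathbb R$, and set $\widetilde u:=E_0u$ and $\widetilde f:=E_0f$. With the coefficient $\mathfrak a$ on $[0,1]\times\mathbb R$, the function $\widetilde u$ is the Lions variational solution on $\mathbb R$ with forcing $\widetilde f$ (and zero initial value), that is, of $\partial_t\widetilde u-\partial_x(\mathfrak a\,\partial_x\widetilde u)=\widetilde f$ on $(0,1)\times\mathbb R$. Moreover, $\mathfrak a$ is bounded, uniformly elliptic, and belongs to $C^{0,1/2}([0,1];L^\infty(\mathbb R))$, but $$\partial_t\widetilde u\notin L^2(0,1;L^2(\mathbb R)).$$
   Context: Let $H=L^2((0,\pi);\mathbb C)$, $V=H_0^1((0,\pi);\mathbb C)$ with norm $\|v\|_V=\|\partial_xv\|_{L^2(0,\pi)}$, and $V'=H^{-1}((0,\pi);\mathbb C)$ the anti-dual of $V$ (Gelfand triple $V\hookrightarrow H\hookrightarrow V'$). Construction. Set $\phi(x)=\sin^2x$ and, for integers $K>2$, $p_K(x)=\sin(Kx)\sin(2x)$. For integers $j\ge1$ set $\tau_j=\frac5{16}-\frac1{16j}$, $\ell_j=\tau_{j+1}-\tau_j=\frac1{16j(j+1)}$, $M_j=j$, $I_j=(\tau_j,\tau_{j+1})$. Fix $\eta\in C_c^\infty(0,1)$ with $0\le\eta\le1$, $\operatorname{supp}\eta\subset[1/10,9/10]$, $\eta=1$ on $[1/3,2/3]$, and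 put $\eta_j(t)=\eta((t-\tau_j)/\ell_j)$ (zero outside $I_j$). For $1\le m\le M_j$ put $K_{j,m}=16^m\ell_j^{-1}=16^{m+1}j(j+1)$ and $\theta_{j,m}(t)=K_{j,m}^2(t-\tau_j)$. Define on $\mathbb R^2$ $$\beta(t,x)=\sum_{j=1}^\infty\sum_{m=1}^{M_j}\eta_j(t)K_{j,m}^{-1}\sin\theta_{j,m}(t)\cos(K_{j,m}x),\qquad \mathfrak a(t,x)=1+\varepsilon\beta(t,x)$$ (a finite sum at each point). Fix a real-valued $\rho\in C_c^\infty(0,1)$ with $\rho=1$ on $[1/4,1/2]$, and set $$y_{j,m}(t)=-\frac{\varepsilon}{2K_{j,m}^2}\eta_j(t)\big(\sin\theta_{j,m}(t)-\cos\theta_{j,m}(t)\big),\qquad u(t,x)=\rho(t)\phi(x)+\sum_{j=1}^\infty\sum_{m=1}^{M_j}y_{j,m}(t)p_{K_{j,m}}(x)$$ for $(t,x)\in[0,1]\times(0,\pi)$. With $\mathcal A(t):V\to V'$, $\langle\mathcal A(t)v,w\rangle_{V',V}=\int_0^\pi\mathfrak a(t,x)\partial_xv\,\overline{\partial_xw}\,dx$, set $f(t):=\partial_tu(t)+\mathcal A(t)u(t)$ for $t\in[0,1]$. It is known that $u\in C([0,1];V)\cap C^1([0,1];V')$, $u(0)=0$, and $f\in C([0,1];H)$. The Lions variational solution on $\mathbb R$ with forcing $g\in L^2(0,1;L^2(\mathbb R))$ and zero initial value is the unique $w\in L^2(0,1;H^1(\mathbb R))\cap H^1(0,1;H^{-1}(\mathbb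 R))$ with $w(0)=0$ and $\partial_tw-\partial_x(\mathfrak a\,\partial_xw)=g$ in $H^{-1}(\mathbb R)$ for a.e. $t$. Uniformly elliptic means $\mathfrak a\ge\lambda$ a.e. for some constant $\lambda>0$. $C^{0,1/2}([0,1];X)$ is the space of $X$-valued bounded $\frac12$-Hölder continuous functions. *)

theory Defs
  imports "HOL-Analysis.Analysis" "HOL-Probability.Essential_Supremum"
begin

section \<open>Spaces of functions of one real variable\<close>

text \<open>
  Elements of function spaces are represented by functions on the real line of which only the
  values on \<open>S\<close> matter; two representatives of one class agree almost everywhere on \<open>S\<close>.
  A normed space is given as a carrier together with a (semi)norm that identifies
  such representatives.
\<close>

definition smooth :: "(real \<Rightarrow> 'a::real_normed_vector) \<Rightarrow> bool" where
  "smooth \<phi> \<longleftrightarrow>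
     (\<exists>D. D 0 = \<phi> \<and> (\<forall>n x. (D n has_vector_derivative D (Suc n) x) (at x)))"

definition test_functions :: "real set \<Rightarrow> (real \<Rightarrow> 'a::real_normed_vector) set" where
  "test_functions S =
     {\<phi>. smooth \<phi> \<and> compact (closure {x. \<phi> x \<noteq> 0}) \<and> closure {x. \<phi> x \<noteq> 0} \<subseteq> S}"

definition L2 :: "real set \<Rightarrow> (real \<Rightarrow> complex) set" where
  "L2 S = {v. v \<in> borel_measurable (lebesgue_on S)
            \<and> integrable (lebesgue_on S) (\<lambda>x. (norm (v x))\<^sup>2)}"

definition L2_inner :: "real set \<Rightarrow> (real \<Rightarrow> complex) \<Rightarrow> (real \<Rightarrow> complex) \<Rightarrow> complex" where
  "L2_inner S v w = (\<integral>x. v x * cnj (w x) \<partial>lebesgue_on S)"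

definition L2_norm :: "real set \<Rightarrow> (real \<Rightarrow> complex) \<Rightarrow> real" where
  "L2_norm S v = sqrt (\<integral>x. (norm (v x))\<^sup>2 \<partial>lebesgue_on S)"

definition has_weak_derivative ::
    "real set \<Rightarrow> (real \<Rightarrow> complex) \<Rightarrow> (real \<Rightarrow> complex) \<Rightarrow> bool" where
  "has_weak_derivative S v v' \<longleftrightarrow>
     (\<forall>\<phi>\<in>test_functions S.
        (\<integral>x. v x * vector_derivative \<phi> (at x) \<partial>lebesgue_on S)
        = - (\<integral>x. v' x * \<phi> x \<partial>lebesgue_on S))"

definition H1 :: "real set \<Rightarrow> (real \<Rightarrow> complex) set" where
  "H1 S = {v \<in> L2 S. \<exists>v'\<in>L2 S. has_weak_derivative S v v'}"

text \<open>The weak derivative of an element of \<^term>\<open>H1 S\<close>; it is unique up to null sets.\<close>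

definition wderiv :: "real set \<Rightarrow> (real \<Rightarrow> complex) \<Rightarrow> real \<Rightarrow> complex" where
  "wderiv S v = (SOME v'. v' \<in> L2 S \<and> has_weak_derivative S v v')"

definition H1_norm :: "real set \<Rightarrow> (real \<Rightarrow> complex) \<Rightarrow> real" where
  "H1_norm S v = sqrt ((L2_norm S v)\<^sup>2 + (L2_norm S (wderiv S v))\<^sup>2)"

definition H10 :: "real set \<Rightarrow> (real \<Rightarrow> complex) set" where
  "H10 S = {v \<in> H1 S. \<forall>e>0. \<exists>\<phi>\<in>test_functions S. H1_norm S (v - \<phi>) < e}"

definition H10_norm :: "real set \<Rightarrow> (real \<Rightarrow> complex) \<Rightarrow> real" where
  "H10_norm S v = L2_norm S (wderiv S v)"

section \<open>Anti-duals\<close>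

type_synonym functional = "(real \<Rightarrow> complex) \<Rightarrow> complex"

definition antidual ::
    "(real \<Rightarrow> complex) set \<Rightarrow> ((real \<Rightarrow> complex) \<Rightarrow> real) \<Rightarrow> functional set" where
  "antidual X N = {F.
      (\<forall>v\<in>X. \<forall>w\<in>X. F (\<lambda>x. v x + w x) = F v + F w)
    \<and> (\<forall>c. \<forall>v\<in>X. F (\<lambda>x. c * v x) = cnj c * F v)
    \<and> (\<exists>C. \<forall>v\<in>X. norm (F v) \<le> C * N v)}"

definition dual_norm ::
    "(real \<Rightarrow> complex) set \<Rightarrow> ((real \<Rightarrow> complex) \<Rightarrow> real) \<Rightarrow> functional \<Rightarrow> real" where
  "dual_norm X N F = (SUP v\<in>{v\<in>X. N v \<le> 1}. norm (F v))"

text \<open>The embeddings of \<open>L\<^sup>2\<close> into the anti-duals of \<open>H\<^sup>1\<close> and \<open>H\<^sup>1\<^sub>0\<close> are both given by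
  \<^term>\<open>L2_inner S\<close>, with \<open>L\<^sup>2\<close> as pivot space.\<close>

definition elliptic_op :: "real set \<Rightarrow> (real \<Rightarrow> real) \<Rightarrow> (real \<Rightarrow> complex) \<Rightarrow> functional" where
  "elliptic_op S a v = (\<lambda>w.
     \<integral>x. complex_of_real (a x) * wderiv S v x * cnj (wderiv S w x) \<partial>lebesgue_on S)"

definition has_dual_derivative ::
    "(real \<Rightarrow> complex) set \<Rightarrow> ((real \<Rightarrow> complex) \<Rightarrow> real) \<Rightarrow> (real \<Rightarrow> functional)
      \<Rightarrow> functional \<Rightarrow> real filter \<Rightarrow> real \<Rightarrow> bool" where
  "has_dual_derivative X N W D F t \<longleftrightarrow>
     D \<in> antidual X N
   \<and> ((\<lambda>s. dual_norm X N (\<lambda>v. (W s v - W t v) /\<^sub>R (s - t) - D v)) \<longlongrightarrow> 0) F"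

section \<open>Functions of time on the unit interval with values in a normed space\<close>

abbreviation unit_time :: "real measure" where
  "unit_time \<equiv> lebesgue_on {0<..<1}"

definition strongly_measurable ::
    "'a::minus set \<Rightarrow> ('a \<Rightarrow> real) \<Rightarrow> (real \<Rightarrow> 'a) \<Rightarrow> bool" where
  "strongly_measurable X N w \<longleftrightarrow>
     (\<exists>s. (\<forall>n. simple_function unit_time (s n) \<and> (\<forall>t. s n t \<in> X))
        \<and> (AE t in unit_time. (\<lambda>n. N (w t - s n t)) \<longlonglongrightarrow> 0))"

definition L2_time :: "'a::minus set \<Rightarrow> ('a \<Rightarrow> real) \<Rightarrow> (real \<Rightarrow> 'a) set" where
  "L2_time X N = {w. (AE t in unit_time. w t \<in> X) \<and> strongly_measurable X N w
                   \<and> (\<integral>\<^sup>+t. ennreal ((N (w t))\<^sup>2) \<partial>unit_time) < \<infinity>}"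

text \<open>
  Weak time derivative in the anti-dual of \<open>X\<close>: the vector identity
  \<open>\<integral> \<psi>' W dt = - \<integral> \<psi> G dt\<close>, read pointwise on \<open>X\<close> (the Bochner integral commutes with
  the evaluation at \<open>v\<close>).
\<close>

definition has_weak_time_derivative ::
    "(real \<Rightarrow> complex) set \<Rightarrow> (real \<Rightarrow> functional) \<Rightarrow> (real \<Rightarrow> functional) \<Rightarrow> bool" where
  "has_weak_time_derivative X W G \<longleftrightarrow>
     (\<forall>\<psi>\<in>test_functions {0<..<1}. \<forall>v\<in>X.
        (\<integral>t. vector_derivative \<psi> (at t) * W t v \<partial>unit_time) = - (\<integral>t. \<psi> t * G t v \<partial>unit_time))"

text \<open>\<open>W(0) = 0\<close>, in the sense of the representative of \<open>W\<close> that is continuous into the anti-dual.\<close>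

definition zero_initial_value ::
    "(real \<Rightarrow> complex) set \<Rightarrow> ((real \<Rightarrow> complex) \<Rightarrow> real) \<Rightarrow> (real \<Rightarrow> functional) \<Rightarrow> bool" where
  "zero_initial_value X N W \<longleftrightarrow>
     (\<exists>Z. (\<forall>t\<in>{0..1}. Z t \<in> antidual X N)
        \<and> (\<forall>t\<in>{0..1}. ((\<lambda>s. dual_norm X N (Z s - Z t)) \<longlongrightarrow> 0) (at t within {0..1}))
        \<and> (AE t in unit_time. \<forall>v\<in>X. Z t v = W t v)
        \<and> (\<forall>v\<in>X. Z 0 v = 0))"

section \<open>Lions variational solutions on the real line\<close>

abbreviation H1_line :: "(real \<Rightarrow> complex) set" where
  "H1_line \<equiv> H1 UNIV"

abbreviation Hm1_line :: "functional set" where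
  "Hm1_line \<equiv> antidual (H1 UNIV) (H1_norm UNIV)"

abbreviation Hm1_norm :: "functional \<Rightarrow> real" where
  "Hm1_norm \<equiv> dual_norm (H1 UNIV) (H1_norm UNIV)"

definition variational_solution ::
    "(real \<Rightarrow> real \<Rightarrow> real) \<Rightarrow> (real \<Rightarrow> real \<Rightarrow> complex) \<Rightarrow> (real \<Rightarrow> real \<Rightarrow> complex) \<Rightarrow> bool" where
  "variational_solution a g w \<longleftrightarrow>
     g \<in> L2_time (L2 UNIV) (L2_norm UNIV)
   \<and> w \<in> L2_time H1_line (H1_norm UNIV)
   \<and> (\<lambda>t. L2_inner UNIV (w t)) \<in> L2_time Hm1_line Hm1_norm
   \<and> (\<exists>w'\<in>L2_time Hm1_line Hm1_norm.
        has_weak_time_derivative H1_line (\<lambda>t. L2_inner UNIV (w t)) w'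
      \<and> (AE t in unit_time. \<forall>v\<in>H1_line.
           w' t v + elliptic_op UNIV (a t) (w t) v = L2_inner UNIV (g t) v))
   \<and> zero_initial_value H1_line (H1_norm UNIV) (\<lambda>t. L2_inner UNIV (w t))"

text \<open>\<^emph>\<open>The\<close> Lions solution is the unique variational solution.\<close>

definition is_Lions_solution ::
    "(real \<Rightarrow> real \<Rightarrow> real) \<Rightarrow> (real \<Rightarrow> real \<Rightarrow> complex) \<Rightarrow> (real \<Rightarrow> real \<Rightarrow> complex) \<Rightarrow> bool" where
  "is_Lions_solution a g w \<longleftrightarrow>
     variational_solution a g w
   \<and> (\<forall>z. variational_solution a g z \<longrightarrow>
        (AE t in unit_time. AE x in lebesgue. z t x = w t x))"

section \<open>Coefficients\<close>

definition uniformly_elliptic :: "(real \<Rightarrow> real \<Rightarrow> real) \<Rightarrow> bool" where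
  "uniformly_elliptic a \<longleftrightarrow>
     (\<exists>c>0. AE (t, x) in lebesgue_on ({0..1} \<times> UNIV). c \<le> a t x)"

definition Linf_norm :: "(real \<Rightarrow> real) \<Rightarrow> ereal" where
  "Linf_norm v = esssup lebesgue (\<lambda>x. ereal \<bar>v x\<bar>)"

definition Holder_Linf :: "real \<Rightarrow> (real \<Rightarrow> real \<Rightarrow> real) \<Rightarrow> bool" where
  "Holder_Linf \<alpha> a \<longleftrightarrow>
     (\<forall>t\<in>{0..1}. a t \<in> borel_measurable lebesgue)
   \<and> (\<exists>B::real. \<forall>t\<in>{0..1}. Linf_norm (a t) \<le> ereal B)
   \<and> (\<exists>C::real. \<forall>s\<in>{0..1}. \<forall>t\<in>{0..1}.
        Linf_norm (\<lambda>x. a t x - a s x) \<le> ereal (C * \<bar>t - s\<bar> powr \<alpha>))"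

section \<open>The construction\<close>

definition phi :: "real \<Rightarrow> real" where
  "phi x = (sin x)\<^sup>2"

definition p_mode :: "real \<Rightarrow> real \<Rightarrow> real" where
  "p_mode K x = sin (K * x) * sin (2 * x)"

definition tau :: "nat \<Rightarrow> real" where
  "tau j = 5 / 16 - 1 / (16 * real j)"

definition ell :: "nat \<Rightarrow> real" where
  "ell j = tau (j + 1) - tau j"

definition M_count :: "nat \<Rightarrow> nat" where
  "M_count j = j"

text \<open>If the support of \<open>\<eta>\<close> lies in the open unit interval, this vanishes outside
  the interval from \<^term>\<open>tau j\<close> to \<^term>\<open>tau (j + 1)\<close>.\<close>

definition eta_resc :: "(real \<Rightarrow> real) \<Rightarrow> nat \<Rightarrow> real \<Rightarrow> real" where
  "eta_resc \<eta> j t = \<eta> ((t - tau j) / ell j)"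

definition K_freq :: "nat \<Rightarrow> nat \<Rightarrow> real" where
  "K_freq j m = 16 ^ m / ell j"

definition theta :: "nat \<Rightarrow> nat \<Rightarrow> real \<Rightarrow> real" where
  "theta j m t = (K_freq j m)\<^sup>2 * (t - tau j)"

definition beta :: "(real \<Rightarrow> real) \<Rightarrow> real \<Rightarrow> real \<Rightarrow> real" where
  "beta \<eta> t x = (\<Sum>\<^sub>\<infinity>j\<in>{1..}. \<Sum>m=1..M_count j.
     eta_resc \<eta> j t * (1 / K_freq j m) * sin (theta j m t) * cos (K_freq j m * x))"

definition coeff_a :: "real \<Rightarrow> (real \<Rightarrow> real) \<Rightarrow> real \<Rightarrow> real \<Rightarrow> real" where
  "coeff_a \<epsilon> \<eta> t x = 1 + \<epsilon> * beta \<eta> t x"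

definition y_amp :: "real \<Rightarrow> (real \<Rightarrow> real) \<Rightarrow> nat \<Rightarrow> nat \<Rightarrow> real \<Rightarrow> real" where
  "y_amp \<epsilon> \<eta> j m t =
     - (\<epsilon> / (2 * (K_freq j m)\<^sup>2)) * eta_resc \<eta> j t * (sin (theta j m t) - cos (theta j m t))"

definition u_sol :: "real \<Rightarrow> (real \<Rightarrow> real) \<Rightarrow> (real \<Rightarrow> real) \<Rightarrow> real \<Rightarrow> real \<Rightarrow> complex" where
  "u_sol \<epsilon> \<eta> \<rho> t x = complex_of_real
     (\<rho> t * phi x + (\<Sum>\<^sub>\<infinity>j\<in>{1..}. \<Sum>m=1..M_count j. y_amp \<epsilon> \<eta> j m t * p_mode (K_freq j m) x))"

abbreviation V_space :: "(real \<Rightarrow> complex) set" where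
  "V_space \<equiv> H10 {0<..<pi}"

abbreviation V_norm :: "(real \<Rightarrow> complex) \<Rightarrow> real" where
  "V_norm \<equiv> H10_norm {0<..<pi}"

text \<open>
  The forcing at time \<open>t\<close> is the sum of the time derivative of \<open>u\<close> in the anti-dual of \<open>V\<close>
  (one-sided at the end points of the unit interval) and of the elliptic term. It is a functional
  on \<open>V\<close> that belongs to \<open>L\<^sup>2\<close>; \<open>forcing\<close> is a function representing it.
\<close>

definition is_forcing_at ::
    "real \<Rightarrow> (real \<Rightarrow> real) \<Rightarrow> (real \<Rightarrow> real) \<Rightarrow> real \<Rightarrow> (real \<Rightarrow> complex) \<Rightarrow> bool" where
  "is_forcing_at \<epsilon> \<eta> \<rho> t g \<longleftrightarrow>
     g \<in> L2 {0<..<pi}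
   \<and> (\<exists>D. has_dual_derivative V_space V_norm (\<lambda>s. L2_inner {0<..<pi} (u_sol \<epsilon> \<eta> \<rho> s)) D
             (at t within {0..1}) t
        \<and> (\<forall>w\<in>V_space. L2_inner {0<..<pi} g w
                   = D w + elliptic_op {0<..<pi} (coeff_a \<epsilon> \<eta> t) (u_sol \<epsilon> \<eta> \<rho> t) w))"

definition forcing ::
    "real \<Rightarrow> (real \<Rightarrow> real) \<Rightarrow> (real \<Rightarrow> real) \<Rightarrow> real \<Rightarrow> real \<Rightarrow> complex" where
  "forcing \<epsilon> \<eta> \<rho> t = (SOME g. is_forcing_at \<epsilon> \<eta> \<rho> t g)"

definition E0 :: "(real \<Rightarrow> complex) \<Rightarrow> real \<Rightarrow> complex" where
  "E0 v x = (if x \<in> {0<..<pi} then v x else 0)"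

end

theory Submission imports Defs begin

text \<open>
  Write \<open>K\<close> for the frequency of a mode and \<open>\<theta>' = K\<^sup>2\<close> for its phase. Since \<open>\<phi>' = sin 2x\<close>, the
  space derivative of the oscillating part of the coefficient, applied to \<open>\<rho> \<phi>\<close>, produces the term
  \<open>- \<epsilon> sin \<theta> sin (K x) sin 2x\<close>: it has order one and is a multiple of the mode \<open>p\<^sub>K\<close>. The amplitude of
  \<open>p\<^sub>K\<close> in \<open>u\<close> solves \<open>y' + K\<^sup>2 y = - \<epsilon> sin \<theta>\<close> up to the derivative of the time cutoff
  (\<open>resonance\<close>), so in the forcing all terms of order one cancel and a bounded function remains
  (\<open>f_bound\<close>). The individual amplitudes keep velocities \<open>y'\<close> of order one. The modes are orthogonal,
  hence \<open>\<parallel>\<partial>\<^sub>t u\<parallel>\<^sup>2\<close> is at least a multiple of \<open>j\<close>, in the mean, on the \<open>j\<close>th time interval. That interval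
  has length of order \<open>1/j\<^sup>2\<close>, and the divergence of the harmonic series excludes
  \<open>\<partial>\<^sub>t u \<in> L\<^sup>2(L\<^sup>2)\<close> (\<open>time_derivative_not_L2\<close>). In \<open>H\<^sup>-\<^sup>1\<close> each mode gains a factor \<open>1/K\<close>, which keeps
  \<open>\<partial>\<^sub>t u\<close> bounded there (\<open>lin_line_pairing\<close>).

  The passage from \<open>(0,\<pi>)\<close> to the line creates no boundary terms, because \<open>u\<close> and \<open>\<partial>\<^sub>x u\<close>, and with it
  the flux, vanish at both end points (\<open>flux_ends\<close>, \<open>elliptic_flux\<close>). The forcing is only given as
  some representative of a functional on \<open>V\<close>; it is identified almost everywhere with the explicit
  \<open>f\<close> by the density of test functions (\<open>forcing_eq\<close>).

  Uniqueness of variational solutions uses the Hoelder continuity of the coefficient in time. The difference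
  \<open>d\<close> of two solutions satisfies \<open>\<langle>d(r), v\<rangle> = - \<integral>\<^sub>0\<^sup>r a\<^sub>q(d(q), v) dq\<close>. For the vector \<open>Y(z)\<close>, the integral of \<open>d\<close>
  over a window of length \<open>H\<close> that ends at \<open>z\<close>, the energy \<open>\<parallel>Y\<parallel>\<^sup>2\<close> can be differentiated
  in the classical sense. Freezing the coefficient in the window costs a factor \<open>\<surd>H\<close>, and the frozen
  form is nonnegative, so \<open>\<parallel>Y(z)\<parallel>\<^sup>2\<close> is of order \<open>\<surd>H H\<^sup>2\<close>. Since \<open>Y / H\<close> tends to
  \<open>d\<close>, the limit \<open>H \<rightarrow> 0\<close> gives \<open>d = 0\<close> (\<open>energy_uniqueness\<close>).
\<close>

section \<open>Square-integrable functions\<close>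

lemma L2_measurable: "v \<in> L2 S \<Longrightarrow> v \<in> borel_measurable (lebesgue_on S)" by (simp add: L2_def)

lemma L2_square_integrable: "v \<in> L2 S \<Longrightarrow> integrable (lebesgue_on S) (\<lambda>x. (norm (v x))\<^sup>2)" by (simp add: L2_def)

lemma L2_bound:
  assumes "v \<in> borel_measurable (lebesgue_on S)" "integrable (lebesgue_on S) g"
    "\<And>x. x \<in> S \<Longrightarrow> (norm (v x))\<^sup>2 \<le> g x"
  shows "v \<in> L2 S"
  unfolding L2_def
proof (safe)
  show "v \<in> borel_measurable (lebesgue_on S)" by fact
  show "integrable (lebesgue_on S) (\<lambda>x. (norm (v x))\<^sup>2)" by (rule Bochner_Integration.integrable_bound[OF assms(2)])
      (use assms in \<open>auto intro!: borel_measurable_power borel_measurable_norm AE_I2 intro: order_trans[OF _ abs_ge_self]\<close>)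
qed

lemma L2_zero [simp]: "(\<lambda>x. 0) \<in> L2 S" by (simp add: L2_def)

lemma norm_add_square_le: "(norm (a + b))\<^sup>2 \<le> 2 * (norm a)\<^sup>2 + 2 * (norm (b::'a::real_normed_vector))\<^sup>2"
proof -
  have "(norm (a + b))\<^sup>2 \<le> (norm a + norm b)\<^sup>2" by (intro power_mono norm_triangle_ineq) auto
  also have "... \<le> 2 * (norm a)\<^sup>2 + 2 * (norm b)\<^sup>2" using sum_squares_bound[of "norm a" "norm b"] by (simp add: power2_sum)
  finally show ?thesis .
qed

lemma L2_add:
  assumes "v \<in> L2 S" "w \<in> L2 S" shows "(\<lambda>x. v x + w x) \<in> L2 S"
proof (rule L2_bound)
  show "(\<lambda>x. v x + w x) \<in> borel_measurable (lebesgue_on S)" using assms by (auto dest!: L2_measurable)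
  show "integrable (lebesgue_on S) (\<lambda>x. 2 * (norm (v x))\<^sup>2 + 2 * (norm (w x))\<^sup>2)" using assms by (auto dest!: L2_square_integrable)
qed (rule norm_add_square_le)

lemma L2_scale: assumes "v \<in> L2 S" shows "(\<lambda>x. c * v x) \<in> L2 S" using assms by (auto simp: L2_def norm_mult power_mult_distrib)

lemma L2_cnj: assumes "v \<in> L2 S" shows "(\<lambda>x. cnj (v x)) \<in> L2 S"
  using assms unfolding L2_def by (auto intro: borel_measurable_continuous_on[OF continuous_on_cnj[OF continuous_on_id]])

lemma L2_diff: assumes "v \<in> L2 S" "w \<in> L2 S" shows "(\<lambda>x. v x - w x) \<in> L2 S" using L2_add[OF assms(1) L2_scale[OF assms(2), of "-1"]] by simp

lemma L2_sum: assumes "\<And>i. i \<in> I \<Longrightarrow> v i \<in> L2 S" shows "(\<lambda>x. \<Sum>i\<in>I. v i x) \<in> L2 S"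
  using assms by (induction I rule: infinite_finite_induct) (auto intro: L2_add)

lemma L2_norm_nonneg [simp]: "0 \<le> L2_norm S v" by (simp add: L2_norm_def)

lemma L2_norm_zero [simp]: "L2_norm S (\<lambda>x. 0) = 0" by (simp add: L2_norm_def)

lemma L2_norm_square: "(L2_norm S v)\<^sup>2 = (\<integral>x. (norm (v x))\<^sup>2 \<partial>lebesgue_on S)" by (simp add: L2_norm_def)

lemma L2_norm_scale: "L2_norm S (\<lambda>x. c * v x) = norm c * L2_norm S v" by (simp add: L2_norm_def norm_mult power_mult_distrib real_sqrt_mult)

lemma L2_norm_cong_AE:
  assumes "AE x in lebesgue_on S. v x = w x" "v \<in> borel_measurable (lebesgue_on S)" "w \<in> borel_measurable (lebesgue_on S)"
  shows "L2_norm S v = L2_norm S w"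
proof -
  have "(\<integral>x. (norm (v x))\<^sup>2 \<partial>lebesgue_on S) = (\<integral>x. (norm (w x))\<^sup>2 \<partial>lebesgue_on S)" by (rule integral_cong_AE) (use assms in auto)
  then show ?thesis by (simp add: L2_norm_def)
qed

lemma L2_product_integrable:
  assumes "v \<in> L2 S" "w \<in> L2 S" shows "integrable (lebesgue_on S) (\<lambda>x. v x * w x)"
proof (rule Bochner_Integration.integrable_bound)
  show "integrable (lebesgue_on S) (\<lambda>x. (norm (v x))\<^sup>2 + (norm (w x))\<^sup>2)" using assms by (auto dest!: L2_square_integrable)
  show "(\<lambda>x. v x * w x) \<in> borel_measurable (lebesgue_on S)" using assms by (auto dest!: L2_measurable)
  show "AE x in lebesgue_on S. norm (v x * w x) \<le> norm ((norm (v x))\<^sup>2 + (norm (w x))\<^sup>2)"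
  proof (rule AE_I2)
    fix x
    have "0 \<le> norm (v x) * norm (w x)" by simp
    with sum_squares_bound[of "norm (v x)" "norm (w x)"]
    show "norm (v x * w x) \<le> norm ((norm (v x))\<^sup>2 + (norm (w x))\<^sup>2)"
      unfolding norm_mult real_norm_def by linarith
  qed
qed

lemma L2_inner_integrable:
  assumes "v \<in> L2 S" "w \<in> L2 S" shows "integrable (lebesgue_on S) (\<lambda>x. v x * cnj (w x))"
  using L2_product_integrable[OF assms(1) L2_cnj[OF assms(2)]] .

lemma nonneg_quadratic_discriminant:
  fixes A B C :: real
  assumes "\<And>s. 0 \<le> B - 2 * s * C + s\<^sup>2 * A" "A \<ge> 0" "B \<ge> 0"
  shows "C \<le> sqrt A * sqrt B"
proof (cases "C > 0")
  case True
  have "A > 0"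
  proof (rule ccontr)
    assume "\<not> A > 0"
    then have "A = 0" using assms by simp
    then show False using assms(1)[of "(B + 1) / (2 * C)"] True by simp
  qed
  have "0 \<le> B - 2 * (C/A) * C + (C/A)\<^sup>2 * A" by (rule assms(1))
  also have "... = B - C\<^sup>2 / A" using \<open>A > 0\<close> by (simp add: field_simps power2_eq_square)
  finally have "C\<^sup>2 \<le> A * B" using \<open>A > 0\<close> by (simp add: field_simps)
  then have "C \<le> sqrt (A * B)" by (rule real_le_rsqrt)
  then show ?thesis by (simp add: real_sqrt_mult)
next
  case False
  then show ?thesis using assms by (smt (verit) mult_nonneg_nonneg real_sqrt_ge_zero)
qed

lemma L2_Cauchy_Schwarz:
  assumes "v \<in> L2 S" "w \<in> L2 S"
  shows "(\<integral>x. norm (v x) * norm (w x) \<partial>lebesgue_on S) \<le> L2_norm S v * L2_norm S w"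
  unfolding L2_norm_def
proof (rule nonneg_quadratic_discriminant)
  fix s
  note [simp] = L2_square_integrable[OF assms(1)] L2_square_integrable[OF assms(2)]
  have [simp]: "integrable (lebesgue_on S) (\<lambda>x. norm (v x) * norm (w x))"
    using integrable_norm[OF L2_product_integrable[OF assms]] by (simp add: norm_mult)
  have "0 \<le> (\<integral>x. (norm (w x) - s * norm (v x))\<^sup>2 \<partial>lebesgue_on S)" by simp
  also have "... = (\<integral>x. (norm (w x))\<^sup>2 - (2 * s) * (norm (v x) * norm (w x)) + s\<^sup>2 * (norm (v x))\<^sup>2 \<partial>lebesgue_on S)"
    by (simp add: power2_diff power_mult_distrib algebra_simps)
  also have "... = (\<integral>x. (norm (w x))\<^sup>2 \<partial>lebesgue_on S) - 2 * s * (\<integral>x. norm (v x) * norm (w x) \<partial>lebesgue_on S)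
     + s\<^sup>2 * (\<integral>x. (norm (v x))\<^sup>2 \<partial>lebesgue_on S)" by (subst Bochner_Integration.integral_add Bochner_Integration.integral_diff;
        auto intro!: Bochner_Integration.integrable_diff integrable_mult_right)+
  finally show "0 \<le> ..." .
qed auto

lemma L2_product_norm_le:
  assumes "v \<in> L2 S" "w \<in> L2 S"
  shows "norm (\<integral>x. v x * w x \<partial>lebesgue_on S) \<le> L2_norm S v * L2_norm S w"
  using integral_norm_bound[of "lebesgue_on S" "\<lambda>x. v x * w x"] L2_Cauchy_Schwarz[OF assms] by (simp add: norm_mult)

lemma L2_norm_cnj [simp]: "L2_norm S (\<lambda>x. cnj (v x)) = L2_norm S v" by (simp add: L2_norm_def)

lemma L2_inner_norm_le:
  assumes "v \<in> L2 S" "w \<in> L2 S"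
  shows "norm (L2_inner S v w) \<le> L2_norm S v * L2_norm S w" using L2_product_norm_le[OF assms(1) L2_cnj[OF assms(2)]] by (simp add: L2_inner_def)

lemma L2_inner_self: "L2_inner S v v = complex_of_real ((L2_norm S v)\<^sup>2)"
proof -
  have "L2_inner S v v = (\<integral>x. complex_of_real ((norm (v x))\<^sup>2) \<partial>lebesgue_on S)"
    unfolding L2_inner_def by (simp only: complex_norm_square)
  then show ?thesis by (simp only: L2_norm_square integral_complex_of_real)
qed

lemma L2_norm_triangle:
  assumes "v \<in> L2 S" "w \<in> L2 S"
  shows "L2_norm S (\<lambda>x. v x + w x) \<le> L2_norm S v + L2_norm S w"
proof -
  note [simp] = L2_square_integrable[OF assms(1)] L2_square_integrable[OF assms(2)]
  have [simp]: "integrable (lebesgue_on S) (\<lambda>x. norm (v x) * norm (w x))"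
    using integrable_norm[OF L2_product_integrable[OF assms]] by (simp add: norm_mult)
  have "(L2_norm S (\<lambda>x. v x + w x))\<^sup>2 = (\<integral>x. (norm (v x + w x))\<^sup>2 \<partial>lebesgue_on S)" by (rule L2_norm_square)
  also have "... \<le> (\<integral>x. ((norm (v x))\<^sup>2 + 2 * (norm (v x) * norm (w x))) + (norm (w x))\<^sup>2 \<partial>lebesgue_on S)"
  proof (rule integral_mono)
    show "integrable (lebesgue_on S) (\<lambda>x. (norm (v x + w x))\<^sup>2)" using L2_add[OF assms] by (rule L2_square_integrable)
    fix x
    have "(norm (v x + w x))\<^sup>2 \<le> (norm (v x) + norm (w x))\<^sup>2" by (intro power_mono norm_triangle_ineq) auto
    then show "(norm (v x + w x))\<^sup>2 \<le> ((norm (v x))\<^sup>2 + 2 * (norm (v x) * norm (w x))) + (norm (w x))\<^sup>2" by (simp add: power2_sum)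
  qed auto
  also have "... = (L2_norm S v)\<^sup>2 + 2 * (\<integral>x. norm (v x) * norm (w x) \<partial>lebesgue_on S) + (L2_norm S w)\<^sup>2"
    by (subst Bochner_Integration.integral_add; (subst Bochner_Integration.integral_add)?) (auto simp: L2_norm_square)
  also have "... \<le> (L2_norm S v + L2_norm S w)\<^sup>2" using L2_Cauchy_Schwarz[OF assms] by (simp add: power2_sum)
  finally show ?thesis by (rule power2_le_imp_le) simp
qed

lemma L2_norm_eq_0_AE:
  assumes "v \<in> L2 S" "L2_norm S v = 0" shows "AE x in lebesgue_on S. v x = 0"
proof -
  have "(\<integral>x. (norm (v x))\<^sup>2 \<partial>lebesgue_on S) = 0" using assms(2) L2_norm_square[of S v] by simp
  then show ?thesis using integral_nonneg_eq_0_iff_AE[OF L2_square_integrable[OF assms(1)]] by simp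
qed

lemma L2_inner_add_left:
  assumes "u \<in> L2 S" "v \<in> L2 S" "w \<in> L2 S"
  shows "L2_inner S (\<lambda>x. u x + v x) w = L2_inner S u w + L2_inner S v w" using L2_inner_integrable[OF assms(1,3)] L2_inner_integrable[OF assms(2,3)]
  by (simp add: L2_inner_def distrib_right)

lemma L2_inner_diff_left:
  assumes "u \<in> L2 S" "v \<in> L2 S" "w \<in> L2 S"
  shows "L2_inner S (\<lambda>x. u x - v x) w = L2_inner S u w - L2_inner S v w" using L2_inner_integrable[OF assms(1,3)] L2_inner_integrable[OF assms(2,3)]
  by (simp add: L2_inner_def left_diff_distrib)

lemma L2_inner_scale_left: "L2_inner S (\<lambda>x. c * v x) w = c * L2_inner S v w" by (simp add: L2_inner_def mult.assoc)

lemma L2_inner_cnj: "cnj (L2_inner S v w) = L2_inner S w v"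
proof -
  have "cnj (L2_inner S v w) = (\<integral>x. cnj (v x * cnj (w x)) \<partial>lebesgue_on S)"
    unfolding L2_inner_def by (simp only: Bochner_Integration.integral_cnj)
  then show ?thesis by (simp add: L2_inner_def mult.commute)
qed

lemma L2_inner_add_right:
  assumes "u \<in> L2 S" "v \<in> L2 S" "w \<in> L2 S"
  shows "L2_inner S w (\<lambda>x. u x + v x) = L2_inner S w u + L2_inner S w v"
  using arg_cong[OF L2_inner_add_left[OF assms], of cnj] by (simp add: L2_inner_cnj)

lemma L2_inner_scale_right: "L2_inner S w (\<lambda>x. c * v x) = cnj c * L2_inner S w v"
  using arg_cong[OF L2_inner_scale_left[of S c v w], of cnj] by (simp add: L2_inner_cnj)

lemma L2_inner_sum_left:
  assumes "\<And>i. i \<in> I \<Longrightarrow> v i \<in> L2 S" "w \<in> L2 S"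
  shows "L2_inner S (\<lambda>x. \<Sum>i\<in>I. v i x) w = (\<Sum>i\<in>I. L2_inner S (v i) w)" using assms
proof (induction I rule: infinite_finite_induct)
  case (insert i I)
  then show ?case by (simp add: L2_inner_add_left L2_sum)
qed (auto simp: L2_inner_def)

lemma integral_support:
  fixes f :: "real \<Rightarrow> 'a::euclidean_space"
  assumes "T \<subseteq> S" "S \<in> sets lebesgue" "T \<in> sets lebesgue" "\<And>x. x \<in> S - T \<Longrightarrow> f x = 0"
  shows "integral\<^sup>L (lebesgue_on S) f = integral\<^sup>L (lebesgue_on T) f"
proof -
  have "integral\<^sup>L (lebesgue_on S) f = integral\<^sup>L (lebesgue_on S) (\<lambda>x. if x \<in> T then f x else 0)"
    by (rule Bochner_Integration.integral_cong) (use assms in auto)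
  then show ?thesis using integral_restrict[of T S f] assms by simp
qed

lemma integrable_support:
  fixes f :: "real \<Rightarrow> 'a::euclidean_space"
  assumes "T \<subseteq> S" "S \<in> sets lebesgue" "T \<in> sets lebesgue" "\<And>x. x \<in> S - T \<Longrightarrow> f x = 0"
  shows "integrable (lebesgue_on S) f \<longleftrightarrow> integrable (lebesgue_on T) f"
proof -
  have "(\<lambda>x. if x \<in> S then f x else 0) = (\<lambda>x. if x \<in> T then f x else 0)" using assms by (auto simp: fun_eq_iff)
  then show ?thesis using Lebesgue_Measure.integrable_restrict_UNIV[OF assms(2), of f]
      Lebesgue_Measure.integrable_restrict_UNIV[OF assms(3), of f] by simp
qed

lemma integrable_lebesgue_on_subset:
  fixes f :: "real \<Rightarrow> 'a::euclidean_space"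
  assumes "integrable (lebesgue_on S) f" "T \<subseteq> S" "S \<in> sets lebesgue" "T \<in> sets lebesgue"
  shows "integrable (lebesgue_on T) f"
proof -
  have "integrable lebesgue (\<lambda>x. indicator T x *\<^sub>R (if x \<in> S then f x else 0))"
    by (rule integrable_mult_indicator) (use assms Lebesgue_Measure.integrable_restrict_UNIV[of S f] in auto)
  moreover have "(\<lambda>x. indicator T x *\<^sub>R (if x \<in> S then f x else 0)) = (\<lambda>x. if x \<in> T then f x else 0)"
    using assms by (auto simp: fun_eq_iff indicator_def)
  ultimately show ?thesis using Lebesgue_Measure.integrable_restrict_UNIV[of T f] assms by simp
qed

lemma continuous_integrable_Icc:
  fixes f :: "real \<Rightarrow> 'a::euclidean_space"
  assumes "continuous_on {a..b} f" shows "integrable (lebesgue_on {a..b}) f" using assms by (rule continuous_imp_integrable_real)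

lemma bounded_measurable_mult_integrable:
  fixes g :: "'a \<Rightarrow> complex"
  assumes "integrable M g" "k \<in> borel_measurable M" "\<And>x. x \<in> space M \<Longrightarrow> norm (k x) \<le> B"
  shows "integrable M (\<lambda>x. k x * g x)"
proof (rule Bochner_Integration.integrable_bound)
  show "integrable M (\<lambda>x. B * norm (g x))" using assms by auto
  show "(\<lambda>x. k x * g x) \<in> borel_measurable M" using assms by auto
  show "AE x in M. norm (k x * g x) \<le> norm (B * norm (g x))"
  proof (rule AE_I2)
    fix x assume "x \<in> space M"
    then have "norm (k x) * norm (g x) \<le> B * norm (g x)" by (intro mult_right_mono assms(3)) auto
    then show "norm (k x * g x) \<le> norm (B * norm (g x))" by (simp add: norm_mult)
  qed
qed

lemma borel_measurable_AE_cong_lebesgue_on: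
  fixes f g :: "real \<Rightarrow> 'a::euclidean_space"
  assumes "f \<in> borel_measurable (lebesgue_on S)" "AE x in lebesgue_on S. f x = g x" "S \<in> sets lebesgue"
  shows "g \<in> borel_measurable (lebesgue_on S)"
proof -
  have "(\<lambda>x. if x \<in> S then f x else 0) \<in> borel_measurable lebesgue" using assms borel_measurable_if by blast
  then have "(\<lambda>x. if x \<in> S then g x else 0) \<in> borel_measurable lebesgue"
    by (rule borel_measurable_AE) (use assms in \<open>auto simp: AE_restrict_space_iff elim: AE_mp\<close>)
  then show ?thesis using borel_measurable_if_D by blast
qed

lemma L2_integrable_on_finite_measure:
  assumes "v \<in> L2 S" "T \<subseteq> S" "S \<in> sets lebesgue" "T \<in> lmeasurable"
  shows "integrable (lebesgue_on T) v"
proof (rule Bochner_Integration.integrable_bound)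
  have T: "T \<in> sets lebesgue" using assms(4) by blast
  interpret finite_measure "lebesgue_on T" using assms(4) by (rule finite_measure_lebesgue_on)
  have "integrable (lebesgue_on T) (\<lambda>x. (norm (v x))\<^sup>2)"
    using integrable_lebesgue_on_subset[OF L2_square_integrable[OF assms(1)] assms(2,3)] T by simp
  then show "integrable (lebesgue_on T) (\<lambda>x. 1 + (norm (v x))\<^sup>2)" by (intro Bochner_Integration.integrable_add) auto
  show "v \<in> borel_measurable (lebesgue_on T)" using L2_measurable[OF assms(1)] assms(2) measurable_restrict_mono by blast
  show "AE x in lebesgue_on T. norm (v x) \<le> norm (1 + (norm (v x))\<^sup>2)"
  proof (rule AE_I2)
    fix x have "2 * norm (v x) \<le> 1 + (norm (v x))\<^sup>2" using sum_squares_bound[of 1 "norm (v x)"] by simp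
    then show "norm (v x) \<le> norm (1 + (norm (v x))\<^sup>2)" using norm_ge_zero[of "v x"] by (simp del: norm_ge_zero)
  qed
qed

lemma integral_Ioo_eq_Icc:
  fixes f :: "real \<Rightarrow> 'a::euclidean_space"
  assumes "f \<in> borel_measurable (lebesgue_on {a..b})"
  shows "integral\<^sup>L (lebesgue_on {a<..<b}) f = integral\<^sup>L (lebesgue_on {a..b}) f"
proof -
  have m: "(\<lambda>x. if x \<in> {a..b} then f x else 0) \<in> borel_measurable lebesgue" using assms by (intro borel_measurable_if_I) auto
  have ae: "AE x in lebesgue. (if x \<in> {a..b} then f x else 0) = (if x \<in> {a<..<b} then f x else 0)"
  proof -
    have "AE x in lebesgue. x \<notin> {a, b}" by (intro AE_not_in) auto
    then show ?thesis by eventually_elim auto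
  qed
  have "integral\<^sup>L lebesgue (\<lambda>x. if x \<in> {a..b} then f x else 0) = integral\<^sup>L lebesgue (\<lambda>x. if x \<in> {a<..<b} then f x else 0)"
    by (rule integral_cong_AE[OF m borel_measurable_AE[OF m ae] ae])
  then show ?thesis by (simp only: Lebesgue_Measure.integral_restrict_UNIV lmeasurable_interval fmeasurableD
        sets_completionI_sets sets_lborel borel_closed borel_open closed_real_atLeastAtMost open_greaterThanLessThan)
qed

text \<open>The intervals form a stable generator of the Borel sets, so a Dynkin argument passes from
  intervals to all Borel sets, and null sets do not contribute.\<close>

lemma AE_zero_if_all_interval_integrals_zero:
  fixes g :: "real \<Rightarrow> complex"
  assumes g: "integrable (lebesgue_on {a..b}) g"
    and zero: "\<And>c. c \<in> {a..b} \<Longrightarrow> (\<integral>x. g x \<partial>lebesgue_on {a..c}) = 0"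
  shows "AE x in lebesgue_on {a..b}. g x = 0"
proof (rule sigma_finite_measure.density_zero[OF _ g])
  show "sigma_finite_measure (lebesgue_on {a..b})" using finite_measure_lebesgue_on[of "{a..b}"] by (simp add: finite_measure_def)
  define G where "G x = (if x \<in> {a..b} then g x else 0)" for x
  have G: "integrable lebesgue G"
    unfolding G_def by (subst Lebesgue_Measure.integrable_restrict_UNIV) (simp_all add: g)
  have GA: "integrable lebesgue (\<lambda>x. indicator A x *\<^sub>R G x)" if "A \<in> sets lebesgue" for A using that G by (rule integrable_mult_indicator)
  have int0: "integral\<^sup>L lebesgue (\<lambda>x. indicator {..c} x *\<^sub>R G x) = 0" for c
  proof -
    define d where "d = min c b"
    have "integral\<^sup>L lebesgue (\<lambda>x. indicator {..c} x *\<^sub>R G x) = integral\<^sup>L lebesgue (\<lambda>x. if x \<in> {a..d} then g x else 0)"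
      by (rule Bochner_Integration.integral_cong) (auto simp: G_def d_def indicator_def)
    also have "... = (\<integral>x. g x \<partial>lebesgue_on {a..d})" by (rule Lebesgue_Measure.integral_restrict_UNIV) simp
    also have "... = 0"
    proof (cases "a \<le> d")
      case True then show ?thesis using zero[of d] by (auto simp: d_def)
    qed simp
    finally show ?thesis .
  qed
  have all0: "integral\<^sup>L lebesgue G = 0"
  proof -
    have "integral\<^sup>L lebesgue G = integral\<^sup>L lebesgue (\<lambda>x. indicator {..b} x *\<^sub>R G x)"
      by (rule Bochner_Integration.integral_cong) (auto simp: G_def indicator_def)
    then show ?thesis using int0 by simp
  qed
  have borel: "integral\<^sup>L lebesgue (\<lambda>x. indicator A x *\<^sub>R G x) = 0" if A: "A \<in> sets borel" for A
  proof -
    have gen: "sets borel = sigma_sets UNIV (range (\<lambda>a. {..a::real}))" by (subst borel_eq_atMost) simp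
    have stable: "Int_stable (range (\<lambda>a::real. {..a}))" by (auto simp: Int_stable_def)
    have sub: "range (\<lambda>a::real. {..a}) \<subseteq> Pow UNIV" by simp
    have "A \<in> sigma_sets UNIV (range (\<lambda>a. {..a::real}))" using A gen by simp
    with stable sub show ?thesis
    proof (induction rule: sigma_sets_induct_disjoint)
      case (compl A)
      then have A: "A \<in> sets lebesgue" using gen by simp
      have "integral\<^sup>L lebesgue (\<lambda>x. indicator (UNIV - A) x *\<^sub>R G x) = integral\<^sup>L lebesgue (\<lambda>x. G x - indicator A x *\<^sub>R G x)"
        by (rule Bochner_Integration.integral_cong) (auto simp: indicator_def)
      also have "... = 0" using G GA[OF A] compl all0 by (simp add: Bochner_Integration.integral_diff)
      finally show ?case .
    next
      case (union A)
      have "A i \<in> sets borel" for i unfolding gen using union by auto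
      then have A: "A i \<in> sets lebesgue" for i by simp
      have "set_lebesgue_integral lebesgue (\<Union>i. A i) G = (\<Sum>i. set_lebesgue_integral lebesgue (A i) G)" by (rule lebesgue_integral_countable_add)
          (use union A G in \<open>auto simp: disjoint_family_on_def set_integrable_def intro!: integrable_mult_indicator\<close>)
      then show ?case using union by (simp add: set_lebesgue_integral_def)
    qed (use int0 in \<open>auto\<close>)
  qed
  fix A assume "A \<in> sets (lebesgue_on {a..b})"
  then have A: "A \<in> sets lebesgue" "A \<subseteq> {a..b}" by (auto simp: sets_restrict_space)
  obtain B N N' where B: "A = B \<union> N" "N \<subseteq> N'" "N' \<in> null_sets lborel" "B \<in> sets lborel" using sets_completionE[OF A(1)] by metis
  have "set_lebesgue_integral (lebesgue_on {a..b}) A g = integral\<^sup>L lebesgue (\<lambda>x. if x \<in> {a..b} then indicator A x *\<^sub>R g x else 0)"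
    unfolding set_lebesgue_integral_def by (rule Lebesgue_Measure.integral_restrict_UNIV[symmetric]) simp
  also have "... = integral\<^sup>L lebesgue (\<lambda>x. indicator A x *\<^sub>R G x)" by (rule Bochner_Integration.integral_cong) (auto simp: G_def)
  also have "... = integral\<^sup>L lebesgue (\<lambda>x. indicator B x *\<^sub>R G x)"
  proof (rule integral_cong_AE)
    have "AE x in lebesgue. x \<notin> N'" using B(3) by (intro AE_not_in null_sets_completionI)
    then show "AE x in lebesgue. indicat_real A x *\<^sub>R G x = indicat_real B x *\<^sub>R G x" by eventually_elim (use B in \<open>auto simp: indicator_def\<close>)
  qed (use A B G in \<open>auto intro!: borel_measurable_integrable GA\<close>)
  also have "... = 0" using borel B by simp
  finally show "set_lebesgue_integral (lebesgue_on {a..b}) A g = 0" .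
qed

section \<open>Smooth functions and cutoffs\<close>

lemma smooth_coinduct:
  assumes "P f" and step: "\<And>g. P g \<Longrightarrow> \<exists>g'. P g' \<and> (\<forall>x. (g has_vector_derivative g' x) (at x))"
  shows "smooth f"
proof -
  obtain nxt where nxt: "\<And>g. P g \<Longrightarrow> P (nxt g) \<and> (\<forall>x. (g has_vector_derivative nxt g x) (at x))" using step by metis
  have P: "P ((nxt ^^ n) f)" for n by (induction n) (use assms(1) nxt in auto)
  show ?thesis unfolding smooth_def by (rule exI[of _ "\<lambda>n. (nxt ^^ n) f"]) (use P nxt in auto)
qed

lemma smooth_derivative:
  assumes "smooth f"
  shows "smooth (\<lambda>x. vector_derivative f (at x))" "(f has_vector_derivative vector_derivative f (at x)) (at x)"
proof -
  obtain D where D: "D 0 = f" "\<And>n x. (D n has_vector_derivative D (Suc n) x) (at x)" using assms unfolding smooth_def by blast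
  have eq: "vector_derivative f (at x) = D 1 x" for x using D(2)[of 0 x] D(1) by (simp add: vector_derivative_at)
  show "smooth (\<lambda>x. vector_derivative f (at x))"
    unfolding smooth_def eq using D(2) by (intro exI[of _ "\<lambda>n. D (Suc n)"]) simp
  show "(f has_vector_derivative vector_derivative f (at x)) (at x)" using D(2)[of 0 x] D(1) by (simp add: eq)
qed

lemma smooth_continuous_on: "smooth f \<Longrightarrow> continuous_on S f"
  by (intro continuous_at_imp_continuous_on ballI has_vector_derivative_continuous[OF smooth_derivative(2)])

lemma smooth_if_derivative:
  assumes "\<And>x. (f has_vector_derivative f' x) (at x)" "smooth f'" shows "smooth f"
proof -
  obtain D where D: "D 0 = f'" "\<And>n x. (D n has_vector_derivative D (Suc n) x) (at x)" using assms(2) unfolding smooth_def by blast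
  show ?thesis unfolding smooth_def using assms(1) D by (intro exI[of _ "\<lambda>n. case n of 0 \<Rightarrow> f | Suc m \<Rightarrow> D m"]) (simp split: nat.split)
qed

lemma smooth_const [simp]: "smooth (\<lambda>x. c)"
proof (rule smooth_coinduct[where P = "\<lambda>f. \<exists>c. f = (\<lambda>x. c)"])
  fix g :: "real \<Rightarrow> 'a" assume "\<exists>c. g = (\<lambda>x. c)"
  then show "\<exists>g'. (\<exists>c. g' = (\<lambda>x. c)) \<and> (\<forall>x. (g has_vector_derivative g' x) (at x))" by (intro exI[of _ "\<lambda>_. 0"]) auto
qed auto

lemma smooth_bounded_linear:
  assumes "bounded_linear L" "smooth f" shows "smooth (\<lambda>x. L (f x))"
proof (rule smooth_coinduct[where P = "\<lambda>h. \<exists>f. smooth f \<and> h = (\<lambda>x. L (f x))"])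
  fix g assume "\<exists>f. smooth f \<and> g = (\<lambda>x. L (f x))"
  then obtain f where f: "smooth f" "g = (\<lambda>x. L (f x))" by blast
  show "\<exists>g'. (\<exists>f. smooth f \<and> g' = (\<lambda>x. L (f x))) \<and> (\<forall>x. (g has_vector_derivative g' x) (at x))"
    using smooth_derivative[OF f(1)] bounded_linear.has_vector_derivative[OF assms(1) smooth_derivative(2)[OF f(1)]]
    by (rule_tac exI[of _ "\<lambda>x. L (vector_derivative f (at x))"], rule_tac conjI,
        rule_tac exI[of _ "\<lambda>x. vector_derivative f (at x)"], simp_all add: f(2))
qed (use assms in auto)

lemma smooth_of_real: "smooth f \<Longrightarrow> smooth (\<lambda>x. complex_of_real (f x))" by (rule smooth_bounded_linear[OF bounded_linear_of_real])

lemma smooth_affine: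
  assumes "smooth f" shows "smooth (\<lambda>x. f (a * x + b))"
proof (rule smooth_coinduct[where P = "\<lambda>h. \<exists>f c. smooth f \<and> h = (\<lambda>x. c *\<^sub>R f (a * x + b))"])
  fix g assume "\<exists>f c. smooth f \<and> g = (\<lambda>x. c *\<^sub>R f (a * x + b))"
  then obtain f c where f: "smooth f" and g: "g = (\<lambda>x. c *\<^sub>R f (a * x + b))" by blast
  have "(g has_vector_derivative (c * a) *\<^sub>R vector_derivative f (at (a * x + b))) (at x)" for x
  proof -
    have "((\<lambda>x. a * x + b) has_vector_derivative a) (at x)" by (auto intro!: derivative_eq_intros)
    from vector_diff_chain_at[OF this smooth_derivative(2)[OF f]]
    have "((\<lambda>x. f (a * x + b)) has_vector_derivative a *\<^sub>R vector_derivative f (at (a * x + b))) (at x)" by (simp add: o_def)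
    from has_vector_derivative_scaleR[OF DERIV_const[of c] this] show ?thesis by (simp add: g mult.commute)
  qed
  then show "\<exists>g'. (\<exists>f c. smooth f \<and> g' = (\<lambda>x. c *\<^sub>R f (a * x + b))) \<and> (\<forall>x. (g has_vector_derivative g' x) (at x))" using smooth_derivative(1)[OF f]
    by (rule_tac exI[of _ "\<lambda>x. (c * a) *\<^sub>R vector_derivative f (at (a * x + b))"], rule_tac conjI,
        rule_tac exI[of _ "\<lambda>x. vector_derivative f (at x)"], rule_tac exI[of _ "c * a"], simp_all)
next
  show "\<exists>f' c. smooth f' \<and> (\<lambda>x. f (a * x + b)) = (\<lambda>x. c *\<^sub>R f' (a * x + b))" using assms by (intro exI[of _ f] exI[of _ "1::real"]) auto
qed

lemma smooth_add:
  assumes "smooth f" "smooth g" shows "smooth (\<lambda>x. f x + g x)"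
proof (rule smooth_coinduct[where P = "\<lambda>h. \<exists>f g. smooth f \<and> smooth g \<and> h = (\<lambda>x. f x + g x)"])
  fix h assume "\<exists>f g. smooth f \<and> smooth g \<and> h = (\<lambda>x. f x + g x)"
  then obtain f g where fg: "smooth f" "smooth g" "h = (\<lambda>x. f x + g x)" by blast
  let ?f = "\<lambda>x. vector_derivative f (at x)" and ?g = "\<lambda>x. vector_derivative g (at x)"
  have "(h has_vector_derivative ?f x + ?g x) (at x)" for x
    unfolding fg(3) by (rule has_vector_derivative_add[OF smooth_derivative(2)[OF fg(1)] smooth_derivative(2)[OF fg(2)]])
  moreover have "smooth ?f" "smooth ?g" using fg smooth_derivative(1) by auto
  ultimately show "\<exists>g'. (\<exists>f g. smooth f \<and> smooth g \<and> g' = (\<lambda>x. f x + g x)) \<and> (\<forall>x. (h has_vector_derivative g' x) (at x))"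
    by (rule_tac exI[of _ "\<lambda>x. ?f x + ?g x"], rule_tac conjI, rule_tac exI[of _ ?f], rule_tac exI[of _ ?g], simp_all)
next
  show "\<exists>f' g'. smooth f' \<and> smooth g' \<and> (\<lambda>x. f x + g x) = (\<lambda>x. f' x + g' x)" by (rule exI[of _ f], rule exI[of _ g]) (simp add: assms)
qed

lemma smooth_sum:
  assumes "\<And>i. i \<in> I \<Longrightarrow> smooth (f i)" shows "smooth (\<lambda>x. \<Sum>i\<in>I. f i x)" using assms
proof (induction I rule: infinite_finite_induct)
  case (insert i I)
  then have "smooth (\<lambda>x. f i x + (\<Sum>i\<in>I. f i x))" by (intro smooth_add) simp_all
  then show ?case using insert.hyps by simp
qed simp_all

text \<open>The finite sums of products of smooth functions form a class that is closed under
  differentiation.\<close>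

inductive product_sum :: "(real \<Rightarrow> 'a::real_normed_algebra) \<Rightarrow> bool" where
  product: "smooth f \<Longrightarrow> smooth g \<Longrightarrow> product_sum (\<lambda>x. f x * g x)"
| sum: "product_sum f \<Longrightarrow> product_sum g \<Longrightarrow> product_sum (\<lambda>x. f x + g x)"

lemma smooth_mult:
  fixes f g :: "real \<Rightarrow> 'a::real_normed_algebra"
  assumes "smooth f" "smooth g" shows "smooth (\<lambda>x. f x * g x)"
proof (rule smooth_coinduct[where P = product_sum])
  show "product_sum (\<lambda>x. f x * g x)" using assms by (rule product)
  fix h :: "real \<Rightarrow> 'a" assume "product_sum h"
  then show "\<exists>h'. product_sum h' \<and> (\<forall>x. (h has_vector_derivative h' x) (at x))"
  proof induction
    case (product f g)
    let ?f = "\<lambda>x. vector_derivative f (at x)" and ?g = "\<lambda>x. vector_derivative g (at x)"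
    have "product_sum (\<lambda>x. f x * ?g x + ?f x * g x)" by (intro product_sum.sum product_sum.product product smooth_derivative(1))
    moreover have "((\<lambda>x. f x * g x) has_vector_derivative f x * ?g x + ?f x * g x) (at x)" for x
      by (rule has_vector_derivative_mult[OF smooth_derivative(2)[OF product(1)] smooth_derivative(2)[OF product(2)]])
    ultimately show ?case by (intro exI[of _ "\<lambda>x. f x * ?g x + ?f x * g x"]) simp
  next
    case (sum f g)
    then obtain f' g' where f': "product_sum f'" "\<And>x. (f has_vector_derivative f' x) (at x)"
      and g': "product_sum g'" "\<And>x. (g has_vector_derivative g' x) (at x)" by metis
    have "((\<lambda>x. f x + g x) has_vector_derivative f' x + g' x) (at x)" for x by (rule has_vector_derivative_add[OF f'(2) g'(2)])
    then show ?case by (intro exI[of _ "\<lambda>x. f' x + g' x"] conjI product_sum.sum f' g' allI)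
  qed
qed

lemma smooth_sin_cos:
  "smooth (\<lambda>x. a * sin (k * x) + b * cos (k * x))"
proof (rule smooth_coinduct[where P = "\<lambda>f. \<exists>a b. f = (\<lambda>x. a * sin (k * x) + b * cos (k * x))"])
  fix g assume "\<exists>a b. g = (\<lambda>x. a * sin (k * x) + b * cos (k * x))"
  then obtain a b where g: "g = (\<lambda>x. a * sin (k * x) + b * cos (k * x))" by blast
  have "(g has_vector_derivative (- b * k) * sin (k * x) + (a * k) * cos (k * x)) (at x)" for x
    unfolding g has_real_derivative_iff_has_vector_derivative[symmetric] by (auto intro!: derivative_eq_intros simp: algebra_simps)
  then show "\<exists>g'. (\<exists>a b. g' = (\<lambda>x. a * sin (k * x) + b * cos (k * x))) \<and> (\<forall>x. (g has_vector_derivative g' x) (at x))"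
    by (rule_tac exI[of _ "\<lambda>x. (- b * k) * sin (k * x) + (a * k) * cos (k * x)"], rule_tac conjI,
        rule_tac exI[of _ "- b * k"], rule_tac exI[of _ "a * k"], simp_all)
next
  show "\<exists>a' b'. (\<lambda>x. a * sin (k * x) + b * cos (k * x)) = (\<lambda>x. a' * sin (k * x) + b' * cos (k * x))"
    by (rule exI[of _ a], rule exI[of _ b]) (rule refl)
qed

lemma smooth_sin: "smooth (\<lambda>x. sin (k * x))" and smooth_cos: "smooth (\<lambda>x. cos (k * x))"
  using smooth_sin_cos[of 1 k 0] smooth_sin_cos[of 0 k 1] by simp_all

lemma smooth_eqI_local:
  assumes "smooth f" "smooth g" "a < b" "\<And>x. x \<in> {a<..<b} \<Longrightarrow> f x = g x" "a < c" "c < b"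
  shows "smooth (\<lambda>x. if x \<le> c then f x else g x)"
proof (rule smooth_coinduct[where P = "\<lambda>h. \<exists>f g. smooth f \<and> smooth g \<and> (\<forall>x\<in>{a<..<b}. f x = g x) \<and> h = (\<lambda>x. if x \<le> c then f x else g x)"])
  fix h :: "real \<Rightarrow> 'a"
  assume "\<exists>f g. smooth f \<and> smooth g \<and> (\<forall>x\<in>{a<..<b}. f x = g x) \<and> h = (\<lambda>x. if x \<le> c then f x else g x)"
  then obtain f g where fg: "smooth f" "smooth g" "\<And>x. x\<in>{a<..<b} \<Longrightarrow> f x = g x"
    and h: "h = (\<lambda>x. if x \<le> c then f x else g x)" by blast
  let ?f = "\<lambda>x. vector_derivative f (at x)" and ?g = "\<lambda>x. vector_derivative g (at x)"
  have f': "(f has_vector_derivative ?f x) (at x)" and g': "(g has_vector_derivative ?g x) (at x)" for x using fg smooth_derivative by auto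
  have eq: "?f x = ?g x" if "x \<in> {a<..<b}" for x using has_vector_derivative_transform_within_open[OF f' open_greaterThanLessThan that, of g] fg(3) g'
    by (metis vector_derivative_at)
  have "(h has_vector_derivative (if x \<le> c then ?f x else ?g x)) (at x)" for x
  proof (cases "x < b")
    case True
    have *: "(if x \<le> c then ?f x else ?g x) = ?f x" using True eq[of x] \<open>a < c\<close> by auto
    show ?thesis unfolding * by (rule has_vector_derivative_transform_within_open[OF f', of "{..<b}"])
        (use True fg(3) \<open>a < c\<close> in \<open>auto simp: h\<close>)
  next
    case False
    then have *: "(if x \<le> c then ?f x else ?g x) = ?g x" using \<open>c < b\<close> by auto
    show ?thesis unfolding * by (rule has_vector_derivative_transform_within_open[OF g', of "{c<..}"])
        (use False \<open>c < b\<close> in \<open>auto simp: h\<close>)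
  qed
  moreover have "smooth ?f" "smooth ?g" using fg smooth_derivative by auto
  ultimately show "\<exists>h'. (\<exists>f g. smooth f \<and> smooth g \<and> (\<forall>x\<in>{a<..<b}. f x = g x) \<and> h' = (\<lambda>x. if x \<le> c then f x else g x))
      \<and> (\<forall>x. (h has_vector_derivative h' x) (at x))" using eq by (rule_tac exI[of _ "\<lambda>x. if x \<le> c then ?f x else ?g x"], rule_tac conjI,
        rule_tac exI[of _ ?f], rule_tac exI[of _ ?g], simp_all)
next
  show "\<exists>f' g'. smooth f' \<and> smooth g' \<and> (\<forall>x\<in>{a<..<b}. f' x = g' x)
      \<and> (\<lambda>x. if x \<le> c then f x else g x) = (\<lambda>x. if x \<le> c then f' x else g' x)" using assms by (rule_tac exI[of _ f], rule_tac exI[of _ g], simp)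
qed

lemma test_function_outside:
  assumes "\<phi> \<in> test_functions S" "x \<notin> S" shows "\<phi> x = 0" using assms closure_subset[of "{x. \<phi> x \<noteq> 0}"] by (auto simp: test_functions_def)

lemma test_function_derivative_outside:
  assumes "\<phi> \<in> test_functions S" "x \<notin> closure {x. \<phi> x \<noteq> 0}"
  shows "vector_derivative \<phi> (at x) = 0"
proof -
  have "((\<lambda>_. 0) has_vector_derivative 0) (at x)" by simp
  then have "(\<phi> has_vector_derivative 0) (at x)" by (rule has_vector_derivative_transform_within_open[where S = "- closure {x. \<phi> x \<noteq> 0}"])
      (use assms closure_subset[of "{x. \<phi> x \<noteq> 0}"] in auto)
  then show ?thesis by (rule vector_derivative_at)
qed

lemma test_functionI:
  assumes "smooth \<phi>" "compact K" "K \<subseteq> S" "\<And>x. x \<notin> K \<Longrightarrow> \<phi> x = 0"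
  shows "\<phi> \<in> test_functions S"
proof -
  have "closure {x. \<phi> x \<noteq> 0} \<subseteq> K" by (rule closure_minimal) (use assms compact_imp_closed in auto)
  moreover from this have "compact (closure {x. \<phi> x \<noteq> 0})"
    using assms(2) by (meson closed_closure compact_Int_closed compact_imp_bounded bounded_subset compact_eq_bounded_closed)
  ultimately show ?thesis using assms by (auto simp: test_functions_def)
qed

lemma test_function_bounded:
  assumes "\<phi> \<in> test_functions S" obtains B where "\<And>x. norm (\<phi> x) \<le> B" "B > 0"
proof -
  let ?K = "closure {x. \<phi> x \<noteq> 0}"
  have "compact (\<phi> ` ?K)" using assms smooth_continuous_on by (intro compact_continuous_image) (auto simp: test_functions_def)
  from compact_imp_bounded[OF this] obtain B where B0: "B > 0" "\<forall>y\<in>\<phi> ` ?K. norm y \<le> B"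
    unfolding bounded_pos by blast
  then have B: "\<And>x. x \<in> ?K \<Longrightarrow> norm (\<phi> x) \<le> B" "B > 0" by blast+
  have "norm (\<phi> x) \<le> B" for x using B closure_subset[of "{x. \<phi> x \<noteq> 0}"] by (cases "\<phi> x = 0") auto
  then show ?thesis using that B(2) by blast
qed

lemma test_function_derivative:
  assumes "\<phi> \<in> test_functions S"
  shows "(\<lambda>x. vector_derivative \<phi> (at x)) \<in> test_functions S" using assms smooth_derivative(1)[of \<phi>] test_function_derivative_outside[OF assms]
  by (intro test_functionI[where K = "closure {x. \<phi> x \<noteq> 0}"]) (auto simp: test_functions_def)

lemma test_function_mono: "\<phi> \<in> test_functions S \<Longrightarrow> S \<subseteq> T \<Longrightarrow> \<phi> \<in> test_functions T" by (auto simp: test_functions_def)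

lemma test_function_bounded_linear:
  assumes "bounded_linear L" "\<phi> \<in> test_functions S" shows "(\<lambda>x. L (\<phi> x)) \<in> test_functions S"
proof (rule test_functionI[where K = "closure {x. \<phi> x \<noteq> 0}"])
  fix x assume "x \<notin> closure {x. \<phi> x \<noteq> 0}"
  then have "\<phi> x = 0" using closure_subset[of "{x. \<phi> x \<noteq> 0}"] by auto
  then show "L (\<phi> x) = 0" using assms(1) by (simp add: linear_simps)
qed (use assms smooth_bounded_linear in \<open>auto simp: test_functions_def\<close>)

lemma test_function_L2:
  assumes "\<phi> \<in> test_functions T" "S \<in> sets lebesgue" shows "\<phi> \<in> L2 S"
proof -
  let ?K = "closure {x. \<phi> x \<noteq> 0}"
  have c: "continuous_on UNIV \<phi>" "compact ?K" using assms smooth_continuous_on by (auto simp: test_functions_def)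
  obtain a where a: "?K \<subseteq> {-a..a}" using c(2) bounded_subset_cbox_symmetric[OF compact_imp_bounded[OF c(2)]] by (auto simp: cbox_interval)
  show ?thesis unfolding L2_def
  proof safe
    show "\<phi> \<in> borel_measurable (lebesgue_on S)" using borel_measurable_continuous_onI[OF c(1)]
      by (intro measurable_restrict_space1 measurable_completion) simp
    have "integrable (lebesgue_on UNIV) (\<lambda>x. (norm (\<phi> x))\<^sup>2)" by (subst integrable_support[where T = "{-a..a}"])
        (use a closure_subset[of "{x. \<phi> x \<noteq> 0}"] c(1) in
          \<open>auto intro!: continuous_integrable_Icc continuous_intros intro: continuous_on_subset\<close>)
    then show "integrable (lebesgue_on S) (\<lambda>x. (norm (\<phi> x))\<^sup>2)"
      using integrable_lebesgue_on_subset assms(2) by (metis UNIV_I sets.top space_completion space_lborel space_borel subsetI)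
  qed
qed

text \<open>A smooth function that is constantly one on an interval provides a smooth step, and products
  of two reflected, rescaled steps provide cutoffs that increase to the indicator of an interval.\<close>

locale smooth_bump =
  fixes \<eta> :: "real \<Rightarrow> real"
  assumes \<eta>_test: "\<eta> \<in> test_functions {0<..<1}"
    and \<eta>_range: "0 \<le> \<eta> s \<and> \<eta> s \<le> 1"
    and \<eta>_supp: "closure {s. \<eta> s \<noteq> 0} \<subseteq> {1/10..9/10}"
    and \<eta>_one: "s \<in> {1/3..2/3} \<Longrightarrow> \<eta> s = 1"
begin

abbreviation \<eta>' :: "real \<Rightarrow> real" where "\<eta>' x \<equiv> vector_derivative \<eta> (at x)"

lemma smooth_\<eta>: "smooth \<eta>" using \<eta>_test by (simp add: test_functions_def)

lemma \<eta>_deriv: "(\<eta> has_real_derivative \<eta>' x) (at x)"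
  using smooth_derivative(2)[OF smooth_\<eta>] by (simp add: has_real_derivative_iff_has_vector_derivative)

lemma \<eta>_zero: "x \<le> 0 \<or> x \<ge> 1 \<Longrightarrow> \<eta> x = 0" and \<eta>'_zero: "x \<le> 0 \<or> x \<ge> 1 \<Longrightarrow> \<eta>' x = 0"
  using test_function_outside[OF \<eta>_test] test_function_outside[OF test_function_derivative[OF \<eta>_test]] by auto

lemma \<eta>_zero_left: "x < 1/10 \<Longrightarrow> \<eta> x = 0" using \<eta>_supp closure_subset[of "{s. \<eta> s \<noteq> 0}"] by force

lemma \<eta>'_bounded: obtains L where "\<And>x. \<bar>\<eta>' x\<bar> \<le> L" "L > 0"
  using test_function_bounded[OF test_function_derivative[OF \<eta>_test]] by (metis real_norm_def)

definition ramp :: "real \<Rightarrow> real" where "ramp x = (if x \<le> 1/2 then \<eta> x else 1)"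

abbreviation ramp' :: "real \<Rightarrow> real" where "ramp' x \<equiv> vector_derivative ramp (at x)"

lemma smooth_ramp: "smooth ramp"
  unfolding ramp_def by (rule smooth_eqI_local[where a = "1/3" and b = "2/3"]) (use smooth_\<eta> \<eta>_one in auto)

lemma ramp_deriv: "(ramp has_real_derivative ramp' x) (at x)"
  using smooth_derivative(2)[OF smooth_ramp] by (simp add: has_real_derivative_iff_has_vector_derivative)

lemma ramp_range: "0 \<le> ramp x" "ramp x \<le> 1" using \<eta>_range by (auto simp: ramp_def)

lemma ramp_zero: "x < 1/10 \<Longrightarrow> ramp x = 0" using \<eta>_zero_left by (auto simp: ramp_def)

lemma ramp_one: "x \<ge> 1/3 \<Longrightarrow> ramp x = 1" using \<eta>_one by (auto simp: ramp_def)

lemma ramp'_zero: "x \<le> 0 \<or> x \<ge> 1/2 \<Longrightarrow> ramp' x = 0"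
proof -
  assume "x \<le> 0 \<or> x \<ge> 1/2"
  then have "x \<in> {..<1/10} \<or> x \<in> {1/3<..}" by auto
  then have "(ramp has_vector_derivative 0) (at x)"
  proof
    assume "x \<in> {..<1/10}"
    show ?thesis by (rule has_vector_derivative_transform_within_open[where f = "\<lambda>_. 0" and S = "{..<1/10}"])
        (use \<open>x \<in> {..<1/10}\<close> ramp_zero in auto)
  next
    assume "x \<in> {1/3<..}"
    show ?thesis by (rule has_vector_derivative_transform_within_open[where f = "\<lambda>_. 1" and S = "{1/3<..}"])
        (use \<open>x \<in> {1/3<..}\<close> ramp_one in auto)
  qed
  then show ?thesis by (rule vector_derivative_at)
qed

lemma ramp'_bounded: obtains B where "\<And>x. \<bar>ramp' x\<bar> \<le> B" "B > 0"
proof -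
  have "compact (ramp' ` {0..1/2})" by (intro compact_continuous_image smooth_continuous_on smooth_derivative smooth_ramp) auto
  from compact_imp_bounded[OF this] obtain B where B0: "B > 0" "\<forall>y\<in>ramp' ` {0..1/2}. norm y \<le> B"
    unfolding bounded_pos by blast
  then have B: "\<And>x. x \<in> {0..1/2} \<Longrightarrow> \<bar>ramp' x\<bar> \<le> B" "B > 0" by (simp_all add: real_norm_def)
  have "\<bar>ramp' x\<bar> \<le> B" for x using B ramp'_zero[of x] by (cases "x \<in> {0..1/2}") auto
  then show ?thesis using B(2) that by blast
qed

definition cut :: "real \<Rightarrow> real \<Rightarrow> nat \<Rightarrow> real \<Rightarrow> real" where
  "cut a b n x = ramp (real (Suc n) * (x - a)) * ramp (real (Suc n) * (b - x))"

definition cut' :: "real \<Rightarrow> real \<Rightarrow> nat \<Rightarrow> real \<Rightarrow> real" where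
  "cut' a b n x = real (Suc n) * ramp' (real (Suc n) * (x - a)) * ramp (real (Suc n) * (b - x))
     - ramp (real (Suc n) * (x - a)) * (real (Suc n) * ramp' (real (Suc n) * (b - x)))"

lemma cut_deriv: "(cut a b n has_real_derivative cut' a b n x) (at x)"
proof -
  define N where "N = real (Suc n)"
  have l: "((\<lambda>x. ramp (N * (x - a))) has_real_derivative ramp' (N * (x - a)) * N) (at x)"
    by (rule DERIV_chain2[OF ramp_deriv]) (auto intro!: derivative_eq_intros)
  have r: "((\<lambda>x. ramp (N * (b - x))) has_real_derivative ramp' (N * (b - x)) * (- N)) (at x)"
    by (rule DERIV_chain2[OF ramp_deriv]) (auto intro!: derivative_eq_intros)
  have eq: "cut a b n = (\<lambda>x. ramp (N * (x - a)) * ramp (N * (b - x)))" by (simp add: fun_eq_iff cut_def N_def)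
  show ?thesis unfolding eq by (rule DERIV_cong[OF DERIV_mult[OF l r]]) (unfold cut'_def N_def[symmetric], simp add: algebra_simps)
qed

lemma smooth_cut: "smooth (cut a b n)"
proof -
  define N where "N = real (Suc n)"
  have "cut a b n = (\<lambda>x. ramp (N * x + (- N * a)) * ramp ((- N) * x + N * b))"
    unfolding fun_eq_iff cut_def N_def[symmetric] by (simp add: right_diff_distrib)
  moreover have "smooth (\<lambda>x. ramp (N * x + (- N * a)) * ramp ((- N) * x + N * b))"
    by (rule smooth_mult[OF smooth_affine[OF smooth_ramp] smooth_affine[OF smooth_ramp]])
  ultimately show ?thesis by simp
qed

lemma cut_range: "0 \<le> cut a b n x" "cut a b n x \<le> 1" using ramp_range by (auto simp: cut_def intro!: mult_le_one)

lemma cut_zero: assumes "x \<notin> {a + 1/(10 * real (Suc n))..b - 1/(10 * real (Suc n))}" shows "cut a b n x = 0"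
proof -
  define N where "N = real (Suc n)"
  have "N > 0" by (simp add: N_def)
  have "x - a < 1/(10 * N) \<or> b - x < 1/(10 * N)" using assms unfolding N_def[symmetric] by auto
  then have "N * (x - a) < N * (1/(10 * N)) \<or> N * (b - x) < N * (1/(10 * N))" using \<open>N > 0\<close> by (simp only: mult_less_cancel_left_pos)
  then have "N * (x - a) < 1/10 \<or> N * (b - x) < 1/10" using \<open>N > 0\<close> by simp
  then show ?thesis unfolding cut_def N_def[symmetric] using ramp_zero by auto
qed

lemma cut_zero_outside: "x \<notin> {a<..<b} \<Longrightarrow> cut a b n x = 0"
proof (rule cut_zero)
  assume "x \<notin> {a<..<b}"
  moreover define e where "e = 1/(10 * real (Suc n))"
  moreover have "0 < e" by (simp add: e_def)
  ultimately show "x \<notin> {a + 1/(10 * real (Suc n))..b - 1/(10 * real (Suc n))}"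
    unfolding e_def[symmetric] by auto
qed

lemma cut_eventually: assumes "x \<in> {a<..<b}"
  shows "eventually (\<lambda>n. cut a b n x = 1 \<and> cut' a b n x = 0) sequentially"
proof -
  obtain N where N: "real N > 1 / (x - a)" "real N > 1 / (b - x)" using reals_Archimedean2[of "max (1 / (x - a)) (1 / (b - x))"] by auto
  show ?thesis
  proof (rule eventually_sequentiallyI[of N])
    fix n assume n: "N \<le> n"
    have "real N \<le> real (Suc n)" using n by simp
    then have "1 / (x - a) \<le> real (Suc n)" "1 / (b - x) \<le> real (Suc n)" using N by linarith+
    then have "real (Suc n) * (x - a) \<ge> 1" "real (Suc n) * (b - x) \<ge> 1"
      using assms by (simp_all only: pos_divide_le_eq diff_gt_0_iff_gt greaterThanLessThan_iff)
    then show "cut a b n x = 1 \<and> cut' a b n x = 0" using ramp_one ramp'_zero by (auto simp: cut_def cut'_def)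
  qed
qed

lemma cut_test:
  assumes "smooth h" shows "(\<lambda>x. complex_of_real (cut a b n x) * h x) \<in> test_functions {a<..<b}"
proof (rule test_functionI)
  show "smooth (\<lambda>x. complex_of_real (cut a b n x) * h x)" by (intro smooth_mult smooth_of_real smooth_cut assms)
  define e where "e = 1/(10 * real (Suc n))"
  have "0 < e" by (simp add: e_def)
  then show "{a + 1/(10 * real (Suc n))..b - 1/(10 * real (Suc n))} \<subseteq> {a<..<b}"
    unfolding e_def[symmetric] by auto
  fix x assume "x \<notin> {a + 1/(10 * real (Suc n))..b - 1/(10 * real (Suc n))}"
  then show "complex_of_real (cut a b n x) * h x = 0" using cut_zero by simp
qed auto

lemma cut_test': "(\<lambda>x. complex_of_real (cut a b n x)) \<in> test_functions {a<..<b}" using cut_test[OF smooth_const[of 1]] by simp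

end

section \<open>The fundamental lemma and the lemma of du Bois-Reymond\<close>

lemma continuous_measurable_lebesgue_on:
  fixes f :: "real \<Rightarrow> 'a::euclidean_space"
  assumes "continuous_on UNIV f" shows "f \<in> borel_measurable (lebesgue_on S)" using borel_measurable_continuous_onI[OF assms]
  by (intro measurable_restrict_space1 measurable_completion) simp

lemma smooth_measurable:
  fixes f :: "real \<Rightarrow> 'a::euclidean_space"
  assumes "smooth f" shows "f \<in> borel_measurable (lebesgue_on S)" by (intro continuous_measurable_lebesgue_on smooth_continuous_on assms)

lemma AE_lebesgue_on:
  assumes "AE x in lebesgue. P x" "S \<in> sets lebesgue" shows "AE x in lebesgue_on S. P x"
  using assms by (subst AE_restrict_space_iff) (auto elim: eventually_mono)

lemma open_covered_by_rational_intervals: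
  fixes S :: "real set"
  assumes "open S" "x \<in> S"
  obtains a b where "a \<in> \<rat>" "b \<in> \<rat>" "x \<in> {a..b}" "{a..b} \<subseteq> S"
proof -
  obtain e where e: "e > 0" "ball x e \<subseteq> S" using assms openE by blast
  obtain a where a: "a \<in> \<rat>" "x - e < a" "a < x" using Rats_dense_in_real[of "x - e" x] e by auto
  obtain b where b: "b \<in> \<rat>" "x < b" "b < x + e" using Rats_dense_in_real[of x "x + e"] e by auto
  have "{a..b} \<subseteq> ball x e" using a b by (auto simp: dist_real_def)
  then show ?thesis using that[of a b] a b e by auto
qed

context smooth_bump
begin

text \<open>Testing with cutoffs gives that all integrals over compact intervals vanish.\<close>

lemma fundamental_lemma:
  fixes g :: "real \<Rightarrow> complex"
  assumes S: "open S"
    and loc: "\<And>a b. {a..b} \<subseteq> S \<Longrightarrow> integrable (lebesgue_on {a..b}) g"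
    and zero: "\<And>\<phi>. \<phi> \<in> test_functions S \<Longrightarrow> (\<integral>x. g x * \<phi> x \<partial>lebesgue_on S) = 0"
  shows "AE x in lebesgue_on S. g x = 0"
proof -
  have SL: "S \<in> sets lebesgue" using S by simp
  have int0: "(\<integral>x. g x \<partial>lebesgue_on {a..b}) = 0" if ab: "{a..b} \<subseteq> S" for a b
  proof -
    let ?M = "lebesgue_on {a..b}"
    let ?\<phi> = "\<lambda>n x. complex_of_real (cut a b n x)"
    have test: "?\<phi> n \<in> test_functions S" for n by (rule test_function_mono[OF cut_test']) (use ab in auto)
    have z: "(\<integral>x. ?\<phi> n x * g x \<partial>?M) = 0" for n
    proof -
      have "(\<integral>x. ?\<phi> n x * g x \<partial>lebesgue_on S) = (\<integral>x. ?\<phi> n x * g x \<partial>?M)" by (rule integral_support) (use ab SL cut_zero_outside[of _ a b n] in auto)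
      then show ?thesis using zero[OF test[of n]] by (simp add: mult.commute)
    qed
    have "(\<lambda>n. \<integral>x. ?\<phi> n x * g x \<partial>?M) \<longlonglongrightarrow> (\<integral>x. g x \<partial>?M)"
    proof (rule integral_dominated_convergence[where w = "\<lambda>x. norm (g x)"])
      show "integrable ?M (\<lambda>x. norm (g x))" using loc[OF ab] by simp
      show "g \<in> borel_measurable ?M" using loc[OF ab] by simp
      show "(\<lambda>x. ?\<phi> n x * g x) \<in> borel_measurable ?M" for n by (rule borel_measurable_times[OF smooth_measurable[OF smooth_of_real[OF smooth_cut]]])
          (use loc[OF ab] in simp)
      show "AE x in ?M. norm (?\<phi> n x * g x) \<le> norm (g x)" for n
        using cut_range[of a b n] by (intro AE_I2) (auto simp: norm_mult intro: mult_left_le_one_le)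
      have "AE x in lebesgue. x \<notin> {a, b}" by (intro AE_not_in) auto
      then have "AE x in ?M. x \<notin> {a, b}" by (rule AE_lebesgue_on) simp
      then show "AE x in ?M. (\<lambda>n. ?\<phi> n x * g x) \<longlonglongrightarrow> g x"
      proof (rule lebesgue_on_mono)
        fix x assume "x \<notin> {a, b}" "x \<in> {a..b}"
        then have "eventually (\<lambda>n. cut a b n x = 1 \<and> cut' a b n x = 0) sequentially" by (intro cut_eventually) auto
        then have "eventually (\<lambda>n. ?\<phi> n x * g x = g x) sequentially" by eventually_elim simp
        then show "(\<lambda>n. ?\<phi> n x * g x) \<longlonglongrightarrow> g x" by (rule tendsto_eventually)
      qed
    qed
    then show ?thesis using z by (simp add: LIMSEQ_const_iff)
  qed
  let ?I = "{(a, b). a \<in> \<rat> \<and> b \<in> \<rat> \<and> {a..b::real} \<subseteq> S}"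
  have "AE x in lebesgue. \<forall>(a, b)\<in>?I. x \<in> {a..b} \<longrightarrow> g x = 0"
  proof (rule AE_ball_countable'[where I = ?I and P = "\<lambda>p x. case p of (a, b) \<Rightarrow> x \<in> {a..b} \<longrightarrow> g x = 0"])
    have "?I \<subseteq> \<rat> \<times> \<rat>" by auto
    then show "countable ?I" by (rule countable_subset) (intro countable_SIGMA countable_rat)
    fix p assume "p \<in> ?I"
    then obtain a b where p: "p = (a, b)" "{a..b} \<subseteq> S" by auto
    have "AE x in lebesgue_on {a..b}. g x = 0" by (rule AE_zero_if_all_interval_integrals_zero[OF loc[OF p(2)] int0]) (use p(2) in auto)
    then show "AE x in lebesgue. case p of (a, b) \<Rightarrow> x \<in> {a..b} \<longrightarrow> g x = 0" using p by (simp add: AE_restrict_space_iff)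
  qed
  then have "AE x in lebesgue. x \<in> S \<longrightarrow> g x = 0"
  proof eventually_elim
    case (elim x)
    show ?case
    proof
      assume "x \<in> S"
      then obtain a b where ab: "a \<in> \<rat>" "b \<in> \<rat>" "x \<in> {a..b}" "{a..b} \<subseteq> S" by (rule open_covered_by_rational_intervals[OF S])
      then have "(a, b) \<in> ?I" by simp
      from bspec[OF elim this] ab(3) show "g x = 0" by simp
    qed
  qed
  then show ?thesis using SL by (simp add: AE_restrict_space_iff)
qed

text \<open>The product of height and width of the kernels stays bounded, so their absolute masses do too, and \<open>c\<close> is nearly constant on their shrinking supports.\<close>

lemma concentrating_kernels:
  fixes c :: "real \<Rightarrow> complex"
  assumes p: "p \<in> {a..b}" and c: "continuous_on {a..b} c"
    and kc: "\<And>n. continuous_on {a..b} (k n)"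
    and k1: "eventually (\<lambda>n. (\<integral>x. k n x \<partial>lebesgue_on {a..b}) = (1::real)) sequentially"
    and kB: "\<And>n x. \<bar>k n x\<bar> \<le> real (Suc n) * B"
    and k0: "\<And>n x. real (Suc n) * \<bar>x - p\<bar> > 1 \<Longrightarrow> k n x = 0"
  shows "(\<lambda>n. \<integral>x. complex_of_real (k n x) * c x \<partial>lebesgue_on {a..b}) \<longlonglongrightarrow> c p"
proof (rule LIMSEQ_I)
  fix r :: real assume r: "r > 0"
  let ?M = "lebesgue_on {a..b}"
  have B: "B \<ge> 0" using kB[of 0 0] abs_ge_zero[of "k 0 0"] by (simp del: abs_ge_zero)
  define e where "e = r / (2 * B + 1) / 2"
  have e0: "e > 0" using r B by (simp add: e_def)
  have "2 * B + 1 \<noteq> 0" using B by simp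
  then have "e * (2 * B + 1) = r / 2" unfolding e_def by (simp del: distrib_right_numeral)
  then have e: "e > 0" "e * (2 * B) < r" using r e0 by (auto simp: distrib_left)
  obtain d where d: "d > 0" "\<And>x. x \<in> {a..b} \<Longrightarrow> dist x p < d \<Longrightarrow> dist (c x) (c p) < e" using c p e unfolding continuous_on_iff by metis
  obtain N where N: "real N > 1 / d" using reals_Archimedean2 by blast
  obtain N1 where N1: "\<And>n. n \<ge> N1 \<Longrightarrow> (\<integral>x. k n x \<partial>?M) = 1" using k1 by (auto simp: eventually_sequentially)
  show "\<exists>N. \<forall>n\<ge>N. norm ((\<integral>x. complex_of_real (k n x) * c x \<partial>?M) - c p) < r"
  proof (intro exI[of _ "max N N1"] allI impI)
    fix n assume n: "max N N1 \<le> n"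
    define m where "m = real (Suc n)"
    have m: "m > 0" "m > 1 / d" using n N by (auto simp: m_def)
    note int = continuous_integrable_Icc
    have i1: "integrable ?M (\<lambda>x. complex_of_real (k n x) * c x)" by (intro int continuous_intros c kc)
    have i2: "integrable ?M (\<lambda>x. complex_of_real (k n x))" by (intro int continuous_intros kc)
    have "(\<integral>x. complex_of_real (k n x) \<partial>?M) = 1" using N1[of n] n by simp
    then have "(\<integral>x. complex_of_real (k n x) * c x \<partial>?M) - c p
      = (\<integral>x. complex_of_real (k n x) * c x \<partial>?M) - (\<integral>x. complex_of_real (k n x) * c p \<partial>?M)" by simp
    also have "... = (\<integral>x. complex_of_real (k n x) * (c x - c p) \<partial>?M)" using i1 i2 by (simp add: right_diff_distrib)
    also have "norm ... \<le> (\<integral>x. norm (complex_of_real (k n x) * (c x - c p)) \<partial>?M)" by (rule integral_norm_bound)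
    also have "... \<le> (\<integral>x. indicator {p - 1/m..p + 1/m} x * (m * B * e) \<partial>?M)"
    proof (rule integral_mono)
      show "integrable ?M (\<lambda>x. norm (complex_of_real (k n x) * (c x - c p)))" by (intro int continuous_intros c kc)
      show "integrable ?M (\<lambda>x. indicator {p - 1/m..p + 1/m} x * (m * B * e))" using B m e
      proof (intro finite_measure.integrable_const_bound[OF finite_measure_lebesgue_on, where B = "m * B * e"])
        show "(\<lambda>x. indicator {p - 1/m..p + 1/m} x * (m * B * e)) \<in> borel_measurable ?M"
          by (intro measurable_restrict_space1 measurable_completion) simp
      qed (auto simp: indicator_def)
      fix x assume "x \<in> space ?M"
      then have x: "x \<in> {a..b}" by simp
      show "norm (complex_of_real (k n x) * (c x - c p)) \<le> indicator {p - 1/m..p + 1/m} x * (m * B * e)"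
      proof (cases "x \<in> {p - 1/m..p + 1/m}")
        case True
        have "1 / m < d" using m d by (simp add: field_simps)
        then have "dist x p < d" using True by (auto simp: dist_real_def)
        then have "norm (c x - c p) \<le> e" using d(2)[OF x] by (simp add: dist_norm less_imp_le)
        then have "\<bar>k n x\<bar> * norm (c x - c p) \<le> (m * B) * e" using kB[of n x] B m by (intro mult_mono) (auto simp: m_def)
        then show ?thesis using True by (simp add: norm_mult)
      next
        case False
        then have "1 / m < \<bar>x - p\<bar>" by auto
        then have "m * \<bar>x - p\<bar> > 1" using m by (simp add: field_simps)
        then have "k n x = 0" unfolding m_def by (rule k0)
        moreover have "0 \<le> m * B * e" using m B e by simp
        ultimately show ?thesis by simp
      qed
    qed
    also have "... \<le> (\<integral>x. indicator {p - 1/m..p + 1/m} x * (m * B * e) \<partial>lebesgue)"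
    proof -
      have "(\<integral>x. indicator {p - 1/m..p + 1/m} x * (m * B * e) \<partial>?M)
        = (\<integral>x. indicator {a..b} x *\<^sub>R (indicator {p - 1/m..p + 1/m} x * (m * B * e)) \<partial>lebesgue)" by (rule integral_restrict_space) simp
      also have "... \<le> (\<integral>x. indicator {p - 1/m..p + 1/m} x * (m * B * e) \<partial>lebesgue)"
      proof (rule Bochner_Integration.integral_mono_AE')
        show "integrable lebesgue (\<lambda>x. indicator {p - 1/m..p + 1/m} x * (m * B * e))"
          by (intro integrable_mult_left integrable_real_indicator) (auto simp: emeasure_lborel_Icc_eq)
      qed (use m B e in \<open>auto simp: indicator_def intro!: AE_I2\<close>)
      finally show ?thesis .
    qed
    also have "... = e * (2 * B)" using m by (simp add: field_simps)
    also have "... < r" by (rule e)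
    finally show "norm ((\<integral>x. complex_of_real (k n x) * c x \<partial>?M) - c p) < r" .
  qed
qed

lemma integral_derivative_Icc:
  fixes F :: "real \<Rightarrow> 'a::euclidean_space"
  assumes "a \<le> b" "\<And>x. x \<in> {a..b} \<Longrightarrow> (F has_vector_derivative f x) (at x)" "continuous_on {a..b} f"
  shows "(\<integral>x. f x \<partial>lebesgue_on {a..b}) = F b - F a"
proof -
  have "(f has_integral (F b - F a)) {a..b}" by (rule fundamental_theorem_of_calculus[OF assms(1)])
      (use assms(2) in \<open>auto intro: has_vector_derivative_at_within\<close>)
  moreover have "(\<integral>x. f x \<partial>lebesgue_on {a..b}) = integral {a..b} f"
    by (rule lebesgue_integral_eq_integral[OF continuous_integrable_Icc[OF assms(3)]]) simp
  ultimately show ?thesis by (simp add: integral_unique)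
qed

lemma continuous_on_ramp'_affine: "continuous_on S (\<lambda>x. ramp' (m * x + d))"
  by (rule continuous_on_compose2[OF smooth_continuous_on[OF smooth_derivative(1)[OF smooth_ramp], of UNIV]])
    (auto intro!: continuous_intros)

text \<open>The derivatives of the cutoffs of an interval concentrate, with total masses one and minus one,
  at its two end points.\<close>

lemma du_Bois_Reymond:
  fixes c g :: "real \<Rightarrow> complex"
  assumes S: "S \<in> sets lebesgue" and ab: "{a..b} \<subseteq> S" "a < b"
    and c: "continuous_on {a..b} c" and g: "integrable (lebesgue_on {a..b}) g"
    and weak: "\<And>\<psi>. \<psi> \<in> test_functions S \<Longrightarrow>
      (\<integral>x. vector_derivative \<psi> (at x) * c x \<partial>lebesgue_on S) = - (\<integral>x. \<psi> x * g x \<partial>lebesgue_on S)"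
  shows "c b - c a = (\<integral>x. g x \<partial>lebesgue_on {a..b})"
proof -
  let ?M = "lebesgue_on {a..b}"
  let ?\<psi> = "\<lambda>n x. complex_of_real (cut a b n x)"
  have test: "?\<psi> n \<in> test_functions S" for n by (rule test_function_mono[OF cut_test']) (use ab in auto)
  have deriv: "vector_derivative (?\<psi> n) (at x) = complex_of_real (cut' a b n x)" for n x using cut_deriv[of a b n x]
    by (intro vector_derivative_at has_vector_derivative_of_real)
      (simp add: has_real_derivative_iff_has_vector_derivative)
  have cut'0: "cut' a b n x = 0" if "x \<notin> {a..b}" for n x
  proof -
    have "x < a \<or> b < x" using that by auto
    then show ?thesis
    proof
      assume "x < a"
      then have "real (Suc n) * (x - a) \<le> 0" by (simp add: mult_le_0_iff del: of_nat_Suc)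
      then show ?thesis using ramp'_zero ramp_zero by (simp add: cut'_def del: of_nat_Suc)
    next
      assume "b < x"
      then have "real (Suc n) * (b - x) \<le> 0" by (simp add: mult_le_0_iff del: of_nat_Suc)
      then show ?thesis using ramp'_zero ramp_zero by (simp add: cut'_def del: of_nat_Suc)
    qed
  qed
  have eq: "(\<integral>x. complex_of_real (cut' a b n x) * c x \<partial>?M) = - (\<integral>x. ?\<psi> n x * g x \<partial>?M)" for n
  proof -
    have "(\<integral>x. vector_derivative (?\<psi> n) (at x) * c x \<partial>lebesgue_on S) = (\<integral>x. complex_of_real (cut' a b n x) * c x \<partial>?M)"
      unfolding deriv by (rule integral_support) (use ab S cut'0 in auto)
    moreover have "(\<integral>x. ?\<psi> n x * g x \<partial>lebesgue_on S) = (\<integral>x. ?\<psi> n x * g x \<partial>?M)"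
      by (rule integral_support) (use ab S cut_zero_outside[of _ a b n] in auto)
    ultimately show ?thesis using weak[OF test[of n]] by simp
  qed
  have "(\<lambda>n. \<integral>x. ?\<psi> n x * g x \<partial>?M) \<longlonglongrightarrow> (\<integral>x. g x \<partial>?M)"
  proof (rule integral_dominated_convergence[where w = "\<lambda>x. norm (g x)"])
    show "(\<lambda>x. ?\<psi> n x * g x) \<in> borel_measurable ?M" for n
      by (rule borel_measurable_times[OF smooth_measurable[OF smooth_of_real[OF smooth_cut]]]) (use g in simp)
    show "AE x in ?M. norm (?\<psi> n x * g x) \<le> norm (g x)" for n
      using cut_range[of a b n] by (intro AE_I2) (auto simp: norm_mult intro: mult_left_le_one_le)
    have "AE x in lebesgue. x \<notin> {a, b}" by (intro AE_not_in) auto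
    then have "AE x in ?M. x \<notin> {a, b}" by (rule AE_lebesgue_on) simp
    then show "AE x in ?M. (\<lambda>n. ?\<psi> n x * g x) \<longlonglongrightarrow> g x"
    proof (rule lebesgue_on_mono)
      fix x assume "x \<notin> {a, b}" "x \<in> {a..b}"
      then have "eventually (\<lambda>n. cut a b n x = 1 \<and> cut' a b n x = 0) sequentially" by (intro cut_eventually) auto
      then have "eventually (\<lambda>n. ?\<psi> n x * g x = g x) sequentially" by eventually_elim simp
      then show "(\<lambda>n. ?\<psi> n x * g x) \<longlonglongrightarrow> g x" by (rule tendsto_eventually)
    qed
  qed (use g in auto)
  then have lim1: "(\<lambda>n. \<integral>x. complex_of_real (cut' a b n x) * c x \<partial>?M) \<longlonglongrightarrow> - (\<integral>x. g x \<partial>?M)"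
    unfolding eq by (rule tendsto_minus)
  obtain B where B: "\<And>x. \<bar>ramp' x\<bar> \<le> B" "B > 0" using ramp'_bounded by blast
  define kl where "kl n x = real (Suc n) * ramp' (real (Suc n) * x + (- real (Suc n) * a))" for n x
  define kr where "kr n x = real (Suc n) * ramp' ((- real (Suc n)) * x + real (Suc n) * b)" for n x
  have big: "eventually (\<lambda>n. real (Suc n) * (b - a) \<ge> 1) sequentially"
  proof -
    obtain N where N: "real N > 1 / (b - a)" using reals_Archimedean2 by blast
    show ?thesis
    proof (rule eventually_sequentiallyI[of N])
      fix n assume "N \<le> n"
      then have "1 / (b - a) \<le> real (Suc n)" using N by linarith
      then show "real (Suc n) * (b - a) \<ge> 1" using ab by (simp add: pos_divide_le_eq del: of_nat_Suc)
    qed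
  qed
  have "(\<lambda>n. \<integral>x. complex_of_real (kl n x) * c x \<partial>?M) \<longlonglongrightarrow> c a"
  proof (rule concentrating_kernels[OF _ c, where B = B])
    show kc: "continuous_on {a..b} (kl n)" for n
      unfolding kl_def by (intro continuous_intros continuous_on_ramp'_affine)
    show "eventually (\<lambda>n. (\<integral>x. kl n x \<partial>lebesgue_on {a..b}) = 1) sequentially" using big
    proof eventually_elim
      case (elim n)
      define m where "m = real (Suc n)"
      have d: "((\<lambda>x. ramp (m * x + (- m * a))) has_vector_derivative kl n x) (at x)" for x
        unfolding has_real_derivative_iff_has_vector_derivative[symmetric] kl_def m_def[symmetric]
        by (rule DERIV_cong[OF DERIV_chain2[OF ramp_deriv]]) (auto intro!: derivative_eq_intros)
      have "(\<integral>x. kl n x \<partial>lebesgue_on {a..b}) = ramp (m * b + (- m * a)) - ramp (m * a + (- m * a))"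
        by (rule integral_derivative_Icc[OF _ d kc]) (use ab in simp)
      moreover have "m * b + (- m * a) \<ge> 1" using elim unfolding m_def[symmetric] by (simp add: right_diff_distrib)
      ultimately show ?case using ramp_one[of "m * b + (- m * a)"] ramp_zero[of 0] by simp
    qed
    show "\<bar>kl n x\<bar> \<le> real (Suc n) * B" for n x using B(1) by (simp add: kl_def abs_mult mult_left_mono del: of_nat_Suc)
    show "kl n x = 0" if h: "real (Suc n) * \<bar>x - a\<bar> > 1" for n x
    proof -
      define m where "m = real (Suc n)"
      have m: "m > 0" by (simp add: m_def)
      have "\<bar>m * x + (- m * a)\<bar> = \<bar>m * (x - a)\<bar>" by (simp add: right_diff_distrib)
      also have "... = m * \<bar>x - a\<bar>" using m by (simp add: abs_mult)
      finally have h: "\<bar>m * x + (- m * a)\<bar> > 1" using h unfolding m_def[symmetric] by simp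
      then show ?thesis using ramp'_zero[of "m * x + (- m * a)"] unfolding kl_def m_def[symmetric] by (auto simp: abs_if split: if_splits)
    qed
  qed (use ab in auto)
  moreover have "(\<lambda>n. \<integral>x. complex_of_real (kr n x) * c x \<partial>?M) \<longlonglongrightarrow> c b"
  proof (rule concentrating_kernels[OF _ c, where B = B])
    show kc: "continuous_on {a..b} (kr n)" for n
      unfolding kr_def by (intro continuous_intros continuous_on_ramp'_affine)
    show "eventually (\<lambda>n. (\<integral>x. kr n x \<partial>lebesgue_on {a..b}) = 1) sequentially" using big
    proof eventually_elim
      case (elim n)
      define m where "m = real (Suc n)"
      have d: "((\<lambda>x. - ramp ((- m) * x + m * b)) has_vector_derivative kr n x) (at x)" for x
        unfolding has_real_derivative_iff_has_vector_derivative[symmetric] kr_def m_def[symmetric]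
        by (rule DERIV_cong[OF DERIV_minus[OF DERIV_chain2[OF ramp_deriv]]]) (auto intro!: derivative_eq_intros)
      have "(\<integral>x. kr n x \<partial>lebesgue_on {a..b}) = - ramp ((- m) * b + m * b) - - ramp ((- m) * a + m * b)"
        by (rule integral_derivative_Icc[OF _ d kc]) (use ab in simp)
      moreover have "(- m) * a + m * b \<ge> 1" using elim unfolding m_def[symmetric] by (simp add: right_diff_distrib)
      ultimately show ?case using ramp_one[of "(- m) * a + m * b"] ramp_zero[of 0] by simp
    qed
    show "\<bar>kr n x\<bar> \<le> real (Suc n) * B" for n x using B(1) by (simp add: kr_def abs_mult mult_left_mono del: of_nat_Suc)
    show "kr n x = 0" if h: "real (Suc n) * \<bar>x - b\<bar> > 1" for n x
    proof -
      define m where "m = real (Suc n)"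
      have m: "m > 0" by (simp add: m_def)
      have "\<bar>(- m) * x + m * b\<bar> = \<bar>m * (x - b)\<bar>" by (simp add: right_diff_distrib)
      also have "... = m * \<bar>x - b\<bar>" using m by (simp add: abs_mult)
      finally have h: "\<bar>(- m) * x + m * b\<bar> > 1" using h unfolding m_def[symmetric] by simp
      then show ?thesis using ramp'_zero[of "(- m) * x + m * b"] unfolding kr_def m_def[symmetric] by (auto simp: abs_if split: if_splits)
    qed
  qed (use ab in auto)
  ultimately have "(\<lambda>n. (\<integral>x. complex_of_real (kl n x) * c x \<partial>?M) - (\<integral>x. complex_of_real (kr n x) * c x \<partial>?M)) \<longlonglongrightarrow> c a - c b" by (rule tendsto_diff)
  moreover have "eventually (\<lambda>n. (\<integral>x. complex_of_real (kl n x) * c x \<partial>?M) - (\<integral>x. complex_of_real (kr n x) * c x \<partial>?M)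
     = (\<integral>x. complex_of_real (cut' a b n x) * c x \<partial>?M)) sequentially" using big
  proof eventually_elim
    case (elim n)
    define m where "m = real (Suc n)"
    have m: "m * (b - a) \<ge> 1" "m > 0" using elim by (auto simp: m_def)
    (* once the interval is long against the transition width, each factor is constant where
       the derivative of the other one does not vanish *)
    have cut': "cut' a b n x = kl n x - kr n x" if "x \<in> {a..b}" for x
    proof -
      have sum: "m * (x - a) + m * (b - x) \<ge> 1" using m by (simp add: right_diff_distrib)
      have 1: "ramp' (m * (x - a)) * ramp (m * (b - x)) = ramp' (m * (x - a))" using ramp'_zero[of "m * (x - a)"] ramp_one[of "m * (b - x)"] sum
        by (cases "m * (x - a) \<ge> 1/2") auto
      have 2: "ramp (m * (x - a)) * ramp' (m * (b - x)) = ramp' (m * (b - x))" using ramp'_zero[of "m * (b - x)"] ramp_one[of "m * (x - a)"] sum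
        by (cases "m * (b - x) \<ge> 1/2") auto
      have a: "m * x + (- m * a) = m * (x - a)" "(- m) * x + m * b = m * (b - x)" by (auto simp: right_diff_distrib)
      have "cut' a b n x = m * (ramp' (m * (x - a)) * ramp (m * (b - x))) - m * (ramp (m * (x - a)) * ramp' (m * (b - x)))"
        unfolding cut'_def m_def[symmetric] by simp
      then show ?thesis unfolding 1 2 kl_def kr_def m_def[symmetric] a by simp
    qed
    have "continuous_on {a..b} (kl n)" "continuous_on {a..b} (kr n)"
      unfolding kl_def kr_def by (intro continuous_intros continuous_on_ramp'_affine)+
    then have "integrable ?M (\<lambda>x. complex_of_real (kl n x) * c x)" "integrable ?M (\<lambda>x. complex_of_real (kr n x) * c x)"
      using c by (auto intro!: continuous_integrable_Icc continuous_intros)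
    then have "(\<integral>x. complex_of_real (kl n x) * c x \<partial>?M) - (\<integral>x. complex_of_real (kr n x) * c x \<partial>?M)
      = (\<integral>x. complex_of_real (kl n x) * c x - complex_of_real (kr n x) * c x \<partial>?M)" by simp
    also have "... = (\<integral>x. complex_of_real (cut' a b n x) * c x \<partial>?M)" by (rule Bochner_Integration.integral_cong) (auto simp: cut' left_diff_distrib)
    finally show ?case .
  qed
  ultimately have "(\<lambda>n. \<integral>x. complex_of_real (cut' a b n x) * c x \<partial>?M) \<longlonglongrightarrow> c a - c b" by (rule Lim_transform_eventually)
  from LIMSEQ_unique[OF this lim1] show ?thesis by (simp add: algebra_simps)
qed

end

section \<open>Sobolev functions\<close>

lemma smooth_E0_L2:
  assumes "smooth h" "S \<in> sets lebesgue" "{0<..<pi} \<subseteq> S" shows "E0 h \<in> L2 S"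
proof (rule L2_bound[where g = "\<lambda>x. if x \<in> {0..pi} then (norm (h x))\<^sup>2 else 0"])
  have "(\<lambda>x. if x \<in> {0<..<pi} then h x else 0) \<in> borel_measurable (lebesgue_on S)"
    by (rule iffD2[OF borel_measurable_if_lebesgue_on[OF _ assms(2,3)] smooth_measurable[OF assms(1)]]) simp
  then show "E0 h \<in> borel_measurable (lebesgue_on S)" by (simp add: E0_def[abs_def])
  let ?g = "\<lambda>x. if x \<in> {0..pi} then (norm (h x))\<^sup>2 else 0"
  have "integrable (lebesgue_on {0..pi}) (\<lambda>x. (norm (h x))\<^sup>2)" by (rule continuous_integrable_Icc, rule continuous_on_power, rule continuous_on_norm,
        rule smooth_continuous_on, rule assms)
  then have "integrable lebesgue ?g" by (subst Lebesgue_Measure.integrable_restrict_UNIV) simp_all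
  then have "integrable (lebesgue_on UNIV) ?g" by (simp add: lebesgue_on_UNIV_eq)
  then show "integrable (lebesgue_on S) ?g" by (rule integrable_lebesgue_on_subset) (use assms in auto)
  show "(norm (E0 h x))\<^sup>2 \<le> ?g x" if "x \<in> S" for x
    unfolding E0_def by auto
qed

context smooth_bump
begin

lemma weak_derivative_unique:
  assumes S: "open S" and v: "v1 \<in> L2 S" "v2 \<in> L2 S"
    "has_weak_derivative S v v1" "has_weak_derivative S v v2"
  shows "AE x in lebesgue_on S. v1 x = v2 x"
proof -
  have SL: "S \<in> sets lebesgue" using S by simp
  have "AE x in lebesgue_on S. v1 x - v2 x = 0"
  proof (rule fundamental_lemma[OF S])
    show "integrable (lebesgue_on {a..b}) (\<lambda>x. v1 x - v2 x)" if "{a..b} \<subseteq> S" for a b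
      by (rule L2_integrable_on_finite_measure[OF L2_diff[OF v(1,2)] that SL]) simp
    fix \<phi> :: "real \<Rightarrow> complex" assume \<phi>: "\<phi> \<in> test_functions S"
    have i: "integrable (lebesgue_on S) (\<lambda>x. v1 x * \<phi> x)" "integrable (lebesgue_on S) (\<lambda>x. v2 x * \<phi> x)"
      using test_function_L2[OF \<phi> SL] v by (auto intro: L2_product_integrable)
    have "(\<integral>x. v1 x * \<phi> x \<partial>lebesgue_on S) = (\<integral>x. v2 x * \<phi> x \<partial>lebesgue_on S)" using v(3,4) \<phi> unfolding has_weak_derivative_def by fastforce
    then show "(\<integral>x. (v1 x - v2 x) * \<phi> x \<partial>lebesgue_on S) = 0" using i by (simp add: left_diff_distrib)
  qed
  then show ?thesis by eventually_elim simp
qed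

lemma H1_L2: "v \<in> H1 S \<Longrightarrow> v \<in> L2 S" by (simp add: H1_def)

lemma wderiv:
  assumes "v \<in> H1 S"
  shows wderiv_L2: "wderiv S v \<in> L2 S" and wderiv_weak: "has_weak_derivative S v (wderiv S v)"
proof -
  have "\<exists>v'. v' \<in> L2 S \<and> has_weak_derivative S v v'" using assms by (auto simp: H1_def)
  from someI_ex[OF this] show "wderiv S v \<in> L2 S" "has_weak_derivative S v (wderiv S v)" by (auto simp: wderiv_def)
qed

lemma H1I: "v \<in> L2 S \<Longrightarrow> v' \<in> L2 S \<Longrightarrow> has_weak_derivative S v v' \<Longrightarrow> v \<in> H1 S" by (auto simp: H1_def)

lemma wderiv_AE:
  assumes "open S" "v \<in> L2 S" "v' \<in> L2 S" "has_weak_derivative S v v'"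
  shows "AE x in lebesgue_on S. wderiv S v x = v' x" by (rule weak_derivative_unique[OF assms(1) wderiv_L2[OF H1I[OF assms(2-4)]] assms(3)
        wderiv_weak[OF H1I[OF assms(2-4)]] assms(4)])

lemma has_weak_derivative_add:
  assumes "S \<in> sets lebesgue" "v \<in> L2 S" "w \<in> L2 S" "v' \<in> L2 S" "w' \<in> L2 S"
    "has_weak_derivative S v v'" "has_weak_derivative S w w'"
  shows "has_weak_derivative S (\<lambda>x. v x + w x) (\<lambda>x. v' x + w' x)"
  unfolding has_weak_derivative_def
proof
  fix \<phi> :: "real \<Rightarrow> complex" assume \<phi>: "\<phi> \<in> test_functions S"
  note L2 = test_function_L2[OF \<phi> assms(1)] test_function_L2[OF test_function_derivative[OF \<phi>] assms(1)]
  show "(\<integral>x. (v x + w x) * vector_derivative \<phi> (at x) \<partial>lebesgue_on S) = - (\<integral>x. (v' x + w' x) * \<phi> x \<partial>lebesgue_on S)"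
    using assms \<phi> L2 unfolding has_weak_derivative_def by (simp add: distrib_right L2_product_integrable)
qed

lemma has_weak_derivative_scale:
  assumes "has_weak_derivative S v v'"
  shows "has_weak_derivative S (\<lambda>x. c * v x) (\<lambda>x. c * v' x)" using assms unfolding has_weak_derivative_def by (simp add: mult.assoc)

lemma H1_add:
  assumes "S \<in> sets lebesgue" "v \<in> H1 S" "w \<in> H1 S" shows "(\<lambda>x. v x + w x) \<in> H1 S"
  using assms(2,3)[THEN H1_L2] assms(2,3)[THEN wderiv_L2] assms(2,3)[THEN wderiv_weak]
  by (intro H1I[OF L2_add L2_add has_weak_derivative_add[OF assms(1)], of v w "wderiv S v" "wderiv S w"])

lemma H1_scale: assumes "v \<in> H1 S" shows "(\<lambda>x. c * v x) \<in> H1 S" by (rule H1I[OF L2_scale[OF H1_L2[OF assms]] L2_scale[OF wderiv_L2[OF assms]]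
        has_weak_derivative_scale[OF wderiv_weak[OF assms]]])

lemma H1_zero: "(\<lambda>x. 0) \<in> H1 S" by (rule H1I[of _ _ "\<lambda>x. 0"]) (auto simp: has_weak_derivative_def)

lemma H1_diff: assumes "S \<in> sets lebesgue" "v \<in> H1 S" "w \<in> H1 S" shows "(\<lambda>x. v x - w x) \<in> H1 S"
  using H1_add[OF assms(1,2) H1_scale[OF assms(3), of "-1"]] by simp

lemma wderiv_add:
  assumes "open S" "v \<in> H1 S" "w \<in> H1 S"
  shows "AE x in lebesgue_on S. wderiv S (\<lambda>x. v x + w x) x = wderiv S v x + wderiv S w x"
  using assms(2,3)[THEN H1_L2] assms(2,3)[THEN wderiv_L2] assms(2,3)[THEN wderiv_weak] assms(1)
  by (intro wderiv_AE[OF assms(1) L2_add L2_add has_weak_derivative_add]) simp_all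

lemma wderiv_scale:
  assumes "open S" "v \<in> H1 S"
  shows "AE x in lebesgue_on S. wderiv S (\<lambda>x. c * v x) x = c * wderiv S v x"
  by (rule wderiv_AE[OF assms(1) L2_scale[OF H1_L2[OF assms(2)]] L2_scale[OF wderiv_L2[OF assms(2)]]
        has_weak_derivative_scale[OF wderiv_weak[OF assms(2)]]])

lemma L2_norm_wderiv:
  assumes "open S" "v \<in> L2 S" "v' \<in> L2 S" "has_weak_derivative S v v'"
  shows "L2_norm S (wderiv S v) = L2_norm S v'" by (rule L2_norm_cong_AE[OF wderiv_AE[OF assms] L2_measurable[OF wderiv_L2[OF H1I[OF assms(2-4)]]]
        L2_measurable[OF assms(3)]])

lemma H1_norm_eq:
  assumes "open S" "v \<in> L2 S" "v' \<in> L2 S" "has_weak_derivative S v v'"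
  shows "H1_norm S v = sqrt ((L2_norm S v)\<^sup>2 + (L2_norm S v')\<^sup>2)" using L2_norm_wderiv[OF assms] by (simp add: H1_norm_def)

lemma H1_norm_nonneg [simp]: "0 \<le> H1_norm S v" by (simp add: H1_norm_def)

lemma L2_norm_le_H1_norm: "L2_norm S v \<le> H1_norm S v"
  and wderiv_norm_le_H1_norm: "L2_norm S (wderiv S v) \<le> H1_norm S v" by (simp_all add: H1_norm_def real_le_rsqrt)

lemma wderiv_norm_triangle:
  assumes "open S" "v \<in> H1 S" "w \<in> H1 S"
  shows "L2_norm S (wderiv S (\<lambda>x. v x + w x)) \<le> L2_norm S (wderiv S v) + L2_norm S (wderiv S w)"
proof -
  have SL: "S \<in> sets lebesgue" using assms by simp
  have "L2_norm S (wderiv S (\<lambda>x. v x + w x)) = L2_norm S (\<lambda>x. wderiv S v x + wderiv S w x)"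
    using assms(2,3)[THEN H1_L2] assms(2,3)[THEN wderiv_L2] assms(2,3)[THEN wderiv_weak] SL
    by (intro L2_norm_wderiv[OF assms(1) L2_add L2_add has_weak_derivative_add])
  also have "... \<le> L2_norm S (wderiv S v) + L2_norm S (wderiv S w)" using assms(2,3)[THEN wderiv_L2] by (rule L2_norm_triangle)
  finally show ?thesis .
qed

lemma wderiv_norm_scale:
  assumes "open S" "v \<in> H1 S"
  shows "L2_norm S (wderiv S (\<lambda>x. c * v x)) = norm c * L2_norm S (wderiv S v)"
proof -
  have "L2_norm S (wderiv S (\<lambda>x. c * v x)) = L2_norm S (\<lambda>x. c * wderiv S v x)"
    by (rule L2_norm_wderiv[OF assms(1) L2_scale[OF H1_L2[OF assms(2)]] L2_scale[OF wderiv_L2[OF assms(2)]]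
          has_weak_derivative_scale[OF wderiv_weak[OF assms(2)]]])
  then show ?thesis by (simp add: L2_norm_scale)
qed

lemma H1_norm_triangle:
  assumes "open S" "v \<in> H1 S" "w \<in> H1 S"
  shows "H1_norm S (\<lambda>x. v x + w x) \<le> H1_norm S v + H1_norm S w"
proof -
  have "H1_norm S (\<lambda>x. v x + w x) \<le> sqrt ((L2_norm S v + L2_norm S w)\<^sup>2 + (L2_norm S (wderiv S v) + L2_norm S (wderiv S w))\<^sup>2)"
    unfolding H1_norm_def using L2_norm_triangle[OF assms(2,3)[THEN H1_L2]] wderiv_norm_triangle[OF assms]
    by (intro real_sqrt_le_mono add_mono power_mono) simp_all
  also have "... \<le> H1_norm S v + H1_norm S w"
    unfolding H1_norm_def by (rule real_sqrt_sum_squares_triangle_ineq)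
  finally show ?thesis .
qed

lemma H1_norm_scale:
  assumes "open S" "v \<in> H1 S" shows "H1_norm S (\<lambda>x. c * v x) = norm c * H1_norm S v"
proof -
  have "H1_norm S (\<lambda>x. c * v x) = sqrt ((norm c)\<^sup>2 * ((L2_norm S v)\<^sup>2 + (L2_norm S (wderiv S v))\<^sup>2))"
    by (simp add: H1_norm_def L2_norm_scale wderiv_norm_scale[OF assms] power_mult_distrib distrib_left)
  then show ?thesis by (simp add: H1_norm_def real_sqrt_mult)
qed

lemma H1_norm_zero: assumes "open S" shows "H1_norm S (\<lambda>x. 0) = 0"
  using H1_norm_eq[OF assms, of "\<lambda>x. 0" "\<lambda>x. 0"] by (simp add: has_weak_derivative_def)

lemma integration_by_parts_Icc:
  fixes f g :: "real \<Rightarrow> complex"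
  assumes "a \<le> b" "\<And>x. (f has_vector_derivative f' x) (at x)" "\<And>x. (g has_vector_derivative g' x) (at x)"
    "continuous_on {a..b} f'" "continuous_on {a..b} g'"
  shows "(\<integral>x. f x * g' x \<partial>lebesgue_on {a..b}) = f b * g b - f a * g a - (\<integral>x. f' x * g x \<partial>lebesgue_on {a..b})"
proof -
  have c: "continuous_on {a..b} f" "continuous_on {a..b} g"
    by (intro continuous_at_imp_continuous_on ballI has_vector_derivative_continuous[OF assms(2)])
      (intro continuous_at_imp_continuous_on ballI has_vector_derivative_continuous[OF assms(3)])
  have "(\<integral>x. f x * g' x + f' x * g x \<partial>lebesgue_on {a..b}) = f b * g b - f a * g a"
    by (rule integral_derivative_Icc[OF assms(1) has_vector_derivative_mult[OF assms(2,3)]])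
      (intro continuous_intros c assms)
  moreover have "integrable (lebesgue_on {a..b}) (\<lambda>x. f x * g' x)" "integrable (lebesgue_on {a..b}) (\<lambda>x. f' x * g x)"
    by (intro continuous_integrable_Icc continuous_intros c assms)+
  ultimately show ?thesis by (simp add: algebra_simps)
qed

lemma E0_weak_derivative:
  assumes h: "smooth h" "h 0 = 0" "h pi = 0" and S: "S \<in> sets lebesgue" "{0<..<pi} \<subseteq> S"
  shows "has_weak_derivative S (E0 h) (E0 (\<lambda>x. vector_derivative h (at x)))"
  unfolding has_weak_derivative_def
proof
  fix \<phi> :: "real \<Rightarrow> complex" assume \<phi>: "\<phi> \<in> test_functions S"
  let ?h' = "\<lambda>x. vector_derivative h (at x)" and ?\<phi>' = "\<lambda>x. vector_derivative \<phi> (at x)"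
  have sm: "smooth \<phi>" "smooth ?\<phi>'" "smooth ?h'" using \<phi> smooth_derivative(1) h by (auto simp: test_functions_def)
  have restrict: "(\<integral>x. E0 f x * g x \<partial>lebesgue_on S) = (\<integral>x. f x * g x \<partial>lebesgue_on {0..pi})"
    if "smooth f" "smooth g" for f g
  proof -
    have "(\<integral>x. E0 f x * g x \<partial>lebesgue_on S) = (\<integral>x. E0 f x * g x \<partial>lebesgue_on {0<..<pi})" by (rule integral_support) (use S in \<open>auto simp: E0_def\<close>)
    also have "... = (\<integral>x. f x * g x \<partial>lebesgue_on {0<..<pi})" by (rule Bochner_Integration.integral_cong) (auto simp: E0_def)
    also have "... = (\<integral>x. f x * g x \<partial>lebesgue_on {0..pi})" by (rule integral_Ioo_eq_Icc) (intro borel_measurable_times smooth_measurable that)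
    finally show ?thesis .
  qed
  have "(\<integral>x. h x * ?\<phi>' x \<partial>lebesgue_on {0..pi}) = - (\<integral>x. ?h' x * \<phi> x \<partial>lebesgue_on {0..pi})"
    using integration_by_parts_Icc[of 0 pi h ?h' \<phi> ?\<phi>', OF _ smooth_derivative(2)[OF h(1)]
        smooth_derivative(2)[OF sm(1)] smooth_continuous_on[OF sm(3)] smooth_continuous_on[OF sm(2)]] h(2,3) by simp
  then show "(\<integral>x. E0 h x * ?\<phi>' x \<partial>lebesgue_on S) = - (\<integral>x. E0 ?h' x * \<phi> x \<partial>lebesgue_on S)" using h sm by (simp add: restrict)
qed

lemma E0_H1:
  assumes "smooth h" "h 0 = 0" "h pi = 0" "S \<in> sets lebesgue" "{0<..<pi} \<subseteq> S"
  shows "E0 h \<in> H1 S" by (rule H1I[OF smooth_E0_L2[OF assms(1,4,5)] smooth_E0_L2[OF smooth_derivative(1)[OF assms(1)] assms(4,5)]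
        E0_weak_derivative[OF assms]])

text \<open>Multiplying by cutoffs turns a smooth function that vanishes at both ends of the interval into
  test functions. The derivative of the cutoff is large only near the ends, where the Lipschitz
  continuity of the function compensates for it, so dominated convergence applies.\<close>

lemma H1_integration_by_parts:
  fixes h :: "real \<Rightarrow> complex"
  assumes v: "v \<in> H1 S" and S: "S \<in> sets lebesgue" "{a<..<b} \<subseteq> S" and ab: "a < b"
    and h: "smooth h" "h a = 0" "h b = 0"
  shows "(\<integral>x. vector_derivative h (at x) * v x \<partial>lebesgue_on {a<..<b}) = - (\<integral>x. h x * wderiv S v x \<partial>lebesgue_on {a<..<b})"
proof -
  let ?M = "lebesgue_on {a<..<b}" and ?h' = "\<lambda>x. vector_derivative h (at x)"
  let ?v' = "wderiv S v"
  have iv: "integrable ?M v" "integrable ?M ?v'" by (rule L2_integrable_on_finite_measure[OF H1_L2[OF v] S(2,1)], simp)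
      (rule L2_integrable_on_finite_measure[OF wderiv_L2[OF v] S(2,1)], simp)
  have h': "(h has_vector_derivative ?h' x) (at x)" for x by (rule smooth_derivative(2)[OF h(1)])
  have "compact (?h' ` {a..b})" "compact (h ` {a..b})"
    by (rule compact_continuous_image[OF smooth_continuous_on[OF smooth_derivative(1)[OF h(1)]] compact_Icc],
        rule compact_continuous_image[OF smooth_continuous_on[OF h(1)] compact_Icc])
  then have "bounded (?h' ` {a..b})" "bounded (h ` {a..b})" by (simp_all only: compact_imp_bounded)
  then obtain L0 B0 where L0: "\<forall>y\<in>?h' ` {a..b}. norm y \<le> L0" "L0 > 0" and B0: "\<forall>y\<in>h ` {a..b}. norm y \<le> B0" "B0 > 0"
    unfolding bounded_pos by blast
  have L: "norm (?h' x) \<le> L0" and Bh: "norm (h x) \<le> B0" if "x \<in> {a..b}" for x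
    using bspec[OF L0(1) imageI[OF that]] bspec[OF B0(1) imageI[OF that]] by simp_all
  have Lip: "norm (h x - h y) \<le> L0 * \<bar>x - y\<bar>" if "x \<in> {a..b}" "y \<in> {a..b}" for x y
  proof -
    have "norm (h x - h y) \<le> L0 * norm (x - y)"
    proof (rule differentiable_bound[where S = "{a..b}"])
      show "(h has_derivative (\<lambda>t. t *\<^sub>R ?h' z)) (at z within {a..b})" for z
        using h'[of z] has_vector_derivative_at_within by (auto simp: has_vector_derivative_def)
      show "onorm (\<lambda>t. t *\<^sub>R ?h' z) \<le> L0" if "z \<in> {a..b}" for z
        by (rule onorm_le) (use L[OF that] in \<open>auto simp: mult.commute[of L0] intro: mult_left_mono\<close>)
    qed (use that in auto)
    then show ?thesis by simp
  qed
  obtain B where B: "\<And>x. \<bar>ramp' x\<bar> \<le> B" "B > 0" using ramp'_bounded by blast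
  have yB: "\<bar>y * ramp' y\<bar> \<le> B" for y
  proof (cases "0 < y \<and> y < 1/2")
    case True
    then have "\<bar>y\<bar> * \<bar>ramp' y\<bar> \<le> 1 * B" using B by (intro mult_mono) auto
    then show ?thesis by (simp add: abs_mult)
  next
    case False
    then show ?thesis using ramp'_zero[of y] B by (auto simp: not_less)
  qed
  define C where "C = L0 * B + L0 * B"
  have bound: "norm (complex_of_real (cut' a b n x) * h x) \<le> C" if x: "x \<in> {a<..<b}" for n x
  proof -
    define m where "m = real (Suc n)"
    have m: "m > 0" by (simp add: m_def)
    have 1: "\<bar>m * ramp' (m * (x - a))\<bar> * norm (h x) \<le> L0 * B"
    proof -
      have "norm (h x) \<le> L0 * \<bar>x - a\<bar>" using Lip[of x a] h x by simp
      then have "\<bar>m * ramp' (m * (x - a))\<bar> * norm (h x) \<le> \<bar>m * ramp' (m * (x - a))\<bar> * (L0 * \<bar>x - a\<bar>)" by (intro mult_left_mono) auto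
      also have "... = L0 * \<bar>(m * (x - a)) * ramp' (m * (x - a))\<bar>" by (simp add: abs_mult)
      also have "... \<le> L0 * B" using yB L0 by (intro mult_left_mono) auto
      finally show ?thesis .
    qed
    have 2: "\<bar>m * ramp' (m * (b - x))\<bar> * norm (h x) \<le> L0 * B"
    proof -
      have "norm (h x) \<le> L0 * \<bar>b - x\<bar>" using Lip[of x b] h x by (simp add: abs_minus_commute)
      then have "\<bar>m * ramp' (m * (b - x))\<bar> * norm (h x) \<le> \<bar>m * ramp' (m * (b - x))\<bar> * (L0 * \<bar>b - x\<bar>)" by (intro mult_left_mono) auto
      also have "... = L0 * \<bar>(m * (b - x)) * ramp' (m * (b - x))\<bar>" by (simp add: abs_mult)
      also have "... \<le> L0 * B" using yB L0 by (intro mult_left_mono) auto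
      finally show ?thesis .
    qed
    have "\<bar>cut' a b n x\<bar> \<le> \<bar>m * ramp' (m * (x - a))\<bar> + \<bar>m * ramp' (m * (b - x))\<bar>"
    proof -
      have "\<bar>m * ramp' (m * (x - a)) * ramp (m * (b - x))\<bar> \<le> \<bar>m * ramp' (m * (x - a))\<bar>"
        using ramp_range[of "m * (b - x)"] by (simp add: abs_mult mult_left_le)
      moreover have "\<bar>ramp (m * (x - a)) * (m * ramp' (m * (b - x)))\<bar> \<le> \<bar>m * ramp' (m * (b - x))\<bar>"
        using ramp_range[of "m * (x - a)"] by (subst abs_mult) (simp add: mult_left_le_one_le)
      ultimately show ?thesis unfolding cut'_def m_def[symmetric] by linarith
    qed
    then have "\<bar>cut' a b n x\<bar> * norm (h x) \<le> (\<bar>m * ramp' (m * (x - a))\<bar> + \<bar>m * ramp' (m * (b - x))\<bar>) * norm (h x)" by (rule mult_right_mono) simp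
    then show ?thesis using 1 2 unfolding C_def norm_mult norm_of_real distrib_right by linarith
  qed
  let ?\<phi> = "\<lambda>n x. complex_of_real (cut a b n x) * h x"
  let ?d = "\<lambda>n x. complex_of_real (cut' a b n x) * h x + complex_of_real (cut a b n x) * ?h' x"
  have test0: "?\<phi> n \<in> test_functions {a<..<b}" for n by (rule cut_test[OF h(1)])
  have test: "?\<phi> n \<in> test_functions S" for n by (rule test_function_mono[OF test0 S(2)])
  have dv: "vector_derivative (?\<phi> n) (at x) = ?d n x" for n x
  proof -
    have "((\<lambda>x. complex_of_real (cut a b n x)) has_vector_derivative complex_of_real (cut' a b n x)) (at x)" using cut_deriv[of a b n x]
      by (intro has_vector_derivative_of_real) (simp add: has_real_derivative_iff_has_vector_derivative)
    from has_vector_derivative_mult[OF this h'[of x]] show ?thesis by (intro vector_derivative_at) (simp add: add.commute)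
  qed
  have eq: "(\<integral>x. ?d n x * v x \<partial>?M) = - (\<integral>x. ?\<phi> n x * ?v' x \<partial>?M)" for n
  proof -
    have "(\<integral>x. v x * vector_derivative (?\<phi> n) (at x) \<partial>lebesgue_on S) = (\<integral>x. v x * vector_derivative (?\<phi> n) (at x) \<partial>?M)"
      by (rule integral_support) (use S test_function_outside[OF test_function_derivative[OF test0]] in auto)
    moreover have "(\<integral>x. ?v' x * ?\<phi> n x \<partial>lebesgue_on S) = (\<integral>x. ?v' x * ?\<phi> n x \<partial>?M)"
      by (rule integral_support) (use S test_function_outside[OF test0] in auto)
    moreover have "(\<integral>x. v x * vector_derivative (?\<phi> n) (at x) \<partial>lebesgue_on S) = - (\<integral>x. ?v' x * ?\<phi> n x \<partial>lebesgue_on S)"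
      using wderiv_weak[OF v] test[of n] unfolding has_weak_derivative_def by (rule bspec)
    moreover have "(\<integral>x. ?d n x * v x \<partial>?M) = (\<integral>x. v x * vector_derivative (?\<phi> n) (at x) \<partial>?M)"
      unfolding dv by (intro Bochner_Integration.integral_cong refl) (rule mult.commute)
    moreover have "(\<integral>x. ?\<phi> n x * ?v' x \<partial>?M) = (\<integral>x. ?v' x * ?\<phi> n x \<partial>?M)" by (intro Bochner_Integration.integral_cong refl) (rule mult.commute)
    ultimately show ?thesis by (simp only:)
  qed
  have m1: "?\<phi> n \<in> borel_measurable ?M" for n using test0[of n] by (intro smooth_measurable) (simp add: test_functions_def)
  have m2: "?d n \<in> borel_measurable ?M" for n using test_function_derivative[OF test0[of n]] unfolding dv
    by (intro smooth_measurable) (simp add: test_functions_def)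
  have ev: "eventually (\<lambda>n. ?\<phi> n x = h x \<and> ?d n x = ?h' x) sequentially" if "x \<in> {a<..<b}" for x using cut_eventually[OF that] by eventually_elim simp
  have "(\<lambda>n. \<integral>x. ?\<phi> n x * ?v' x \<partial>?M) \<longlonglongrightarrow> (\<integral>x. h x * ?v' x \<partial>?M)"
  proof (rule integral_dominated_convergence[where w = "\<lambda>x. B0 * norm (?v' x)"])
    show "AE x in ?M. (\<lambda>n. ?\<phi> n x * ?v' x) \<longlonglongrightarrow> h x * ?v' x"
    proof (rule AE_I2)
      fix x assume "x \<in> space ?M"
      then have "x \<in> {a<..<b}" by simp
      from ev[OF this] have "eventually (\<lambda>n. ?\<phi> n x * ?v' x = h x * ?v' x) sequentially" by eventually_elim (simp only:)
      then show "(\<lambda>n. ?\<phi> n x * ?v' x) \<longlonglongrightarrow> h x * ?v' x" by (rule tendsto_eventually)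
    qed
    show "AE x in ?M. norm (?\<phi> n x * ?v' x) \<le> B0 * norm (?v' x)" for n
    proof (rule AE_I2)
      fix x assume "x \<in> space ?M"
      then have "norm (h x) \<le> B0" using Bh by simp
      then have "\<bar>cut a b n x\<bar> * norm (h x) \<le> 1 * B0" using cut_range[of a b n x] by (intro mult_mono) auto
      then show "norm (?\<phi> n x * ?v' x) \<le> B0 * norm (?v' x)"
        unfolding norm_mult norm_of_real by (intro mult_right_mono) auto
    qed
  qed (use iv m1 smooth_measurable[OF h(1)] in auto)
  moreover have "(\<lambda>n. \<integral>x. ?d n x * v x \<partial>?M) \<longlonglongrightarrow> (\<integral>x. ?h' x * v x \<partial>?M)"
  proof (rule integral_dominated_convergence[where w = "\<lambda>x. (C + L0) * norm (v x)"])
    show "AE x in ?M. (\<lambda>n. ?d n x * v x) \<longlonglongrightarrow> ?h' x * v x"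
    proof (rule AE_I2)
      fix x assume "x \<in> space ?M"
      then have "x \<in> {a<..<b}" by simp
      from ev[OF this] have "eventually (\<lambda>n. ?d n x * v x = ?h' x * v x) sequentially" by eventually_elim (simp only:)
      then show "(\<lambda>n. ?d n x * v x) \<longlonglongrightarrow> ?h' x * v x" by (rule tendsto_eventually)
    qed
    show "AE x in ?M. norm (?d n x * v x) \<le> (C + L0) * norm (v x)" for n
    proof (rule AE_I2)
      fix x assume "x \<in> space ?M"
      then have x: "x \<in> {a<..<b}" by simp
      then have "norm (?h' x) \<le> L0" using L by simp
      then have "\<bar>cut a b n x\<bar> * norm (?h' x) \<le> 1 * L0" using cut_range[of a b n x] by (intro mult_mono) auto
      then have "norm (complex_of_real (cut a b n x) * ?h' x) \<le> L0" by (simp add: norm_mult)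
      then have "norm (?d n x) \<le> C + L0" using bound[OF x, of n] by (intro norm_triangle_le add_mono)
      then show "norm (?d n x * v x) \<le> (C + L0) * norm (v x)"
        unfolding norm_mult by (intro mult_right_mono) auto
    qed
    show "(\<lambda>x. ?d n x * v x) \<in> borel_measurable ?M" for n using borel_measurable_times[OF m2[of n]] iv by auto
  qed (use iv smooth_measurable[OF smooth_derivative(1)[OF h(1)]] in auto)
  ultimately have "(\<integral>x. ?h' x * v x \<partial>?M) = - (\<integral>x. h x * ?v' x \<partial>?M)"
    unfolding eq by (intro LIMSEQ_unique[OF _ tendsto_minus])
  then show ?thesis .
qed

text \<open>The form of integration by parts that is used with anti-linear functionals.\<close>

lemma H1_integration_by_parts_cnj:
  fixes h :: "real \<Rightarrow> complex"
  assumes v: "v \<in> H1 S" and S: "S \<in> sets lebesgue" "{0<..<pi} \<subseteq> S"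
    and h: "smooth h" "h 0 = 0" "h pi = 0"
  shows "L2_inner S (E0 (\<lambda>x. vector_derivative h (at x))) v = - L2_inner S (E0 h) (wderiv S v)"
proof -
  let ?k = "\<lambda>x. cnj (h x)"
  have k: "smooth ?k" by (rule smooth_bounded_linear[OF bounded_linear_cnj h(1)])
  have k': "vector_derivative ?k (at x) = cnj (vector_derivative h (at x))" for x
    by (rule vector_derivative_at) (rule bounded_linear.has_vector_derivative[OF bounded_linear_cnj smooth_derivative(2)[OF h(1)]])
  have restrict: "L2_inner S (E0 f) w = cnj (\<integral>x. cnj (f x) * w x \<partial>lebesgue_on {0<..<pi})" for f w
  proof -
    have "L2_inner S (E0 f) w = (\<integral>x. E0 f x * cnj (w x) \<partial>lebesgue_on {0<..<pi})"
      unfolding L2_inner_def by (rule integral_support) (use S in \<open>auto simp: E0_def\<close>)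
    also have "... = (\<integral>x. cnj (cnj (f x) * w x) \<partial>lebesgue_on {0<..<pi})" by (rule Bochner_Integration.integral_cong) (auto simp: E0_def)
    finally show ?thesis by (simp only: Bochner_Integration.integral_cnj)
  qed
  have "(\<integral>x. vector_derivative ?k (at x) * v x \<partial>lebesgue_on {0<..<pi}) = - (\<integral>x. ?k x * wderiv S v x \<partial>lebesgue_on {0<..<pi})"
    by (rule H1_integration_by_parts[OF v S _ k]) (use h in auto)
  then show ?thesis unfolding restrict k' by simp
qed

end

section \<open>Seminormed spaces of functions and their anti-duals\<close>

text \<open>Elements of the spaces are functions, not classes, so null vectors are allowed. The norms of the spaces \<open>L\<^sup>2\<close>, \<open>H\<^sup>1\<close> and \<open>H\<^sup>1\<^sub>0\<close> are instances.\<close>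

locale seminormed =
  fixes X :: "(real \<Rightarrow> complex) set" and N :: "(real \<Rightarrow> complex) \<Rightarrow> real"
  assumes zero_mem: "(\<lambda>x. 0) \<in> X"
    and add_mem: "v \<in> X \<Longrightarrow> w \<in> X \<Longrightarrow> (\<lambda>x. v x + w x) \<in> X"
    and scale_mem: "v \<in> X \<Longrightarrow> (\<lambda>x. c * v x) \<in> X"
    and N_nonneg: "0 \<le> N v"
    and N_triangle: "v \<in> X \<Longrightarrow> w \<in> X \<Longrightarrow> N (\<lambda>x. v x + w x) \<le> N v + N w"
    and N_scale: "v \<in> X \<Longrightarrow> N (\<lambda>x. c * v x) = norm c * N v"
begin

lemma diff_mem: "v \<in> X \<Longrightarrow> w \<in> X \<Longrightarrow> (\<lambda>x. v x - w x) \<in> X" using add_mem[OF _ scale_mem[of w "-1"], of v] by simp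

lemma N_zero: "N (\<lambda>x. 0) = 0" using N_scale[OF zero_mem, of 0] by simp

lemma N_diff: "v \<in> X \<Longrightarrow> w \<in> X \<Longrightarrow> N (\<lambda>x. v x - w x) \<le> N v + N w" using N_triangle[OF _ scale_mem[of w "-1"], of v] N_scale[of w "-1"] by simp

lemma N_diff_commute: "v \<in> X \<Longrightarrow> w \<in> X \<Longrightarrow> N (\<lambda>x. v x - w x) = N (\<lambda>x. w x - v x)" using N_scale[OF diff_mem[of v w], of "-1"] by simp

lemma N_diff_ge: assumes "v \<in> X" "w \<in> X" shows "\<bar>N v - N w\<bar> \<le> N (\<lambda>x. v x - w x)"
  using N_triangle[OF diff_mem[OF assms] assms(2)] N_triangle[OF diff_mem[OF assms(2,1)] assms(1)]
    N_diff_commute[OF assms] by simp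

lemma sum_mem: "(\<And>i. i \<in> I \<Longrightarrow> v i \<in> X) \<Longrightarrow> (\<lambda>x. \<Sum>i\<in>I. v i x) \<in> X"
proof (induction I rule: infinite_finite_induct)
  case (insert i I)
  have "(\<lambda>x. v i x + (\<Sum>i\<in>I. v i x)) \<in> X" by (rule add_mem) (use insert in auto)
  then show ?case using insert.hyps by simp
qed (simp_all add: zero_mem)

lemma N_sum: "(\<And>i. i \<in> I \<Longrightarrow> v i \<in> X) \<Longrightarrow> N (\<lambda>x. \<Sum>i\<in>I. v i x) \<le> (\<Sum>i\<in>I. N (v i))"
proof (induction I rule: infinite_finite_induct)
  case (insert i I)
  have "N (\<lambda>x. v i x + (\<Sum>i\<in>I. v i x)) \<le> N (v i) + N (\<lambda>x. \<Sum>i\<in>I. v i x)" using insert by (intro N_triangle sum_mem) auto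
  also have "... \<le> N (v i) + (\<Sum>i\<in>I. N (v i))" using insert by simp
  finally show ?case using insert.hyps by simp
qed (simp_all add: N_zero)

lemma dual_norm_bdd:
  assumes "F \<in> antidual X N" shows "bdd_above ((\<lambda>v. norm (F v)) ` {v \<in> X. N v \<le> 1})"
proof -
  obtain C where "\<forall>v\<in>X. norm (F v) \<le> C * N v" using assms unfolding antidual_def by blast
  then have C: "\<And>v. v \<in> X \<Longrightarrow> norm (F v) \<le> C * N v" by blast
  show ?thesis
  proof (rule bdd_aboveI2)
    fix v assume v: "v \<in> {v \<in> X. N v \<le> 1}"
    then have "norm (F v) \<le> C * N v" using C by simp
    also have "... \<le> \<bar>C\<bar> * 1" using v N_nonneg by (intro mult_mono) auto
    finally show "norm (F v) \<le> \<bar>C\<bar>" by simp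
  qed
qed

lemma dual_norm_nonneg: assumes "F \<in> antidual X N" shows "0 \<le> dual_norm X N F"
  unfolding dual_norm_def by (rule cSUP_upper2[OF dual_norm_bdd[OF assms], of "\<lambda>x. 0"]) (auto simp: zero_mem N_zero)

lemma antidual_le:
  assumes F: "F \<in> antidual X N" and v: "v \<in> X" shows "norm (F v) \<le> dual_norm X N F * N v"
proof (cases "N v = 0")
  case True
  obtain C where "\<forall>v\<in>X. norm (F v) \<le> C * N v" using F unfolding antidual_def by blast
  from bspec[OF this v] True show ?thesis by simp
next
  case False
  then have pos: "N v > 0" using N_nonneg[of v] by simp
  define c where "c = complex_of_real (1 / N v)"
  have "norm c = 1 / N v" using pos by (simp add: c_def norm_divide)
  then have "(\<lambda>x. c * v x) \<in> {v \<in> X. N v \<le> 1}" using scale_mem[OF v, of c] N_scale[OF v, of c] pos by simp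
  from cSUP_upper[OF this dual_norm_bdd[OF F]]
  have "norm (F (\<lambda>x. c * v x)) \<le> dual_norm X N F" by (simp add: dual_norm_def)
  moreover have "F (\<lambda>x. c * v x) = cnj c * F v" using F v by (auto simp: antidual_def)
  ultimately have "norm (F v) / N v \<le> dual_norm X N F" using pos by (simp add: norm_mult c_def norm_divide)
  then show ?thesis using pos by (simp add: field_simps)
qed

lemma dual_norm_le:
  assumes "\<And>v. v \<in> X \<Longrightarrow> norm (F v) \<le> C * N v" "0 \<le> C" shows "dual_norm X N F \<le> C"
  unfolding dual_norm_def
proof (rule cSUP_least)
  show "{v \<in> X. N v \<le> 1} \<noteq> {}" using zero_mem N_zero by force
  fix v assume v: "v \<in> {v \<in> X. N v \<le> 1}"
  then have "norm (F v) \<le> C * N v" using assms(1) by simp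
  also have "... \<le> C * 1" using v assms(2) by (intro mult_left_mono) auto
  finally show "norm (F v) \<le> C" by simp
qed

end

lemma L2_seminormed: "seminormed (L2 S) (L2_norm S)" by unfold_locales (auto intro: L2_add L2_scale L2_norm_triangle simp: L2_norm_scale)

lemma (in smooth_bump) H1_seminormed:
  assumes "open S" shows "seminormed (H1 S) (H1_norm S)"
  by unfold_locales (use assms in \<open>auto intro: H1_zero H1_add H1_scale H1_norm_triangle simp: H1_norm_scale\<close>)

section \<open>Strongly measurable functions of time\<close>

text \<open>Continuity at almost every time suffices: sample on an equidistant grid.\<close>

lemma strongly_measurable_AE_continuous:
  assumes x0: "x0 \<in> X"
    and cont: "AE t in unit_time. ((\<lambda>s. N (w t - w s)) \<longlongrightarrow> 0) (nhds t) \<and> (\<forall>\<^sub>F s in nhds t. w s \<in> X)"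
  shows "strongly_measurable X N w"
proof -
  define q where "q n t = real_of_int \<lfloor>real (Suc n) * t\<rfloor> / real (Suc n)" for n and t :: real
  define w0 where "w0 t = (if w t \<in> X then w t else x0)" for t
  have q_lim: "(\<lambda>n. q n t) \<longlonglongrightarrow> t" for t
  proof (rule tendsto_sandwich[where f = "\<lambda>n. t - 1 / real (Suc n)" and h = "\<lambda>n. t"])
    have "t - 1 / real (Suc n) \<le> q n t \<and> q n t \<le> t" for n
    proof -
      define m where "m = real (Suc n)"
      have m: "m > 0" by (simp add: m_def)
      have "m * t - 1 \<le> real_of_int \<lfloor>m * t\<rfloor>" "real_of_int \<lfloor>m * t\<rfloor> \<le> m * t" by linarith+
      then have "(m * t - 1) / m \<le> q n t" "q n t \<le> (m * t) / m" using m unfolding q_def m_def[symmetric] by (intro divide_right_mono; simp)+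
      then show ?thesis using m unfolding m_def[symmetric] by (simp add: diff_divide_distrib)
    qed
    then show "\<forall>\<^sub>F n in sequentially. t - 1 / real (Suc n) \<le> q n t" "\<forall>\<^sub>F n in sequentially. q n t \<le> t" by auto
    show "(\<lambda>n. t - 1 / real (Suc n)) \<longlonglongrightarrow> t" using tendsto_diff[OF tendsto_const LIMSEQ_inverse_real_of_nat, of t] by (simp add: inverse_eq_divide)
  qed simp
  have q_simple: "simple_function unit_time (q n)" for n
  proof (rule simple_function_borel_measurable)
    have "(\<lambda>t. real_of_int \<lfloor>real (Suc n) * t\<rfloor> / real (Suc n)) \<in> borel_measurable borel" by measurable
    then show "q n \<in> borel_measurable unit_time"
      unfolding q_def[abs_def] by (intro measurable_restrict_space1 measurable_completion) simp
    have "q n ` space unit_time \<subseteq> (\<lambda>k. real_of_int k / real (Suc n)) ` {0..int (Suc n)}"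
    proof
      fix y assume "y \<in> q n ` space unit_time"
      then obtain t where t: "0 < t" "t < 1" "y = q n t" by auto
      define m where "m = real (Suc n)"
      have "0 \<le> m * t" "m * t \<le> m" using t by (auto simp: m_def intro: mult_left_le)
      then have "0 \<le> \<lfloor>m * t\<rfloor>" "real_of_int \<lfloor>m * t\<rfloor> \<le> m" by linarith+
      then have "\<lfloor>m * t\<rfloor> \<in> {0..int (Suc n)}" by (simp add: m_def)
      then show "y \<in> (\<lambda>k. real_of_int k / real (Suc n)) ` {0..int (Suc n)}"
        unfolding t(3) q_def m_def by (rule imageI)
    qed
    then show "finite (q n ` space unit_time)" by (rule finite_subset) simp
  qed
  show ?thesis unfolding strongly_measurable_def
  proof (intro exI[of _ "\<lambda>n t. w0 (q n t)"] conjI allI)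
    show "simple_function unit_time (\<lambda>t. w0 (q n t))" for n by (rule simple_function_compose1[OF q_simple])
    show "w0 (q n t) \<in> X" for n t using x0 by (simp add: w0_def)
    show "AE t in unit_time. (\<lambda>n. N (w t - w0 (q n t))) \<longlonglongrightarrow> 0" using cont
    proof eventually_elim
      case (elim t)
      have "(\<lambda>n. N (w t - w (q n t))) \<longlonglongrightarrow> 0" using elim q_lim[of t] by (auto intro: filterlim_compose)
      moreover have "\<forall>\<^sub>F n in sequentially. N (w t - w (q n t)) = N (w t - w0 (q n t))"
        using eventually_compose_filterlim[OF conjunct2[OF elim] q_lim[of t]] by eventually_elim (simp add: w0_def)
      ultimately show ?case by (rule Lim_transform_eventually)
    qed
  qed
qed

lemma L2_timeI:
  assumes x0: "x0 \<in> X"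
    and cont: "AE t in unit_time. ((\<lambda>s. N (w t - w s)) \<longlongrightarrow> 0) (nhds t) \<and> (\<forall>\<^sub>F s in nhds t. w s \<in> X)"
    and bound: "AE t in unit_time. 0 \<le> N (w t) \<and> N (w t) \<le> C"
  shows "w \<in> L2_time X N"
  unfolding L2_time_def
proof (intro CollectI conjI)
  show "AE t in unit_time. w t \<in> X" using cont by eventually_elim (auto dest: eventually_nhds_x_imp_x)
  show "strongly_measurable X N w" by (rule strongly_measurable_AE_continuous[OF x0 cont])
  interpret finite_measure unit_time by (rule finite_measure_lebesgue_on) simp
  have "(\<integral>\<^sup>+t. ennreal ((N (w t))\<^sup>2) \<partial>unit_time) \<le> (\<integral>\<^sup>+t. ennreal (C\<^sup>2) \<partial>unit_time)"
  proof (rule nn_integral_mono_AE)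
    show "AE t in unit_time. ennreal ((N (w t))\<^sup>2) \<le> ennreal (C\<^sup>2)" using bound by eventually_elim (auto intro!: ennreal_leI power_mono)
  qed
  also have "... < \<infinity>" by (simp add: ennreal_mult_less_top emeasure_restrict_space)
  finally show "(\<integral>\<^sup>+t. ennreal ((N (w t))\<^sup>2) \<partial>unit_time) < \<infinity>" .
qed

text \<open>Redefining a strongly measurable function on a null set makes it a limit of simple functions at
  every time.\<close>

locale simple_limit = seminormed +
  fixes d :: "real \<Rightarrow> real \<Rightarrow> complex" and s :: "nat \<Rightarrow> real \<Rightarrow> real \<Rightarrow> complex"
  assumes d_mem: "d t \<in> X" and s_mem: "s n t \<in> X"
    and s_simple: "simple_function unit_time (s n)"
    and s_lim: "(\<lambda>n. N (\<lambda>x. d t x - s n t x)) \<longlonglongrightarrow> 0"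

lemma (in seminormed) simple_limit_representative:
  assumes w: "w \<in> L2_time X N"
  obtains d s where "simple_limit X N d s" "AE t in unit_time. d t = w t"
    "(\<integral>\<^sup>+t. ennreal ((N (d t))\<^sup>2) \<partial>unit_time) < \<infinity>"
proof -
  obtain s where s: "\<And>n. simple_function unit_time (s n)" "\<And>n t. s n t \<in> X"
    "AE t in unit_time. (\<lambda>n. N (w t - s n t)) \<longlonglongrightarrow> 0" using w by (auto simp: L2_time_def strongly_measurable_def)
  have "AE t in unit_time. w t \<in> X \<and> (\<lambda>n. N (w t - s n t)) \<longlonglongrightarrow> 0" using s(3) w by (auto simp: L2_time_def)
  then obtain B where B: "B \<in> null_sets unit_time"
    "\<And>t. t \<in> space unit_time - B \<Longrightarrow> w t \<in> X \<and> (\<lambda>n. N (w t - s n t)) \<longlonglongrightarrow> 0" by (rule AE_E3) blast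
  define G where "G = {0<..<1} - B"
  have G: "G \<in> sets unit_time" using B sets.top[of unit_time] by (auto simp: G_def)
  have good: "w t \<in> X" "(\<lambda>n. N (w t - s n t)) \<longlonglongrightarrow> 0" if "t \<in> G" for t using that B(2)[of t] by (auto simp: G_def)
  define d where "d t = (if t \<in> G then w t else (\<lambda>x. 0))" for t
  define s' where "s' n t = (if t \<in> G then s n t else (\<lambda>x. 0))" for n t
  have ae: "AE t in unit_time. d t = w t" using AE_not_in[OF B(1)] AE_space[of unit_time] by eventually_elim (auto simp: d_def G_def)
  have "simple_limit X N d s'"
  proof (unfold_locales)
    show "d t \<in> X" for t using good(1) zero_mem by (auto simp: d_def)
    show "s' n t \<in> X" for n t using s(2) zero_mem by (auto simp: s'_def)
    show "simple_function unit_time (s' n)" for n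
      unfolding s'_def[abs_def] by (rule simple_function_If_set) (use s(1) G in auto)
    show "(\<lambda>n. N (\<lambda>x. d t x - s' n t x)) \<longlonglongrightarrow> 0" for t using good(2)[of t] by (auto simp: d_def s'_def fun_diff_def N_zero)
  qed
  moreover have "(\<integral>\<^sup>+t. ennreal ((N (d t))\<^sup>2) \<partial>unit_time) = (\<integral>\<^sup>+t. ennreal ((N (w t))\<^sup>2) \<partial>unit_time)"
    by (rule nn_integral_cong_AE) (use ae in \<open>auto elim: eventually_mono\<close>)
  ultimately show ?thesis using that ae w by (auto simp: L2_time_def)
qed

context simple_limit
begin

lemma measurable_functional:
  fixes l :: "real \<Rightarrow> (real \<Rightarrow> complex) \<Rightarrow> complex"
  assumes "\<And>v. v \<in> X \<Longrightarrow> (\<lambda>t. l t v) \<in> borel_measurable unit_time"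
    and "\<And>t v w. t \<in> {0<..<1} \<Longrightarrow> v \<in> X \<Longrightarrow> w \<in> X \<Longrightarrow> norm (l t v - l t w) \<le> C * N (\<lambda>x. v x - w x)"
  shows "(\<lambda>t. l t (d t)) \<in> borel_measurable unit_time"
proof (rule borel_measurable_LIMSEQ_metric[where f = "\<lambda>n t. l t (s n t)"])
  fix n
  have fin: "finite (s n ` space unit_time)" using s_simple by (simp add: simple_function_def)
  have "(\<lambda>t. (\<lambda>v t. l t v) (s n t) t) \<in> borel_measurable unit_time"
  proof (rule measurable_compose_countable'[where f = "\<lambda>v t. l t v" and g = "s n" and I = "s n ` space unit_time"])
    show "s n \<in> unit_time \<rightarrow>\<^sub>M count_space (s n ` space unit_time)"
      using s_simple[of n] unfolding simple_function_def by (subst measurable_count_space_eq2) (auto simp: fin)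
    show "countable (s n ` space unit_time)" using fin by (rule countable_finite)
    show "(\<lambda>t. l t v) \<in> borel_measurable unit_time" if "v \<in> s n ` space unit_time" for v using assms(1) s_mem that by auto
  qed
  then show "(\<lambda>t. l t (s n t)) \<in> borel_measurable unit_time" .
next
  fix t assume "t \<in> space unit_time"
  then have t: "t \<in> {0<..<1}" by simp
  have "(\<lambda>n. C * N (\<lambda>x. d t x - s n t x)) \<longlonglongrightarrow> C * 0" by (rule tendsto_mult[OF tendsto_const s_lim])
  then have g: "(\<lambda>n. C * N (\<lambda>x. d t x - s n t x)) \<longlonglongrightarrow> 0" by simp
  have "(\<lambda>n. l t (d t) - l t (s n t)) \<longlonglongrightarrow> 0" by (rule Lim_null_comparison[OF always_eventually g]) (rule allI, rule assms(2)[OF t d_mem s_mem])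
  from tendsto_diff[OF tendsto_const[of "l t (d t)"] this]
  show "(\<lambda>n. l t (s n t)) \<longlonglongrightarrow> l t (d t)" by simp
qed

lemma N_measurable: "(\<lambda>t. N (d t)) \<in> borel_measurable unit_time"
proof (rule borel_measurable_LIMSEQ_real[where u = "\<lambda>n t. N (s n t)"])
  show "(\<lambda>t. N (s n t)) \<in> borel_measurable unit_time" for n by (rule borel_measurable_simple_function[OF simple_function_compose1[OF s_simple]])
  fix t
  have "(\<lambda>n. N (s n t) - N (d t)) \<longlonglongrightarrow> 0" by (rule Lim_null_comparison[OF _ s_lim[of t]])
      (use N_diff_ge[OF d_mem s_mem] in \<open>auto simp: abs_minus_commute\<close>)
  then show "(\<lambda>n. N (s n t)) \<longlonglongrightarrow> N (d t)" by (simp add: LIM_zero_iff)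
qed

lemma N_diff_simple_measurable:
  assumes "simple_function unit_time \<sigma>" "\<And>t. \<sigma> t \<in> X"
  shows "(\<lambda>t. N (\<lambda>x. d t x - \<sigma> t x)) \<in> borel_measurable unit_time"
proof (rule borel_measurable_LIMSEQ_real[where u = "\<lambda>n t. N (\<lambda>x. s n t x - \<sigma> t x)"])
  show "(\<lambda>t. N (\<lambda>x. s n t x - \<sigma> t x)) \<in> borel_measurable unit_time" for n
    by (rule borel_measurable_simple_function[OF simple_function_compose2[OF s_simple assms(1)]])
  fix t
  have "norm (N (\<lambda>x. s n t x - \<sigma> t x) - N (\<lambda>x. d t x - \<sigma> t x)) \<le> N (\<lambda>x. d t x - s n t x)" for n
    using N_diff_ge[OF diff_mem[OF d_mem[of t] assms(2)[of t]] diff_mem[OF s_mem[of n t] assms(2)[of t]]] by (simp add: abs_minus_commute)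
  then have "(\<lambda>n. N (\<lambda>x. s n t x - \<sigma> t x) - N (\<lambda>x. d t x - \<sigma> t x)) \<longlonglongrightarrow> 0" by (intro Lim_null_comparison[OF _ s_lim[of t]]) auto
  then show "(\<lambda>n. N (\<lambda>x. s n t x - \<sigma> t x)) \<longlonglongrightarrow> N (\<lambda>x. d t x - \<sigma> t x)" by (simp add: LIM_zero_iff)
qed

end

context seminormed
begin

definition real_functional :: "((real \<Rightarrow> complex) \<Rightarrow> complex) \<Rightarrow> real \<Rightarrow> bool" where
  "real_functional l \<Gamma> \<longleftrightarrow> 0 \<le> \<Gamma>
     \<and> (\<forall>v\<in>X. \<forall>w\<in>X. l (\<lambda>x. v x + w x) = l v + l w)
     \<and> (\<forall>r::real. \<forall>v\<in>X. l (\<lambda>x. complex_of_real r * v x) = complex_of_real r * l v)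
     \<and> (\<forall>v\<in>X. norm (l v) \<le> \<Gamma> * N v)"

lemma real_functionalD:
  assumes "real_functional l \<Gamma>"
  shows "0 \<le> \<Gamma>" "v \<in> X \<Longrightarrow> w \<in> X \<Longrightarrow> l (\<lambda>x. v x + w x) = l v + l w"
    "v \<in> X \<Longrightarrow> l (\<lambda>x. complex_of_real r * v x) = complex_of_real r * l v"
    "v \<in> X \<Longrightarrow> norm (l v) \<le> \<Gamma> * N v" using assms by (auto simp: real_functional_def)

lemma real_functional_diff:
  assumes "real_functional l \<Gamma>" "v \<in> X" "w \<in> X"
  shows "l (\<lambda>x. v x - w x) = l v - l w" "norm (l v - l w) \<le> \<Gamma> * N (\<lambda>x. v x - w x)"
proof -
  show *: "l (\<lambda>x. v x - w x) = l v - l w" using real_functionalD(2)[OF assms(1,2) scale_mem[OF assms(3), of "-1"]]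
      real_functionalD(3)[OF assms(1,3), of "-1"] by simp
  show "norm (l v - l w) \<le> \<Gamma> * N (\<lambda>x. v x - w x)" using real_functionalD(4)[OF assms(1) diff_mem[OF assms(2,3)]] * by simp
qed

lemma real_functional_weaken: "real_functional l C \<Longrightarrow> C \<le> C' \<Longrightarrow> real_functional l C'"
  unfolding real_functional_def using N_nonneg by (smt (verit) mult_right_mono)

lemma real_functional_zero: "real_functional l \<Gamma> \<Longrightarrow> l (\<lambda>x. 0) = 0" using real_functionalD(3)[OF _ zero_mem, of l \<Gamma> 0] by simp

lemma real_functional_sum:
  assumes l: "real_functional l \<Gamma>" and "\<And>i. i \<in> I \<Longrightarrow> v i \<in> X"
  shows "l (\<lambda>x. \<Sum>i\<in>I. complex_of_real (r i) * v i x) = (\<Sum>i\<in>I. complex_of_real (r i) * l (v i))" using assms(2)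
proof (induction I rule: infinite_finite_induct)
  case (insert i I)
  have "l (\<lambda>x. complex_of_real (r i) * v i x + (\<Sum>i\<in>I. complex_of_real (r i) * v i x))
    = l (\<lambda>x. complex_of_real (r i) * v i x) + l (\<lambda>x. \<Sum>i\<in>I. complex_of_real (r i) * v i x)"
    using insert by (intro real_functionalD(2)[OF l] scale_mem sum_mem) auto
  then show ?case using insert real_functionalD(3)[OF l] by simp
qed (simp_all add: real_functional_zero[OF l])

end

lemma finite_measure_unit_time: "finite_measure unit_time" by (rule finite_measure_lebesgue_on) simp

lemma measure_unit_time: "measure unit_time {0<..<1} = 1" by (simp add: measure_restrict_space)

lemma set_integral_unit_time_le:
  fixes f :: "real \<Rightarrow> real"
  assumes "integrable unit_time f" "\<And>t. 0 \<le> f t" "W \<in> sets unit_time"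
  shows "(LINT t:W|unit_time. f t) \<le> integral\<^sup>L unit_time f"
  unfolding set_lebesgue_integral_def by (rule integral_mono[OF integrable_mult_indicator]) (use assms in \<open>auto simp: indicator_def\<close>)

locale square_integrable_limit = simple_limit +
  assumes square_finite: "(\<integral>\<^sup>+t. ennreal ((N (d t))\<^sup>2) \<partial>unit_time) < \<infinity>"
begin

lemma N_square_integrable: "integrable unit_time (\<lambda>t. (N (d t))\<^sup>2)"
proof (rule integrableI_bounded)
  show "(\<lambda>t. (N (d t))\<^sup>2) \<in> borel_measurable unit_time" using N_measurable by measurable
  show "(\<integral>\<^sup>+ t. ennreal (norm ((N (d t))\<^sup>2)) \<partial>unit_time) < \<infinity>" using square_finite by simp
qed

lemma N_integrable: "integrable unit_time (\<lambda>t. N (d t))"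
proof (rule Bochner_Integration.integrable_bound)
  show "integrable unit_time (\<lambda>t. 1 + (N (d t))\<^sup>2)"
    by (intro Bochner_Integration.integrable_add N_square_integrable finite_measure.integrable_const finite_measure_unit_time)
  show "AE t in unit_time. norm (N (d t)) \<le> norm (1 + (N (d t))\<^sup>2)"
  proof (rule AE_I2)
    fix t have "2 * N (d t) \<le> 1 + (N (d t))\<^sup>2" using sum_squares_bound[of 1 "N (d t)"] by simp
    then show "norm (N (d t)) \<le> norm (1 + (N (d t))\<^sup>2)" using N_nonneg[of "d t"] by simp
  qed
qed (rule N_measurable)

definition mass :: real where "mass = (\<integral>t. N (d t) \<partial>unit_time)"

lemma truncated_simple:
  assumes "\<delta> > 0"
  obtains \<sigma> where "simple_function unit_time \<sigma>" "\<And>t. \<sigma> t \<in> X"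
    "integrable unit_time (\<lambda>t. N (\<lambda>x. d t x - \<sigma> t x))" "(\<integral>t. N (\<lambda>x. d t x - \<sigma> t x) \<partial>unit_time) < \<delta>"
proof -
  define \<sigma> where "\<sigma> n t = (if t \<in> {t \<in> space unit_time. N (s n t) \<le> 2 * N (d t)} then s n t else (\<lambda>x. 0))" for n t
  have Ns: "(\<lambda>t. N (s n t)) \<in> borel_measurable unit_time" for n by (rule borel_measurable_simple_function[OF simple_function_compose1[OF s_simple]])
  have set: "{t \<in> space unit_time. N (s n t) \<le> 2 * N (d t)} \<in> sets unit_time" for n using Ns N_measurable by measurable
  have simple: "simple_function unit_time (\<sigma> n)" for n
    unfolding \<sigma>_def[abs_def] by (rule simple_function_If_set) (use s_simple set in auto)
  have mem: "\<sigma> n t \<in> X" for n t using s_mem zero_mem by (simp add: \<sigma>_def)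
  have bound: "N (\<lambda>x. d t x - \<sigma> n t x) \<le> 3 * N (d t)" for n t
  proof -
    have "N (\<sigma> n t) \<le> 2 * N (d t)" using N_nonneg[of "d t"] by (simp add: \<sigma>_def N_zero)
    then show ?thesis using N_diff[OF d_mem mem, of t n t] by simp
  qed
  have meas: "(\<lambda>t. N (\<lambda>x. d t x - \<sigma> n t x)) \<in> borel_measurable unit_time" for n by (rule N_diff_simple_measurable[OF simple mem])
  have lim: "(\<lambda>n. N (\<lambda>x. d t x - \<sigma> n t x)) \<longlonglongrightarrow> 0" if t: "t \<in> space unit_time" for t
  proof (cases "N (d t) = 0")
    case True
    have "N (\<lambda>x. d t x - \<sigma> n t x) = 0" for n using bound[of t n] N_nonneg[of "\<lambda>x. d t x - \<sigma> n t x"] True by simp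
    then show ?thesis by simp
  next
    case False
    then have pos: "N (d t) > 0" using N_nonneg[of "d t"] by simp
    have "eventually (\<lambda>n. N (\<lambda>x. d t x - s n t x) < N (d t)) sequentially" using s_lim[of t] pos by (rule order_tendstoD(2))
    then have "eventually (\<lambda>n. N (\<lambda>x. d t x - s n t x) = N (\<lambda>x. d t x - \<sigma> n t x)) sequentially"
    proof eventually_elim
      case (elim n)
      have "N (s n t) \<le> 2 * N (d t)" using N_diff_ge[OF d_mem s_mem, of t n t] elim by (simp add: abs_if split: if_splits)
      then show ?case using t by (simp add: \<sigma>_def)
    qed
    then show ?thesis by (rule Lim_transform_eventually[OF s_lim])
  qed
  have "(\<lambda>n. \<integral>t. N (\<lambda>x. d t x - \<sigma> n t x) \<partial>unit_time) \<longlonglongrightarrow> (\<integral>t. 0 \<partial>unit_time)"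
  proof (rule integral_dominated_convergence[where w = "\<lambda>t. 3 * N (d t)"])
    show "integrable unit_time (\<lambda>t. 3 * N (d t))" using N_integrable by simp
    show "AE t in unit_time. norm (N (\<lambda>x. d t x - \<sigma> n t x)) \<le> 3 * N (d t)" for n using bound N_nonneg by (intro AE_I2) simp
  qed (use meas lim in \<open>auto intro!: AE_I2\<close>)
  then have "eventually (\<lambda>n. (\<integral>t. N (\<lambda>x. d t x - \<sigma> n t x) \<partial>unit_time) < \<delta>) sequentially" using assms by (intro order_tendstoD(2)) auto
  then obtain n where n: "(\<integral>t. N (\<lambda>x. d t x - \<sigma> n t x) \<partial>unit_time) < \<delta>" by (auto simp: eventually_sequentially)
  have "integrable unit_time (\<lambda>t. N (\<lambda>x. d t x - \<sigma> n t x))"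
  proof (rule Bochner_Integration.integrable_bound)
    show "integrable unit_time (\<lambda>t. 3 * N (d t))" using N_integrable by simp
    show "AE t in unit_time. norm (N (\<lambda>x. d t x - \<sigma> n t x)) \<le> norm (3 * N (d t))" using bound N_nonneg by (intro AE_I2) simp
  qed (rule meas)
  then show ?thesis using that[OF simple mem _ n] by blast
qed

text \<open>The vector integral over a set of times is replaced by vectors that represent it, up to an
  arbitrarily small error, simultaneously for all bounded functionals: integrate a simple function
  that is close to \<open>d\<close>.\<close>

lemma approximate_integral:
  assumes W: "W \<in> sets unit_time" and \<delta>: "\<delta> > 0"
  obtains y where "y \<in> X" "N y \<le> mass + \<delta>"
    "\<And>l \<Gamma>. real_functional l \<Gamma> \<Longrightarrow> norm ((LINT t:W|unit_time. l (d t)) - l y) \<le> \<Gamma> * \<delta>"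
proof -
  obtain \<sigma> where \<sigma>: "simple_function unit_time \<sigma>" "\<And>t. \<sigma> t \<in> X"
    and int: "integrable unit_time (\<lambda>t. N (\<lambda>x. d t x - \<sigma> t x))"
    and small: "(\<integral>t. N (\<lambda>x. d t x - \<sigma> t x) \<partial>unit_time) < \<delta>" using truncated_simple[OF \<delta>] by blast
  interpret finite_measure unit_time by (rule finite_measure_unit_time)
  define I where "I = \<sigma> ` space unit_time"
  have fin: "finite I" using \<sigma>(1) by (simp add: I_def simple_function_def)
  define A where "A c = {t \<in> space unit_time. \<sigma> t = c} \<inter> W" for c
  have A: "A c \<in> sets unit_time" for c
  proof -
    have "\<sigma> -` {c} \<inter> space unit_time \<in> sets unit_time" by (rule simple_functionD(2)[OF \<sigma>(1)])
    moreover have "A c = (\<sigma> -` {c} \<inter> space unit_time) \<inter> W" by (auto simp: A_def)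
    ultimately show ?thesis using W by simp
  qed
  define r where "r c = measure unit_time (A c)" for c
  define y where "y x = (\<Sum>c\<in>I. complex_of_real (r c) * c x)" for x
  have I_X: "c \<in> I \<Longrightarrow> c \<in> X" for c using \<sigma>(2) by (auto simp: I_def)
  have yX: "y \<in> X" unfolding y_def[abs_def] by (intro sum_mem scale_mem I_X)
  have simple_int: "integrable unit_time (\<lambda>t. indicator W t *\<^sub>R f (\<sigma> t)) \<and>
     (LINT t:W|unit_time. f (\<sigma> t)) = (\<Sum>c\<in>I. r c *\<^sub>R f c)" for f :: "_ \<Rightarrow> 'b::{banach, second_countable_topology}"
  proof -
    have eq: "indicator W t *\<^sub>R f (\<sigma> t) = (\<Sum>c\<in>I. indicator (A c) t *\<^sub>R f c)" if "t \<in> space unit_time" for t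
    proof -
      have "(\<Sum>c\<in>I. indicator (A c) t *\<^sub>R f c) = (\<Sum>c\<in>I. if c = \<sigma> t then indicator W t *\<^sub>R f c else 0)"
        by (rule sum.cong) (use that in \<open>auto simp: A_def indicator_def\<close>)
      also have "... = indicator W t *\<^sub>R f (\<sigma> t)" using fin that by (simp add: I_def sum.delta)
      finally show ?thesis by simp
    qed
    have hbi: "has_bochner_integral unit_time (\<lambda>t. indicator (A c) t *\<^sub>R f c) (r c *\<^sub>R f c)" for c
      unfolding r_def using A by (intro has_bochner_integral_indicator) (auto simp: emeasure_eq_measure)
    then have i: "integrable unit_time (\<lambda>t. indicator (A c) t *\<^sub>R f c)"
      and v: "(\<integral>t. indicator (A c) t *\<^sub>R f c \<partial>unit_time) = r c *\<^sub>R f c" for c by (simp_all add: has_bochner_integral_iff)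
    have "integrable unit_time (\<lambda>t. \<Sum>c\<in>I. indicator (A c) t *\<^sub>R f c)" using i by simp
    moreover have "(LINT t:W|unit_time. f (\<sigma> t)) = (\<integral>t. (\<Sum>c\<in>I. indicator (A c) t *\<^sub>R f c) \<partial>unit_time)"
      unfolding set_lebesgue_integral_def by (rule Bochner_Integration.integral_cong[OF refl eq])
    moreover have "... = (\<Sum>c\<in>I. r c *\<^sub>R f c)" using i v by simp
    ultimately show ?thesis using Bochner_Integration.integrable_cong[OF refl eq, of unit_time] by simp
  qed
  have "N y \<le> (\<Sum>c\<in>I. N (\<lambda>x. complex_of_real (r c) * c x))"
    unfolding y_def[abs_def] by (intro N_sum scale_mem I_X)
  also have "... = (\<Sum>c\<in>I. r c *\<^sub>R N c)" by (rule sum.cong) (use I_X in \<open>auto simp: N_scale r_def\<close>)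
  also have "... = (LINT t:W|unit_time. N (\<sigma> t))" using simple_int[of N] by simp
  also have "... \<le> (\<integral>t. N (d t) + N (\<lambda>x. d t x - \<sigma> t x) \<partial>unit_time)"
    unfolding set_lebesgue_integral_def
  proof (rule integral_mono)
    show "integrable unit_time (\<lambda>t. indicator W t *\<^sub>R N (\<sigma> t))" using simple_int[of N] by simp
    fix t
    have "N (\<sigma> t) \<le> N (d t) + N (\<lambda>x. d t x - \<sigma> t x)" using N_diff_ge[OF d_mem \<sigma>(2), of t t] by (simp add: abs_if split: if_splits)
    then show "indicator W t *\<^sub>R N (\<sigma> t) \<le> N (d t) + N (\<lambda>x. d t x - \<sigma> t x)" using N_nonneg by (auto simp: indicator_def add_nonneg_nonneg)
  qed (use int N_integrable in auto)
  also have "... \<le> mass + \<delta>" using int N_integrable small by (simp add: mass_def)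
  finally have Ny: "N y \<le> mass + \<delta>" .
  have "norm ((LINT t:W|unit_time. l (d t)) - l y) \<le> \<Gamma> * \<delta>" if l: "real_functional l \<Gamma>" for l \<Gamma>
  proof -
    have ly: "l y = (LINT t:W|unit_time. l (\<sigma> t))" using real_functional_sum[OF l, of I "\<lambda>c. c" r] I_X simple_int[of l]
      by (simp add: y_def[abs_def] scaleR_conv_of_real)
    have meas: "(\<lambda>t. l (d t)) \<in> borel_measurable unit_time" using measurable_functional[of "\<lambda>t. l" \<Gamma>] real_functional_diff(2)[OF l] by simp
    have bound: "norm (indicator W t *\<^sub>R l (d t) - indicator W t *\<^sub>R l (\<sigma> t)) \<le> \<Gamma> * N (\<lambda>x. d t x - \<sigma> t x)" for t
      using real_functional_diff(2)[OF l d_mem \<sigma>(2), of t t] real_functionalD(1)[OF l] N_nonneg[of "\<lambda>x. d t x - \<sigma> t x"] by (auto simp: indicator_def)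
    have i1: "integrable unit_time (\<lambda>t. indicator W t *\<^sub>R l (d t))"
    proof (rule Bochner_Integration.integrable_bound)
      show "integrable unit_time (\<lambda>t. \<Gamma> * N (d t))" using N_integrable by simp
      show "(\<lambda>t. indicator W t *\<^sub>R l (d t)) \<in> borel_measurable unit_time" using W meas by measurable
      show "AE t in unit_time. norm (indicator W t *\<^sub>R l (d t)) \<le> norm (\<Gamma> * N (d t))"
        using real_functionalD(4)[OF l d_mem] real_functionalD(1)[OF l] N_nonneg by (intro AE_I2) (auto simp: indicator_def)
    qed
    have i2: "integrable unit_time (\<lambda>t. indicator W t *\<^sub>R l (\<sigma> t))" using simple_int[of l] by simp
    have "(LINT t:W|unit_time. l (d t)) - l y = (\<integral>t. indicator W t *\<^sub>R l (d t) - indicator W t *\<^sub>R l (\<sigma> t) \<partial>unit_time)"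
      using i1 i2 by (simp add: ly set_lebesgue_integral_def)
    also have "norm ... \<le> (\<integral>t. \<Gamma> * N (\<lambda>x. d t x - \<sigma> t x) \<partial>unit_time)"
      by (rule Bochner_Integration.integral_norm_bound_integral) (use i1 i2 int bound in auto)
    also have "... \<le> \<Gamma> * \<delta>" using small real_functionalD(1)[OF l] int by (simp add: mult_left_mono)
    finally show ?thesis .
  qed
  then show ?thesis using that[OF yX Ny] by blast
qed

end

locale time_form = square_integrable_limit +
  fixes B :: "real \<Rightarrow> (real \<Rightarrow> complex) \<Rightarrow> (real \<Rightarrow> complex) \<Rightarrow> complex" and \<Gamma> :: real
  assumes \<Gamma>: "0 \<le> \<Gamma>"
    and B_left: "q \<in> {0<..<1} \<Longrightarrow> w \<in> X \<Longrightarrow> real_functional (\<lambda>v. B q v w) (\<Gamma> * N w)"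
    and B_right: "q \<in> {0<..<1} \<Longrightarrow> v \<in> X \<Longrightarrow> real_functional (B q v) (\<Gamma> * N v)"
    and B_measurable: "v \<in> X \<Longrightarrow> w \<in> X \<Longrightarrow> (\<lambda>q. B q v w) \<in> borel_measurable unit_time"
begin

lemma B_bound: "q \<in> {0<..<1} \<Longrightarrow> v \<in> X \<Longrightarrow> w \<in> X \<Longrightarrow> norm (B q v w) \<le> \<Gamma> * N v * N w" using real_functionalD(4)[OF B_right] by blast

lemma Bd_measurable: assumes "w \<in> X" shows "(\<lambda>q. B q (d q) w) \<in> borel_measurable unit_time"
  by (rule measurable_functional[where l = "\<lambda>q v. B q v w" and C = "\<Gamma> * N w"])
    (use assms B_measurable real_functional_diff(2)[OF B_left] in auto)

lemma Bd_integrable: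
  assumes "w \<in> X" "W \<in> sets unit_time" shows "integrable unit_time (\<lambda>q. indicator W q *\<^sub>R B q (d q) w)"
proof (rule Bochner_Integration.integrable_bound)
  show "integrable unit_time (\<lambda>q. \<Gamma> * N w * N (d q))" using N_integrable by simp
  show "(\<lambda>q. indicator W q *\<^sub>R B q (d q) w) \<in> borel_measurable unit_time" using Bd_measurable[OF assms(1)] assms(2) by measurable
  show "AE q in unit_time. norm (indicator W q *\<^sub>R B q (d q) w) \<le> norm (\<Gamma> * N w * N (d q))" using B_bound[OF _ d_mem assms(1)] \<Gamma> N_nonneg
    by (intro AE_I2) (auto simp: indicator_def abs_mult mult_ac)
qed

lemma Bd_set_bound:
  assumes "w \<in> X" "W \<in> sets unit_time"
  shows "norm (LINT q:W|unit_time. B q (d q) w) \<le> \<Gamma> * N w * (LINT q:W|unit_time. N (d q))"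
proof -
  have i: "integrable unit_time (\<lambda>q. indicator W q *\<^sub>R N (d q))" by (rule integrable_mult_indicator[OF assms(2) N_integrable])
  have "norm (LINT q:W|unit_time. B q (d q) w) \<le> (\<integral>q. \<Gamma> * N w * (indicator W q *\<^sub>R N (d q)) \<partial>unit_time)"
    unfolding set_lebesgue_integral_def
  proof (rule Bochner_Integration.integral_norm_bound_integral[OF Bd_integrable[OF assms]])
    show "integrable unit_time (\<lambda>q. \<Gamma> * N w * (indicator W q *\<^sub>R N (d q)))" using i by simp
    show "norm (indicator W q *\<^sub>R B q (d q) w) \<le> \<Gamma> * N w * (indicator W q *\<^sub>R N (d q))" if "q \<in> space unit_time" for q
      using B_bound[OF _ d_mem assms(1), of q] that by (auto simp: indicator_def mult_ac)
  qed
  also have "... = \<Gamma> * N w * (LINT q:W|unit_time. N (d q))" using i by (simp add: set_lebesgue_integral_def)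
  finally show ?thesis .
qed

lemma integral_real_functional:
  assumes W: "W \<in> sets unit_time"
  shows "real_functional (\<lambda>w. LINT q:W|unit_time. B q (d q) w) (\<Gamma> * (LINT q:W|unit_time. N (d q)))"
proof -
  have pos: "0 \<le> (LINT q:W|unit_time. N (d q))"
    unfolding set_lebesgue_integral_def by (rule integral_nonneg_AE) (auto simp: N_nonneg)
  have "(LINT q:W|unit_time. B q (d q) (\<lambda>x. v x + w x)) = (LINT q:W|unit_time. B q (d q) v) + (LINT q:W|unit_time. B q (d q) w)"
    if vw: "v \<in> X" "w \<in> X" for v w
  proof -
    have "(LINT q:W|unit_time. B q (d q) (\<lambda>x. v x + w x)) = (\<integral>q. indicator W q *\<^sub>R B q (d q) v + indicator W q *\<^sub>R B q (d q) w \<partial>unit_time)"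
      unfolding set_lebesgue_integral_def
      by (rule Bochner_Integration.integral_cong) (use real_functionalD(2)[OF B_right[OF _ d_mem] vw] in \<open>auto simp: scaleR_add_right\<close>)
    then show ?thesis using Bd_integrable[OF _ W] vw by (simp add: set_lebesgue_integral_def)
  qed
  moreover have "(LINT q:W|unit_time. B q (d q) (\<lambda>x. complex_of_real r * v x)) = complex_of_real r * (LINT q:W|unit_time. B q (d q) v)"
    if v: "v \<in> X" for r v
  proof -
    have "(LINT q:W|unit_time. B q (d q) (\<lambda>x. complex_of_real r * v x)) = (\<integral>q. complex_of_real r * (indicator W q *\<^sub>R B q (d q) v) \<partial>unit_time)"
      unfolding set_lebesgue_integral_def by (rule Bochner_Integration.integral_cong) (use real_functionalD(3)[OF B_right[OF _ d_mem] v] in auto)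
    then show ?thesis by (simp only: integral_mult_right_zero set_lebesgue_integral_def)
  qed
  ultimately show ?thesis
    unfolding real_functional_def using Bd_set_bound[OF _ W] \<Gamma> pos by (auto simp: mult_ac)
qed

text \<open>A fixed form, integrated over a product of two time sets, is approximated by its value at the
  vectors that represent the integrals over the factors.\<close>

lemma fixed_form_approximation:
  assumes const: "\<And>q. B q = G"
    and W: "W1 \<in> sets unit_time"
    and y1: "y1 \<in> X" "N y1 \<le> mass + \<delta>"
      "\<And>l \<Gamma>. real_functional l \<Gamma> \<Longrightarrow> norm ((LINT t:W1|unit_time. l (d t)) - l y1) \<le> \<Gamma> * \<delta>"
    and y2: "y2 \<in> X" "\<And>l \<Gamma>. real_functional l \<Gamma> \<Longrightarrow> norm ((LINT t:W2|unit_time. l (d t)) - l y2) \<le> \<Gamma> * \<delta>"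
    and "N y2 \<le> mass + \<delta>" "0 < \<delta>"
  shows "norm ((LINT s:W2|unit_time. LINT r:W1|unit_time. G (d r) (d s)) - G y1 y2) \<le> \<Gamma> * (2 * mass + \<delta>) * \<delta>"
proof -
  define l where "l w = (LINT r:W1|unit_time. G (d r) w)" for w
  have half: "(1/2::real) \<in> {0<..<1}" by simp
  have G_left: "w \<in> X \<Longrightarrow> real_functional (\<lambda>v. G v w) (\<Gamma> * N w)" for w using B_left[OF half] const by simp
  have m: "(LINT q:W1|unit_time. N (d q)) \<le> mass"
    unfolding mass_def by (rule set_integral_unit_time_le[OF N_integrable N_nonneg W])
  have "real_functional l (\<Gamma> * (LINT q:W1|unit_time. N (d q)))" using integral_real_functional[OF W] const by (simp add: l_def[abs_def])
  from y2(2)[OF this] have "norm ((LINT s:W2|unit_time. l (d s)) - l y2) \<le> \<Gamma> * (LINT q:W1|unit_time. N (d q)) * \<delta>" .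
  also have "... \<le> \<Gamma> * mass * \<delta>" using m \<Gamma> assms by (intro mult_right_mono mult_left_mono) auto
  finally have 1: "norm ((LINT s:W2|unit_time. l (d s)) - l y2) \<le> \<Gamma> * mass * \<delta>" .
  have "norm (l y2 - G y1 y2) \<le> \<Gamma> * N y2 * \<delta>"
    unfolding l_def by (rule y1(3)[OF G_left[OF y2(1)]])
  also have "... \<le> \<Gamma> * (mass + \<delta>) * \<delta>" using \<Gamma> assms by (intro mult_right_mono mult_left_mono) auto
  finally have 2: "norm (l y2 - G y1 y2) \<le> \<Gamma> * (mass + \<delta>) * \<delta>" .
  have "norm ((LINT s:W2|unit_time. l (d s)) - G y1 y2) \<le> \<Gamma> * mass * \<delta> + \<Gamma> * (mass + \<delta>) * \<delta>"
    using norm_triangle_ineq[of "(LINT s:W2|unit_time. l (d s)) - l y2" "l y2 - G y1 y2"] 1 2 by simp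
  then show ?thesis by (simp add: l_def[abs_def] algebra_simps)
qed

end

section \<open>The energy method\<close>

definition past :: "real \<Rightarrow> real set" where "past r = {0<..<1} \<inter> {..<r}"

lemma past_sets [measurable, simp]: "past r \<in> sets unit_time" by (simp add: past_def sets_restrict_space_iff)

lemma past_mono: "r \<le> r' \<Longrightarrow> past r \<subseteq> past r'" by (auto simp: past_def)

lemma past_empty: "r \<le> 0 \<Longrightarrow> past r = {}" by (auto simp: past_def)

lemma measure_past_diff: "0 \<le> y' \<Longrightarrow> y' \<le> y \<Longrightarrow> y \<le> 1 \<Longrightarrow> measure unit_time (past y - past y') = y - y'"
  and measure_past_diff_le: "y' \<le> y \<Longrightarrow> measure unit_time (past y - past y') \<le> y - y'"
proof -
  have le: "measure unit_time (past y - past y') \<le> y - y'" if "y' \<le> y" for y y'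
  proof -
    have sub: "past y - past y' \<subseteq> {0<..<1}" by (auto simp: past_def)
    have "measure unit_time (past y - past y') = measure lebesgue (past y - past y')" using sub by (intro measure_restrict_space) auto
    also have "... \<le> measure lebesgue {y'..y}" by (rule measure_mono_fmeasurable) (auto simp: past_def)
    also have "... = y - y'" using that by simp
    finally show ?thesis .
  qed
  then show "y' \<le> y \<Longrightarrow> measure unit_time (past y - past y') \<le> y - y'" .
  assume y: "0 \<le> y'" "y' \<le> y" "y \<le> 1"
  interpret finite_measure unit_time by (rule finite_measure_unit_time)
  have 1: "measure unit_time (past 1 - past y) \<le> 1 - y" "measure unit_time (past y - past y') \<le> y - y'"
    "measure unit_time (past y' - past 0) \<le> y' - 0" using le[OF y(3)] le[OF y(2)] le[OF y(1)] by simp_all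
  have "measure unit_time (past 1 - past 0) = 1"
  proof -
    have "past 1 - past 0 = {0<..<1}" by (auto simp: past_def)
    then show ?thesis using measure_unit_time by simp
  qed
  moreover have "measure unit_time (past 1 - past 0) \<le> measure unit_time (past 1 - past y) + measure unit_time (past y - past y') + measure unit_time (past y' - past 0)"
  proof -
    have "past 1 - past 0 = ((past 1 - past y) \<union> (past y - past y')) \<union> (past y' - past 0)" using y by (auto simp: past_def)
    then have "measure unit_time (past 1 - past 0) \<le> measure unit_time ((past 1 - past y) \<union> (past y - past y')) + measure unit_time (past y' - past 0)"
      using measure_Un_le[of "(past 1 - past y) \<union> (past y - past y')" unit_time "past y' - past 0"] by simp
    moreover have "measure unit_time ((past 1 - past y) \<union> (past y - past y')) \<le> measure unit_time (past 1 - past y) + measure unit_time (past y - past y')"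
      by (rule measure_Un_le) auto
    ultimately show ?thesis by simp
  qed
  ultimately show "measure unit_time (past y - past y') = y - y'" using 1 by simp
qed

lemma set_integral_unit_time_const:
  fixes c :: "'a::{banach, second_countable_topology}"
  assumes "A \<in> sets unit_time" shows "(LINT q:A|unit_time. c) = measure unit_time A *\<^sub>R c"
proof -
  interpret finite_measure unit_time by (rule finite_measure_unit_time)
  have "has_bochner_integral unit_time (\<lambda>q. indicator A q *\<^sub>R c) (measure unit_time A *\<^sub>R c)"
    using assms by (intro has_bochner_integral_indicator) (auto simp: emeasure_eq_measure)
  then show ?thesis by (simp add: set_lebesgue_integral_def has_bochner_integral_iff)
qed

lemma set_integral_past_diff:
  fixes f :: "real \<Rightarrow> 'a::{banach, second_countable_topology}"
  assumes "integrable unit_time f" "y' \<le> y"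
  shows "(LINT q:past y|unit_time. f q) - (LINT q:past y'|unit_time. f q) = (LINT q:past y - past y'|unit_time. f q)"
proof -
  have "(LINT q:past y|unit_time. f q) - (LINT q:past y'|unit_time. f q)
     = (\<integral>q. indicator (past y) q *\<^sub>R f q - indicator (past y') q *\<^sub>R f q \<partial>unit_time)"
    unfolding set_lebesgue_integral_def by (subst Bochner_Integration.integral_diff) (auto intro: integrable_mult_indicator[OF past_sets assms(1)])
  also have "... = (LINT q:past y - past y'|unit_time. f q)"
    unfolding set_lebesgue_integral_def by (rule Bochner_Integration.integral_cong) (use past_mono[OF assms(2)] in \<open>auto simp: indicator_def\<close>)
  finally show ?thesis .
qed

lemma set_integral_past_diff_le:
  fixes f :: "real \<Rightarrow> 'a::{banach, second_countable_topology}"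
  assumes "f \<in> borel_measurable unit_time" "y' \<le> y" "\<And>q. q \<in> past y - past y' \<Longrightarrow> norm (f q) \<le> C"
    and C: "0 \<le> C"
  shows "norm (LINT q:past y - past y'|unit_time. f q) \<le> C * (y - y')"
proof -
  interpret finite_measure unit_time by (rule finite_measure_unit_time)
  have A: "past y - past y' \<in> sets unit_time" by simp
  have "norm (LINT q:past y - past y'|unit_time. f q) \<le> (\<integral>q. indicator (past y - past y') q *\<^sub>R C \<partial>unit_time)"
    unfolding set_lebesgue_integral_def
  proof (rule Bochner_Integration.integral_norm_bound_integral)
    show i: "integrable unit_time (\<lambda>q. indicator (past y - past y') q *\<^sub>R C)" using A by (intro integrable_mult_indicator) auto
    show "integrable unit_time (\<lambda>q. indicator (past y - past y') q *\<^sub>R f q)" by (rule Bochner_Integration.integrable_bound[OF i])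
        (use assms(1,3) A C in \<open>auto simp: indicator_def intro!: AE_I2 borel_measurable_scaleR borel_measurable_indicator\<close>)
    show "norm (indicator (past y - past y') q *\<^sub>R f q) \<le> indicator (past y - past y') q *\<^sub>R C" for q using assms(3) by (auto simp: indicator_def)
  qed
  also have "... = C * measure unit_time (past y - past y')" using set_integral_unit_time_const[OF A, of C] by (simp add: set_lebesgue_integral_def)
  also have "... \<le> C * (y - y')" using measure_past_diff_le[OF assms(2)] C by (intro mult_left_mono) auto
  finally show ?thesis .
qed

lemma set_integral_past_continuous:
  fixes f :: "real \<Rightarrow> 'a::{banach, second_countable_topology}"
  assumes f: "integrable unit_time f"
  shows "continuous_on S (\<lambda>y. LINT q:past y|unit_time. f q)"
proof (rule continuous_at_imp_continuous_on, rule ballI, rule continuous_at_sequentiallyI)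
  fix y :: real and u assume u: "u \<longlonglongrightarrow> y"
  show "(\<lambda>n. LINT q:past (u n)|unit_time. f q) \<longlonglongrightarrow> (LINT q:past y|unit_time. f q)"
    unfolding set_lebesgue_integral_def
  proof (rule integral_dominated_convergence[where w = "\<lambda>q. norm (f q)"])
    show "integrable unit_time (\<lambda>q. norm (f q))" using f by simp
    show "(\<lambda>q. indicator (past (u n)) q *\<^sub>R f q) \<in> borel_measurable unit_time" for n
      using borel_measurable_integrable[OF integrable_mult_indicator[OF past_sets f]] .
    show "(\<lambda>q. indicator (past y) q *\<^sub>R f q) \<in> borel_measurable unit_time"
      using borel_measurable_integrable[OF integrable_mult_indicator[OF past_sets f]] .
    show "AE q in unit_time. norm (indicator (past (u n)) q *\<^sub>R f q) \<le> norm (f q)" for n by (rule AE_I2) (auto simp: indicator_def)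
    have "AE q in lebesgue. q \<notin> {y}" by (intro AE_not_in) auto
    then have "AE q in unit_time. q \<notin> {y}" by (rule AE_lebesgue_on) simp
    then show "AE q in unit_time. (\<lambda>n. indicator (past (u n)) q *\<^sub>R f q) \<longlonglongrightarrow> indicator (past y) q *\<^sub>R f q"
    proof eventually_elim
      case (elim q)
      have "eventually (\<lambda>n. (q < u n) = (q < y)) sequentially"
      proof (cases "q < y")
        case True
        then show ?thesis using order_tendstoD(1)[OF u True] by (auto elim: eventually_mono)
      next
        case False
        then have yq: "y < q" using elim by auto
        show ?thesis using order_tendstoD(2)[OF u yq] yq by (auto elim: eventually_mono)
      qed
      then have "eventually (\<lambda>n. indicator (past (u n)) q *\<^sub>R f q = indicator (past y) q *\<^sub>R f q) sequentially"
        by eventually_elim (auto simp: past_def indicator_def)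
      then show ?case by (rule tendsto_eventually)
    qed
  qed
qed

text \<open>The abstract evolution \<open>d(r) = - \<integral>\<^sub>0\<^sup>r B\<^sub>q d(q) dq\<close>, an identity of functionals: \<open>P\<close> is the inner product of the pivot space and \<open>B\<close> a nonnegative form that is Hoelder continuous of exponent one half in time. The function \<open>\<zeta> v\<close> is the representative of \<open>r \<mapsto> P (d r) v\<close> that is continuous in time.\<close>

locale energy = time_form X N d s B \<Gamma>
  for X :: "(real \<Rightarrow> complex) set" and N :: "(real \<Rightarrow> complex) \<Rightarrow> real"
    and d :: "real \<Rightarrow> real \<Rightarrow> complex" and s :: "nat \<Rightarrow> real \<Rightarrow> real \<Rightarrow> complex"
    and B :: "real \<Rightarrow> (real \<Rightarrow> complex) \<Rightarrow> (real \<Rightarrow> complex) \<Rightarrow> complex" and \<Gamma> :: real +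
  fixes P :: "(real \<Rightarrow> complex) \<Rightarrow> (real \<Rightarrow> complex) \<Rightarrow> complex" and Ca :: real
  assumes P_left: "w \<in> X \<Longrightarrow> real_functional (\<lambda>v. P v w) (N w)"
    and P_right: "v \<in> X \<Longrightarrow> real_functional (P v) (N v)"
    and P_hermitian: "cnj (P v w) = P w v"
    and P_Cauchy_Schwarz: "v \<in> X \<Longrightarrow> w \<in> X \<Longrightarrow> norm (P v w) \<le> sqrt (Re (P v v)) * N w"
    and P_pos: "0 \<le> Re (P v v)"
    and Ca: "0 \<le> Ca"
    and B_Holder: "p \<in> {0<..<1} \<Longrightarrow> q \<in> {0<..<1} \<Longrightarrow> v \<in> X \<Longrightarrow> w \<in> X
      \<Longrightarrow> norm (B q v w - B p v w) \<le> Ca * sqrt \<bar>q - p\<bar> * N v * N w"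
    and B_pos: "q \<in> {0<..<1} \<Longrightarrow> v \<in> X \<Longrightarrow> 0 \<le> Re (B q v v)"
    and evolution: "AE r in unit_time. \<forall>v\<in>X. P (d r) v = - (LINT q:past r|unit_time. B q (d q) v)"
begin

definition K :: real where "K = sqrt (\<integral>t. (N (d t))\<^sup>2 \<partial>unit_time)"

lemma K_nonneg: "0 \<le> K" by (simp add: K_def)

lemma K_square: "K\<^sup>2 = (\<integral>t. (N (d t))\<^sup>2 \<partial>unit_time)" by (simp add: K_def)

lemma set_mass_square:
  assumes A: "A \<in> sets unit_time"
  shows "(LINT q:A|unit_time. N (d q)) \<le> sqrt (measure unit_time A) * sqrt (LINT q:A|unit_time. (N (d q))\<^sup>2)"
proof (rule nonneg_quadratic_discriminant)
  interpret finite_measure unit_time by (rule finite_measure_unit_time)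
  fix r :: real
  have i: "integrable unit_time (\<lambda>q. indicator A q *\<^sub>R N (d q))" "integrable unit_time (\<lambda>q. indicator A q *\<^sub>R (N (d q))\<^sup>2)"
    "integrable unit_time (\<lambda>q. indicator A q *\<^sub>R (1::real))"
    by (rule integrable_mult_indicator[OF A N_integrable], rule integrable_mult_indicator[OF A N_square_integrable],
        rule integrable_mult_indicator[OF A integrable_const])
  have "0 \<le> (\<integral>q. indicator A q *\<^sub>R (N (d q) - r)\<^sup>2 \<partial>unit_time)" by simp
  also have "... = (\<integral>q. (indicator A q *\<^sub>R (N (d q))\<^sup>2 - 2 * r * (indicator A q *\<^sub>R N (d q))) + r\<^sup>2 * (indicator A q *\<^sub>R 1) \<partial>unit_time)"
    by (rule Bochner_Integration.integral_cong) (auto simp: indicator_def power2_diff)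
  also have "... = (\<integral>q. indicator A q *\<^sub>R (N (d q))\<^sup>2 \<partial>unit_time) - 2 * r * (\<integral>q. indicator A q *\<^sub>R N (d q) \<partial>unit_time) + r\<^sup>2 * (\<integral>q. indicator A q *\<^sub>R 1 \<partial>unit_time)"
    using i by (subst Bochner_Integration.integral_add Bochner_Integration.integral_diff; simp)+
  finally show "0 \<le> (LINT q:A|unit_time. (N (d q))\<^sup>2) - 2 * r * (LINT q:A|unit_time. N (d q)) + r\<^sup>2 * measure unit_time A"
    using set_integral_unit_time_const[OF A, of "1::real"] by (simp add: set_lebesgue_integral_def)
next
  show "0 \<le> (LINT q:A|unit_time. (N (d q))\<^sup>2)"
    unfolding set_lebesgue_integral_def by (rule integral_nonneg_AE) simp
qed simp

lemma past_mass_Holder: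
  assumes "y' \<le> y" shows "(LINT q:past y - past y'|unit_time. N (d q)) \<le> K * sqrt (y - y')"
proof -
  have A: "past y - past y' \<in> sets unit_time" by simp
  have "(LINT q:past y - past y'|unit_time. N (d q))
     \<le> sqrt (measure unit_time (past y - past y')) * sqrt (LINT q:past y - past y'|unit_time. (N (d q))\<^sup>2)" by (rule set_mass_square[OF A])
  also have "... \<le> sqrt (y - y') * K" unfolding K_def
  proof (intro mult_mono)
    show "0 \<le> sqrt (LINT q:past y - past y'|unit_time. (N (d q))\<^sup>2)"
      unfolding set_lebesgue_integral_def by (intro real_sqrt_ge_zero integral_nonneg_AE) simp
  qed (use measure_past_diff_le[OF assms] set_integral_unit_time_le[OF N_square_integrable _ A] assms in simp_all)
  finally show ?thesis by (simp add: mult.commute)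
qed

lemma past_integral_Holder:
  fixes f :: "real \<Rightarrow> complex"
  assumes f: "f \<in> borel_measurable unit_time" "\<And>q. q \<in> {0<..<1} \<Longrightarrow> norm (f q) \<le> C * N (d q)" and C: "0 \<le> C"
  shows "integrable unit_time f"
    "norm ((LINT q:past y|unit_time. f q) - (LINT q:past y'|unit_time. f q)) \<le> C * K * sqrt \<bar>y - y'\<bar>"
proof -
  show i: "integrable unit_time f"
  proof (rule Bochner_Integration.integrable_bound)
    show "integrable unit_time (\<lambda>q. C * N (d q))" using N_integrable by simp
    show "AE q in unit_time. norm (f q) \<le> norm (C * N (d q))" using f(2) by (intro AE_I2) (simp add: order_trans[OF _ abs_ge_self])
  qed (rule f(1))
  have le: "norm ((LINT q:past y|unit_time. f q) - (LINT q:past y'|unit_time. f q)) \<le> C * K * sqrt (y - y')" if y: "y' \<le> y" for y y'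
  proof -
    have A: "past y - past y' \<in> sets unit_time" by simp
    have "norm ((LINT q:past y|unit_time. f q) - (LINT q:past y'|unit_time. f q)) = norm (LINT q:past y - past y'|unit_time. f q)"
      using set_integral_past_diff[OF i y] by simp
    also have "... \<le> (\<integral>q. C * (indicator (past y - past y') q *\<^sub>R N (d q)) \<partial>unit_time)"
      unfolding set_lebesgue_integral_def
    proof (rule Bochner_Integration.integral_norm_bound_integral)
      show "integrable unit_time (\<lambda>q. indicator (past y - past y') q *\<^sub>R f q)" by (rule integrable_mult_indicator[OF A i])
      show "integrable unit_time (\<lambda>q. C * (indicator (past y - past y') q *\<^sub>R N (d q)))" using integrable_mult_indicator[OF A N_integrable] by simp
      show "norm (indicator (past y - past y') q *\<^sub>R f q) \<le> C * (indicator (past y - past y') q *\<^sub>R N (d q))"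
        if "q \<in> space unit_time" for q using f(2)[of q] that by (auto simp: indicator_def)
    qed
    also have "... = C * (LINT q:past y - past y'|unit_time. N (d q))" by (simp add: set_lebesgue_integral_def)
    also have "... \<le> C * (K * sqrt (y - y'))" using past_mass_Holder[OF y] C by (rule mult_left_mono)
    finally show ?thesis by (simp add: mult_ac)
  qed
  show "norm ((LINT q:past y|unit_time. f q) - (LINT q:past y'|unit_time. f q)) \<le> C * K * sqrt \<bar>y - y'\<bar>"
    using le[of y y'] le[of y' y] by (cases "y' \<le> y") (auto simp: norm_minus_commute)
qed

definition \<zeta> :: "(real \<Rightarrow> complex) \<Rightarrow> real \<Rightarrow> complex" where
  "\<zeta> v r = - (LINT q:past r|unit_time. B q (d q) v)"

lemma \<zeta>_Holder: assumes "v \<in> X" shows "norm (\<zeta> v r - \<zeta> v r') \<le> \<Gamma> * N v * K * sqrt \<bar>r - r'\<bar>"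
proof -
  have "norm ((LINT q:past r|unit_time. B q (d q) v) - (LINT q:past r'|unit_time. B q (d q) v)) \<le> (\<Gamma> * N v) * K * sqrt \<bar>r - r'\<bar>"
    by (rule past_integral_Holder(2)[OF Bd_measurable[OF assms]])
      (use B_bound[OF _ d_mem assms] \<Gamma> N_nonneg in \<open>auto simp: mult_ac\<close>)
  then show ?thesis by (simp add: \<zeta>_def norm_minus_commute)
qed

lemma \<zeta>_zero: "r \<le> 0 \<Longrightarrow> \<zeta> v r = 0" by (simp add: \<zeta>_def past_empty set_lebesgue_integral_def)

lemma \<zeta>_continuous: assumes "v \<in> X" shows "continuous_on UNIV (\<zeta> v)"
proof (rule continuous_at_imp_continuous_on, rule ballI)
  fix r
  have "((\<lambda>r'. \<Gamma> * N v * K * sqrt \<bar>r' - r\<bar>) \<longlongrightarrow> \<Gamma> * N v * K * sqrt \<bar>r - r\<bar>) (at r)" by (intro tendsto_intros)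
  then have "((\<lambda>r'. \<Gamma> * N v * K * sqrt \<bar>r' - r\<bar>) \<longlongrightarrow> 0) (at r)" by simp
  then have "((\<lambda>r'. \<zeta> v r' - \<zeta> v r) \<longlongrightarrow> 0) (at r)" by (rule Lim_null_comparison[OF always_eventually, rotated]) (rule allI, rule \<zeta>_Holder[OF assms])
  then show "isCont (\<zeta> v) r" by (simp add: isCont_def LIM_zero_iff)
qed

lemma \<zeta>_evolution: "AE r in unit_time. \<forall>v\<in>X. \<zeta> v r = P (d r) v" using evolution by (simp add: \<zeta>_def eq_commute)

lemma \<zeta>_measurable: "v \<in> X \<Longrightarrow> \<zeta> v \<in> borel_measurable unit_time" by (rule continuous_measurable_lebesgue_on[OF \<zeta>_continuous])

lemma P_measurable: "v \<in> X \<Longrightarrow> (\<lambda>r. P (d r) v) \<in> borel_measurable unit_time" by (rule measurable_functional[where l = "\<lambda>q u. P u v" and C = "N v"])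
    (use real_functional_diff(2)[OF P_left] in auto)

lemma P_bound: "v \<in> X \<Longrightarrow> w \<in> X \<Longrightarrow> norm (P v w) \<le> N w * N v" using real_functionalD(4)[OF P_left] by blast

lemma P_integrable: assumes "v \<in> X" shows "integrable unit_time (\<lambda>r. P (d r) v)"
  by (rule past_integral_Holder(1)[OF P_measurable[OF assms], where C = "N v"])
    (use P_bound[OF d_mem assms] N_nonneg in auto)

definition Z :: "(real \<Rightarrow> complex) \<Rightarrow> real \<Rightarrow> complex" where
  "Z v y = (LINT r:past y|unit_time. P (d r) v)"

lemma Z_linearization:
  assumes v: "v \<in> X" and y: "y \<le> 1" "y' \<le> 1"
  shows "norm (Z v y' - Z v y - complex_of_real (y' - y) * \<zeta> v y) \<le> 2 * (\<Gamma> * N v * K * sqrt \<bar>y' - y\<bar>) * \<bar>y' - y\<bar>"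
proof -
  let ?E = "\<lambda>y y'. \<Gamma> * N v * K * sqrt \<bar>y' - y\<bar>"
  have E: "0 \<le> ?E y y'" for y y' using \<Gamma> N_nonneg K_nonneg by simp
  have right: "norm (Z v y' - Z v y - complex_of_real (y' - y) * \<zeta> v y) \<le> ?E y y' * (y' - y)" if y: "y \<le> y'" "y' \<le> 1" for y y'
  proof -
    interpret finite_measure unit_time by (rule finite_measure_unit_time)
    let ?A = "past y' - past y"
    have A: "?A \<in> sets unit_time" by simp
    have "Z v y' - Z v y = (LINT r:?A|unit_time. P (d r) v)"
      unfolding Z_def by (rule set_integral_past_diff[OF P_integrable[OF v] y(1)])
    also have "... = (LINT r:?A|unit_time. \<zeta> v r)"
      unfolding set_lebesgue_integral_def
    proof (rule integral_cong_AE)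
      show "AE r in unit_time. indicator ?A r *\<^sub>R P (d r) v = indicator ?A r *\<^sub>R \<zeta> v r" using \<zeta>_evolution by eventually_elim (use v in simp)
    qed (use P_measurable[OF v] \<zeta>_measurable[OF v] A in \<open>auto intro!: borel_measurable_scaleR borel_measurable_indicator\<close>)
    finally have 1: "Z v y' - Z v y = (LINT r:?A|unit_time. \<zeta> v r)" .
    have 2: "complex_of_real (y' - y) * \<zeta> v y = (LINT r:?A|unit_time. \<zeta> v y)"
    proof (cases "0 \<le> y")
      case True
      have "(LINT r:?A|unit_time. \<zeta> v y) = measure unit_time ?A *\<^sub>R \<zeta> v y" by (rule set_integral_unit_time_const[OF A])
      then show ?thesis using measure_past_diff[OF True y] by (simp add: scaleR_conv_of_real)
    next
      case False
      then show ?thesis using \<zeta>_zero[of y v] by (simp add: set_lebesgue_integral_def)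
    qed
    have i: "integrable unit_time (\<lambda>r. indicator ?A r *\<^sub>R \<zeta> v r)"
    proof -
      have "integrable unit_time (\<zeta> v)"
      proof (rule integrable_const_bound[where B = "\<Gamma> * N v * K"])
        show "AE r in unit_time. norm (\<zeta> v r) \<le> \<Gamma> * N v * K"
        proof (rule AE_I2)
          fix r assume "r \<in> space unit_time"
          then have r: "sqrt \<bar>r - 0\<bar> \<le> 1" by simp
          have "norm (\<zeta> v r - \<zeta> v 0) \<le> \<Gamma> * N v * K * sqrt \<bar>r - 0\<bar>" by (rule \<zeta>_Holder[OF v])
          also have "... \<le> \<Gamma> * N v * K * 1" using \<Gamma> N_nonneg K_nonneg by (intro mult_left_mono r) simp
          finally show "norm (\<zeta> v r) \<le> \<Gamma> * N v * K" by (simp add: \<zeta>_zero)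
        qed
      qed (rule \<zeta>_measurable[OF v])
      then show ?thesis by (rule integrable_mult_indicator[OF A])
    qed
    have "Z v y' - Z v y - complex_of_real (y' - y) * \<zeta> v y = (LINT r:?A|unit_time. \<zeta> v r - \<zeta> v y)"
      unfolding 1 2 set_lebesgue_integral_def scaleR_diff_right
      by (rule Bochner_Integration.integral_diff[symmetric, OF i]) (use A in \<open>auto intro!: integrable_mult_indicator\<close>)
    also have "norm ... \<le> ?E y y' * (y' - y)"
    proof (rule set_integral_past_diff_le)
      show "(\<lambda>r. \<zeta> v r - \<zeta> v y) \<in> borel_measurable unit_time" using \<zeta>_measurable[OF v] by simp
      fix r assume "r \<in> ?A"
      then have "y \<le> r" "r < y'" by (auto simp: past_def)
      then have "sqrt \<bar>r - y\<bar> \<le> sqrt \<bar>y' - y\<bar>" by simp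
      then have "\<Gamma> * N v * K * sqrt \<bar>r - y\<bar> \<le> ?E y y'" using \<Gamma> N_nonneg K_nonneg by (intro mult_left_mono) simp_all
      then show "norm (\<zeta> v r - \<zeta> v y) \<le> ?E y y'" using \<zeta>_Holder[OF v, of r y] by simp
    qed (rule y(1), rule E)
    finally show ?thesis .
  qed
  show ?thesis
  proof (cases "y \<le> y'")
    case True
    have "norm (Z v y' - Z v y - complex_of_real (y' - y) * \<zeta> v y) \<le> ?E y y' * (y' - y)" by (rule right[OF True y(2)])
    also have "... \<le> 2 * ?E y y' * (y' - y)"
    proof -
      have "0 \<le> ?E y y' * (y' - y)" using True by (intro mult_nonneg_nonneg[OF E]) simp
      then show ?thesis unfolding mult.assoc[of 2] by linarith
    qed
    also have "... = 2 * ?E y y' * \<bar>y' - y\<bar>" using True by simp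
    finally show ?thesis .
  next
    case False
    then have y': "y' \<le> y" by simp
    have eq: "Z v y' - Z v y - complex_of_real (y' - y) * \<zeta> v y
      = - (Z v y - Z v y' - complex_of_real (y - y') * \<zeta> v y') + complex_of_real (y - y') * (\<zeta> v y - \<zeta> v y')" by (simp add: algebra_simps)
    have "norm (- (Z v y - Z v y' - complex_of_real (y - y') * \<zeta> v y') + complex_of_real (y - y') * (\<zeta> v y - \<zeta> v y')) \<le> ?E y' y * (y - y') + (y - y') * ?E y y'"
    proof (rule order_trans[OF norm_triangle_ineq add_mono])
      show "norm (- (Z v y - Z v y' - complex_of_real (y - y') * \<zeta> v y')) \<le> ?E y' y * (y - y')"
        using right[OF y' y(1)] by (simp only: norm_minus_cancel)
      have "norm (\<zeta> v y - \<zeta> v y') \<le> ?E y y'" using \<zeta>_Holder[OF v, of y y'] by (simp only: abs_minus_commute[of y y'])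
      then show "norm (complex_of_real (y - y') * (\<zeta> v y - \<zeta> v y')) \<le> (y - y') * ?E y y'"
        using y' unfolding norm_mult norm_of_real by (intro mult_mono) simp_all
    qed
    then have "norm (Z v y' - Z v y - complex_of_real (y' - y) * \<zeta> v y) \<le> ?E y' y * (y - y') + (y - y') * ?E y y'"
      unfolding eq .
    moreover have "?E y' y * (y - y') + (y - y') * ?E y y' = 2 * ?E y y' * \<bar>y' - y\<bar>"
    proof -
      have "\<bar>y' - y\<bar> = y - y'" "\<bar>y - y'\<bar> = y - y'" using y' by simp_all
      then show ?thesis by simp
    qed
    ultimately show ?thesis by (simp only:)
  qed
qed

end

lemma norm_diff_triangle_le_sum: "norm a \<le> A \<Longrightarrow> norm b \<le> B \<Longrightarrow> norm (a - b) \<le> A + B"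
  for a b :: "'a::real_normed_vector" by (rule order_trans[OF norm_triangle_ineq4 add_mono])

text \<open>The window average of \<open>d\<close> occurs only through the functional \<open>Xw z\<close> that it represents, and its energy through \<open>Q z z\<close>, a double integral over the window. No vector-valued integral is formed; where a vector is needed, an approximate one suffices.\<close>

locale energy_window = energy +
  fixes H :: real
  assumes H: "0 < H" "H \<le> 1"
begin

definition win :: "real \<Rightarrow> real set" where "win z = past z - past (z - H)"

lemma win_sets [simp]: "win z \<in> sets unit_time" by (simp add: win_def)

lemma win_integral:
  fixes f :: "real \<Rightarrow> 'a::{banach, second_countable_topology}"
  assumes "integrable unit_time f"
  shows "(LINT q:win z|unit_time. f q) = (LINT q:past z|unit_time. f q) - (LINT q:past (z - H)|unit_time. f q)"
  unfolding win_def using set_integral_past_diff[OF assms, of "z - H" z] H by simp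

definition Xw :: "real \<Rightarrow> (real \<Rightarrow> complex) \<Rightarrow> complex" where
  "Xw z v = (LINT r:win z|unit_time. P (d r) v)"

definition lw :: "real \<Rightarrow> (real \<Rightarrow> complex) \<Rightarrow> complex" where
  "lw z v = (LINT q:win z|unit_time. B q (d q) v)"

definition Q :: "real \<Rightarrow> real \<Rightarrow> complex" where
  "Q z y = (LINT s:win y|unit_time. Xw z (d s))"

definition bet :: "real \<Rightarrow> real \<Rightarrow> complex" where
  "bet z y = (LINT s:win y|unit_time. lw z (d s))"

lemma P_form: "time_form X N d s (\<lambda>_. P) 1"
proof unfold_locales
  show "0 \<le> (1::real)" by simp
qed (use P_left P_right in auto)

lemma win_mass: "(LINT q:win z|unit_time. N (d q)) \<le> mass"
  unfolding mass_def by (rule set_integral_unit_time_le[OF N_integrable N_nonneg win_sets])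

lemma win_mass_nonneg: "0 \<le> (LINT q:win z|unit_time. N (d q))"
  unfolding set_lebesgue_integral_def by (rule integral_nonneg_AE) (auto simp: N_nonneg)

lemma Xw_functional: "real_functional (Xw z) mass"
proof (rule real_functional_weaken)
  show "real_functional (Xw z) (1 * (LINT q:win z|unit_time. N (d q)))"
    unfolding Xw_def[abs_def] by (rule time_form.integral_real_functional[OF P_form win_sets])
qed (use win_mass in simp)

lemma lw_functional: "real_functional (lw z) (\<Gamma> * mass)"
proof (rule real_functional_weaken)
  show "real_functional (lw z) (\<Gamma> * (LINT q:win z|unit_time. N (d q)))"
    unfolding lw_def[abs_def] by (rule integral_real_functional[OF win_sets])
qed (use win_mass \<Gamma> in \<open>simp add: mult_left_mono\<close>)

lemma functional_measurable: assumes "real_functional l C" shows "(\<lambda>s. l (d s)) \<in> borel_measurable unit_time"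
  by (rule measurable_functional[where l = "\<lambda>_. l" and C = C]) (use real_functional_diff(2)[OF assms] in auto)

lemma functional_integrable: assumes "real_functional l C" shows "integrable unit_time (\<lambda>s. l (d s))"
  by (rule past_integral_Holder(1)[OF functional_measurable[OF assms], where C = C])
    (use real_functionalD[OF assms] d_mem in auto)

lemma lw_eq: assumes "v \<in> X" shows "\<zeta> v z - \<zeta> v (z - H) = - lw z v"
proof -
  have "integrable unit_time (\<lambda>q. B q (d q) v)" using Bd_integrable[OF assms, of "{0<..<1}"]
    by (rule Bochner_Integration.integrable_cong[THEN iffD1, OF refl, rotated]) (auto simp: indicator_def)
  from win_integral[OF this] show ?thesis by (simp add: \<zeta>_def lw_def)
qed

lemma Xw_eq: "v \<in> X \<Longrightarrow> Xw z v = Z v z - Z v (z - H)"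
  unfolding Xw_def Z_def by (rule win_integral[OF P_integrable])

lemma Xw_linearization:
  assumes v: "v \<in> X" and z: "z \<le> 1" "z' \<le> 1"
  shows "norm (Xw z' v - Xw z v + complex_of_real (z' - z) * lw z v) \<le> 4 * (\<Gamma> * K * sqrt \<bar>z' - z\<bar>) * \<bar>z' - z\<bar> * N v"
proof -
  have lw: "lw z v = \<zeta> v (z - H) - \<zeta> v z" using lw_eq[OF v, of z] by (simp add: algebra_simps)
  have shift: "(z' - H) - (z - H) = z' - z" by simp
  have eq: "Xw z' v - Xw z v + complex_of_real (z' - z) * lw z v
    = (Z v z' - Z v z - complex_of_real (z' - z) * \<zeta> v z)
     - (Z v (z' - H) - Z v (z - H) - complex_of_real (z' - z) * \<zeta> v (z - H))"
    unfolding lw Xw_eq[OF v] by (simp add: algebra_simps)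
  have "norm (Z v z' - Z v z - complex_of_real (z' - z) * \<zeta> v z) \<le> 2 * (\<Gamma> * N v * K * sqrt \<bar>z' - z\<bar>) * \<bar>z' - z\<bar>" by (rule Z_linearization[OF v z])
  moreover have "norm (Z v (z' - H) - Z v (z - H) - complex_of_real (z' - z) * \<zeta> v (z - H)) \<le> 2 * (\<Gamma> * N v * K * sqrt \<bar>z' - z\<bar>) * \<bar>z' - z\<bar>"
    using Z_linearization[OF v, of "z - H" "z' - H"] z H unfolding shift by simp
  ultimately have "norm (Xw z' v - Xw z v + complex_of_real (z' - z) * lw z v)
     \<le> 2 * (\<Gamma> * N v * K * sqrt \<bar>z' - z\<bar>) * \<bar>z' - z\<bar> + 2 * (\<Gamma> * N v * K * sqrt \<bar>z' - z\<bar>) * \<bar>z' - z\<bar>"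
    unfolding eq by (rule norm_diff_triangle_le_sum)
  moreover have "2 * (\<Gamma> * N v * K * sqrt \<bar>z' - z\<bar>) * \<bar>z' - z\<bar> + 2 * (\<Gamma> * N v * K * sqrt \<bar>z' - z\<bar>) * \<bar>z' - z\<bar>
     = 4 * (\<Gamma> * K * sqrt \<bar>z' - z\<bar>) * \<bar>z' - z\<bar> * N v" by simp
  ultimately show ?thesis by (simp only:)
qed

lemma Q_approximation:
  assumes \<delta>: "0 < \<delta>"
  obtains y y' where "y \<in> X" "y' \<in> X" "norm (Q z z' - P y y') \<le> (2 * mass + \<delta>) * \<delta>"
    "norm (Q z' z - P y' y) \<le> (2 * mass + \<delta>) * \<delta>"
    "norm (Q z z - P y y) \<le> (2 * mass + \<delta>) * \<delta>"
    "\<And>v. v \<in> X \<Longrightarrow> norm (Xw z v - P y v) \<le> N v * \<delta>"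
proof -
  obtain y where y: "y \<in> X" "N y \<le> mass + \<delta>"
    "\<And>l \<Gamma>. real_functional l \<Gamma> \<Longrightarrow> norm ((LINT t:win z|unit_time. l (d t)) - l y) \<le> \<Gamma> * \<delta>" using approximate_integral[OF win_sets \<delta>] by metis
  obtain y' where y': "y' \<in> X" "N y' \<le> mass + \<delta>"
    "\<And>l \<Gamma>. real_functional l \<Gamma> \<Longrightarrow> norm ((LINT t:win z'|unit_time. l (d t)) - l y') \<le> \<Gamma> * \<delta>" using approximate_integral[OF win_sets \<delta>] by metis
  note ff = time_form.fixed_form_approximation[OF P_form refl win_sets _ _ _ _ _ _ \<delta>]
  show ?thesis
  proof (rule that[OF y(1) y'(1)])
    show "norm (Q z z' - P y y') \<le> (2 * mass + \<delta>) * \<delta>" using ff[OF y y'(1,3,2)] by (simp add: Q_def Xw_def[abs_def])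
    show "norm (Q z' z - P y' y) \<le> (2 * mass + \<delta>) * \<delta>" using ff[OF y' y(1,3,2)] by (simp add: Q_def Xw_def[abs_def])
    show "norm (Q z z - P y y) \<le> (2 * mass + \<delta>) * \<delta>" using ff[OF y y(1,3,2)] by (simp add: Q_def Xw_def[abs_def])
    show "norm (Xw z v - P y v) \<le> N v * \<delta>" if "v \<in> X" for v
      unfolding Xw_def by (rule y(3)[OF P_left[OF that]])
  qed
qed

lemma small_error_limit: "((\<lambda>\<delta>. (2 * mass + \<delta>) * \<delta>) \<longlongrightarrow> 0) (at_right 0)"
proof -
  have "((\<lambda>\<delta>. (2 * mass + \<delta>) * \<delta>) \<longlongrightarrow> (2 * mass + 0) * 0) (at_right 0)" by (intro tendsto_intros)
  then show ?thesis by simp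
qed

lemma Q_hermitian: "Q z z' = cnj (Q z' z)"
proof -
  have "norm (Q z z' - cnj (Q z' z)) \<le> 2 * ((2 * mass + \<delta>) * \<delta>)" if \<delta>: "0 < \<delta>" for \<delta>
  proof -
    obtain y y' where y: "norm (Q z z' - P y y') \<le> (2 * mass + \<delta>) * \<delta>"
      "norm (Q z' z - P y' y) \<le> (2 * mass + \<delta>) * \<delta>" using Q_approximation[OF \<delta>] by metis
    have eq: "Q z z' - cnj (Q z' z) = (Q z z' - P y y') - cnj (Q z' z - P y' y)" by (simp add: P_hermitian)
    have "norm (Q z z' - cnj (Q z' z)) \<le> (2 * mass + \<delta>) * \<delta> + (2 * mass + \<delta>) * \<delta>"
      unfolding eq by (rule norm_diff_triangle_le_sum) (use y in \<open>simp_all only: complex_mod_cnj\<close>)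
    then show ?thesis by (simp only: mult_2)
  qed
  then have "eventually (\<lambda>\<delta>. norm (Q z z' - cnj (Q z' z)) \<le> 2 * ((2 * mass + \<delta>) * \<delta>)) (at_right 0)"
    by (intro eventually_at_right_less[THEN eventually_mono]) auto
  moreover have "((\<lambda>\<delta>. 2 * ((2 * mass + \<delta>) * \<delta>)) \<longlongrightarrow> 2 * 0) (at_right 0)" by (intro tendsto_mult tendsto_const small_error_limit)
  ultimately have "norm (Q z z' - cnj (Q z' z)) \<le> 2 * 0" by (intro tendsto_lowerbound) auto
  then show ?thesis by simp
qed

text \<open>Cauchy--Schwarz for the vector that represents \<open>Xw z\<close>, obtained in the limit from the approximate representatives.\<close>

lemma Xw_le: assumes v: "v \<in> X" shows "norm (Xw z v) \<le> sqrt (Re (Q z z)) * N v"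
proof -
  let ?e = "\<lambda>\<delta>. (2 * mass + \<delta>) * \<delta>"
  have le: "norm (Xw z v) \<le> sqrt (Re (Q z z) + ?e \<delta>) * N v + N v * \<delta>" if \<delta>: "0 < \<delta>" for \<delta>
  proof -
    obtain y where y: "y \<in> X" "norm (Q z z - P y y) \<le> ?e \<delta>" "norm (Xw z v - P y v) \<le> N v * \<delta>" using Q_approximation[OF \<delta>, of z z] v by metis
    have "Re (P y y) \<le> Re (Q z z) + ?e \<delta>" using abs_Re_le_cmod[of "Q z z - P y y"] y(2) by (simp add: abs_if split: if_splits)
    then have "norm (P y v) \<le> sqrt (Re (Q z z) + ?e \<delta>) * N v"
      using P_Cauchy_Schwarz[OF y(1) v] N_nonneg[of v] by (meson mult_right_mono order_trans real_sqrt_le_iff)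
    moreover have "norm (Xw z v) \<le> norm (P y v) + norm (Xw z v - P y v)" using norm_triangle_ineq[of "P y v" "Xw z v - P y v"] by simp
    ultimately show ?thesis using y(3) by linarith
  qed
  have "((\<lambda>\<delta>. sqrt (Re (Q z z) + ?e \<delta>) * N v + N v * \<delta>) \<longlongrightarrow> sqrt (Re (Q z z) + 0) * N v + N v * 0) (at_right 0)"
    by (intro tendsto_add tendsto_mult tendsto_const tendsto_real_sqrt small_error_limit tendsto_ident_at)
  moreover have "eventually (\<lambda>\<delta>. norm (Xw z v) \<le> sqrt (Re (Q z z) + ?e \<delta>) * N v + N v * \<delta>) (at_right 0)"
    by (intro eventually_at_right_less[THEN eventually_mono] le)
  ultimately have "norm (Xw z v) \<le> sqrt (Re (Q z z) + 0) * N v + N v * 0" by (intro tendsto_lowerbound) auto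
  then show ?thesis by simp
qed

text \<open>The energy of a window dissipates, up to the error of freezing the coefficient inside it.\<close>

lemma bet_lower_bound:
  assumes z: "z \<in> {0<..<1}"
  shows "- Re (bet z z) \<le> Ca * sqrt H * (LINT q:win z|unit_time. N (d q))\<^sup>2"
proof -
  let ?m = "LINT q:win z|unit_time. N (d q)"
  have Bz: "time_form X N d s (\<lambda>_. B z) \<Gamma>"
  proof unfold_locales
    show "0 \<le> \<Gamma>" by (rule \<Gamma>)
  qed (use B_left[OF z] B_right[OF z] in auto)
  interpret Bz: time_form X N d s "\<lambda>_. B z" \<Gamma> by (rule Bz)
  define l where "l v = (LINT q:win z|unit_time. B z (d q) v)" for v
  have l_fun: "real_functional l (\<Gamma> * ?m)" unfolding l_def[abs_def] by (rule Bz.integral_real_functional[OF win_sets])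
  have diff: "norm (lw z v - l v) \<le> Ca * sqrt H * N v * ?m" if v: "v \<in> X" for v
  proof -
    have i: "integrable unit_time (\<lambda>q. indicator (win z) q *\<^sub>R N (d q))" by (rule integrable_mult_indicator[OF win_sets N_integrable])
    have eq: "lw z v - l v = (\<integral>q. indicator (win z) q *\<^sub>R B q (d q) v - indicator (win z) q *\<^sub>R B z (d q) v \<partial>unit_time)"
      unfolding lw_def l_def set_lebesgue_integral_def
      by (rule Bochner_Integration.integral_diff[symmetric, OF Bd_integrable[OF v win_sets] Bz.Bd_integrable[OF v win_sets]])
    have "norm (lw z v - l v) \<le> (\<integral>q. Ca * sqrt H * N v * (indicator (win z) q *\<^sub>R N (d q)) \<partial>unit_time)"
      unfolding eq
    proof (rule Bochner_Integration.integral_norm_bound_integral)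
      show "integrable unit_time (\<lambda>q. indicator (win z) q *\<^sub>R B q (d q) v - indicator (win z) q *\<^sub>R B z (d q) v)"
        by (rule Bochner_Integration.integrable_diff[OF Bd_integrable[OF v win_sets] Bz.Bd_integrable[OF v win_sets]])
      show "integrable unit_time (\<lambda>q. Ca * sqrt H * N v * (indicator (win z) q *\<^sub>R N (d q)))" using i by simp
      fix q
      show "norm (indicator (win z) q *\<^sub>R B q (d q) v - indicator (win z) q *\<^sub>R B z (d q) v) \<le> Ca * sqrt H * N v * (indicator (win z) q *\<^sub>R N (d q))"
      proof (cases "q \<in> win z")
        case True
        then have q: "q \<in> {0<..<1}" "\<bar>q - z\<bar> \<le> H" by (auto simp: win_def past_def)
        have "norm (B q (d q) v - B z (d q) v) \<le> Ca * sqrt \<bar>q - z\<bar> * N (d q) * N v" by (rule B_Holder[OF z q(1) d_mem v])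
        also have "... \<le> Ca * sqrt H * N (d q) * N v" using q(2) Ca N_nonneg by (intro mult_right_mono mult_left_mono) simp_all
        finally show ?thesis using True by (simp add: mult_ac)
      qed simp
    qed
    also have "... = Ca * sqrt H * N v * ?m" by (simp add: set_lebesgue_integral_def)
    finally show ?thesis .
  qed
  have pos: "0 \<le> Re (LINT s:win z|unit_time. l (d s))"
  proof -
    let ?e = "\<lambda>\<delta>. \<Gamma> * ((2 * mass + \<delta>) * \<delta>)"
    have "- ?e \<delta> \<le> Re (LINT s:win z|unit_time. l (d s))" if \<delta>: "0 < \<delta>" for \<delta>
    proof -
      obtain y where y: "y \<in> X" "N y \<le> mass + \<delta>"
        "\<And>l \<Gamma>. real_functional l \<Gamma> \<Longrightarrow> norm ((LINT t:win z|unit_time. l (d t)) - l y) \<le> \<Gamma> * \<delta>" using approximate_integral[OF win_sets \<delta>] by metis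
      have "norm ((LINT s:win z|unit_time. l (d s)) - B z y y) \<le> \<Gamma> * (2 * mass + \<delta>) * \<delta>"
        unfolding l_def[abs_def] by (rule Bz.fixed_form_approximation[OF refl win_sets y y(1,3,2) \<delta>])
      then have "\<bar>Re ((LINT s:win z|unit_time. l (d s)) - B z y y)\<bar> \<le> ?e \<delta>" using abs_Re_le_cmod order_trans by (metis mult.assoc)
      then show ?thesis using B_pos[OF z y(1)] by simp
    qed
    then have "eventually (\<lambda>\<delta>. - ?e \<delta> \<le> Re (LINT s:win z|unit_time. l (d s))) (at_right 0)" by (intro eventually_at_right_less[THEN eventually_mono])
    moreover have "((\<lambda>\<delta>. - ?e \<delta>) \<longlongrightarrow> - (\<Gamma> * 0)) (at_right 0)" by (intro tendsto_minus tendsto_mult tendsto_const small_error_limit)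
    ultimately have "- (\<Gamma> * 0) \<le> Re (LINT s:win z|unit_time. l (d s))" by (intro tendsto_upperbound) auto
    then show ?thesis by simp
  qed
  have i1: "integrable unit_time (\<lambda>s. indicator (win z) s *\<^sub>R lw z (d s))" "integrable unit_time (\<lambda>s. indicator (win z) s *\<^sub>R l (d s))"
    by (rule integrable_mult_indicator[OF win_sets functional_integrable[OF lw_functional]])
      (rule integrable_mult_indicator[OF win_sets functional_integrable[OF l_fun]])
  have eq: "bet z z - (LINT s:win z|unit_time. l (d s)) = (\<integral>s. indicator (win z) s *\<^sub>R lw z (d s) - indicator (win z) s *\<^sub>R l (d s) \<partial>unit_time)"
    unfolding bet_def set_lebesgue_integral_def by (rule Bochner_Integration.integral_diff[symmetric, OF i1])
  have "norm (bet z z - (LINT s:win z|unit_time. l (d s))) \<le> (\<integral>s. Ca * sqrt H * ?m * (indicator (win z) s *\<^sub>R N (d s)) \<partial>unit_time)"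
    unfolding eq
  proof (rule Bochner_Integration.integral_norm_bound_integral)
    show "integrable unit_time (\<lambda>s. Ca * sqrt H * ?m * (indicator (win z) s *\<^sub>R N (d s)))"
      using integrable_mult_indicator[OF win_sets N_integrable] by simp
    show "norm (indicator (win z) s *\<^sub>R lw z (d s) - indicator (win z) s *\<^sub>R l (d s)) \<le> Ca * sqrt H * ?m * (indicator (win z) s *\<^sub>R N (d s))" for s
      using diff[OF d_mem, of s] by (auto simp: indicator_def mult_ac)
  qed (rule Bochner_Integration.integrable_diff[OF i1])
  also have "... = Ca * sqrt H * ?m\<^sup>2" by (simp add: set_lebesgue_integral_def power2_eq_square)
  finally have "\<bar>Re (bet z z - (LINT s:win z|unit_time. l (d s)))\<bar> \<le> Ca * sqrt H * ?m\<^sup>2" using abs_Re_le_cmod order_trans by blast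
  then show ?thesis using pos by simp
qed

lemma Q_linearization:
  assumes z: "z \<le> 1" "z' \<le> 1"
  shows "norm (Q z' y - Q z y + complex_of_real (z' - z) * bet z y) \<le> 4 * (\<Gamma> * K * sqrt \<bar>z' - z\<bar>) * \<bar>z' - z\<bar> * mass"
proof -
  note i = integrable_mult_indicator[OF win_sets functional_integrable[OF Xw_functional]]
    integrable_mult_indicator[OF win_sets functional_integrable[OF lw_functional]]
  have eq: "Q z' y - Q z y + complex_of_real (z' - z) * bet z y
    = (\<integral>s. (indicator (win y) s *\<^sub>R Xw z' (d s) - indicator (win y) s *\<^sub>R Xw z (d s))
        + complex_of_real (z' - z) * (indicator (win y) s *\<^sub>R lw z (d s)) \<partial>unit_time)"
    unfolding Q_def bet_def set_lebesgue_integral_def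
    by (subst Bochner_Integration.integral_add Bochner_Integration.integral_diff integral_mult_right_zero;
        (intro Bochner_Integration.integrable_diff integrable_mult_right i)?)+ simp
  have "norm (Q z' y - Q z y + complex_of_real (z' - z) * bet z y) \<le> (\<integral>s. 4 * (\<Gamma> * K * sqrt \<bar>z' - z\<bar>) * \<bar>z' - z\<bar> * N (d s) \<partial>unit_time)"
    unfolding eq
  proof (rule Bochner_Integration.integral_norm_bound_integral)
    show "integrable unit_time (\<lambda>s. (indicator (win y) s *\<^sub>R Xw z' (d s) - indicator (win y) s *\<^sub>R Xw z (d s))
        + complex_of_real (z' - z) * (indicator (win y) s *\<^sub>R lw z (d s)))"
      by (intro Bochner_Integration.integrable_add Bochner_Integration.integrable_diff integrable_mult_right i)
    show "integrable unit_time (\<lambda>s. 4 * (\<Gamma> * K * sqrt \<bar>z' - z\<bar>) * \<bar>z' - z\<bar> * N (d s))" using N_integrable by simp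
    show "norm ((indicator (win y) s *\<^sub>R Xw z' (d s) - indicator (win y) s *\<^sub>R Xw z (d s))
        + complex_of_real (z' - z) * (indicator (win y) s *\<^sub>R lw z (d s))) \<le> 4 * (\<Gamma> * K * sqrt \<bar>z' - z\<bar>) * \<bar>z' - z\<bar> * N (d s)" for s
    proof (cases "s \<in> win y")
      case True
      then show ?thesis using Xw_linearization[OF d_mem z, of s] by simp
    next
      case False
      then show ?thesis using \<Gamma> K_nonneg N_nonneg by simp
    qed
  qed
  also have "... = 4 * (\<Gamma> * K * sqrt \<bar>z' - z\<bar>) * \<bar>z' - z\<bar> * mass" by (simp add: mass_def)
  finally show ?thesis .
qed

lemma bet_Holder: "norm (bet z y - bet z y') \<le> 2 * (\<Gamma> * mass * K * sqrt \<bar>y - y'\<bar>)"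
proof -
  let ?I = "\<lambda>y. LINT s:past y|unit_time. lw z (d s)"
  have h: "norm (?I y - ?I y') \<le> \<Gamma> * mass * K * sqrt \<bar>y - y'\<bar>" for y y' by (rule past_integral_Holder(2)[OF functional_measurable[OF lw_functional]])
      (use real_functionalD[OF lw_functional] d_mem in auto)
  have eq: "bet z y - bet z y' = (?I y - ?I y') - (?I (y - H) - ?I (y' - H))"
    unfolding bet_def win_integral[OF functional_integrable[OF lw_functional]] by simp
  have "norm (bet z y - bet z y') \<le> \<Gamma> * mass * K * sqrt \<bar>y - y'\<bar> + \<Gamma> * mass * K * sqrt \<bar>(y - H) - (y' - H)\<bar>"
    unfolding eq by (rule norm_diff_triangle_le_sum[OF h h])
  moreover have "(y - H) - (y' - H) = y - y'" by simp
  ultimately have "norm (bet z y - bet z y') \<le> \<Gamma> * mass * K * sqrt \<bar>y - y'\<bar> + \<Gamma> * mass * K * sqrt \<bar>y - y'\<bar>" by metis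
  then show ?thesis by linarith
qed

text \<open>Moving both ends of the window changes each of the two slots of \<open>Q\<close>; by hermitian symmetry both contribute the same real part.\<close>

lemma energy_derivative:
  assumes z: "z < 1"
  shows "((\<lambda>z. Re (Q z z)) has_real_derivative - 2 * Re (bet z z)) (at z)"
proof -
  define C where "C = 10 * \<Gamma> * K * mass"
  have le: "\<bar>Re (Q z' z') - Re (Q z z) + 2 * (z' - z) * Re (bet z z)\<bar> \<le> C * sqrt \<bar>z' - z\<bar> * \<bar>z' - z\<bar>" if z': "z' < 1" for z'
  proof -
    let ?e = "4 * (\<Gamma> * K * sqrt \<bar>z' - z\<bar>) * \<bar>z' - z\<bar> * mass"
    have "Re (Q z z') = Re (Q z' z)" using Q_hermitian[of z z'] by simp
    then have eq: "Re (Q z' z') - Re (Q z z) + 2 * (z' - z) * Re (bet z z)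
      = Re (Q z' z' - Q z z' + complex_of_real (z' - z) * bet z z')
       + Re (Q z' z - Q z z + complex_of_real (z' - z) * bet z z)
       - (z' - z) * Re (bet z z' - bet z z)" by (simp add: algebra_simps)
    have "\<bar>Re (Q z' z') - Re (Q z z) + 2 * (z' - z) * Re (bet z z)\<bar> \<le> ?e + ?e + \<bar>z' - z\<bar> * (2 * (\<Gamma> * mass * K * sqrt \<bar>z' - z\<bar>))"
    proof -
      have 1: "\<bar>Re (Q z' y - Q z y + complex_of_real (z' - z) * bet z y)\<bar> \<le> ?e" for y
        using abs_Re_le_cmod Q_linearization[of z z' y] z z' order_trans less_imp_le by blast
      have "\<bar>Re (bet z z' - bet z z)\<bar> \<le> 2 * (\<Gamma> * mass * K * sqrt \<bar>z' - z\<bar>)" using abs_Re_le_cmod bet_Holder order_trans by blast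
      then have "\<bar>(z' - z) * Re (bet z z' - bet z z)\<bar> \<le> \<bar>z' - z\<bar> * (2 * (\<Gamma> * mass * K * sqrt \<bar>z' - z\<bar>))"
        unfolding abs_mult by (rule mult_left_mono) simp
      with 1[of z'] 1[of z] show ?thesis unfolding eq by linarith
    qed
    also have "... = C * sqrt \<bar>z' - z\<bar> * \<bar>z' - z\<bar>" by (simp add: C_def algebra_simps)
    finally show ?thesis .
  qed
  have "((\<lambda>z'. (Re (Q z' z') - Re (Q z z)) / (z' - z) - (- 2 * Re (bet z z))) \<longlongrightarrow> 0) (at z)"
  proof (rule Lim_null_comparison)
    have "((\<lambda>z'. C * sqrt \<bar>z' - z\<bar>) \<longlongrightarrow> C * sqrt \<bar>z - z\<bar>) (at z)" by (intro tendsto_intros)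
    then show "((\<lambda>z'. C * sqrt \<bar>z' - z\<bar>) \<longlongrightarrow> 0) (at z)" by simp
    have "eventually (\<lambda>z'. z' < 1 \<and> z' \<noteq> z) (at z)"
      using z by (auto intro: eventually_conj eventually_neq_at_within order_tendstoD[OF tendsto_ident_at])
    then show "eventually (\<lambda>z'. norm ((Re (Q z' z') - Re (Q z z)) / (z' - z) - (- 2 * Re (bet z z))) \<le> C * sqrt \<bar>z' - z\<bar>) (at z)"
    proof eventually_elim
      case (elim z')
      have "(Re (Q z' z') - Re (Q z z)) / (z' - z) - (- 2 * Re (bet z z)) = (Re (Q z' z') - Re (Q z z) + 2 * (z' - z) * Re (bet z z)) / (z' - z)"
        using elim by (simp add: field_simps)
      then show ?case using le[of z'] elim by (simp add: divide_le_eq)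
    qed
  qed
  then show ?thesis unfolding has_field_derivative_iff by (rule LIM_zero_cancel)
qed

lemma window_mass_square: "(LINT q:win z|unit_time. N (d q))\<^sup>2 \<le> H * ((LINT q:past z|unit_time. (N (d q))\<^sup>2) - (LINT q:past (z - H)|unit_time. (N (d q))\<^sup>2))"
proof -
  let ?D = "LINT q:win z|unit_time. (N (d q))\<^sup>2"
  have D: "0 \<le> ?D" unfolding set_lebesgue_integral_def by (rule integral_nonneg_AE) simp
  have "measure unit_time (win z) \<le> H" using measure_past_diff_le[of "z - H" z] H by (simp add: win_def)
  then have "(LINT q:win z|unit_time. N (d q)) \<le> sqrt H * sqrt ?D"
    using set_mass_square[OF win_sets, of z] D by (meson mult_right_mono order_trans real_sqrt_le_iff real_sqrt_ge_zero)
  then have "(LINT q:win z|unit_time. N (d q))\<^sup>2 \<le> (sqrt H * sqrt ?D)\<^sup>2" using win_mass_nonneg by (rule power_mono)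
  also have "... = H * ?D" using H D by (simp add: power_mult_distrib)
  finally show ?thesis using win_integral[OF N_square_integrable, of z] by simp
qed

text \<open>The derivative is bounded by a multiple of the mass of \<open>(N d)\<^sup>2\<close> in the window. Integrating over the position of the window covers each time at most for a length \<open>H\<close>, which is the second factor \<open>H\<close>.\<close>

lemma energy_bound:
  assumes z: "z \<in> {0<..<1}" shows "Re (Q z z) \<le> 2 * Ca * sqrt H * H * (H * K\<^sup>2)"
proof -
  define \<nu> where "\<nu> y = (LINT q:past y|unit_time. (N (d q))\<^sup>2)" for y
  have \<nu>_cont: "continuous_on S \<nu>" for S
    unfolding \<nu>_def[abs_def] by (rule set_integral_past_continuous[OF N_square_integrable])
  have \<nu>0: "\<nu> y = 0" if "y \<le> 0" for y using that by (simp add: \<nu>_def past_empty set_lebesgue_integral_def)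
  have \<nu>K: "\<nu> y \<le> K\<^sup>2" for y
    unfolding \<nu>_def K_square by (rule set_integral_unit_time_le[OF N_square_integrable]) auto
  define J where "J y = integral {-2..y} \<nu>" for y
  have J': "(J has_real_derivative \<nu> y) (at y)" if "y \<in> {-2<..<2}" for y
  proof -
    have "((\<lambda>u. integral {-2..u} \<nu>) has_real_derivative \<nu> y) (at y within {-2..2})"
      by (rule integral_has_real_derivative[OF \<nu>_cont]) (use that in auto)
    then show ?thesis using that unfolding J_def[abs_def] by (simp add: at_within_Icc_at)
  qed
  define C where "C = 2 * Ca * sqrt H * H"
  have C: "0 \<le> C" using Ca H by (simp add: C_def)
  define g where "g y = Re (Q y y) - C * (J y - J (y - H))" for y
  have g': "\<exists>D. (g has_real_derivative D) (at y) \<and> D \<le> 0" if y: "y \<in> {0<..<1}" for y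
  proof -
    have "((\<lambda>y. J (y - H)) has_real_derivative \<nu> (y - H) * 1) (at y)" by (rule DERIV_chain2[OF J']) (use y H in \<open>auto intro!: derivative_eq_intros\<close>)
    then have "(g has_real_derivative - 2 * Re (bet y y) - C * (\<nu> y - \<nu> (y - H))) (at y)"
      unfolding g_def[abs_def] using y by (intro DERIV_diff DERIV_cmult energy_derivative J') auto
    moreover have "- 2 * Re (bet y y) - C * (\<nu> y - \<nu> (y - H)) \<le> 0"
    proof -
      have "- Re (bet y y) \<le> Ca * sqrt H * (LINT q:win y|unit_time. N (d q))\<^sup>2" by (rule bet_lower_bound[OF y])
      also have "... \<le> Ca * sqrt H * (H * (\<nu> y - \<nu> (y - H)))"
        unfolding \<nu>_def using window_mass_square Ca H by (intro mult_left_mono) auto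
      finally show ?thesis by (simp add: C_def algebra_simps)
    qed
    ultimately show ?thesis by blast
  qed
  have "g z \<le> g 0"
  proof (rule DERIV_nonpos_imp_decreasing_open[where f = g and a = 0 and b = z])
    show "\<exists>D. (g has_real_derivative D) (at x) \<and> D \<le> 0" if "0 < x" "x < z" for x using g'[of x] that z by auto
    have "isCont g x" if "x \<in> {0..z}" for x
    proof -
      have "((\<lambda>y. J (y - H)) has_real_derivative \<nu> (x - H) * 1) (at x)"
        by (rule DERIV_chain2[OF J']) (use that z H in \<open>auto intro!: derivative_eq_intros\<close>)
      then have "(g has_real_derivative - 2 * Re (bet x x) - C * (\<nu> x - \<nu> (x - H))) (at x)"
        unfolding g_def[abs_def] using that z by (intro DERIV_diff DERIV_cmult energy_derivative J') auto
      then show ?thesis by (rule DERIV_isCont)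
    qed
    then show "continuous_on {0..z} g" by (intro continuous_at_imp_continuous_on ballI)
  qed (use z in auto)
  moreover have "g 0 \<le> 0"
  proof -
    have "win 0 = {}" using past_empty[of 0] by (simp add: win_def)
    then have "Q 0 0 = 0" by (simp add: Q_def set_lebesgue_integral_def)
    moreover have "J 0 - J (0 - H) = 0"
    proof -
      have "J y = 0" if "y \<le> 0" for y
      proof -
        have "integral {-2..y} \<nu> = integral {-2..y} (\<lambda>_. 0)" by (rule Henstock_Kurzweil_Integration.integral_cong) (use \<nu>0 that in auto)
        then show ?thesis by (simp add: J_def)
      qed
      then show ?thesis using H by simp
    qed
    ultimately show ?thesis by (simp add: g_def)
  qed
  ultimately have "Re (Q z z) \<le> C * (J z - J (z - H))" by (simp add: g_def)
  also have "... \<le> C * (H * K\<^sup>2)"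
  proof (rule mult_left_mono[OF _ C])
    have i: "\<nu> integrable_on {a..b}" for a b by (rule integrable_continuous_real[OF \<nu>_cont])
    have "J z - J (z - H) = integral {z - H..z} \<nu>"
      using Henstock_Kurzweil_Integration.integral_combine[of "-2" "z - H" z \<nu>] i z H by (simp add: J_def)
    also have "... \<le> integral {z - H..z} (\<lambda>_. K\<^sup>2)" by (rule integral_le[OF i]) (use \<nu>K in auto)
    also have "... = H * K\<^sup>2" using H by simp
    finally show "J z - J (z - H) \<le> H * K\<^sup>2" .
  qed
  finally show ?thesis by (simp add: C_def)
qed

text \<open>By its Hoelder continuity, \<open>\<zeta>\<close> differs from its average over the window, which is controlled by the energy, by a term of order \<open>\<surd>H\<close>.\<close>

lemma \<zeta>_bound:
  assumes z: "z \<in> {0<..<1}" and v: "v \<in> X"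
  shows "norm (\<zeta> v z) \<le> N v * (sqrt (2 * Ca * sqrt H) * K + 2 * \<Gamma> * K * sqrt H)"
proof -
  have Hz: "\<bar>(z - H) - z\<bar> = H" using H by simp
  have "norm (Xw z v - complex_of_real H * \<zeta> v z) \<le> 2 * (\<Gamma> * N v * K * sqrt H) * H"
  proof -
    have "norm (Z v (z - H) - Z v z - complex_of_real ((z - H) - z) * \<zeta> v z) \<le> 2 * (\<Gamma> * N v * K * sqrt \<bar>(z - H) - z\<bar>) * \<bar>(z - H) - z\<bar>"
      by (rule Z_linearization[OF v]) (use z H in auto)
    moreover have "Xw z v - complex_of_real H * \<zeta> v z = - (Z v (z - H) - Z v z - complex_of_real ((z - H) - z) * \<zeta> v z)" by (simp add: Xw_eq[OF v])
    ultimately show ?thesis unfolding Hz by (simp only: norm_minus_cancel)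
  qed
  moreover have "norm (Xw z v) \<le> (H * (sqrt (2 * Ca * sqrt H) * K)) * N v"
  proof -
    have "norm (Xw z v) \<le> sqrt (Re (Q z z)) * N v" by (rule Xw_le[OF v])
    also have "... \<le> sqrt (2 * Ca * sqrt H * H * (H * K\<^sup>2)) * N v" using energy_bound[OF z] N_nonneg by (intro mult_right_mono) simp_all
    also have "2 * Ca * sqrt H * H * (H * K\<^sup>2) = (2 * Ca * sqrt H) * (H * K)\<^sup>2" by (simp add: power_mult_distrib power2_eq_square)
    also have "sqrt ... = sqrt (2 * Ca * sqrt H) * (H * K)"
      unfolding real_sqrt_mult using H K_nonneg by simp
    finally show ?thesis by (simp add: mult_ac)
  qed
  moreover have "norm (complex_of_real H * \<zeta> v z) \<le> norm (Xw z v) + norm (Xw z v - complex_of_real H * \<zeta> v z)"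
    using norm_triangle_ineq4[of "Xw z v" "Xw z v - complex_of_real H * \<zeta> v z"] by simp
  ultimately have "H * norm (\<zeta> v z) \<le> (H * (sqrt (2 * Ca * sqrt H) * K)) * N v + 2 * (\<Gamma> * N v * K * sqrt H) * H" using H by (simp add: norm_mult)
  also have "... = H * (N v * (sqrt (2 * Ca * sqrt H) * K + 2 * \<Gamma> * K * sqrt H))" by (simp add: algebra_simps)
  finally show ?thesis using H by simp
qed

end

context energy
begin

theorem energy_uniqueness:
  assumes z: "z \<in> {0<..<1}" and v: "v \<in> X" shows "\<zeta> v z = 0"
proof -
  let ?b = "\<lambda>H. N v * (sqrt (2 * Ca * sqrt H) * K + 2 * \<Gamma> * K * sqrt H)"
  have "norm (\<zeta> v z) \<le> ?b H" if "0 < H" "H < 1" for H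
  proof -
    interpret energy_window X N d s B \<Gamma> P Ca H by unfold_locales (use that in auto)
    show ?thesis by (rule \<zeta>_bound[OF z v])
  qed
  then have "eventually (\<lambda>H. norm (\<zeta> v z) \<le> ?b H) (at_right 0)" by (intro eventually_at_rightI[of 0 1]) auto
  moreover have "(?b \<longlongrightarrow> N v * (sqrt (2 * Ca * sqrt 0) * K + 2 * \<Gamma> * K * sqrt 0)) (at_right 0)" by (intro tendsto_intros)
  ultimately have "norm (\<zeta> v z) \<le> N v * (sqrt (2 * Ca * sqrt 0) * K + 2 * \<Gamma> * K * sqrt 0)" by (intro tendsto_lowerbound) auto
  then show ?thesis by simp
qed

end

section \<open>Uniqueness of variational solutions\<close>

lemma integral_cong_AE_lebesgue_on:
  fixes f g :: "real \<Rightarrow> 'a::euclidean_space"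
  assumes "f \<in> borel_measurable (lebesgue_on S)" "AE x in lebesgue_on S. f x = g x" "S \<in> sets lebesgue"
  shows "integral\<^sup>L (lebesgue_on S) f = integral\<^sup>L (lebesgue_on S) g"
  by (rule integral_cong_AE[OF assms(1) borel_measurable_AE_cong_lebesgue_on[OF assms] assms(2)])

lemma L2_weight:
  assumes c: "c \<in> borel_measurable (lebesgue_on S)" "\<And>x. x \<in> S \<Longrightarrow> \<bar>c x\<bar> \<le> \<Gamma>" "0 \<le> \<Gamma>" and f: "f \<in> L2 S"
  shows "(\<lambda>x. complex_of_real (c x) * f x) \<in> L2 S" "L2_norm S (\<lambda>x. complex_of_real (c x) * f x) \<le> \<Gamma> * L2_norm S f"
proof -
  note [simp] = L2_square_integrable[OF f]
  have m: "(\<lambda>x. complex_of_real (c x) * f x) \<in> borel_measurable (lebesgue_on S)" using c(1) L2_measurable[OF f] by measurable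
  have le: "(norm (complex_of_real (c x) * f x))\<^sup>2 \<le> \<Gamma>\<^sup>2 * (norm (f x))\<^sup>2" if "x \<in> S" for x
    unfolding norm_mult norm_of_real power_mult_distrib by (intro mult_right_mono power_mono c(2)[OF that]) auto
  show L2: "(\<lambda>x. complex_of_real (c x) * f x) \<in> L2 S" by (rule L2_bound[OF m _ le]) simp_all
  have "(L2_norm S (\<lambda>x. complex_of_real (c x) * f x))\<^sup>2 \<le> (\<integral>x. \<Gamma>\<^sup>2 * (norm (f x))\<^sup>2 \<partial>lebesgue_on S)"
    unfolding L2_norm_square by (rule integral_mono[OF L2_square_integrable[OF L2]]) (use le in simp_all)
  also have "... = (\<Gamma> * L2_norm S f)\<^sup>2" by (simp add: power_mult_distrib L2_norm_square)
  finally show "L2_norm S (\<lambda>x. complex_of_real (c x) * f x) \<le> \<Gamma> * L2_norm S f" by (rule power2_le_imp_le) (simp add: c(3))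
qed

lemma L2_inner_cong_AE:
  assumes "v \<in> L2 S" "w \<in> L2 S" "v' \<in> L2 S" "w' \<in> L2 S"
    "AE x in lebesgue_on S. v x = v' x" "AE x in lebesgue_on S. w x = w' x"
  shows "L2_inner S v w = L2_inner S v' w'"
  unfolding L2_inner_def
proof (rule integral_cong_AE)
  show "AE x in lebesgue_on S. v x * cnj (w x) = v' x * cnj (w' x)" using assms(5,6) by eventually_elim simp
qed (use L2_inner_integrable assms in \<open>auto intro: borel_measurable_integrable\<close>)

lemma elliptic_op_L2_inner:
  "elliptic_op S a v w = L2_inner S (\<lambda>x. complex_of_real (a x) * wderiv S v x) (wderiv S w)" by (simp add: elliptic_op_def L2_inner_def)

context smooth_bump
begin

context
  fixes c :: "real \<Rightarrow> real" and \<Gamma> :: real and S :: "real set"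
  assumes S: "open S" and c: "c \<in> borel_measurable (lebesgue_on S)" "\<And>x. x \<in> S \<Longrightarrow> \<bar>c x\<bar> \<le> \<Gamma>" "0 \<le> \<Gamma>"
begin

lemma elliptic_weight:
  assumes "v \<in> H1 S" shows "(\<lambda>x. complex_of_real (c x) * wderiv S v x) \<in> L2 S" by (rule L2_weight(1)[OF c wderiv_L2[OF assms]])

lemma elliptic_bound:
  assumes "v \<in> H1 S" "w \<in> H1 S" shows "norm (elliptic_op S c v w) \<le> \<Gamma> * H1_norm S v * H1_norm S w"
proof -
  have "norm (elliptic_op S c v w) \<le> L2_norm S (\<lambda>x. complex_of_real (c x) * wderiv S v x) * L2_norm S (wderiv S w)"
    unfolding elliptic_op_L2_inner by (rule L2_inner_norm_le[OF elliptic_weight[OF assms(1)] wderiv_L2[OF assms(2)]])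
  also have "... \<le> (\<Gamma> * H1_norm S v) * H1_norm S w"
  proof (intro mult_mono wderiv_norm_le_H1_norm)
    have "\<Gamma> * L2_norm S (wderiv S v) \<le> \<Gamma> * H1_norm S v" by (intro mult_left_mono wderiv_norm_le_H1_norm c(3))
    then show "L2_norm S (\<lambda>x. complex_of_real (c x) * wderiv S v x) \<le> \<Gamma> * H1_norm S v" using L2_weight(2)[OF c wderiv_L2[OF assms(1)]] by simp
  qed (use c(3) in simp_all)
  finally show ?thesis .
qed

lemma elliptic_add_left:
  assumes "v \<in> H1 S" "v' \<in> H1 S" "w \<in> H1 S"
  shows "elliptic_op S c (\<lambda>x. v x + v' x) w = elliptic_op S c v w + elliptic_op S c v' w"
proof -
  have SL: "S \<in> sets lebesgue" using S by simp
  have "elliptic_op S c (\<lambda>x. v x + v' x) w = L2_inner S (\<lambda>x. complex_of_real (c x) * wderiv S v x + complex_of_real (c x) * wderiv S v' x) (wderiv S w)"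
    unfolding elliptic_op_L2_inner
  proof (rule L2_inner_cong_AE)
    show "AE x in lebesgue_on S. complex_of_real (c x) * wderiv S (\<lambda>x. v x + v' x) x
       = complex_of_real (c x) * wderiv S v x + complex_of_real (c x) * wderiv S v' x"
      using wderiv_add[OF S assms(1,2)] by eventually_elim (simp add: distrib_left)
  qed (use assms SL in \<open>simp_all add: elliptic_weight L2_add H1_add wderiv_L2\<close>)
  then show ?thesis unfolding elliptic_op_L2_inner
    using L2_inner_add_left[OF elliptic_weight[OF assms(1)] elliptic_weight[OF assms(2)] wderiv_L2[OF assms(3)]] by simp
qed

lemma elliptic_scale_left:
  assumes "v \<in> H1 S" "w \<in> H1 S"
  shows "elliptic_op S c (\<lambda>x. k * v x) w = k * elliptic_op S c v w"
proof -
  have "elliptic_op S c (\<lambda>x. k * v x) w = L2_inner S (\<lambda>x. k * (complex_of_real (c x) * wderiv S v x)) (wderiv S w)"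
    unfolding elliptic_op_L2_inner
  proof (rule L2_inner_cong_AE)
    show "AE x in lebesgue_on S. complex_of_real (c x) * wderiv S (\<lambda>x. k * v x) x = k * (complex_of_real (c x) * wderiv S v x)"
      using wderiv_scale[OF S assms(1), of k] by eventually_elim simp
  qed (use assms in \<open>simp_all add: elliptic_weight L2_scale H1_scale wderiv_L2\<close>)
  then show ?thesis unfolding elliptic_op_L2_inner by (simp add: L2_inner_scale_left)
qed

lemma elliptic_hermitian: "cnj (elliptic_op S c v w) = elliptic_op S c w v"
proof -
  have "cnj (elliptic_op S c v w) = (\<integral>x. cnj (complex_of_real (c x) * wderiv S v x * cnj (wderiv S w x)) \<partial>lebesgue_on S)"
    unfolding elliptic_op_def by (simp only: Bochner_Integration.integral_cnj)
  then show ?thesis by (simp add: elliptic_op_def mult_ac)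
qed

lemma elliptic_functional_left:
  assumes "w \<in> H1 S"
  shows "seminormed.real_functional (H1 S) (H1_norm S) (\<lambda>v. elliptic_op S c v w) (\<Gamma> * H1_norm S w)"
  unfolding seminormed.real_functional_def[OF H1_seminormed[OF S]]
proof (intro conjI ballI allI)
  show "norm (elliptic_op S c v w) \<le> \<Gamma> * H1_norm S w * H1_norm S v" if "v \<in> H1 S" for v using elliptic_bound[OF that assms] by (simp only: mult_ac)
qed (use assms c(3) elliptic_add_left elliptic_scale_left in simp_all)

lemma elliptic_functional_right:
  assumes "v \<in> H1 S"
  shows "seminormed.real_functional (H1 S) (H1_norm S) (elliptic_op S c v) (\<Gamma> * H1_norm S v)"
  unfolding seminormed.real_functional_def[OF H1_seminormed[OF S]]
proof (intro conjI ballI allI)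
  fix w w' assume w: "w \<in> H1 S" "w' \<in> H1 S"
  show "elliptic_op S c v (\<lambda>x. w x + w' x) = elliptic_op S c v w + elliptic_op S c v w'"
    using arg_cong[OF elliptic_add_left[OF w assms], of cnj] by (simp add: elliptic_hermitian)
next
  fix r w assume w: "w \<in> H1 S"
  show "elliptic_op S c v (\<lambda>x. complex_of_real r * w x) = complex_of_real r * elliptic_op S c v w"
    using arg_cong[OF elliptic_scale_left[OF w assms, of "complex_of_real r"], of cnj] by (simp add: elliptic_hermitian)
qed (use elliptic_bound[OF assms] c(3) in auto)

end

lemma elliptic_nonneg:
  assumes "\<And>x. 0 \<le> c x" shows "0 \<le> Re (elliptic_op S c v v)"
proof -
  have "elliptic_op S c v v = (\<integral>x. complex_of_real (c x * (norm (wderiv S v x))\<^sup>2) \<partial>lebesgue_on S)"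
    unfolding elliptic_op_def of_real_mult mult.assoc complex_norm_square by simp
  also have "... = complex_of_real (\<integral>x. c x * (norm (wderiv S v x))\<^sup>2 \<partial>lebesgue_on S)" by (rule integral_complex_of_real)
  finally show ?thesis using assms by simp
qed

lemma elliptic_diff_coefficient:
  assumes S: "open S" and c: "c \<in> borel_measurable (lebesgue_on S)" "\<And>x. x \<in> S \<Longrightarrow> \<bar>c x\<bar> \<le> \<Gamma>" "0 \<le> \<Gamma>"
    and c': "c' \<in> borel_measurable (lebesgue_on S)" "\<And>x. x \<in> S \<Longrightarrow> \<bar>c' x\<bar> \<le> \<Gamma>"
    and vw: "v \<in> H1 S" "w \<in> H1 S"
  shows "elliptic_op S c v w - elliptic_op S c' v w = elliptic_op S (\<lambda>x. c x - c' x) v w"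
proof -
  have "elliptic_op S (\<lambda>x. c x - c' x) v w
    = L2_inner S (\<lambda>x. complex_of_real (c x) * wderiv S v x - complex_of_real (c' x) * wderiv S v x) (wderiv S w)"
    unfolding elliptic_op_L2_inner by (simp add: left_diff_distrib)
  then show ?thesis using L2_inner_diff_left[OF elliptic_weight[OF S c vw(1)] elliptic_weight[OF S c' c(3) vw(1)] wderiv_L2[OF vw(2)]]
    by (simp add: elliptic_op_L2_inner)
qed

end

lemma unit_time_interval_integral:
  fixes f :: "real \<Rightarrow> complex"
  assumes f: "integrable unit_time f" and ab: "0 < a" "a \<le> b" "b < 1"
  shows "(\<integral>q. f q \<partial>lebesgue_on {a..b}) = (LINT q:past b|unit_time. f q) - (LINT q:past a|unit_time. f q)"
proof -
  have sub: "{a..b} \<subseteq> {0<..<1}" using ab by auto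
  have A: "{a..b} \<in> sets unit_time" using sub by (simp add: sets_restrict_space_iff)
  have "(LINT q:past b|unit_time. f q) - (LINT q:past a|unit_time. f q) = (LINT q:past b - past a|unit_time. f q)"
    by (rule set_integral_past_diff[OF f ab(2)])
  also have "... = (LINT q:{a..b}|unit_time. f q)"
    unfolding set_lebesgue_integral_def
  proof (rule integral_cong_AE)
    have "AE q in lebesgue. q \<notin> {b}" by (intro AE_not_in) auto
    then have "AE q in unit_time. q \<notin> {b}" by (rule AE_lebesgue_on) simp
    then show "AE q in unit_time. indicator (past b - past a) q *\<^sub>R f q = indicator {a..b} q *\<^sub>R f q"
      by eventually_elim (use ab in \<open>auto simp: past_def indicator_def\<close>)
  qed (use integrable_mult_indicator[OF _ f] A in \<open>auto intro!: borel_measurable_integrable\<close>)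
  also have "... = (\<integral>q. indicator {a..b} q *\<^sub>R f q \<partial>lebesgue_on {a..b})"
    unfolding set_lebesgue_integral_def by (rule integral_support) (use sub in auto)
  also have "... = (\<integral>q. f q \<partial>lebesgue_on {a..b})" by (rule Bochner_Integration.integral_cong) auto
  finally show ?thesis by simp
qed

lemma (in seminormed) antidual_diff:
  assumes "F \<in> antidual X N" "G \<in> antidual X N" shows "F - G \<in> antidual X N"
proof -
  have "\<exists>C. \<forall>v\<in>X. norm ((F - G) v) \<le> C * N v"
  proof (intro exI ballI)
    fix v assume v: "v \<in> X"
    have "norm (F v - G v) \<le> dual_norm X N F * N v + dual_norm X N G * N v"
      by (rule norm_diff_triangle_le_sum[OF antidual_le[OF assms(1) v] antidual_le[OF assms(2) v]])
    then show "norm ((F - G) v) \<le> (dual_norm X N F + dual_norm X N G) * N v" by (simp add: distrib_right)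
  qed
  then show ?thesis using assms by (auto simp: antidual_def algebra_simps)
qed

lemma (in seminormed) zero_initial_value_continuous:
  assumes Z: "\<forall>t\<in>{0..1}. Z t \<in> antidual X N"
    "\<forall>t\<in>{0..1}. ((\<lambda>s. dual_norm X N (Z s - Z t)) \<longlongrightarrow> 0) (at t within {0..1})" and v: "v \<in> X"
  shows "continuous_on {0..1::real} (\<lambda>t. Z t v)"
  unfolding continuous_on_def
proof
  fix t :: real assume t: "t \<in> {0..1}"
  have "((\<lambda>s. dual_norm X N (Z s - Z t) * N v) \<longlongrightarrow> 0 * N v) (at t within {0..1})" using Z(2) t by (intro tendsto_mult tendsto_const) auto
  then have lim: "((\<lambda>s. dual_norm X N (Z s - Z t) * N v) \<longlongrightarrow> 0) (at t within {0..1})" by simp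
  have "((\<lambda>s. Z s v - Z t v) \<longlongrightarrow> 0) (at t within {0..1})"
  proof (rule Lim_null_comparison[OF _ lim])
    have "eventually (\<lambda>s. s \<in> {0..1}) (at t within {0..1})" by (simp add: eventually_at_filter)
    then show "eventually (\<lambda>s. norm (Z s v - Z t v) \<le> dual_norm X N (Z s - Z t) * N v) (at t within {0..1})"
      by eventually_elim (use antidual_le[OF antidual_diff v] Z(1) t in fastforce)
  qed
  then show "((\<lambda>s. Z s v) \<longlongrightarrow> Z t v) (at t within {0..1})" by (simp add: LIM_zero_iff)
qed

lemma (in seminormed) square_integrable_difference:
  assumes "square_integrable_limit X N d s" "square_integrable_limit X N d' s'"
  shows "square_integrable_limit X N (\<lambda>t x. d t x - d' t x) (\<lambda>n t x. s n t x - s' n t x)"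
proof -
  interpret A: square_integrable_limit X N d s by fact
  interpret B: square_integrable_limit X N d' s' by fact
  interpret C: simple_limit X N "\<lambda>t x. d t x - d' t x" "\<lambda>n t x. s n t x - s' n t x"
  proof unfold_locales
    show "simple_function unit_time (\<lambda>t x. s n t x - s' n t x)" for n by (rule simple_function_compose2[OF A.s_simple B.s_simple])
    show "(\<lambda>n. N (\<lambda>x. (d t x - d' t x) - (s n t x - s' n t x))) \<longlonglongrightarrow> 0" for t
    proof (rule Lim_null_comparison)
      show "(\<lambda>n. N (\<lambda>x. d t x - s n t x) + N (\<lambda>x. d' t x - s' n t x)) \<longlonglongrightarrow> 0" using tendsto_add[OF A.s_lim B.s_lim, of t t] by simp
      have "(\<lambda>x. (d t x - d' t x) - (s n t x - s' n t x)) = (\<lambda>x. (d t x - s n t x) - (d' t x - s' n t x))" for n by (simp add: fun_eq_iff)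
      then show "eventually (\<lambda>n. norm (N (\<lambda>x. (d t x - d' t x) - (s n t x - s' n t x))) \<le> N (\<lambda>x. d t x - s n t x) + N (\<lambda>x. d' t x - s' n t x)) sequentially"
        using N_diff[OF diff_mem[OF A.d_mem A.s_mem] diff_mem[OF B.d_mem B.s_mem], of t _ t t _ t] N_nonneg by (intro always_eventually allI) simp
    qed
  qed (use A.d_mem B.d_mem A.s_mem B.s_mem diff_mem in auto)
  show ?thesis
  proof unfold_locales
    have "integrable unit_time (\<lambda>t. (N (\<lambda>x. d t x - d' t x))\<^sup>2)"
    proof (rule Bochner_Integration.integrable_bound)
      show "integrable unit_time (\<lambda>t. 2 * (N (d t))\<^sup>2 + 2 * (N (d' t))\<^sup>2)" using A.N_square_integrable B.N_square_integrable by simp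
      show "(\<lambda>t. (N (\<lambda>x. d t x - d' t x))\<^sup>2) \<in> borel_measurable unit_time" using C.N_measurable by measurable
      show "AE t in unit_time. norm ((N (\<lambda>x. d t x - d' t x))\<^sup>2) \<le> norm (2 * (N (d t))\<^sup>2 + 2 * (N (d' t))\<^sup>2)"
      proof (rule AE_I2)
        fix t
        have "(N (\<lambda>x. d t x - d' t x))\<^sup>2 \<le> (N (d t) + N (d' t))\<^sup>2" by (intro power_mono N_diff A.d_mem B.d_mem N_nonneg)
        also have "... \<le> 2 * (N (d t))\<^sup>2 + 2 * (N (d' t))\<^sup>2" using sum_squares_bound[of "N (d t)" "N (d' t)"] by (simp add: power2_sum)
        finally show "norm ((N (\<lambda>x. d t x - d' t x))\<^sup>2) \<le> norm (2 * (N (d t))\<^sup>2 + 2 * (N (d' t))\<^sup>2)" by simp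
      qed
    qed
    then show "(\<integral>\<^sup>+t. ennreal ((N (\<lambda>x. d t x - d' t x))\<^sup>2) \<partial>unit_time) < \<infinity>" by (simp add: integrable_iff_bounded)
  qed
qed

lemma (in seminormed) square_integrable_representative:
  assumes w: "w \<in> L2_time X N"
  obtains d s where "square_integrable_limit X N d s" "AE t in unit_time. d t = w t"
proof -
  obtain d s where "simple_limit X N d s" "AE t in unit_time. d t = w t"
    "(\<integral>\<^sup>+t. ennreal ((N (d t))\<^sup>2) \<partial>unit_time) < \<infinity>" using simple_limit_representative[OF w] by metis
  then show ?thesis using that by (simp add: square_integrable_limit_def square_integrable_limit_axioms_def)
qed

lemma L2_functional_left: "w \<in> L2 S \<Longrightarrow> seminormed.real_functional (L2 S) (L2_norm S) (\<lambda>v. L2_inner S v w) (L2_norm S w)"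
  unfolding seminormed.real_functional_def[OF L2_seminormed]
proof (intro conjI ballI allI)
  show "norm (L2_inner S v w) \<le> L2_norm S w * L2_norm S v" if "w \<in> L2 S" "v \<in> L2 S" for v
    using L2_inner_norm_le[OF that(2,1)] by (simp only: mult.commute)
qed (simp_all add: L2_inner_add_left L2_inner_scale_left)

lemma (in smooth_bump) H1_functional_of_L2:
  assumes S: "open S" and v: "v \<in> L2 S"
  shows "seminormed.real_functional (H1 S) (H1_norm S) (L2_inner S v) (L2_norm S v)"
  unfolding seminormed.real_functional_def[OF H1_seminormed[OF S]]
proof (intro conjI ballI allI)
  show "norm (L2_inner S v w) \<le> L2_norm S v * H1_norm S w" if "w \<in> H1 S" for w
  proof -
    have "norm (L2_inner S v w) \<le> L2_norm S v * L2_norm S w" by (rule L2_inner_norm_le[OF v H1_L2[OF that]])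
    also have "... \<le> L2_norm S v * H1_norm S w" by (intro mult_left_mono L2_norm_le_H1_norm) simp
    finally show ?thesis .
  qed
qed (simp_all add: L2_inner_add_right[OF H1_L2 H1_L2 v] L2_inner_scale_right)

lemma (in smooth_bump) H1_functional_of_L2_left:
  assumes S: "open S" and w: "w \<in> H1 S"
  shows "seminormed.real_functional (H1 S) (H1_norm S) (\<lambda>v. L2_inner S v w) (H1_norm S w)"
  unfolding seminormed.real_functional_def[OF H1_seminormed[OF S]]
proof (intro conjI ballI allI)
  show "norm (L2_inner S v w) \<le> H1_norm S w * H1_norm S v" if "v \<in> H1 S" for v
  proof -
    have "norm (L2_inner S v w) \<le> L2_norm S v * L2_norm S w" by (rule L2_inner_norm_le[OF H1_L2[OF that] H1_L2[OF w]])
    also have "... \<le> H1_norm S v * H1_norm S w" by (intro mult_mono L2_norm_le_H1_norm) simp_all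
    finally show ?thesis by (simp only: mult.commute)
  qed
qed (simp_all add: L2_inner_add_left[OF H1_L2 H1_L2 H1_L2[OF w]] L2_inner_scale_left)

lemma (in smooth_bump) time_pairing_integrable:
  assumes g: "g \<in> L2_time (L2 UNIV) (L2_norm UNIV)" and v: "v \<in> L2 UNIV"
  shows "integrable unit_time (\<lambda>t. L2_inner UNIV (g t) v)"
proof -
  interpret seminormed "L2 UNIV" "L2_norm UNIV" by (rule L2_seminormed)
  obtain d s where ds: "square_integrable_limit (L2 UNIV) (L2_norm UNIV) d s" and ae: "AE t in unit_time. d t = g t"
    using square_integrable_representative[OF g] by metis
  interpret square_integrable_limit "L2 UNIV" "L2_norm UNIV" d s by (rule ds)
  have m: "(\<lambda>t. L2_inner UNIV (d t) v) \<in> borel_measurable unit_time"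
    by (rule measurable_functional[where l = "\<lambda>_ u. L2_inner UNIV u v" and C = "L2_norm UNIV v"])
      (use real_functional_diff(2)[OF L2_functional_left[OF v]] in auto)
  have i: "integrable unit_time (\<lambda>t. L2_inner UNIV (d t) v)"
  proof (rule Bochner_Integration.integrable_bound[OF _ m])
    show "integrable unit_time (\<lambda>t. L2_norm UNIV v * L2_norm UNIV (d t))" using N_integrable by simp
    show "AE t in unit_time. norm (L2_inner UNIV (d t) v) \<le> norm (L2_norm UNIV v * L2_norm UNIV (d t))"
      using L2_inner_norm_le[OF d_mem v] by (intro AE_I2) (simp add: mult.commute)
  qed
  have ae': "AE t in unit_time. L2_inner UNIV (d t) v = L2_inner UNIV (g t) v" using ae by eventually_elim simp
  have "(\<lambda>t. L2_inner UNIV (g t) v) \<in> borel_measurable unit_time" by (rule borel_measurable_AE_cong_lebesgue_on[OF m ae']) simp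
  then show ?thesis using i ae' m integrable_cong_AE by blast
qed

locale Holder_coefficient = smooth_bump +
  fixes a :: "real \<Rightarrow> real \<Rightarrow> real" and \<Lambda> Ca :: real
  assumes a_range: "0 \<le> a t x" "a t x \<le> \<Lambda>"
    and a_measurable: "a t \<in> borel_measurable lebesgue"
    and a_Holder: "p \<in> {0<..<1} \<Longrightarrow> q \<in> {0<..<1} \<Longrightarrow> \<bar>a p x - a q x\<bar> \<le> Ca * sqrt \<bar>p - q\<bar>"
    and Ca_nonneg: "0 \<le> Ca"
begin

lemma \<Lambda>_nonneg: "0 \<le> \<Lambda>" using a_range[of 0 0] by simp

lemma a_facts: "a t \<in> borel_measurable (lebesgue_on UNIV)" "\<bar>a t x\<bar> \<le> \<Lambda>"
  using a_measurable[of t] a_range[of t x] by (simp_all add: lebesgue_on_UNIV_eq)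

sublocale H1: seminormed H1_line "H1_norm UNIV" by (rule H1_seminormed) simp

abbreviation form :: "real \<Rightarrow> (real \<Rightarrow> complex) \<Rightarrow> (real \<Rightarrow> complex) \<Rightarrow> complex" where
  "form t v w \<equiv> elliptic_op UNIV (a t) v w"

lemma form_Holder:
  assumes p: "p \<in> {0<..<1}" "q \<in> {0<..<1}" and vw: "v \<in> H1_line" "w \<in> H1_line"
  shows "norm (form q v w - form p v w) \<le> Ca * sqrt \<bar>q - p\<bar> * H1_norm UNIV v * H1_norm UNIV w"
proof -
  have "form q v w - form p v w = elliptic_op UNIV (\<lambda>x. a q x - a p x) v w"
    by (rule elliptic_diff_coefficient[OF open_UNIV a_facts \<Lambda>_nonneg a_facts vw])
  moreover have "norm (elliptic_op UNIV (\<lambda>x. a q x - a p x) v w) \<le> (Ca * sqrt \<bar>q - p\<bar>) * H1_norm UNIV v * H1_norm UNIV w"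
  proof (rule elliptic_bound[OF open_UNIV _ _ _ vw])
    show "(\<lambda>x. a q x - a p x) \<in> borel_measurable (lebesgue_on UNIV)" using a_facts(1) by measurable
    show "\<bar>a q x - a p x\<bar> \<le> Ca * sqrt \<bar>q - p\<bar>" for x by (rule a_Holder[OF p(2,1)])
    show "0 \<le> Ca * sqrt \<bar>q - p\<bar>" using Ca_nonneg by simp
  qed
  ultimately show ?thesis by simp
qed

lemma form_measurable:
  assumes vw: "v \<in> H1_line" "w \<in> H1_line" shows "(\<lambda>q. form q v w) \<in> borel_measurable unit_time"
proof -
  have "continuous_on {0<..<1} (\<lambda>q. form q v w)"
    unfolding continuous_on_def
  proof
    fix p :: real assume p: "p \<in> {0<..<1}"
    let ?C = "Ca * H1_norm UNIV v * H1_norm UNIV w"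
    have "((\<lambda>q. ?C * sqrt \<bar>q - p\<bar>) \<longlongrightarrow> ?C * sqrt \<bar>p - p\<bar>) (at p within {0<..<1})" by (intro tendsto_intros)
    then have lim: "((\<lambda>q. ?C * sqrt \<bar>q - p\<bar>) \<longlongrightarrow> 0) (at p within {0<..<1})" by simp
    have "((\<lambda>q. form q v w - form p v w) \<longlongrightarrow> 0) (at p within {0<..<1})"
    proof (rule Lim_null_comparison[OF _ lim])
      have "eventually (\<lambda>q. q \<in> {0<..<1}) (at p within {0<..<1})" by (simp add: eventually_at_filter)
      then show "eventually (\<lambda>q. norm (form q v w - form p v w) \<le> ?C * sqrt \<bar>q - p\<bar>) (at p within {0<..<1})"
        by eventually_elim (use form_Holder[OF p _ vw] in \<open>simp add: mult_ac\<close>)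
    qed
    then show "((\<lambda>q. form q v w) \<longlongrightarrow> form p v w) (at p within {0<..<1})" by (simp add: LIM_zero_iff)
  qed
  then have "(\<lambda>q. form q v w) \<in> borel_measurable (restrict_space borel {0<..<1})" by (rule borel_measurable_continuous_on_restrict)
  then have "(\<lambda>q. form q v w) \<in> borel_measurable (restrict_space lborel {0<..<1})"
    by (simp add: measurable_def space_restrict_space sets_restrict_space)
  then show ?thesis by (rule measurable_mono[THEN subsetD, rotated -1]) (auto simp: sets_restrict_space space_restrict_space)
qed

lemma form_time_form:
  assumes "square_integrable_limit H1_line (H1_norm UNIV) d s"
  shows "time_form H1_line (H1_norm UNIV) d s form \<Lambda>"
proof -
  interpret square_integrable_limit H1_line "H1_norm UNIV" d s by fact
  show ?thesis by unfold_locales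
      (use \<Lambda>_nonneg form_measurable elliptic_functional_left[OF open_UNIV a_facts \<Lambda>_nonneg]
        elliptic_functional_right[OF open_UNIV a_facts \<Lambda>_nonneg] in auto)
qed

text \<open>In a variational solution, every pairing with a fixed function is absolutely continuous.\<close>

lemma variational_solution_pairing:
  assumes sol: "variational_solution a g z"
  obtains d s Z where "square_integrable_limit H1_line (H1_norm UNIV) d s" "AE t in unit_time. d t = z t"
    "\<And>v. v \<in> H1_line \<Longrightarrow> continuous_on {0..1} (\<lambda>t. Z t v)" "\<And>v. v \<in> H1_line \<Longrightarrow> Z 0 v = 0"
    "AE t in unit_time. \<forall>v\<in>H1_line. Z t v = L2_inner UNIV (d t) v"
    "\<And>v \<psi>. v \<in> H1_line \<Longrightarrow> \<psi> \<in> test_functions {0<..<1} \<Longrightarrow>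
       (\<integral>t. vector_derivative \<psi> (at t) * Z t v \<partial>unit_time)
         = - (\<integral>t. \<psi> t * (L2_inner UNIV (g t) v - form t (d t) v) \<partial>unit_time)"
proof -
  obtain d s where ds: "square_integrable_limit H1_line (H1_norm UNIV) d s" and ae: "AE t in unit_time. d t = z t"
    using sol H1.square_integrable_representative[of z] unfolding variational_solution_def by metis
  interpret time_form H1_line "H1_norm UNIV" d s form \<Lambda> by (rule form_time_form[OF ds])
  obtain z' where weak: "has_weak_time_derivative H1_line (\<lambda>t. L2_inner UNIV (z t)) z'"
    and eq: "AE t in unit_time. \<forall>v\<in>H1_line. z' t v + form t (z t) v = L2_inner UNIV (g t) v" using sol unfolding variational_solution_def by blast
  obtain Z where Z: "\<forall>t\<in>{0..1}. Z t \<in> Hm1_line"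
    "\<forall>t\<in>{0..1}. ((\<lambda>s. Hm1_norm (Z s - Z t)) \<longlongrightarrow> 0) (at t within {0..1})"
    "AE t in unit_time. \<forall>v\<in>H1_line. Z t v = L2_inner UNIV (z t) v" "\<forall>v\<in>H1_line. Z 0 v = 0"
    using sol unfolding variational_solution_def zero_initial_value_def by blast
  have g: "g \<in> L2_time (L2 UNIV) (L2_norm UNIV)" using sol unfolding variational_solution_def by blast
  show ?thesis
  proof (rule that[OF ds ae])
    show cont: "continuous_on {0..1} (\<lambda>t. Z t v)" if "v \<in> H1_line" for v by (rule H1.zero_initial_value_continuous[OF Z(1,2) that])
    show "Z 0 v = 0" if "v \<in> H1_line" for v using Z(4) that by blast
    show "AE t in unit_time. \<forall>v\<in>H1_line. Z t v = L2_inner UNIV (d t) v" using Z(3) ae by eventually_elim simp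
    fix v and \<psi> :: "real \<Rightarrow> complex" assume v: "v \<in> H1_line" and \<psi>: "\<psi> \<in> test_functions {0<..<1}"
    have \<psi>m: "\<psi> \<in> borel_measurable unit_time" "(\<lambda>t. vector_derivative \<psi> (at t)) \<in> borel_measurable unit_time"
      using \<psi> test_function_derivative[OF \<psi>] by (auto simp: test_functions_def intro: smooth_measurable)
    have Zm: "(\<lambda>t. Z t v) \<in> borel_measurable unit_time"
    proof -
      have "(\<lambda>t. Z t v) \<in> borel_measurable (lebesgue_on {0..1})" using continuous_integrable_Icc[OF cont[OF v]] by simp
      then show ?thesis by (rule measurable_restrict_mono) auto
    qed
    have "(\<integral>t. vector_derivative \<psi> (at t) * Z t v \<partial>unit_time) = (\<integral>t. vector_derivative \<psi> (at t) * L2_inner UNIV (z t) v \<partial>unit_time)"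
    proof (rule integral_cong_AE_lebesgue_on)
      show "AE t in unit_time. vector_derivative \<psi> (at t) * Z t v = vector_derivative \<psi> (at t) * L2_inner UNIV (z t) v"
        using Z(3) by eventually_elim (use v in simp)
    qed (use \<psi>m Zm in auto)
    moreover have "(\<integral>t. \<psi> t * (L2_inner UNIV (g t) v - form t (d t) v) \<partial>unit_time) = (\<integral>t. \<psi> t * z' t v \<partial>unit_time)"
    proof (rule integral_cong_AE_lebesgue_on)
      show "AE t in unit_time. \<psi> t * (L2_inner UNIV (g t) v - form t (d t) v) = \<psi> t * z' t v" using eq ae
      proof eventually_elim
        case (elim t)
        have "z' t v + form t (z t) v = L2_inner UNIV (g t) v" using elim(1) v by blast
        then have "L2_inner UNIV (g t) v - form t (d t) v = z' t v" unfolding elim(2) by (simp add: algebra_simps)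
        then show ?case by simp
      qed
      have "(\<lambda>t. L2_inner UNIV (g t) v) \<in> borel_measurable unit_time" using time_pairing_integrable[OF g H1_L2[OF v]] by simp
      then show "(\<lambda>t. \<psi> t * (L2_inner UNIV (g t) v - form t (d t) v)) \<in> borel_measurable unit_time" using \<psi>m(1) Bd_measurable[OF v] by simp
    qed simp
    ultimately show "(\<integral>t. vector_derivative \<psi> (at t) * Z t v \<partial>unit_time)
         = - (\<integral>t. \<psi> t * (L2_inner UNIV (g t) v - form t (d t) v) \<partial>unit_time)" using weak v \<psi> unfolding has_weak_time_derivative_def by simp
  qed
qed

text \<open>Every pairing of the difference with a fixed function is absolutely continuous and vanishes initially, which gives the integral identity of the energy method with the inner product of \<open>L\<^sup>2\<close> and the elliptic form.\<close>

theorem variational_solution_unique: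
  assumes sol: "variational_solution a g z" "variational_solution a g w"
  shows "AE t in unit_time. AE x in lebesgue. z t x = w t x"
proof -
  obtain dz sz Zz where z: "square_integrable_limit H1_line (H1_norm UNIV) dz sz" "AE t in unit_time. dz t = z t"
    "\<And>v. v \<in> H1_line \<Longrightarrow> continuous_on {0..1} (\<lambda>t. Zz t v)" "\<And>v. v \<in> H1_line \<Longrightarrow> Zz 0 v = 0"
    "AE t in unit_time. \<forall>v\<in>H1_line. Zz t v = L2_inner UNIV (dz t) v"
    "\<And>v \<psi>. v \<in> H1_line \<Longrightarrow> \<psi> \<in> test_functions {0<..<1} \<Longrightarrow>
       (\<integral>t. vector_derivative \<psi> (at t) * Zz t v \<partial>unit_time)
         = - (\<integral>t. \<psi> t * (L2_inner UNIV (g t) v - form t (dz t) v) \<partial>unit_time)" by (rule variational_solution_pairing[OF sol(1)]) blast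
  obtain dw sw Zw where w: "square_integrable_limit H1_line (H1_norm UNIV) dw sw" "AE t in unit_time. dw t = w t"
    "\<And>v. v \<in> H1_line \<Longrightarrow> continuous_on {0..1} (\<lambda>t. Zw t v)" "\<And>v. v \<in> H1_line \<Longrightarrow> Zw 0 v = 0"
    "AE t in unit_time. \<forall>v\<in>H1_line. Zw t v = L2_inner UNIV (dw t) v"
    "\<And>v \<psi>. v \<in> H1_line \<Longrightarrow> \<psi> \<in> test_functions {0<..<1} \<Longrightarrow>
       (\<integral>t. vector_derivative \<psi> (at t) * Zw t v \<partial>unit_time)
         = - (\<integral>t. \<psi> t * (L2_inner UNIV (g t) v - form t (dw t) v) \<partial>unit_time)" by (rule variational_solution_pairing[OF sol(2)]) blast
  define d where "d t x = dz t x - dw t x" for t x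
  define s where "s n t x = sz n t x - sw n t x" for n t x
  have ds: "square_integrable_limit H1_line (H1_norm UNIV) d s"
    unfolding d_def[abs_def] s_def[abs_def] by (rule H1.square_integrable_difference[OF z(1) w(1)])
  interpret z: time_form H1_line "H1_norm UNIV" dz sz form \<Lambda> by (rule form_time_form[OF z(1)])
  interpret w: time_form H1_line "H1_norm UNIV" dw sw form \<Lambda> by (rule form_time_form[OF w(1)])
  interpret d: time_form H1_line "H1_norm UNIV" d s form \<Lambda> by (rule form_time_form[OF ds])
  have g: "g \<in> L2_time (L2 UNIV) (L2_norm UNIV)" using sol unfolding variational_solution_def by blast
  have int: "integrable unit_time (\<lambda>t. form t (d t) v)" if "time_form H1_line (H1_norm UNIV) d s form \<Lambda>" "v \<in> H1_line" for d s v
    using time_form.Bd_integrable[OF that, of "{0<..<1}"]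
    by (rule Bochner_Integration.integrable_cong[THEN iffD1, OF refl, rotated]) (auto simp: indicator_def)
  have form_d: "form t (d t) v = form t (dz t) v - form t (dw t) v" if "v \<in> H1_line" for t v
    unfolding d_def[abs_def] by (rule H1.real_functional_diff(1)[OF elliptic_functional_left[OF open_UNIV a_facts \<Lambda>_nonneg that] z.d_mem w.d_mem])
  define c where "c v t = Zz t v - Zw t v" for v t
  have c_cont: "continuous_on {0..1} (c v)" if "v \<in> H1_line" for v
    unfolding c_def[abs_def] by (intro continuous_on_diff z(3) w(3) that)
  have c_weak: "(\<integral>t. vector_derivative \<psi> (at t) * c v t \<partial>unit_time) = - (\<integral>t. \<psi> t * (- form t (d t) v) \<partial>unit_time)"
    if v: "v \<in> H1_line" and \<psi>: "\<psi> \<in> test_functions {0<..<1}" for v \<psi>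
  proof -
    obtain B where B: "\<And>t. norm (\<psi> t) \<le> B" using test_function_bounded[OF \<psi>] by metis
    obtain B' where B': "\<And>t. norm (vector_derivative \<psi> (at t)) \<le> B'" using test_function_bounded[OF test_function_derivative[OF \<psi>]] by metis
    have \<psi>m: "\<psi> \<in> borel_measurable unit_time" "(\<lambda>t. vector_derivative \<psi> (at t)) \<in> borel_measurable unit_time"
      using \<psi> test_function_derivative[OF \<psi>] by (auto simp: test_functions_def intro: smooth_measurable)
    have cont_int: "integrable unit_time f" if "continuous_on {0..1} f" for f :: "real \<Rightarrow> complex"
      by (rule integrable_lebesgue_on_subset[OF continuous_integrable_Icc[OF that]]) auto
    have i1: "integrable unit_time (\<lambda>t. vector_derivative \<psi> (at t) * Zz t v)" "integrable unit_time (\<lambda>t. vector_derivative \<psi> (at t) * Zw t v)"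
      using cont_int[OF z(3)[OF v]] cont_int[OF w(3)[OF v]] \<psi>m(2) B' by (auto intro!: bounded_measurable_mult_integrable[where B = B'])
    have i2: "integrable unit_time (\<lambda>t. \<psi> t * (L2_inner UNIV (g t) v - form t (dz t) v))" "integrable unit_time (\<lambda>t. \<psi> t * (L2_inner UNIV (g t) v - form t (dw t) v))"
      using time_pairing_integrable[OF g H1_L2[OF v]] int[OF z.time_form_axioms v] int[OF w.time_form_axioms v] \<psi>m(1) B
      by (auto intro!: bounded_measurable_mult_integrable[where B = B])
    have "(\<integral>t. vector_derivative \<psi> (at t) * c v t \<partial>unit_time)
      = (\<integral>t. vector_derivative \<psi> (at t) * Zz t v \<partial>unit_time) - (\<integral>t. vector_derivative \<psi> (at t) * Zw t v \<partial>unit_time)"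
      using i1 by (simp add: c_def right_diff_distrib)
    also have "... = - ((\<integral>t. \<psi> t * (L2_inner UNIV (g t) v - form t (dz t) v) \<partial>unit_time) - (\<integral>t. \<psi> t * (L2_inner UNIV (g t) v - form t (dw t) v) \<partial>unit_time))"
      unfolding z(6)[OF v \<psi>] w(6)[OF v \<psi>] by simp
    also have "... = - (\<integral>t. \<psi> t * (L2_inner UNIV (g t) v - form t (dz t) v) - \<psi> t * (L2_inner UNIV (g t) v - form t (dw t) v) \<partial>unit_time)"
      using i2 by (simp only: Bochner_Integration.integral_diff)
    also have "... = - (\<integral>t. \<psi> t * (- form t (d t) v) \<partial>unit_time)"
      unfolding form_d[OF v] by (simp only: right_diff_distrib[symmetric]) simp
    finally show ?thesis .
  qed
  have evo: "c v b = - (LINT q:past b|unit_time. form q (d q) v)" if b: "b \<in> {0<..<1}" and v: "v \<in> H1_line" for b v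
  proof -
    let ?I = "\<lambda>b. LINT q:past b|unit_time. form q (d q) v"
    have inc: "c v b - c v a' = - (?I b - ?I a')" if a': "0 < a'" "a' < b" for a'
    proof -
      have i: "integrable unit_time (\<lambda>t. - form t (d t) v)" using int[OF d.time_form_axioms v] by simp
      have "c v b - c v a' = (\<integral>q. - form q (d q) v \<partial>lebesgue_on {a'..b})"
      proof (rule du_Bois_Reymond[where S = "{0<..<1}"])
        show "continuous_on {a'..b} (c v)" by (rule continuous_on_subset[OF c_cont[OF v]]) (use a' b in auto)
        show "integrable (lebesgue_on {a'..b}) (\<lambda>q. - form q (d q) v)" by (rule integrable_lebesgue_on_subset[OF i]) (use a' b in auto)
      qed (use a' b c_weak[OF v] in auto)
      also have "... = - (\<integral>q. form q (d q) v \<partial>lebesgue_on {a'..b})" by simp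
      also have "(\<integral>q. form q (d q) v \<partial>lebesgue_on {a'..b}) = ?I b - ?I a'"
        by (rule unit_time_interval_integral[OF int[OF d.time_form_axioms v]]) (use a' b in auto)
      finally show ?thesis .
    qed
    have "continuous_on {0..1} (\<lambda>t. c v t + ?I t)" by (intro continuous_on_add c_cont[OF v] set_integral_past_continuous int[OF d.time_form_axioms v])
    then have "((\<lambda>t. c v t + ?I t) \<longlongrightarrow> c v 0 + ?I 0) (at 0 within {0..1})"
      unfolding continuous_on_def by simp
    moreover have "c v 0 + ?I 0 = 0" using z(4)[OF v] w(4)[OF v] by (simp add: c_def past_empty set_lebesgue_integral_def)
    ultimately have lim: "((\<lambda>t. c v t + ?I t) \<longlongrightarrow> 0) (at_right 0)" by (simp add: at_within_Icc_at_right)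
    have "eventually (\<lambda>t. t \<in> {0<..<b}) (at_right 0)" using b by (intro eventually_at_right_real) auto
    then have "eventually (\<lambda>t. c v t + ?I t = c v b + ?I b) (at_right 0)"
    proof eventually_elim
      case (elim t)
      then have "0 < t" "t < b" by simp_all
      from inc[OF this] show ?case by (simp add: algebra_simps)
    qed
    from Lim_transform_eventually[OF lim this] have "c v b + ?I b = 0" using tendsto_const_iff[of "at_right (0::real)" "c v b + ?I b" 0] by simp
    then show ?thesis by (simp add: add_eq_0_iff2)
  qed
  have evolution: "AE r in unit_time. \<forall>v\<in>H1_line. L2_inner UNIV (d r) v = - (LINT q:past r|unit_time. form q (d q) v)"
    using z(5) w(5) AE_space[of unit_time]
  proof eventually_elim
    case (elim r)
    show ?case
    proof
      fix v assume v: "v \<in> H1_line"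
      have "L2_inner UNIV (d r) v = c v r" using elim(1,2) v L2_inner_diff_left[OF H1_L2[OF z.d_mem] H1_L2[OF w.d_mem] H1_L2[OF v], of r r]
        by (simp add: c_def d_def[abs_def])
      then show "L2_inner UNIV (d r) v = - (LINT q:past r|unit_time. form q (d q) v)" using evo[OF _ v, of r] elim(3) by simp
    qed
  qed
  interpret energy H1_line "H1_norm UNIV" d s form \<Lambda> "L2_inner UNIV" Ca
  proof unfold_locales
    show "H1.real_functional (\<lambda>v. L2_inner UNIV v w) (H1_norm UNIV w)" if "w \<in> H1_line" for w by (rule H1_functional_of_L2_left[OF open_UNIV that])
    show "H1.real_functional (L2_inner UNIV v) (H1_norm UNIV v)" if "v \<in> H1_line" for v
      by (rule H1.real_functional_weaken[OF H1_functional_of_L2[OF open_UNIV H1_L2[OF that]] L2_norm_le_H1_norm])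
    show "norm (L2_inner UNIV v w) \<le> sqrt (Re (L2_inner UNIV v v)) * H1_norm UNIV w" if "v \<in> H1_line" "w \<in> H1_line" for v w
    proof -
      have "norm (L2_inner UNIV v w) \<le> L2_norm UNIV v * L2_norm UNIV w" by (rule L2_inner_norm_le[OF H1_L2[OF that(1)] H1_L2[OF that(2)]])
      also have "... \<le> L2_norm UNIV v * H1_norm UNIV w" by (intro mult_left_mono L2_norm_le_H1_norm) simp
      finally show ?thesis by (simp add: L2_inner_self)
    qed
    show "norm (form q v w - form p v w) \<le> Ca * sqrt \<bar>q - p\<bar> * H1_norm UNIV v * H1_norm UNIV w"
      if "p \<in> {0<..<1}" "q \<in> {0<..<1}" "v \<in> H1_line" "w \<in> H1_line" for p q v w by (rule form_Holder[OF that])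
    show "0 \<le> Re (form q v v)" for q v by (rule elliptic_nonneg[OF a_range(1)])
  qed (use evolution Ca_nonneg in \<open>simp_all add: L2_inner_cnj L2_inner_self\<close>)
  have zero: "AE r in unit_time. \<forall>v\<in>H1_line. L2_inner UNIV (d r) v = 0"
    using \<zeta>_evolution AE_space[of unit_time] by eventually_elim (use energy_uniqueness in auto)
  show ?thesis using zero z(2) w(2)
  proof eventually_elim
    case (elim r)
    have dX: "d r \<in> H1_line" by (rule d.d_mem)
    have "L2_inner UNIV (d r) (d r) = 0" using elim(1) dX by blast
    then have "L2_norm UNIV (d r) = 0" by (simp add: L2_inner_self)
    from L2_norm_eq_0_AE[OF H1_L2[OF dX] this] have "AE x in lebesgue. d r x = 0" unfolding lebesgue_on_UNIV_eq .
    then show ?case unfolding elim(2,3)[symmetric] by eventually_elim (simp add: d_def)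
  qed
qed

end

section \<open>The oscillating modes\<close>

lemma ell_eq: assumes "j \<ge> 1" shows "ell j = 1 / (16 * real j * (real j + 1))"
proof -
  define x where "x = real j"
  have x: "x > 0" using assms by (simp add: x_def)
  have L: "ell j = 1 / (16 * x) - 1 / (16 * (x + 1))" by (simp add: ell_def tau_def x_def add.commute)
 have "1 / (16 * x) * (16 * x * y) = y" "1 / (16 * y) * (16 * x * y) = x" if "y > 0" for y using x that by simp_all
  from this(1)[of "x + 1"] this(2)[of "x + 1"] x
  have "1 / (16 * x) * (16 * x * (x + 1)) = x + 1" "1 / (16 * (x + 1)) * (16 * x * (x + 1)) = x" by linarith+
  then have "ell j * (16 * x * (x + 1)) = 1" unfolding L left_diff_distrib by linarith
  then show ?thesis using x unfolding x_def[symmetric] by (simp add: eq_divide_eq)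
qed

lemma ell_pos: "j \<ge> 1 \<Longrightarrow> 0 < ell j" by (simp add: ell_eq)

lemma tau_Suc: "tau (j + 1) = tau j + ell j" by (simp add: ell_def)

lemma tau_one: "tau 1 = 1/4" by (simp add: tau_def)

lemma tau_less: "j \<ge> 1 \<Longrightarrow> tau j < 5/16" by (simp add: tau_def)

lemma tau_mono: "1 \<le> i \<Longrightarrow> i \<le> j \<Longrightarrow> tau i \<le> tau j" by (simp add: tau_def frac_le)

lemma tau_ge: "j \<ge> 1 \<Longrightarrow> 1/4 \<le> tau j" using tau_mono[of 1 j] tau_one by simp

lemma K_freq_eq: assumes "j \<ge> 1" shows "K_freq j m = real (16 ^ (m + 1) * j * (j + 1))" using assms by (simp add: K_freq_def ell_eq field_simps)

lemma K_freq_pos: "j \<ge> 1 \<Longrightarrow> 0 < K_freq j m" by (simp add: K_freq_def ell_pos)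

lemma K_freq_ge_power: assumes "j \<ge> 1" shows "16 ^ (m + 1) * (real j * (real j + 1)) = K_freq j m" using assms by (simp add: K_freq_eq algebra_simps)

lemma K_freq_ge: assumes "j \<ge> 1" shows "32 \<le> K_freq j m"
proof -
  have "(16::nat) * 1 * 2 \<le> 16 ^ (m + 1) * j * (j + 1)" using assms by (intro mult_mono) auto
  then show ?thesis unfolding K_freq_eq[OF assms] by linarith
qed

lemma K_freq_ell: assumes "j \<ge> 1" shows "1 / ell j \<le> K_freq j m" using ell_pos[OF assms] by (simp add: K_freq_def divide_right_mono)

lemma geometric_partial: "(\<Sum>m=1..n. (1/16::real) ^ (m + 1)) \<le> 1 - (1/16) ^ n"
proof (induction n)
  case (Suc n)
  have "(\<Sum>m=1..Suc n. (1/16::real) ^ (m + 1)) = (\<Sum>m=1..n. (1/16::real) ^ (m + 1)) + (1/16) ^ (Suc n + 1)" by simp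
  also have "... \<le> 1 - (1/16) ^ n + (1/16) ^ (Suc n + 1)" using Suc by simp
  also have "... \<le> 1 - (1/16) ^ Suc n" using zero_le_power[of "1/16::real" n] by (simp add: field_simps)
  finally show ?case .
qed simp

lemma sum_inverse_K: assumes "j \<ge> 1" shows "(\<Sum>m=1..n. 1 / K_freq j m) \<le> 1 / (real j * (real j + 1))"
proof -
  have "(\<Sum>m=1..n. 1 / K_freq j m) = (\<Sum>m=1..n. (1/16) ^ (m + 1) * (1 / (real j * (real j + 1))))"
    by (rule sum.cong) (auto simp: K_freq_ge_power[OF assms, symmetric] power_one_over power_divide divide_simps)
  also have "... = (\<Sum>m=1..n. (1/16) ^ (m + 1)) * (1 / (real j * (real j + 1)))" by (simp only: sum_distrib_right)
  also have "... \<le> 1 * (1 / (real j * (real j + 1)))" by (intro mult_right_mono order_trans[OF geometric_partial]) auto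
  finally show ?thesis by simp
qed

lemma sum_inverse_K_le_1: assumes "j \<ge> 1" shows "(\<Sum>m=1..n. 1 / K_freq j m) \<le> 1/2"
proof -
  have "1 * 2 \<le> real j * (real j + 1)" using assms by (intro mult_mono) auto
  then have "1 / (real j * (real j + 1)) \<le> 1/2" by (intro divide_left_mono) auto
  then show ?thesis using sum_inverse_K[OF assms, of n] by simp
qed

lemma sum_inverse_K_times: assumes "j \<ge> 1" shows "(\<Sum>m=1..n. 1 / K_freq j m) * real j \<le> 1"
proof -
  have "(\<Sum>m=1..n. 1 / K_freq j m) * real j \<le> (1 / (real j * (real j + 1))) * real j" by (rule mult_right_mono[OF sum_inverse_K[OF assms]]) simp
  also have "... = 1 / (real j + 1)" using assms by simp
  also have "... \<le> 1" by simp
  finally show ?thesis .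
qed

lemma sum_le_scaled_inverse_K:
  assumes "j \<ge> 1" "\<And>m. m \<in> {1..n} \<Longrightarrow> \<bar>f m\<bar> \<le> C * (1 / K_freq j m)"
  shows "\<bar>\<Sum>m=1..n. f m\<bar> \<le> C * (\<Sum>m=1..n. 1 / K_freq j m)"
proof -
  have "\<bar>\<Sum>m=1..n. f m\<bar> \<le> (\<Sum>m=1..n. C * (1 / K_freq j m))" by (rule order_trans[OF sum_abs sum_mono]) (use assms in auto)
  then show ?thesis by (simp only: sum_distrib_left)
qed

lemma sin_K_pi: assumes "j \<ge> 1" shows "sin (K_freq j m * pi) = 0"
  unfolding K_freq_eq[OF assms] using sin_npi by blast

definition p1 :: "real \<Rightarrow> real \<Rightarrow> real" where
  "p1 K x = K * cos (K * x) * sin (2 * x) + 2 * sin (K * x) * cos (2 * x)"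

definition p2 :: "real \<Rightarrow> real \<Rightarrow> real" where
  "p2 K x = - (K\<^sup>2 + 4) * p_mode K x + 4 * K * cos (K * x) * cos (2 * x)"

definition p_primitive :: "real \<Rightarrow> real \<Rightarrow> real" where
  "p_primitive K x = sin ((K - 2) * x) / (2 * (K - 2)) - sin ((K + 2) * x) / (2 * (K + 2))"

lemma p_mode_deriv: "(p_mode K has_real_derivative p1 K x) (at x)"
  unfolding p_mode_def[abs_def] p1_def by (auto intro!: derivative_eq_intros simp: algebra_simps)

lemma p1_deriv: "(p1 K has_real_derivative p2 K x) (at x)"
  unfolding p1_def[abs_def] p2_def p_mode_def by (auto intro!: derivative_eq_intros simp: algebra_simps power2_eq_square)

lemma p_primitive_deriv:
  assumes "K > 2" shows "(p_primitive K has_real_derivative p_mode K x) (at x)"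
proof -
  have "(p_primitive K has_real_derivative (cos ((K - 2) * x) * (K - 2) / (2 * (K - 2)) - cos ((K + 2) * x) * (K + 2) / (2 * (K + 2)))) (at x)"
    unfolding p_primitive_def[abs_def] using assms by (auto intro!: derivative_eq_intros)
  moreover have "cos ((K - 2) * x) * (K - 2) / (2 * (K - 2)) - cos ((K + 2) * x) * (K + 2) / (2 * (K + 2)) = p_mode K x"
  proof -
    have "cos ((K - 2) * x) - cos ((K + 2) * x) = 2 * (sin (K * x) * sin (2 * x))" by (simp add: left_diff_distrib distrib_right cos_diff cos_add)
    moreover have "cos ((K - 2) * x) * (K - 2) / (2 * (K - 2)) = cos ((K - 2) * x) / 2"
      "cos ((K + 2) * x) * (K + 2) / (2 * (K + 2)) = cos ((K + 2) * x) / 2"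
    proof -
      have h: "c * L / (2 * L) = c / 2" if "L \<noteq> 0" for c L :: real using that by simp
      show "cos ((K - 2) * x) * (K - 2) / (2 * (K - 2)) = cos ((K - 2) * x) / 2" by (rule h) (use assms in simp)
      show "cos ((K + 2) * x) * (K + 2) / (2 * (K + 2)) = cos ((K + 2) * x) / 2" by (rule h) (use assms in simp)
    qed
    ultimately show ?thesis unfolding p_mode_def by linarith
  qed
  ultimately show ?thesis by simp
qed

definition phi1 :: "real \<Rightarrow> real" where "phi1 x = sin (2 * x)"
definition phi2 :: "real \<Rightarrow> real" where "phi2 x = 2 * cos (2 * x)"
definition phi_primitive :: "real \<Rightarrow> real" where "phi_primitive x = x / 2 - sin (2 * x) / 4"

lemma phi_deriv: "(phi has_real_derivative phi1 x) (at x)"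
  unfolding phi_def[abs_def] phi1_def by (auto intro!: derivative_eq_intros simp: sin_double)

lemma phi1_deriv: "(phi1 has_real_derivative phi2 x) (at x)"
  unfolding phi1_def[abs_def] phi2_def by (auto intro!: derivative_eq_intros)

lemma phi_primitive_deriv: "(phi_primitive has_real_derivative phi x) (at x)"
proof -
  have "(phi_primitive has_real_derivative 1 / 2 - cos (2 * x) * 2 / 4) (at x)"
    unfolding phi_primitive_def[abs_def] by (auto intro!: derivative_eq_intros)
  moreover have "1 / 2 - cos (2 * x) * 2 / 4 = phi x" by (simp add: phi_def cos_double_sin diff_divide_distrib)
  ultimately show ?thesis by simp
qed

lemma smooth_cmult: "smooth f \<Longrightarrow> smooth (\<lambda>x. c * (f x :: real))" by (rule smooth_mult[OF smooth_const])

lemma smooth_p_mode: "smooth (p_mode K)"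
  unfolding p_mode_def[abs_def] by (rule smooth_mult[OF smooth_sin smooth_sin])

lemma smooth_real_derivative:
  fixes f f' :: "real \<Rightarrow> real"
  assumes "smooth f" "\<And>x. (f has_real_derivative f' x) (at x)" shows "smooth f'"
proof -
  have "vector_derivative f (at x) = f' x" for x
    using assms(2)[of x] by (intro vector_derivative_at) (simp add: has_real_derivative_iff_has_vector_derivative)
  then show ?thesis using smooth_derivative(1)[OF assms(1)] by simp
qed

lemma smooth_p_primitive: "smooth (p_primitive K)"
proof -
  have "smooth (\<lambda>x. 1 / (2 * (K - 2)) * sin ((K - 2) * x) + - 1 / (2 * (K + 2)) * sin ((K + 2) * x))"
    by (rule smooth_add[OF smooth_cmult[OF smooth_sin] smooth_cmult[OF smooth_sin]])
  then show ?thesis by (simp add: p_primitive_def[abs_def])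
qed

lemma smooth_phi: "smooth phi" using smooth_mult[OF smooth_sin[of 1] smooth_sin[of 1]] by (simp add: phi_def[abs_def] power2_eq_square)

lemma smooth_phi_primitive: "smooth phi_primitive" using smooth_if_derivative[OF _ smooth_phi] phi_primitive_deriv
  by (simp add: has_real_derivative_iff_has_vector_derivative)

lemma p_ends: "p_mode K 0 = 0" "p_mode K pi = 0" by (simp_all add: p_mode_def)

lemma p1_ends: assumes "j \<ge> 1" shows "p1 (K_freq j m) 0 = 0" "p1 (K_freq j m) pi = 0" using sin_K_pi[OF assms] by (simp_all add: p1_def)

lemma p_primitive_ends: assumes "j \<ge> 1" shows "p_primitive (K_freq j m) 0 = 0" "p_primitive (K_freq j m) pi = 0" using sin_K_pi[OF assms]
  by (simp_all add: p_primitive_def left_diff_distrib distrib_right sin_diff sin_add)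

lemma phi_ends: "phi 0 = 0" "phi pi = 0" "phi1 0 = 0" "phi1 pi = 0" by (simp_all add: phi_def phi1_def)

lemma abs_sin_sin: "\<bar>sin a * sin b\<bar> \<le> (1::real)" and abs_cos_sin: "\<bar>cos a * sin b\<bar> \<le> (1::real)"
  and abs_sin_cos: "\<bar>sin a * cos b\<bar> \<le> (1::real)" and abs_cos_cos: "\<bar>cos a * cos b\<bar> \<le> (1::real)" by (simp_all add: abs_mult mult_le_one)

lemma p_mode_bound: "\<bar>p_mode K x\<bar> \<le> 1" by (simp add: p_mode_def abs_sin_sin)

lemma p1_bound: assumes "K \<ge> 2" shows "\<bar>p1 K x\<bar> \<le> 2 * K"
proof -
  have "\<bar>p1 K x\<bar> \<le> \<bar>K * (cos (K * x) * sin (2 * x))\<bar> + \<bar>2 * (sin (K * x) * cos (2 * x))\<bar>"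
    unfolding p1_def by (metis abs_triangle_ineq mult.assoc)
  also have "... \<le> K * 1 + 2 * 1" using assms unfolding abs_mult[of K] abs_mult[of 2] by (intro add_mono mult_mono abs_cos_sin abs_sin_cos) auto
  finally show ?thesis using assms by simp
qed

lemma p2_bound: assumes "K \<ge> 4" shows "\<bar>p2 K x\<bar> \<le> 3 * K\<^sup>2"
proof -
  have "\<bar>p2 K x\<bar> \<le> \<bar>(K\<^sup>2 + 4) * p_mode K x\<bar> + \<bar>(4 * K) * (cos (K * x) * cos (2 * x))\<bar>"
  proof -
    have "p2 K x = - ((K\<^sup>2 + 4) * p_mode K x) + (4 * K) * (cos (K * x) * cos (2 * x))"
      unfolding p2_def by (simp only: mult_minus_left mult.assoc)
    then show ?thesis using abs_triangle_ineq[of "- ((K\<^sup>2 + 4) * p_mode K x)" "(4 * K) * (cos (K * x) * cos (2 * x))"]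
      by (simp only: abs_minus_cancel)
  qed
  also have "... \<le> (K\<^sup>2 + 4) * 1 + (4 * K) * 1"
    using assms unfolding abs_mult[of "K\<^sup>2 + 4"] abs_mult[of "4 * K"] by (intro add_mono mult_mono p_mode_bound abs_cos_cos) auto
  also have "... \<le> 3 * K\<^sup>2"
  proof -
    have "4 * 4 \<le> K * K" "4 * K \<le> K * K" using assms by (intro mult_mono; simp)+
    moreover have "(K\<^sup>2 + 4) * 1 + (4 * K) * 1 = K * K + 4 + 4 * K" by (simp add: power2_eq_square)
    ultimately show ?thesis unfolding power2_eq_square by linarith
  qed
  finally show ?thesis .
qed

lemma p_primitive_bound: assumes "K \<ge> 4" shows "\<bar>p_primitive K x\<bar> \<le> 2 / K"
proof -
  have "\<bar>p_primitive K x\<bar> \<le> \<bar>sin ((K - 2) * x) / (2 * (K - 2))\<bar> + \<bar>sin ((K + 2) * x) / (2 * (K + 2))\<bar>"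
    unfolding p_primitive_def by (rule abs_triangle_ineq4)
  also have "... \<le> 1 / (2 * (K - 2)) + 1 / (2 * (K + 2))" using assms by (intro add_mono) (auto simp: abs_mult intro!: divide_right_mono)
  also have "... \<le> 1 / K + 1 / K" using assms by (intro add_mono divide_left_mono) auto
  finally show ?thesis by simp
qed

locale construction = smooth_bump +
  fixes \<epsilon> :: real and \<rho> :: "real \<Rightarrow> real"
  assumes \<epsilon>: "0 < \<epsilon>" "\<epsilon> \<le> 1"
    and \<rho>_test: "\<rho> \<in> test_functions {0<..<1}"
    and \<rho>_one: "s \<in> {1/4..1/2} \<Longrightarrow> \<rho> s = 1"
begin

abbreviation \<rho>' :: "real \<Rightarrow> real" where "\<rho>' t \<equiv> vector_derivative \<rho> (at t)"

lemma smooth_\<rho>: "smooth \<rho>" using \<rho>_test by (simp add: test_functions_def)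

lemma \<rho>_deriv: "(\<rho> has_real_derivative \<rho>' x) (at x)"
  using smooth_derivative(2)[OF smooth_\<rho>] by (simp add: has_real_derivative_iff_has_vector_derivative)

lemma \<rho>_zero: "\<rho> 0 = 0" using test_function_outside[OF \<rho>_test, of 0] by simp

definition R :: real where "R = (SOME R. R > 0 \<and> (\<forall>t. \<bar>\<rho> t\<bar> \<le> R \<and> \<bar>\<rho>' t\<bar> \<le> R \<and> \<bar>\<eta>' t\<bar> \<le> R))"

lemma R: "0 < R" "\<bar>\<rho> t\<bar> \<le> R" "\<bar>\<rho>' t\<bar> \<le> R" "\<bar>\<eta>' t\<bar> \<le> R"
proof -
  obtain A where A: "\<And>t. norm (\<rho> t) \<le> A" "A > 0" using test_function_bounded[OF \<rho>_test] by metis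
  obtain B where B: "\<And>t. norm (\<rho>' t) \<le> B" "B > 0" using test_function_bounded[OF test_function_derivative[OF \<rho>_test]] by metis
  obtain C where C: "\<And>t. \<bar>\<eta>' t\<bar> \<le> C" "C > 0" using \<eta>'_bounded by metis
  have "\<exists>R>0. \<forall>t. \<bar>\<rho> t\<bar> \<le> R \<and> \<bar>\<rho>' t\<bar> \<le> R \<and> \<bar>\<eta>' t\<bar> \<le> R"
  proof (intro exI[of _ "A + B + C"] conjI allI)
    fix t show "\<bar>\<rho> t\<bar> \<le> A + B + C" "\<bar>\<rho>' t\<bar> \<le> A + B + C" "\<bar>\<eta>' t\<bar> \<le> A + B + C" using A(1)[of t] B(1)[of t] C(1)[of t] A(2) B(2) C(2) by auto
  qed (use A(2) B(2) C(2) in auto)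
  from someI_ex[OF this[unfolded Bex_def]] show "0 < R" "\<bar>\<rho> t\<bar> \<le> R" "\<bar>\<rho>' t\<bar> \<le> R" "\<bar>\<eta>' t\<bar> \<le> R"
    unfolding R_def by auto
qed

abbreviation e :: "nat \<Rightarrow> real \<Rightarrow> real" where "e j t \<equiv> eta_resc \<eta> j t"

definition e' :: "nat \<Rightarrow> real \<Rightarrow> real" where "e' j t = \<eta>' ((t - tau j) / ell j) / ell j"

lemma e_range: "0 \<le> e j t" "e j t \<le> 1" using \<eta>_range by (auto simp: eta_resc_def)

lemma e_deriv: assumes "j \<ge> 1" shows "(e j has_real_derivative e' j t) (at t)"
proof -
  have "((\<lambda>t. \<eta> ((t - tau j) / ell j)) has_real_derivative \<eta>' ((t - tau j) / ell j) * (1 / ell j)) (at t)"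
    by (rule DERIV_chain2[OF \<eta>_deriv]) (use ell_pos[OF assms] in \<open>auto intro!: derivative_eq_intros\<close>)
  then show ?thesis by (simp add: eta_resc_def[abs_def] e'_def)
qed

lemma e'_bound: assumes "j \<ge> 1" shows "\<bar>e' j t\<bar> \<le> R * K_freq j m"
proof -
  have "\<bar>e' j t\<bar> = \<bar>\<eta>' ((t - tau j) / ell j)\<bar> * (1 / ell j)" using ell_pos[OF assms] by (simp add: e'_def)
  also have "... \<le> R * K_freq j m" using R K_freq_ell[OF assms] ell_pos[OF assms] by (intro mult_mono) (auto intro: less_imp_le)
  finally show ?thesis .
qed

definition inactive :: "nat \<Rightarrow> real \<Rightarrow> bool" where "inactive j t \<longleftrightarrow> \<not> (tau j < t \<and> t < tau (j + 1))"

lemma inactive: assumes "j \<ge> 1" "inactive j t" shows "e j t = 0" "e' j t = 0"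
proof -
  have "(t - tau j) / ell j \<le> 0 \<or> (t - tau j) / ell j \<ge> 1" using assms ell_pos[OF assms(1)] tau_Suc[of j] by (auto simp: inactive_def field_simps)
  then show "e j t = 0" "e' j t = 0" using \<eta>_zero \<eta>'_zero by (auto simp: eta_resc_def e'_def)
qed

lemma e_\<rho>: assumes "j \<ge> 1" shows "\<rho> t * e j t = e j t"
proof (cases "inactive j t")
  case True then show ?thesis using inactive[OF assms] by simp
next
  case False
  then have "1/4 \<le> t" "t \<le> 5/16" using tau_ge[OF assms] tau_less[of "j + 1"] by (auto simp: inactive_def)
  then show ?thesis using \<rho>_one[of t] by simp
qed

lemma active_unique:
  assumes "i \<ge> 1" "j \<ge> 1" "\<not> inactive i t" "\<not> inactive j t" shows "i = j"
proof (rule ccontr)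
  assume "i \<noteq> j"
  then consider "i + 1 \<le> j" | "j + 1 \<le> i" by linarith
  then show False by cases (use assms tau_mono[of "i + 1" j] tau_mono[of "j + 1" i] in \<open>auto simp: inactive_def\<close>)
qed

text \<open>At any time at most one group of modes is switched on.\<close>

definition act :: "real \<Rightarrow> nat" where
  "act t = (if \<exists>j\<ge>1. \<not> inactive j t then SOME j. j \<ge> 1 \<and> \<not> inactive j t else 1)"

lemma act: "act t \<ge> 1" "j \<ge> 1 \<Longrightarrow> j \<noteq> act t \<Longrightarrow> inactive j t"
proof -
  show *: "act t \<ge> 1"
  proof (cases "\<exists>j\<ge>1. \<not> inactive j t")
    case True
    then show ?thesis using someI_ex[OF True] by (simp add: act_def)
  next
    case False
    show ?thesis unfolding act_def if_not_P[OF False] by simp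
  qed
  assume j: "j \<ge> 1" "j \<noteq> act t"
  show "inactive j t"
  proof (rule ccontr)
    assume n: "\<not> inactive j t"
    then have ex: "\<exists>j\<ge>1. \<not> inactive j t" using j by blast
    have "\<not> inactive (act t) t" using someI_ex[OF ex] ex by (simp add: act_def)
    from active_unique[OF j(1) * n this] j(2) show False by simp
  qed
qed

text \<open>Away from these times the active group is locally constant.\<close>

definition bad :: "real set" where "bad = insert (5/16) (tau ` {1..})"

lemma AE_good: "AE t in unit_time. t \<notin> bad"
proof -
  have "countable bad" by (simp add: bad_def)
  then have "AE t in lebesgue. t \<notin> bad" by (intro AE_not_in null_sets_completionI countable_imp_null_set_lborel)
  then show ?thesis by (rule AE_lebesgue_on) simp
qed

lemma act_locally_constant:
  assumes "t \<notin> bad" shows "eventually (\<lambda>s. \<forall>j\<ge>1. j \<noteq> act t \<longrightarrow> inactive j s) (nhds t)"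
proof -
  consider (early) "t < 1/4" | (late) "t > 5/16" | (mid) "1/4 < t" "t < 5/16" using assms tau_one by (force simp: bad_def)
  then show ?thesis
  proof cases
    case early
    then have "eventually (\<lambda>s. s < 1/4) (nhds t)" using eventually_nhds_in_open[of "{..<1/4}" t] by simp
    then show ?thesis
    proof eventually_elim
      case (elim s)
      show ?case using elim tau_ge by (fastforce simp: inactive_def)
    qed
  next
    case late
    then have "eventually (\<lambda>s. s > 5/16) (nhds t)" using eventually_nhds_in_open[of "{5/16<..}" t] by simp
    then show ?thesis
    proof eventually_elim
      case (elim s)
      have "tau (j + 1) < s" if "j \<ge> 1" for j using tau_less[of "j + 1"] elim by simp
      then show ?case by (fastforce simp: inactive_def)
    qed
  next
    case mid
    define P where "P j \<longleftrightarrow> j \<ge> 1 \<and> t < tau (j + 1)" for j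
    obtain n where n: "real n > 1 / (5/16 - t)" using reals_Archimedean2 by blast
    have "n \<ge> 1" using n mid by (cases n) auto
    have "1 / (16 * real (n + 1)) < 5/16 - t"
    proof -
      have "1 / (5/16 - t) < 16 * real (n + 1)" using n by simp
      then show ?thesis using mid by (simp add: divide_less_eq mult.commute less_divide_eq)
    qed
    then have "P n" using \<open>n \<ge> 1\<close> by (simp add: P_def tau_def)
    define j where "j = (LEAST j. P j)"
    have Pj: "P j" unfolding j_def by (rule LeastI[of P n, OF \<open>P n\<close>])
    have "tau j < t"
    proof (cases "j = 1")
      case True then show ?thesis using mid tau_one by simp
    next
      case False
      then have "j - 1 \<ge> 1" "j - 1 < j" using Pj by (auto simp: P_def)
      then have "\<not> P (j - 1)" using not_less_Least unfolding j_def by blast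
      then have "tau j \<le> t" using \<open>j - 1 \<ge> 1\<close> by (simp add: P_def)
      moreover have "t \<noteq> tau j" using assms Pj by (auto simp: bad_def P_def)
      ultimately show ?thesis by simp
    qed
    then have "t \<in> {tau j<..<tau (j + 1)}" using Pj by (simp add: P_def)
    then have ev: "eventually (\<lambda>s. s \<in> {tau j<..<tau (j + 1)}) (nhds t)" by (intro eventually_nhds_in_open) auto
    have "j = act t"
    proof (rule ccontr)
      assume "j \<noteq> act t"
      then have "inactive j t" using act(2) Pj by (auto simp: P_def)
      then show False using \<open>t \<in> {tau j<..<tau (j + 1)}\<close> by (simp add: inactive_def)
    qed
    from ev show ?thesis
    proof eventually_elim
      case (elim s)
      have "inactive i s" if i: "i \<ge> 1" "i \<noteq> act t" for i
      proof (rule ccontr)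
        assume "\<not> inactive i s"
        moreover have "\<not> inactive j s" using elim by (simp add: inactive_def)
        ultimately have "i = j" using active_unique[of i j s] i Pj by (simp add: P_def)
        then show False using i \<open>j = act t\<close> by simp
      qed
      then show ?case by blast
    qed
  qed
qed

lemma infsum_single_group:
  fixes f :: "nat \<Rightarrow> real"
  assumes "J \<ge> 1" "\<And>j. j \<ge> 1 \<Longrightarrow> j \<noteq> J \<Longrightarrow> f j = 0" shows "(\<Sum>\<^sub>\<infinity>j\<in>{1..}. f j) = f J"
proof -
  have "(\<Sum>\<^sub>\<infinity>j\<in>{1..}. f j) = (\<Sum>\<^sub>\<infinity>j\<in>{J}. f j)" by (rule infsum_cong_neutral) (use assms in auto)
  then show ?thesis by simp
qed

end

section \<open>The explicit solution and its forcing\<close>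

context construction
begin

definition b :: "nat \<Rightarrow> nat \<Rightarrow> real \<Rightarrow> real" where
  "b j m t = e j t * (1 / K_freq j m) * sin (theta j m t)"

definition b' :: "nat \<Rightarrow> nat \<Rightarrow> real \<Rightarrow> real" where
  "b' j m t = (1 / K_freq j m) * (e' j t * sin (theta j m t) + e j t * ((K_freq j m)\<^sup>2 * cos (theta j m t)))"

abbreviation y :: "nat \<Rightarrow> nat \<Rightarrow> real \<Rightarrow> real" where "y \<equiv> y_amp \<epsilon> \<eta>"

definition y' :: "nat \<Rightarrow> nat \<Rightarrow> real \<Rightarrow> real" where
  "y' j m t = - (\<epsilon> / (2 * (K_freq j m)\<^sup>2)) *
     (e' j t * (sin (theta j m t) - cos (theta j m t)) + e j t * ((K_freq j m)\<^sup>2 * (cos (theta j m t) + sin (theta j m t))))"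

lemma theta_deriv: "(theta j m has_real_derivative (K_freq j m)\<^sup>2) (at t)"
  unfolding theta_def[abs_def] by (auto intro!: derivative_eq_intros)

lemma b_deriv: assumes "j \<ge> 1" shows "(b j m has_real_derivative b' j m t) (at t)"
  unfolding b_def[abs_def] b'_def by (rule derivative_eq_intros e_deriv[OF assms] theta_deriv refl)+ (simp add: algebra_simps)

lemma y_deriv: assumes "j \<ge> 1" shows "(y j m has_real_derivative y' j m t) (at t)"
proof -
  have "((\<lambda>t. sin (theta j m t) - cos (theta j m t)) has_real_derivative (K_freq j m)\<^sup>2 * (cos (theta j m t) + sin (theta j m t))) (at t)"
    by (rule derivative_eq_intros theta_deriv refl)+ (simp add: algebra_simps)
  from DERIV_cmult[OF DERIV_mult[OF e_deriv[OF assms] this], of "- (\<epsilon> / (2 * (K_freq j m)\<^sup>2))"]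
  have "((\<lambda>t. - (\<epsilon> / (2 * (K_freq j m)\<^sup>2)) * (e j t * (sin (theta j m t) - cos (theta j m t)))) has_real_derivative y' j m t) (at t)"
    by (rule DERIV_cong) (simp add: y'_def mult.commute)
  then show ?thesis unfolding y_amp_def[abs_def] mult.assoc .
qed

lemma inactive_modes:
  assumes "j \<ge> 1" "inactive j t" shows "b j m t = 0" "y j m t = 0" "y' j m t = 0" using inactive[OF assms] by (simp_all add: b_def y_amp_def y'_def)

lemma sin_minus_cos_bound: "\<bar>sin x - cos x\<bar> \<le> (2::real)" and cos_plus_sin_bound: "\<bar>cos x + sin x\<bar> \<le> (2::real)"
  using abs_sin_le_one[of x] abs_cos_le_one[of x] by linarith+

lemma b_bound: assumes "j \<ge> 1" shows "\<bar>b j m t\<bar> \<le> 1 * (1 / K_freq j m)"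
proof -
  have "\<bar>b j m t\<bar> = (e j t * \<bar>sin (theta j m t)\<bar>) * (1 / K_freq j m)"
    using K_freq_pos[OF assms, of m] e_range(1)[of j t] by (simp add: b_def abs_mult)
  also have "... \<le> 1 * (1 / K_freq j m)" using K_freq_pos[OF assms, of m] e_range[of j t] by (intro mult_right_mono mult_le_one) auto
  finally show ?thesis .
qed

lemma y_bound: assumes "j \<ge> 1" shows "\<bar>y j m t\<bar> \<le> 1 / (K_freq j m)\<^sup>2"
proof -
  have "\<bar>y j m t\<bar> = (\<epsilon> * (e j t * \<bar>sin (theta j m t) - cos (theta j m t)\<bar>) / 2) * (1 / (K_freq j m)\<^sup>2)"
    using \<epsilon> e_range(1)[of j t] by (simp add: y_amp_def abs_mult)
  also have "... \<le> 1 * (1 / (K_freq j m)\<^sup>2)"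
  proof (rule mult_right_mono)
    have "e j t * \<bar>sin (theta j m t) - cos (theta j m t)\<bar> \<le> 1 * 2" using e_range[of j t] by (intro mult_mono sin_minus_cos_bound) auto
    then have "\<epsilon> * (e j t * \<bar>sin (theta j m t) - cos (theta j m t)\<bar>) \<le> 1 * 2" using \<epsilon> e_range[of j t] by (intro mult_mono) auto
    then show "\<epsilon> * (e j t * \<bar>sin (theta j m t) - cos (theta j m t)\<bar>) / 2 \<le> 1" by simp
  qed simp
  finally show ?thesis by simp
qed

lemma b'_bound: assumes "j \<ge> 1" shows "\<bar>b' j m t\<bar> \<le> (R + 1) * K_freq j m"
proof -
  define k where "k = K_freq j m"
  have k: "k \<ge> 32" using K_freq_ge[OF assms] by (simp add: k_def)
  have "\<bar>e' j t * sin (theta j m t) + e j t * (k\<^sup>2 * cos (theta j m t))\<bar> \<le> R * k * 1 + 1 * (k\<^sup>2 * 1)"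
  proof (rule order_trans[OF abs_triangle_ineq add_mono]; unfold abs_mult)
    show "\<bar>e' j t\<bar> * \<bar>sin (theta j m t)\<bar> \<le> R * k * 1"
      using e'_bound[OF assms, of t m] k R(1) unfolding k_def[symmetric] by (intro mult_mono[of _ "R * k" _ 1]) simp_all
    have "\<bar>k\<^sup>2\<bar> * \<bar>cos (theta j m t)\<bar> \<le> k\<^sup>2 * 1" by (rule mult_mono) simp_all
    then show "\<bar>e j t\<bar> * (\<bar>k\<^sup>2\<bar> * \<bar>cos (theta j m t)\<bar>) \<le> 1 * (k\<^sup>2 * 1)" using e_range[of j t] by (intro mult_mono[of _ 1]) simp_all
  qed
  then have "(1 / k) * \<bar>e' j t * sin (theta j m t) + e j t * (k\<^sup>2 * cos (theta j m t))\<bar> \<le> (1 / k) * (R * k + k\<^sup>2)"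
    using k by (intro mult_left_mono) auto
  also have "... = R + k" using k by (simp add: field_simps power2_eq_square)
  also have "... \<le> (R + 1) * k" using k R(1) mult_left_mono[of 1 k R] by (simp add: distrib_right)
  finally show ?thesis using k by (simp add: b'_def k_def[symmetric] abs_mult)
qed

lemma y'_remainder:
  assumes "j \<ge> 1"
  shows "\<bar>- (\<epsilon> / (2 * (K_freq j m)\<^sup>2)) * (e' j t * (sin (theta j m t) - cos (theta j m t)))\<bar> \<le> R * (1 / K_freq j m)"
proof -
  define k where "k = K_freq j m"
  have k: "k \<ge> 32" using K_freq_ge[OF assms] by (simp add: k_def)
  have "\<bar>e' j t\<bar> * \<bar>sin (theta j m t) - cos (theta j m t)\<bar> \<le> (R * k) * 2"
    using e'_bound[OF assms, of t m] k R(1) by (intro mult_mono sin_minus_cos_bound) (auto simp: k_def)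
  then have "(\<epsilon> / (2 * k\<^sup>2)) * (\<bar>e' j t\<bar> * \<bar>sin (theta j m t) - cos (theta j m t)\<bar>) \<le> (1 / (2 * k\<^sup>2)) * ((R * k) * 2)"
    using \<epsilon> k R(1) by (intro mult_mono[of _ "1 / (2 * k\<^sup>2)"] divide_right_mono) auto
  also have "... = R * (1 / k)" using k by (simp add: power2_eq_square)
  finally show ?thesis using \<epsilon> k by (simp add: k_def[symmetric] abs_mult)
qed

lemma y'_bound: assumes "j \<ge> 1" shows "\<bar>y' j m t\<bar> \<le> R + 1"
proof -
  define k where "k = K_freq j m"
  have k: "k \<ge> 32" using K_freq_ge[OF assms] by (simp add: k_def)
  have "y' j m t = - (\<epsilon> / (2 * k\<^sup>2)) * (e' j t * (sin (theta j m t) - cos (theta j m t)))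
     + - ((\<epsilon> / 2) * (e j t * (cos (theta j m t) + sin (theta j m t))))" using k by (simp add: y'_def k_def[symmetric] distrib_left)
  moreover have "\<bar>- (\<epsilon> / (2 * k\<^sup>2)) * (e' j t * (sin (theta j m t) - cos (theta j m t)))\<bar> \<le> R"
  proof -
    have "R * (1 / k) \<le> R * 1" using k R(1) by (intro mult_left_mono) auto
    then show ?thesis using y'_remainder[OF assms, of m t] unfolding k_def[symmetric] by linarith
  qed
  moreover have "\<bar>(\<epsilon> / 2) * (e j t * (cos (theta j m t) + sin (theta j m t)))\<bar> \<le> (1/2) * (1 * 2)"
    unfolding abs_mult using \<epsilon> e_range[of j t] by (intro mult_mono cos_plus_sin_bound) auto
  ultimately show ?thesis by linarith
qed

definition u :: "nat \<Rightarrow> real \<Rightarrow> real \<Rightarrow> real" where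
  "u J t x = \<rho> t * phi x + (\<Sum>m=1..J. y J m t * p_mode (K_freq J m) x)"

definition ut :: "nat \<Rightarrow> real \<Rightarrow> real \<Rightarrow> real" where
  "ut J t x = \<rho>' t * phi x + (\<Sum>m=1..J. y' J m t * p_mode (K_freq J m) x)"

definition ux :: "nat \<Rightarrow> real \<Rightarrow> real \<Rightarrow> real" where
  "ux J t x = \<rho> t * phi1 x + (\<Sum>m=1..J. y J m t * p1 (K_freq J m) x)"

definition uxx :: "nat \<Rightarrow> real \<Rightarrow> real \<Rightarrow> real" where
  "uxx J t x = \<rho> t * phi2 x + (\<Sum>m=1..J. y J m t * p2 (K_freq J m) x)"

definition bt :: "nat \<Rightarrow> real \<Rightarrow> real \<Rightarrow> real" where
  "bt J t x = (\<Sum>m=1..J. b J m t * cos (K_freq J m * x))"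

definition btx :: "nat \<Rightarrow> real \<Rightarrow> real \<Rightarrow> real" where
  "btx J t x = (\<Sum>m=1..J. b J m t * (- (K_freq J m) * sin (K_freq J m * x)))"

definition flux :: "nat \<Rightarrow> real \<Rightarrow> real \<Rightarrow> real" where
  "flux J t x = (1 + \<epsilon> * bt J t x) * ux J t x"

definition fluxx :: "nat \<Rightarrow> real \<Rightarrow> real \<Rightarrow> real" where
  "fluxx J t x = (1 + \<epsilon> * bt J t x) * uxx J t x + \<epsilon> * btx J t x * ux J t x"

definition f :: "nat \<Rightarrow> real \<Rightarrow> real \<Rightarrow> real" where
  "f J t x = ut J t x - fluxx J t x"

lemma u_sol_eq: "u_sol \<epsilon> \<eta> \<rho> t x = complex_of_real (u (act t) t x)"
  unfolding u_sol_def u_def M_count_def by (subst infsum_single_group[OF act(1)]) (use inactive_modes act(2) in auto)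

lemma beta_eq: "beta \<eta> t x = bt (act t) t x"
  unfolding beta_def bt_def M_count_def by (subst infsum_single_group[OF act(1)]) (use inactive act(2) in \<open>auto simp: b_def\<close>)

lemma coeff_eq: "coeff_a \<epsilon> \<eta> t x = 1 + \<epsilon> * bt (act t) t x" by (simp add: coeff_a_def beta_eq)

lemma switch_group:
  assumes J: "J \<ge> 1" and in_J: "\<And>j. j \<ge> 1 \<Longrightarrow> j \<noteq> J \<Longrightarrow> inactive j t"
  shows "u (act t) t x = u J t x" "ut (act t) t x = ut J t x" "bt (act t) t x = bt J t x" "f (act t) t x = f J t x"
    "ux (act t) t x = ux J t x"
proof -
  have "u (act t) t x = u J t x \<and> ut (act t) t x = ut J t x \<and> bt (act t) t x = bt J t x \<and> f (act t) t x = f J t x \<and> ux (act t) t x = ux J t x"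
  proof (cases "J = act t")
    case False
    then have i: "inactive J t" "inactive (act t) t" using J act in_J by auto
    show ?thesis
      unfolding u_def ut_def bt_def f_def fluxx_def ux_def uxx_def btx_def using inactive_modes[OF J i(1)] inactive_modes[OF act(1) i(2)] by simp
  qed simp
  then show "u (act t) t x = u J t x" "ut (act t) t x = ut J t x" "bt (act t) t x = bt J t x" "f (act t) t x = f J t x"
    "ux (act t) t x = ux J t x" by auto
qed

lemma u_x_deriv: "(u J t has_real_derivative ux J t x) (at x)"
  unfolding u_def[abs_def] ux_def by (intro DERIV_add DERIV_cmult phi_deriv DERIV_sum p_mode_deriv)

lemma ux_x_deriv: "(ux J t has_real_derivative uxx J t x) (at x)"
  unfolding ux_def[abs_def] uxx_def by (intro DERIV_add DERIV_cmult phi1_deriv DERIV_sum p1_deriv)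

lemma bt_x_deriv: "(bt J t has_real_derivative btx J t x) (at x)"
  unfolding bt_def[abs_def] btx_def by (intro DERIV_sum DERIV_cmult) (auto intro!: derivative_eq_intros)

lemma flux_x_deriv: "(flux J t has_real_derivative fluxx J t x) (at x)"
proof -
  have "((\<lambda>x. 1 + \<epsilon> * bt J t x) has_real_derivative \<epsilon> * btx J t x) (at x)" using DERIV_add[OF DERIV_const DERIV_cmult[OF bt_x_deriv]] by simp
  from DERIV_mult[OF this ux_x_deriv] show ?thesis
    unfolding flux_def[abs_def] fluxx_def by (rule DERIV_cong) (simp add: algebra_simps)
qed

lemma smooth_u: "smooth (u J t)"
  unfolding u_def[abs_def] by (rule smooth_add[OF smooth_cmult[OF smooth_phi] smooth_sum[OF smooth_cmult[OF smooth_p_mode]]])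

lemma smooth_ut: "smooth (ut J t)"
  unfolding ut_def[abs_def] by (rule smooth_add[OF smooth_cmult[OF smooth_phi] smooth_sum[OF smooth_cmult[OF smooth_p_mode]]])

lemma smooth_ux: "smooth (ux J t)" by (rule smooth_real_derivative[OF smooth_u u_x_deriv])

lemma smooth_bt: "smooth (bt J t)"
  unfolding bt_def[abs_def] by (rule smooth_sum[OF smooth_cmult[OF smooth_cos]])

lemma smooth_flux: "smooth (flux J t)"
  unfolding flux_def[abs_def] by (rule smooth_mult[OF smooth_add[OF smooth_const smooth_cmult[OF smooth_bt]] smooth_ux])

lemma smooth_fluxx: "smooth (fluxx J t)" by (rule smooth_real_derivative[OF smooth_flux flux_x_deriv])

lemma smooth_f: "smooth (f J t)" using smooth_add[OF smooth_ut smooth_cmult[OF smooth_fluxx, of "-1"], of J t J t] by (simp add: f_def[abs_def])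

lemma u_ends: "u J t 0 = 0" "u J t pi = 0" by (simp_all add: u_def phi_ends p_ends)

lemma ux_ends: assumes "J \<ge> 1" shows "ux J t 0 = 0" "ux J t pi = 0" by (simp_all add: ux_def phi_ends p1_ends[OF assms])

lemma flux_ends: assumes "J \<ge> 1" shows "flux J t 0 = 0" "flux J t pi = 0" by (simp_all add: flux_def ux_ends[OF assms])

text \<open>The time derivative of each mode, the second space derivative of the mode and the product of the
  oscillating coefficient with \<open>\<phi>'\<close> are individually of order one. They cancel, because the
  amplitude solves the resonant equation \<open>y' + K\<^sup>2 y = - \<epsilon> sin \<theta>\<close> up to the derivative of the
  time cutoff.\<close>

lemma resonance:
  assumes "j \<ge> 1"
  shows "y' j m t + (K_freq j m)\<^sup>2 * y j m t + \<epsilon> * e j t * sin (theta j m t)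
    = - (\<epsilon> / (2 * (K_freq j m)\<^sup>2)) * (e' j t * (sin (theta j m t) - cos (theta j m t)))"
proof -
  define k where "k = K_freq j m"
  have "k \<noteq> 0" using K_freq_pos[OF assms, of m] by (simp add: k_def)
  then have "y' j m t = - (\<epsilon> / (2 * k\<^sup>2)) * (e' j t * (sin (theta j m t) - cos (theta j m t)))
     - (\<epsilon> / 2) * (e j t * (cos (theta j m t) + sin (theta j m t)))"
    "k\<^sup>2 * y j m t = - (\<epsilon> / 2) * (e j t * (sin (theta j m t) - cos (theta j m t)))" by (simp_all add: y'_def y_amp_def k_def[symmetric] distrib_left)
  then show ?thesis unfolding k_def[symmetric] by (simp add: algebra_simps)
qed

text \<open>The forcing after the cancellation of the terms of order one. The coefficient oscillates only where
  \<open>\<rho> = 1\<close>, so \<open>\<rho>\<close> disappears from the product of the oscillation with \<open>\<phi>'\<close>.\<close>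

lemma f_eq:
  assumes J: "J \<ge> 1"
  shows "f J t x = \<rho>' t * phi x - \<rho> t * phi2 x
    + (\<Sum>m=1..J. - (\<epsilon> / (2 * (K_freq J m)\<^sup>2)) * (e' J t * (sin (theta J m t) - cos (theta J m t))) * p_mode (K_freq J m) x)
    + (\<Sum>m=1..J. y J m t * (4 * p_mode (K_freq J m) x - 4 * K_freq J m * cos (K_freq J m * x) * cos (2 * x)))
    - \<epsilon> * bt J t x * uxx J t x
    + \<epsilon> * (e J t * (\<Sum>m=1..J. sin (theta J m t) * sin (K_freq J m * x))) * (\<Sum>m=1..J. y J m t * p1 (K_freq J m) x)"
proof -
  let ?k = "K_freq J"
  define G where "G = (\<Sum>m=1..J. sin (theta J m t) * sin (?k m * x))"
  define Y where "Y = (\<Sum>m=1..J. y J m t * p1 (?k m) x)"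
  have K_ne: "?k m \<noteq> 0" for m using K_freq_pos[OF J, of m] by simp
  have btx: "btx J t x = - (e J t * G)"
  proof -
    have "btx J t x = (\<Sum>m=1..J. - (e J t * (sin (theta J m t) * sin (?k m * x))))"
      unfolding btx_def by (rule sum.cong) (use K_ne in \<open>simp_all add: b_def\<close>)
    then show ?thesis by (simp add: G_def sum_negf sum_distrib_left)
  qed
  have "\<epsilon> * btx J t x * ux J t x = - (\<epsilon> * ((\<rho> t * e J t) * (G * phi1 x)) + \<epsilon> * (e J t * G) * Y)"
    unfolding btx ux_def Y_def[symmetric] by (simp add: algebra_simps)
  then have 1: "\<epsilon> * btx J t x * ux J t x = - ((\<Sum>m=1..J. \<epsilon> * e J t * sin (theta J m t) * p_mode (?k m) x) + \<epsilon> * (e J t * G) * Y)"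
    unfolding e_\<rho>[OF J] by (simp add: G_def phi1_def p_mode_def sum_distrib_left sum_distrib_right mult_ac)
  have 2: "uxx J t x = \<rho> t * phi2 x - (\<Sum>m=1..J. (?k m)\<^sup>2 * y J m t * p_mode (?k m) x)
     - (\<Sum>m=1..J. y J m t * (4 * p_mode (?k m) x - 4 * ?k m * cos (?k m * x) * cos (2 * x)))"
  proof -
    have "y J m t * p2 (?k m) x = - ((?k m)\<^sup>2 * y J m t * p_mode (?k m) x)
      - y J m t * (4 * p_mode (?k m) x - 4 * ?k m * cos (?k m * x) * cos (2 * x))" for m by (simp add: p2_def algebra_simps)
    then show ?thesis unfolding uxx_def by (simp only: sum_subtractf sum_negf)
  qed
  have "(\<Sum>m=1..J. y' J m t * p_mode (?k m) x) + (\<Sum>m=1..J. (?k m)\<^sup>2 * y J m t * p_mode (?k m) x)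
     + (\<Sum>m=1..J. \<epsilon> * e J t * sin (theta J m t) * p_mode (?k m) x)
    = (\<Sum>m=1..J. - (\<epsilon> / (2 * (?k m)\<^sup>2)) * (e' J t * (sin (theta J m t) - cos (theta J m t))) * p_mode (?k m) x)"
    unfolding sum.distrib[symmetric] distrib_right[symmetric] resonance[OF J] ..
  then show ?thesis
    unfolding f_def fluxx_def ut_def 1 G_def[symmetric] Y_def[symmetric] distrib_right mult_1_left using 2 by linarith
qed

lemma bt_bound: assumes "J \<ge> 1" shows "\<bar>bt J t x\<bar> \<le> (\<Sum>m=1..J. 1 / K_freq J m)"
proof -
  have "\<bar>bt J t x\<bar> \<le> 1 * (\<Sum>m=1..J. 1 / K_freq J m)"
    unfolding bt_def
  proof (rule sum_le_scaled_inverse_K[OF assms])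
    fix m
    have "\<bar>b J m t\<bar> * \<bar>cos (K_freq J m * x)\<bar> \<le> (1 * (1 / K_freq J m)) * 1"
      using b_bound[OF assms, of m t] K_freq_pos[OF assms, of m] by (intro mult_mono) auto
    then show "\<bar>b J m t * cos (K_freq J m * x)\<bar> \<le> 1 * (1 / K_freq J m)" by (simp add: abs_mult)
  qed
  then show ?thesis by simp
qed

lemma y_mult_bound:
  assumes J: "J \<ge> 1" and g: "\<bar>g\<bar> \<le> C * K_freq J m" shows "\<bar>y J m t * g\<bar> \<le> C * (1 / K_freq J m)"
proof -
  have "\<bar>y J m t\<bar> * \<bar>g\<bar> \<le> (1 / (K_freq J m)\<^sup>2) * (C * K_freq J m)" using y_bound[OF J, of m t] g by (intro mult_mono) auto
  also have "... = C * (1 / K_freq J m)" using K_freq_pos[OF J, of m] by (simp add: power2_eq_square)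
  finally show ?thesis by (simp add: abs_mult)
qed

lemma phi_bounds: "\<bar>phi x\<bar> \<le> 1" "\<bar>phi1 x\<bar> \<le> 1" "\<bar>phi2 x\<bar> \<le> 2"
proof -
  have "(sin x)\<^sup>2 \<le> 1" using sin_cos_squared_add[of x] zero_le_power2[of "cos x"] by linarith
  then show "\<bar>phi x\<bar> \<le> 1" by (simp add: phi_def)
qed (simp_all add: phi1_def phi2_def abs_mult)

lemma K_ge_2: "j \<ge> 1 \<Longrightarrow> 2 \<le> K_freq j m" using K_freq_ge[of j m] by simp

lemma u_bound: assumes J: "J \<ge> 1" shows "\<bar>u J t x\<bar> \<le> R + 1" "\<bar>ux J t x\<bar> \<le> R + 1"
proof -
  have s1: "\<bar>\<Sum>m=1..J. y J m t * p_mode (K_freq J m) x\<bar> \<le> 1 * (\<Sum>m=1..J. 1 / K_freq J m)"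
  proof (rule sum_le_scaled_inverse_K[OF J], rule y_mult_bound[OF J])
    show "\<bar>p_mode (K_freq J m) x\<bar> \<le> 1 * K_freq J m" for m using p_mode_bound[of "K_freq J m" x] K_freq_ge[OF J, of m] by linarith
  qed
  have s2: "\<bar>\<Sum>m=1..J. y J m t * p1 (K_freq J m) x\<bar> \<le> 2 * (\<Sum>m=1..J. 1 / K_freq J m)"
    by (rule sum_le_scaled_inverse_K[OF J], rule y_mult_bound[OF J], rule p1_bound, rule K_ge_2[OF J])
  have r: "\<bar>\<rho> t * g\<bar> \<le> R" if "\<bar>g\<bar> \<le> 1" for g using mult_mono[OF R(2)[of t] that] R(1) by (simp add: abs_mult)
  show "\<bar>u J t x\<bar> \<le> R + 1" unfolding u_def using r[OF phi_bounds(1), of x] s1 sum_inverse_K_le_1[OF J, of J] by linarith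
  show "\<bar>ux J t x\<bar> \<le> R + 1" unfolding ux_def using r[OF phi_bounds(2), of x] s2 sum_inverse_K_le_1[OF J, of J] by linarith
qed

text \<open>The products of two sums over the modes could grow with the number \<open>j\<close> of modes; the frequencies of the group exceed a multiple of \<open>j\<^sup>2\<close>, so \<open>j \<Sum> 1 / K \<le> 1\<close> absorbs this.\<close>

lemma f_bound: assumes J: "J \<ge> 1" shows "\<bar>f J t x\<bar> \<le> 8 * R + 20"
proof -
  let ?k = "K_freq J" and ?S = "\<Sum>m=1..J. 1 / K_freq J m"
  have S: "0 \<le> ?S" "?S \<le> 1/2" "?S * real J \<le> 1"
    using sum_inverse_K_le_1[OF J, of J] sum_inverse_K_times[OF J, of J] K_freq_pos[OF J, THEN less_imp_le] by (simp_all add: sum_nonneg)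
  have t1: "\<bar>\<rho>' t * phi x\<bar> \<le> R * 1" "\<bar>\<rho> t * phi2 x\<bar> \<le> R * 2"
    unfolding abs_mult using R phi_bounds by (intro mult_mono; simp)+
  have t2: "\<bar>\<Sum>m=1..J. - (\<epsilon> / (2 * (?k m)\<^sup>2)) * (e' J t * (sin (theta J m t) - cos (theta J m t))) * p_mode (?k m) x\<bar> \<le> R * ?S"
  proof (rule sum_le_scaled_inverse_K[OF J])
    fix m
    have "\<bar>- (\<epsilon> / (2 * (?k m)\<^sup>2)) * (e' J t * (sin (theta J m t) - cos (theta J m t)))\<bar> * \<bar>p_mode (?k m) x\<bar> \<le> (R * (1 / ?k m)) * 1"
      using y'_remainder[OF J] R(1) K_freq_pos[OF J, of m] by (intro mult_mono p_mode_bound) auto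
    then show "\<bar>- (\<epsilon> / (2 * (?k m)\<^sup>2)) * (e' J t * (sin (theta J m t) - cos (theta J m t))) * p_mode (?k m) x\<bar> \<le> R * (1 / ?k m)"
      by (simp only: abs_mult mult_1_right)
  qed
  have t3: "\<bar>\<Sum>m=1..J. y J m t * (4 * p_mode (?k m) x - 4 * ?k m * cos (?k m * x) * cos (2 * x))\<bar> \<le> 8 * ?S"
  proof (rule sum_le_scaled_inverse_K[OF J], rule y_mult_bound[OF J])
    fix m
    have "\<bar>?k m * (cos (?k m * x) * cos (2 * x))\<bar> \<le> ?k m * 1"
      unfolding abs_mult[of "?k m"] using K_freq_pos[OF J, of m] by (intro mult_mono abs_cos_cos) auto
    then show "\<bar>4 * p_mode (?k m) x - 4 * ?k m * cos (?k m * x) * cos (2 * x)\<bar> \<le> 8 * ?k m"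
      using p_mode_bound[of "?k m" x] K_freq_ge[OF J, of m] by (simp add: mult.assoc)
  qed
  have uxx: "\<bar>uxx J t x\<bar> \<le> 2 * R + 3 * real J"
  proof -
    have "\<bar>\<Sum>m=1..J. y J m t * p2 (?k m) x\<bar> \<le> (\<Sum>m=1..J. 3)"
    proof (rule order_trans[OF sum_abs sum_mono])
      fix m
      have "\<bar>y J m t\<bar> * \<bar>p2 (?k m) x\<bar> \<le> (1 / (?k m)\<^sup>2) * (3 * (?k m)\<^sup>2)"
        using y_bound[OF J, of m t] K_freq_ge[OF J, of m] by (intro mult_mono p2_bound) auto
      then show "\<bar>y J m t * p2 (?k m) x\<bar> \<le> 3" using K_freq_pos[OF J, of m] by (simp add: abs_mult)
    qed
    then show ?thesis unfolding uxx_def using t1(2) by simp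
  qed
  have t4: "\<bar>\<epsilon> * bt J t x * uxx J t x\<bar> \<le> 2 * R + 3"
  proof -
    have "\<bar>\<epsilon> * bt J t x\<bar> * \<bar>uxx J t x\<bar> \<le> (1 * ?S) * (2 * R + 3 * real J)"
      using \<epsilon> bt_bound[OF J, of t x] S uxx R(1) unfolding abs_mult[of \<epsilon>] by (intro mult_mono) auto
    also have "... = ?S * (2 * R) + 3 * (?S * real J)" by (simp add: algebra_simps)
    also have "... \<le> 1 * (2 * R) + 3 * 1" using S R(1) by (intro add_mono mult_right_mono mult_left_mono) auto
    finally show ?thesis by (simp add: abs_mult)
  qed
  have t5: "\<bar>\<epsilon> * (e J t * (\<Sum>m=1..J. sin (theta J m t) * sin (?k m * x))) * (\<Sum>m=1..J. y J m t * p1 (?k m) x)\<bar> \<le> 2"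
  proof -
    have "\<bar>\<Sum>m=1..J. sin (theta J m t) * sin (?k m * x)\<bar> \<le> (\<Sum>m=1..J. 1)" by (rule order_trans[OF sum_abs sum_mono]) (rule abs_sin_sin)
    then have G: "\<bar>\<Sum>m=1..J. sin (theta J m t) * sin (?k m * x)\<bar> \<le> real J" by simp
    have Y: "\<bar>\<Sum>m=1..J. y J m t * p1 (?k m) x\<bar> \<le> 2 * ?S"
      by (rule sum_le_scaled_inverse_K[OF J], rule y_mult_bound[OF J], rule p1_bound, rule K_ge_2[OF J])
    have "\<bar>\<epsilon>\<bar> * (\<bar>e J t\<bar> * \<bar>\<Sum>m=1..J. sin (theta J m t) * sin (?k m * x)\<bar>) \<le> 1 * (1 * real J)" using \<epsilon> e_range[of J t] G by (intro mult_mono) auto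
    then have "\<bar>\<epsilon>\<bar> * (\<bar>e J t\<bar> * \<bar>\<Sum>m=1..J. sin (theta J m t) * sin (?k m * x)\<bar>) * \<bar>\<Sum>m=1..J. y J m t * p1 (?k m) x\<bar> \<le> real J * (2 * ?S)"
      using Y by (intro mult_mono) auto
    also have "... \<le> 2" using S(3) by (simp add: mult.commute)
    finally show ?thesis by (simp only: abs_mult)
  qed
  have "R * ?S \<le> R * 1" using S R(1) by (intro mult_left_mono) auto
  then show ?thesis unfolding f_eq[OF J] using t1 t2 t3 t4 t5 S R(1) by linarith
qed

end

section \<open>Modes tested against functions of finite energy\<close>

abbreviation emb :: "(real \<Rightarrow> real) \<Rightarrow> real \<Rightarrow> complex" where
  "emb h \<equiv> E0 (\<lambda>x. complex_of_real (h x))"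

lemma emb_L2: "smooth h \<Longrightarrow> S \<in> sets lebesgue \<Longrightarrow> {0<..<pi} \<subseteq> S \<Longrightarrow> emb h \<in> L2 S" by (rule smooth_E0_L2[OF smooth_of_real])

lemma emb_add: "emb (\<lambda>x. h x + k x) = (\<lambda>x. emb h x + emb k x)"
  and emb_diff: "emb (\<lambda>x. h x - k x) = (\<lambda>x. emb h x - emb k x)"
  and emb_cmult: "emb (\<lambda>x. c * h x) = (\<lambda>x. complex_of_real c * emb h x)" by (auto simp: E0_def fun_eq_iff)

lemma smooth_diff: "smooth f \<Longrightarrow> smooth g \<Longrightarrow> smooth (\<lambda>x. f x - (g x :: real))" using smooth_add[OF _ smooth_cmult[of g "-1"], of f] by simp

lemma emb_norm_le:
  assumes "\<And>x. x \<in> {0<..<pi} \<Longrightarrow> \<bar>h x\<bar> \<le> C" and S: "S \<in> sets lebesgue" "{0<..<pi} \<subseteq> S" and h: "smooth h"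
  shows "L2_norm S (emb h) \<le> C * 2"
proof -
  have C: "0 \<le> C" using order_trans[OF abs_ge_zero assms(1)[of "pi / 2"]] by simp
  have "(L2_norm S (emb h))\<^sup>2 = (\<integral>x. (norm (emb h x))\<^sup>2 \<partial>lebesgue_on {0<..<pi})"
    unfolding L2_norm_square by (rule integral_support[OF S(2,1)]) (auto simp: E0_def)
  also have "... \<le> (\<integral>x. C\<^sup>2 \<partial>lebesgue_on {0<..<pi})"
  proof (rule integral_mono)
    show "integrable (lebesgue_on {0<..<pi}) (\<lambda>x. (norm (emb h x))\<^sup>2)" by (rule L2_square_integrable[OF emb_L2[OF h]]) auto
    show "integrable (lebesgue_on {0<..<pi}) (\<lambda>x. C\<^sup>2)" by (rule finite_measure.integrable_const, rule finite_measure_lebesgue_on) simp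
    show "(norm (emb h x))\<^sup>2 \<le> C\<^sup>2" if "x \<in> space (lebesgue_on {0<..<pi})" for x
      using assms(1)[of x] that by (simp add: E0_def power2_le_iff_abs_le[OF C])
  qed
  also have "... = C\<^sup>2 * pi" by (simp add: measure_restrict_space)
  also have "... \<le> C\<^sup>2 * 4" using pi_less_4 by (intro mult_left_mono) auto
  also have "... = (C * 2)\<^sup>2" by (simp add: power_mult_distrib)
  finally show ?thesis by (rule power2_le_imp_le) (use C in simp)
qed

text \<open>Joint continuity gives continuity in time of the values in \<open>L\<^sup>2\<close>, because the space interval
  is compact.\<close>

lemma emb_continuous_in_time:
  assumes h: "continuous_on UNIV (\<lambda>p. h (fst p) (snd p))" "\<And>s. smooth (h s)" and S: "S \<in> sets lebesgue" "{0<..<pi} \<subseteq> S"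
  shows "((\<lambda>s. L2_norm S (emb (\<lambda>x. h t x - h s x))) \<longlongrightarrow> 0) (nhds (t::real))"
proof (rule tendstoI)
  fix r :: real assume r: "r > 0"
  have c: "continuous_on (UNIV \<times> {0..pi}) (\<lambda>p. h (fst p) (snd p))" by (rule continuous_on_subset[OF h(1)]) auto
  have "\<exists>A. t \<in> A \<and> open A \<and> (\<forall>s\<in>A. \<forall>x\<in>{0..pi}. dist (h s x) (h t x) \<le> r / 4)"
  proof (rule continuous_on_prod_compactE[OF c compact_Icc UNIV_I, of "r / 4" t])
    show "0 < r / 4" using r by simp
    fix A assume "t \<in> A" "open A"
      "\<forall>s\<in>A \<inter> UNIV. \<forall>x\<in>{0..pi}. dist (h (fst (s, x)) (snd (s, x))) (h (fst (t, x)) (snd (t, x))) \<le> r / 4"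
    then show ?thesis by (intro exI[of _ A]) simp
  qed
  then obtain A where A: "t \<in> A" "open A" "\<forall>s\<in>A. \<forall>x\<in>{0..pi}. dist (h s x) (h t x) \<le> r / 4" by blast
  have "eventually (\<lambda>s. s \<in> A) (nhds t)" by (rule eventually_nhds_in_open[OF A(2,1)])
  then show "eventually (\<lambda>s. dist (L2_norm S (emb (\<lambda>x. h t x - h s x))) 0 < r) (nhds t)"
  proof eventually_elim
    case (elim s)
    have "L2_norm S (emb (\<lambda>x. h t x - h s x)) \<le> (r / 4) * 2"
    proof (rule emb_norm_le[OF _ S smooth_diff[OF h(2) h(2)]])
      fix x :: real assume "x \<in> {0<..<pi}"
      then show "\<bar>h t x - h s x\<bar> \<le> r / 4" using A(3)[rule_format, of s x] elim by (simp add: dist_real_def abs_minus_commute)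
    qed
    then show ?case using r by (simp add: dist_real_def)
  qed
qed

lemma test_function_add:
  fixes \<phi> \<psi> :: "real \<Rightarrow> 'a::real_normed_vector"
  assumes "\<phi> \<in> test_functions S" "\<psi> \<in> test_functions S" shows "(\<lambda>x. \<phi> x + \<psi> x) \<in> test_functions S"
proof (rule test_functionI[where K = "closure {x. \<phi> x \<noteq> 0} \<union> closure {x. \<psi> x \<noteq> 0}"])
  show "smooth (\<lambda>x. \<phi> x + \<psi> x)" using assms by (intro smooth_add) (auto simp: test_functions_def)
  show "compact (closure {x. \<phi> x \<noteq> 0} \<union> closure {x. \<psi> x \<noteq> 0})" using assms by (intro compact_Un) (auto simp: test_functions_def)
  show "closure {x. \<phi> x \<noteq> 0} \<union> closure {x. \<psi> x \<noteq> 0} \<subseteq> S" using assms by (auto simp: test_functions_def)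
  fix x assume x: "x \<notin> closure {x. \<phi> x \<noteq> 0} \<union> closure {x. \<psi> x \<noteq> 0}"
  then have "x \<notin> {x. \<phi> x \<noteq> 0}" "x \<notin> {x. \<psi> x \<noteq> 0}"
    using subsetD[OF closure_subset[of "{x. \<phi> x \<noteq> 0}"], of x] subsetD[OF closure_subset[of "{x. \<psi> x \<noteq> 0}"], of x] by auto
  then show "\<phi> x + \<psi> x = 0" by simp
qed

abbreviation \<I> :: "real set" where "\<I> \<equiv> {0<..<pi}"

context smooth_bump
begin

lemma V_H1: "v \<in> V_space \<Longrightarrow> v \<in> H1 \<I>" by (simp add: H10_def)

lemma test_function_weak_derivative:
  fixes \<phi> :: "real \<Rightarrow> complex"
  assumes \<phi>: "\<phi> \<in> test_functions \<I>"
  shows "\<phi> \<in> H1 \<I>" "AE x in lebesgue_on \<I>. wderiv \<I> \<phi> x = vector_derivative \<phi> (at x)"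
proof -
  have s: "smooth \<phi>" using \<phi> by (simp add: test_functions_def)
  have z: "\<phi> 0 = 0" "\<phi> pi = 0" using test_function_outside[OF \<phi>] by auto
  have E: "E0 \<phi> = \<phi>" using test_function_outside[OF \<phi>] by (auto simp: E0_def fun_eq_iff)
  have E': "E0 (\<lambda>x. vector_derivative \<phi> (at x)) = (\<lambda>x. vector_derivative \<phi> (at x))"
    using test_function_outside[OF test_function_derivative[OF \<phi>]] by (auto simp: E0_def fun_eq_iff)
  show H: "\<phi> \<in> H1 \<I>" using E0_H1[OF s z, of \<I>] E by simp
  show "AE x in lebesgue_on \<I>. wderiv \<I> \<phi> x = vector_derivative \<phi> (at x)" using E0_weak_derivative[OF s z, of \<I>] E E'
    by (intro wderiv_AE H1_L2[OF H] test_function_L2[OF test_function_derivative[OF \<phi>]]) auto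
qed

lemma test_function_V:
  fixes \<phi> :: "real \<Rightarrow> complex"
  assumes \<phi>: "\<phi> \<in> test_functions \<I>" shows "\<phi> \<in> V_space"
proof -
  have "H1_norm \<I> (\<phi> - \<phi>) = 0" using H1_norm_zero[of \<I>] by (simp add: fun_diff_def)
  then have "\<exists>\<psi>\<in>test_functions \<I>. H1_norm \<I> (\<phi> - \<psi>) < r" if "r > 0" for r using that \<phi> by (intro bexI[of _ \<phi>]) auto
  then show ?thesis using test_function_weak_derivative(1)[OF \<phi>] by (simp add: H10_def)
qed

lemma V_seminormed: "seminormed V_space V_norm"
proof
  show "(\<lambda>x. 0) \<in> V_space" by (rule test_function_V) (rule test_functionI[where K = "{}"], auto)
  show "0 \<le> V_norm v" for v by (simp add: H10_norm_def)
  show "(\<lambda>x. v x + w x) \<in> V_space" if v: "v \<in> V_space" and w: "w \<in> V_space" for v w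
  proof -
    have "\<exists>\<phi>\<in>test_functions \<I>. H1_norm \<I> ((\<lambda>x. v x + w x) - \<phi>) < r" if r: "r > 0" for r
    proof -
      have r2: "r / 2 > 0" using r by simp
      obtain \<phi> where a1: "\<phi> \<in> test_functions \<I>" "H1_norm \<I> (v - \<phi>) < r / 2" using v r2 unfolding H10_def by blast
      obtain \<psi> where a2: "\<psi> \<in> test_functions \<I>" "H1_norm \<I> (w - \<psi>) < r / 2" using w r2 unfolding H10_def by blast
      note a = a1 a2
      have m: "(\<lambda>x. v x - \<phi> x) \<in> H1 \<I>" "(\<lambda>x. w x - \<psi> x) \<in> H1 \<I>"
        by (rule H1_diff[OF _ V_H1[OF v] V_H1[OF test_function_V[OF a1(1)]]] H1_diff[OF _ V_H1[OF w] V_H1[OF test_function_V[OF a2(1)]]]; simp)+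
      have "H1_norm \<I> ((\<lambda>x. v x + w x) - (\<lambda>x. \<phi> x + \<psi> x)) = H1_norm \<I> (\<lambda>x. (v x - \<phi> x) + (w x - \<psi> x))"
        by (rule arg_cong[where f = "H1_norm \<I>"]) (simp add: fun_eq_iff right_diff_distrib)
      also have "... \<le> H1_norm \<I> (\<lambda>x. v x - \<phi> x) + H1_norm \<I> (\<lambda>x. w x - \<psi> x)" by (rule H1_norm_triangle[OF _ m]) simp
      also have "... < r" using a by (simp add: fun_diff_def)
      finally show ?thesis using test_function_add[OF a(1,3)] by blast
    qed
    moreover have "(\<lambda>x. v x + w x) \<in> H1 \<I>" by (rule H1_add[OF _ V_H1[OF v] V_H1[OF w]]) simp
    ultimately show ?thesis unfolding H10_def by blast
  qed
  show "(\<lambda>x. c * v x) \<in> V_space" if v: "v \<in> V_space" for c v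
  proof -
    have "\<exists>\<phi>\<in>test_functions \<I>. H1_norm \<I> ((\<lambda>x. c * v x) - \<phi>) < r" if r: "r > 0" for r
    proof -
      have "r / (norm c + 1) > 0" using r by (simp add: add_nonneg_pos)
      then obtain \<phi> where a: "\<phi> \<in> test_functions \<I>" "H1_norm \<I> (v - \<phi>) < r / (norm c + 1)" using v unfolding H10_def by blast
      have "H1_norm \<I> ((\<lambda>x. c * v x) - (\<lambda>x. c * \<phi> x)) = H1_norm \<I> (\<lambda>x. c * (v x - \<phi> x))"
        by (rule arg_cong[where f = "H1_norm \<I>"]) (simp add: fun_eq_iff right_diff_distrib)
      also have "... = norm c * H1_norm \<I> (\<lambda>x. v x - \<phi> x)"
        by (rule H1_norm_scale[OF _ H1_diff[OF _ V_H1[OF v] V_H1[OF test_function_V[OF a(1)]]]]) auto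
      also have "... \<le> norm c * (r / (norm c + 1))" using a(2) by (intro mult_left_mono) (auto simp: fun_diff_def)
      also have "... < r" using r by (simp add: divide_less_eq distrib_left add_nonneg_pos mult.commute)
      finally show ?thesis using test_function_bounded_linear[OF bounded_linear_mult_right a(1), of c] by blast
    qed
    with H1_scale[OF V_H1[OF v]] show ?thesis unfolding H10_def by blast
  qed
  show "V_norm (\<lambda>x. v x + w x) \<le> V_norm v + V_norm w" if "v \<in> V_space" "w \<in> V_space" for v w
    unfolding H10_norm_def by (rule wderiv_norm_triangle) (use that V_H1 in auto)
  show "V_norm (\<lambda>x. c * v x) = norm c * V_norm v" if "v \<in> V_space" for c v
    unfolding H10_norm_def by (rule wderiv_norm_scale) (use that V_H1 in auto)
qed

text \<open>No boundary condition on \<open>h\<close> is imposed here: both sides are continuous in \<open>v\<close>, and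
  for a test function the boundary terms vanish because of \<open>v\<close>.\<close>

lemma V_integration_by_parts:
  fixes h :: "real \<Rightarrow> complex"
  assumes v: "v \<in> V_space" and h: "smooth h"
  shows "L2_inner \<I> (E0 (\<lambda>x. vector_derivative h (at x))) v = - L2_inner \<I> (E0 h) (wderiv \<I> v)"
proof -
  let ?h' = "\<lambda>x. vector_derivative h (at x)"
  have h': "smooth ?h'" by (rule smooth_derivative(1)[OF h])
  have L: "E0 h \<in> L2 \<I>" "E0 ?h' \<in> L2 \<I>" by (rule smooth_E0_L2[OF h] smooth_E0_L2[OF h']; simp)+
  define T where "T w = L2_inner \<I> (E0 ?h') w + L2_inner \<I> (E0 h) (wderiv \<I> w)" for w
  have T0: "T \<phi> = 0" if \<phi>: "\<phi> \<in> test_functions \<I>" for \<phi>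
  proof -
    have s: "smooth \<phi>" using \<phi> by (simp add: test_functions_def)
    define \<psi> where "\<psi> x = cnj (\<phi> x)" for x
    have \<psi>: "\<psi> \<in> test_functions \<I>" unfolding \<psi>_def[abs_def] by (rule test_function_bounded_linear[OF bounded_linear_cnj \<phi>])
    then have s\<psi>: "smooth \<psi>" by (simp add: test_functions_def)
    let ?\<psi>' = "\<lambda>x. vector_derivative \<psi> (at x)"
    have \<psi>': "?\<psi>' x = cnj (vector_derivative \<phi> (at x))" for x
      unfolding \<psi>_def[abs_def] by (rule vector_derivative_at, rule bounded_linear.has_vector_derivative[OF bounded_linear_cnj smooth_derivative(2)[OF s]])
    have ends: "\<psi> 0 = 0" "\<psi> pi = 0" using test_function_outside[OF \<psi>] by auto
    have c: "continuous_on UNIV h" "continuous_on UNIV ?h'" "continuous_on UNIV \<psi>" "continuous_on UNIV ?\<psi>'"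
      by (rule smooth_continuous_on, rule h h' s\<psi> smooth_derivative(1)[OF s\<psi>])+
    have "(\<integral>x. h x * ?\<psi>' x \<partial>lebesgue_on {0..pi}) = h pi * \<psi> pi - h 0 * \<psi> 0 - (\<integral>x. ?h' x * \<psi> x \<partial>lebesgue_on {0..pi})"
      using pi_ge_zero by (rule integration_by_parts_Icc[OF _ smooth_derivative(2)[OF h] smooth_derivative(2)[OF s\<psi>] continuous_on_subset[OF c(2)] continuous_on_subset[OF c(4)]]) auto
    then have "(\<integral>x. h x * ?\<psi>' x \<partial>lebesgue_on \<I>) = - (\<integral>x. ?h' x * \<psi> x \<partial>lebesgue_on \<I>)"
      using ends by (subst (1 2) integral_Ioo_eq_Icc) (auto intro!: continuous_measurable_lebesgue_on continuous_intros c)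
    moreover have "L2_inner \<I> (E0 ?h') \<phi> = (\<integral>x. ?h' x * \<psi> x \<partial>lebesgue_on \<I>)"
      unfolding L2_inner_def by (rule Bochner_Integration.integral_cong) (auto simp: E0_def \<psi>_def)
    moreover have "L2_inner \<I> (E0 h) (wderiv \<I> \<phi>) = L2_inner \<I> (E0 h) (\<lambda>x. vector_derivative \<phi> (at x))"
      by (rule L2_inner_cong_AE[OF L(1) wderiv_L2[OF test_function_weak_derivative(1)[OF \<phi>]] L(1)
          test_function_L2[OF test_function_derivative[OF \<phi>]] _ test_function_weak_derivative(2)[OF \<phi>]]) auto
    moreover have "L2_inner \<I> (E0 h) (\<lambda>x. vector_derivative \<phi> (at x)) = (\<integral>x. h x * ?\<psi>' x \<partial>lebesgue_on \<I>)"
      unfolding L2_inner_def \<psi>' by (rule Bochner_Integration.integral_cong) (auto simp: E0_def)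
    ultimately show ?thesis by (simp add: T_def)
  qed
  let ?C = "L2_norm \<I> (E0 ?h') + L2_norm \<I> (E0 h)"
  have T_le: "norm (T w) \<le> ?C * H1_norm \<I> w" if w: "w \<in> H1 \<I>" for w
  proof -
    have "norm (L2_inner \<I> (E0 ?h') w) \<le> L2_norm \<I> (E0 ?h') * H1_norm \<I> w"
      by (rule order_trans[OF L2_inner_norm_le[OF L(2) H1_L2[OF w]] mult_left_mono[OF L2_norm_le_H1_norm]]) simp
    moreover have "norm (L2_inner \<I> (E0 h) (wderiv \<I> w)) \<le> L2_norm \<I> (E0 h) * H1_norm \<I> w"
      by (rule order_trans[OF L2_inner_norm_le[OF L(1) wderiv_L2[OF w]] mult_left_mono[OF wderiv_norm_le_H1_norm]]) simp
    ultimately show ?thesis using norm_triangle_ineq[of "L2_inner \<I> (E0 ?h') w" "L2_inner \<I> (E0 h) (wderiv \<I> w)"]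
      unfolding T_def distrib_right by linarith
  qed
  have T_add: "T (\<lambda>x. p x + q x) = T p + T q" if "p \<in> H1 \<I>" "q \<in> H1 \<I>" for p q
  proof -
    have a: "L2_inner \<I> (E0 ?h') (\<lambda>x. p x + q x) = L2_inner \<I> (E0 ?h') p + L2_inner \<I> (E0 ?h') q"
      by (rule L2_inner_add_right[OF H1_L2[OF that(1)] H1_L2[OF that(2)] L(2)])
    have "L2_inner \<I> (E0 h) (wderiv \<I> (\<lambda>x. p x + q x)) = L2_inner \<I> (E0 h) (\<lambda>x. wderiv \<I> p x + wderiv \<I> q x)"
      using that by (intro L2_inner_cong_AE[OF L(1) _ L(1)] wderiv_L2 H1_add L2_add wderiv_add) auto
    then show ?thesis
      unfolding T_def a using L2_inner_add_right[OF wderiv_L2[OF that(1)] wderiv_L2[OF that(2)] L(1)] by simp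
  qed
  have "norm (T v) \<le> r" if r: "r > 0" for r
  proof -
    have C: "?C + 1 > 0" using add_nonneg_nonneg[OF L2_norm_nonneg L2_norm_nonneg, of \<I> "E0 ?h'" \<I> "E0 h"] by linarith
    then have "r / (?C + 1) > 0" using r by simp
    then obtain \<phi> where a: "\<phi> \<in> test_functions \<I>" "H1_norm \<I> (v - \<phi>) < r / (?C + 1)" using v unfolding H10_def by blast
    have d: "(\<lambda>x. v x - \<phi> x) \<in> H1 \<I>" using V_H1[OF v] V_H1[OF test_function_V[OF a(1)]] by (intro H1_diff) auto
    have "T v = T (\<lambda>x. (v x - \<phi> x) + \<phi> x)" by simp
    also have "... = T (\<lambda>x. v x - \<phi> x)" using T_add[OF d V_H1[OF test_function_V[OF a(1)]]] T0[OF a(1)] by simp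
    finally have e: "T v = T (\<lambda>x. v x - \<phi> x)" .
    have "norm (T v) \<le> ?C * H1_norm \<I> (\<lambda>x. v x - \<phi> x)" unfolding e by (rule T_le[OF d])
    also have "... \<le> ?C * (r / (?C + 1))" using a(2) by (intro mult_left_mono) (auto simp: fun_diff_def)
    also have "... \<le> r" using C r by (simp add: divide_le_eq distrib_left mult.commute)
    finally show ?thesis .
  qed
  then have "norm (T v) \<le> 0" by (metis dense_ge)
  then show ?thesis by (simp add: T_def eq_neg_iff_add_eq_0)
qed

end

lemma vector_derivative_of_real:
  assumes "\<And>x. (F has_real_derivative f x) (at x)"
  shows "vector_derivative (\<lambda>x. complex_of_real (F x)) (at x) = complex_of_real (f x)"
  using assms[of x] by (intro vector_derivative_at bounded_linear.has_vector_derivative[OF bounded_linear_of_real])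
    (simp add: has_real_derivative_iff_has_vector_derivative)

lemma phi_primitive_bound: assumes "x \<in> {0<..<pi}" shows "\<bar>phi_primitive x\<bar> \<le> 3"
proof -
  have "0 < x" "x < 4" using assms pi_less_4 by auto
  then show ?thesis using abs_sin_le_one[of "2 * x"] unfolding phi_primitive_def by linarith
qed

context construction
begin

text \<open>At any time \<open>u\<close>, \<open>\<partial>\<^sub>t u\<close> and their difference quotients are combinations of \<open>\<phi>\<close> and the modes of one group, so one estimate for such combinations serves all of them.\<close>

definition lin :: "nat \<Rightarrow> real \<Rightarrow> (nat \<Rightarrow> real) \<Rightarrow> real \<Rightarrow> real" where
  "lin J c0 c x = c0 * phi x + (\<Sum>m=1..J. c m * p_mode (K_freq J m) x)"

definition lin_primitive :: "nat \<Rightarrow> (nat \<Rightarrow> real) \<Rightarrow> real \<Rightarrow> real" where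
  "lin_primitive J c x = (\<Sum>m=1..J. c m * p_primitive (K_freq J m) x)"

lemma u_lin: "u J t = lin J (\<rho> t) (\<lambda>m. y J m t)" and ut_lin: "ut J t = lin J (\<rho>' t) (\<lambda>m. y' J m t)" by (auto simp: u_def ut_def lin_def fun_eq_iff)

lemma lin_diff: "lin J c0 c x - lin J d0 d x = lin J (c0 - d0) (\<lambda>m. c m - d m) x" by (simp add: lin_def left_diff_distrib sum_subtractf)

lemma lin_cmult: "k * lin J c0 c x = lin J (k * c0) (\<lambda>m. k * c m) x" by (simp add: lin_def distrib_left sum_distrib_left mult.assoc)

lemma smooth_lin: "smooth (lin J c0 c)"
  unfolding lin_def[abs_def] by (rule smooth_add[OF smooth_cmult[OF smooth_phi] smooth_sum[OF smooth_cmult[OF smooth_p_mode]]])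

lemma smooth_lin_primitive: "smooth (lin_primitive J c)"
  unfolding lin_primitive_def[abs_def] by (rule smooth_sum[OF smooth_cmult[OF smooth_p_primitive]])

lemma lin_primitive_deriv:
  assumes "J \<ge> 1" shows "(lin_primitive J c has_real_derivative (\<Sum>m=1..J. c m * p_mode (K_freq J m) x)) (at x)"
  unfolding lin_primitive_def[abs_def]
proof (intro DERIV_sum DERIV_cmult p_primitive_deriv)
  show "K_freq J m > 2" for m using K_freq_ge[OF assms, of m] by simp
qed

lemma lin_primitive_ends: assumes "J \<ge> 1" shows "lin_primitive J c 0 = 0" "lin_primitive J c pi = 0"
  by (simp_all add: lin_primitive_def p_primitive_ends[OF assms])

lemma lin_primitive_bound:
  assumes "J \<ge> 1" shows "\<bar>lin_primitive J c x\<bar> \<le> (\<Sum>m=1..J. \<bar>c m\<bar> * (2 / K_freq J m))"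
  unfolding lin_primitive_def
proof (rule order_trans[OF sum_abs sum_mono])
  fix m
  have "\<bar>p_primitive (K_freq J m) x\<bar> \<le> 2 / K_freq J m" by (rule p_primitive_bound) (use K_freq_ge[OF assms, of m] in simp)
  then show "\<bar>c m * p_primitive (K_freq J m) x\<bar> \<le> \<bar>c m\<bar> * (2 / K_freq J m)" unfolding abs_mult by (rule mult_left_mono) simp
qed

text \<open>Tested against functions of finite energy, a mode of frequency \<open>K\<close> gains a factor \<open>1 / K\<close>,
  which makes the sum over the modes of a group converge uniformly in the group.\<close>

lemma lin_line_pairing:
  assumes J: "J \<ge> 1" and v: "v \<in> H1_line"
  shows "norm (L2_inner UNIV (emb (lin J c0 c)) v) \<le> ((\<bar>c0\<bar> + (\<Sum>m=1..J. \<bar>c m\<bar> * (2 / K_freq J m))) * 2) * H1_norm UNIV v"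
proof -
  let ?P = "\<lambda>x. \<Sum>m=1..J. c m * p_mode (K_freq J m) x" and ?Q = "lin_primitive J c"
  have sP: "smooth ?P" by (rule smooth_sum[OF smooth_cmult[OF smooth_p_mode]])
  have s0: "smooth (\<lambda>x. c0 * phi x)" by (rule smooth_cmult[OF smooth_phi])
  have e: "emb (lin J c0 c) = (\<lambda>x. emb (\<lambda>x. c0 * phi x) x + emb ?P x)" unfolding lin_def[abs_def] by (rule emb_add)
  have L: "emb (\<lambda>x. c0 * phi x) \<in> L2 UNIV" "emb ?P \<in> L2 UNIV" "emb ?Q \<in> L2 UNIV"
    by (rule emb_L2[OF s0] emb_L2[OF sP] emb_L2[OF smooth_lin_primitive]; simp)+
  have d: "(\<lambda>x. vector_derivative (\<lambda>x. complex_of_real (?Q x)) (at x)) = (\<lambda>x. complex_of_real (?P x))"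
    using vector_derivative_of_real[of ?Q ?P, OF lin_primitive_deriv[OF J]] by auto
  have "L2_inner UNIV (emb ?P) v = - L2_inner UNIV (emb ?Q) (wderiv UNIV v)"
    using H1_integration_by_parts_cnj[OF v _ _ smooth_of_real[OF smooth_lin_primitive[of J c]]] lin_primitive_ends[OF J] unfolding d by simp
  then have eq: "L2_inner UNIV (emb (lin J c0 c)) v = L2_inner UNIV (emb (\<lambda>x. c0 * phi x)) v - L2_inner UNIV (emb ?Q) (wderiv UNIV v)"
    unfolding e L2_inner_add_left[OF L(1,2) H1_L2[OF v]] by (simp only: diff_conv_add_uminus)
  have "L2_norm UNIV (emb (\<lambda>x. c0 * phi x)) \<le> \<bar>c0\<bar> * 2"
    by (rule emb_norm_le[OF _ _ _ s0]) (use mult_left_mono[OF phi_bounds(1), of "\<bar>c0\<bar>"] in \<open>simp_all add: abs_mult\<close>)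
  then have 1: "norm (L2_inner UNIV (emb (\<lambda>x. c0 * phi x)) v) \<le> (\<bar>c0\<bar> * 2) * H1_norm UNIV v"
    by (intro order_trans[OF L2_inner_norm_le[OF L(1) H1_L2[OF v]]] mult_mono L2_norm_le_H1_norm) auto
  have "L2_norm UNIV (emb ?Q) \<le> (\<Sum>m=1..J. \<bar>c m\<bar> * (2 / K_freq J m)) * 2"
    by (rule emb_norm_le[OF lin_primitive_bound[OF J] _ _ smooth_lin_primitive]) auto
  moreover have "norm (L2_inner UNIV (emb ?Q) (wderiv UNIV v)) \<le> L2_norm UNIV (emb ?Q) * H1_norm UNIV v"
    by (rule order_trans[OF L2_inner_norm_le[OF L(3) wderiv_L2[OF v]] mult_left_mono[OF wderiv_norm_le_H1_norm]]) simp
  ultimately have 2: "norm (L2_inner UNIV (emb ?Q) (wderiv UNIV v)) \<le> ((\<Sum>m=1..J. \<bar>c m\<bar> * (2 / K_freq J m)) * 2) * H1_norm UNIV v"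
    by (elim order_trans) (rule mult_right_mono, simp_all only: H1_norm_nonneg)
  show ?thesis unfolding eq using norm_diff_triangle_le_sum[OF 1 2] by (simp only: distrib_right)
qed

lemma lin_V_pairing:
  assumes J: "J \<ge> 1" and v: "v \<in> V_space"
  shows "norm (L2_inner \<I> (emb (lin J c0 c)) v) \<le> ((\<bar>c0\<bar> * 3 + (\<Sum>m=1..J. \<bar>c m\<bar> * (2 / K_freq J m))) * 2) * V_norm v"
proof -
  let ?Q = "\<lambda>x. c0 * phi_primitive x + lin_primitive J c x"
  have sQ: "smooth ?Q" by (rule smooth_add[OF smooth_cmult[OF smooth_phi_primitive] smooth_lin_primitive])
  have "(?Q has_real_derivative lin J c0 c x) (at x)" for x
    unfolding lin_def by (rule DERIV_add[OF DERIV_cmult[OF phi_primitive_deriv] lin_primitive_deriv[OF J]])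
  then have d: "(\<lambda>x. vector_derivative (\<lambda>x. complex_of_real (?Q x)) (at x)) = (\<lambda>x. complex_of_real (lin J c0 c x))"
    using vector_derivative_of_real[of ?Q "lin J c0 c"] by auto
  have eq: "L2_inner \<I> (emb (lin J c0 c)) v = - L2_inner \<I> (emb ?Q) (wderiv \<I> v)"
    using V_integration_by_parts[OF v smooth_of_real[OF sQ]] unfolding d .
  have "L2_norm \<I> (emb ?Q) \<le> (\<bar>c0\<bar> * 3 + (\<Sum>m=1..J. \<bar>c m\<bar> * (2 / K_freq J m))) * 2"
  proof (rule emb_norm_le[OF _ _ _ sQ])
    fix x assume "x \<in> {0<..<pi}"
    then have "\<bar>c0 * phi_primitive x\<bar> \<le> \<bar>c0\<bar> * 3" unfolding abs_mult by (intro mult_left_mono phi_primitive_bound) auto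
    then show "\<bar>?Q x\<bar> \<le> \<bar>c0\<bar> * 3 + (\<Sum>m=1..J. \<bar>c m\<bar> * (2 / K_freq J m))" using lin_primitive_bound[OF J, of c x] by linarith
  qed auto
  moreover have "norm (L2_inner \<I> (emb ?Q) (wderiv \<I> v)) \<le> L2_norm \<I> (emb ?Q) * V_norm v"
    unfolding H10_norm_def by (rule L2_inner_norm_le[OF emb_L2[OF sQ] wderiv_L2[OF V_H1[OF v]]]) auto
  ultimately show ?thesis
    unfolding eq norm_minus_cancel by (elim order_trans) (rule mult_right_mono, auto simp: H10_norm_def)
qed

lemma e_continuous: "J \<ge> 1 \<Longrightarrow> continuous_on S (e J)" using e_deriv by (intro DERIV_continuous_on) (auto intro: has_field_derivative_at_within)

lemma e'_continuous: "continuous_on S (e' J)"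
  unfolding e'_def[abs_def] divide_inverse
  by (intro continuous_on_mult_right continuous_on_compose2[OF smooth_continuous_on[OF smooth_derivative(1)[OF smooth_\<eta>]]] continuous_intros) auto

lemma \<rho>_continuous: "continuous_on S \<rho>" and \<rho>'_continuous: "continuous_on S \<rho>'"
  by (rule smooth_continuous_on[OF smooth_\<rho>] smooth_continuous_on[OF smooth_derivative(1)[OF smooth_\<rho>]])+

lemma jointly_continuous:
  assumes J: "J \<ge> 1"
  shows "continuous_on UNIV (\<lambda>p. u J (fst p) (snd p))" "continuous_on UNIV (\<lambda>p. ux J (fst p) (snd p))"
    "continuous_on UNIV (\<lambda>p. ut J (fst p) (snd p))" "continuous_on UNIV (\<lambda>p. f J (fst p) (snd p))"
proof -
  have c: "continuous_on UNIV (\<lambda>p::real\<times>real. e J (fst p))" "continuous_on UNIV (\<lambda>p::real\<times>real. e' J (fst p))"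
    "continuous_on UNIV (\<lambda>p::real\<times>real. \<rho> (fst p))" "continuous_on UNIV (\<lambda>p::real\<times>real. \<rho>' (fst p))"
    by (rule continuous_on_compose2[OF e_continuous[OF J, of UNIV]] continuous_on_compose2[OF e'_continuous[of UNIV]]
      continuous_on_compose2[OF \<rho>_continuous[of UNIV]] continuous_on_compose2[OF \<rho>'_continuous[of UNIV]],
      intro continuous_intros, simp)+
  have K: "K_freq J m \<noteq> 0" for m using K_freq_pos[OF J, of m] by simp
  note d = p_mode_def p1_def p2_def phi_def phi1_def phi2_def
  have ys: "continuous_on UNIV (\<lambda>p::real\<times>real. y J m (fst p))" "continuous_on UNIV (\<lambda>p::real\<times>real. y' J m (fst p))"
    "continuous_on UNIV (\<lambda>p::real\<times>real. b J m (fst p))" for m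
    unfolding y_amp_def y'_def b_def theta_def by (intro continuous_intros c; simp add: K)+
  show 1: "continuous_on UNIV (\<lambda>p. u J (fst p) (snd p))" unfolding u_def d by (intro continuous_intros c ys; simp)
  show 2: "continuous_on UNIV (\<lambda>p. ux J (fst p) (snd p))" unfolding ux_def d by (intro continuous_intros c ys; simp)
  show 3: "continuous_on UNIV (\<lambda>p. ut J (fst p) (snd p))" unfolding ut_def d by (intro continuous_intros c ys; simp)
  have 4: "continuous_on UNIV (\<lambda>p. uxx J (fst p) (snd p))" unfolding uxx_def d by (intro continuous_intros c ys; simp)
  have 5: "continuous_on UNIV (\<lambda>p. bt J (fst p) (snd p))" unfolding bt_def by (intro continuous_intros c ys; simp)
  have 6: "continuous_on UNIV (\<lambda>p. btx J (fst p) (snd p))" unfolding btx_def by (intro continuous_intros c ys; simp)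
  show "continuous_on UNIV (\<lambda>p. f J (fst p) (snd p))"
    unfolding f_def fluxx_def by (rule continuous_on_diff[OF 3 continuous_on_add[OF continuous_on_mult[OF continuous_on_add[OF continuous_on_const
      continuous_on_mult[OF continuous_on_const 5]] 4] continuous_on_mult[OF continuous_on_mult[OF continuous_on_const 6] 2]]])
qed

lemma lipschitz_of_derivative:
  fixes g :: "real \<Rightarrow> real"
  assumes "\<And>t. (g has_real_derivative g' t) (at t)" "\<And>t. \<bar>g' t\<bar> \<le> B" shows "\<bar>g s - g t\<bar> \<le> B * \<bar>s - t\<bar>"
  using field_differentiable_bound[OF convex_UNIV has_field_derivative_at_within[OF assms(1)], of B s t] assms(2) by simp

lemma \<rho>_lipschitz: "\<bar>\<rho> s - \<rho> t\<bar> \<le> (R + 1) * \<bar>s - t\<bar>"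
proof (rule lipschitz_of_derivative[OF \<rho>_deriv])
  show "\<bar>\<rho>' t\<bar> \<le> R + 1" for t using R(3)[of t] by linarith
qed

lemma y_lipschitz: "J \<ge> 1 \<Longrightarrow> \<bar>y J m s - y J m t\<bar> \<le> (R + 1) * \<bar>s - t\<bar>" by (rule lipschitz_of_derivative[OF y_deriv y'_bound])

lemma lin_coefficients_bound:
  assumes J: "J \<ge> 1" and c: "\<bar>c0\<bar> \<le> D" "\<And>m. \<bar>c m\<bar> \<le> D"
  shows "(\<bar>c0\<bar> + (\<Sum>m=1..J. \<bar>c m\<bar> * (2 / K_freq J m))) * 2 \<le> 4 * D"
proof -
  have "(\<Sum>m=1..J. \<bar>c m\<bar> * (2 / K_freq J m)) \<le> (\<Sum>m=1..J. (2 * D) * (1 / K_freq J m))"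
  proof (rule sum_mono)
    fix m
    have "\<bar>c m\<bar> * (2 / K_freq J m) \<le> D * (2 / K_freq J m)" using c(2) K_freq_pos[OF J, of m] by (intro mult_right_mono) auto
    also have "... = (2 * D) * (1 / K_freq J m)" by simp
    finally show "\<bar>c m\<bar> * (2 / K_freq J m) \<le> (2 * D) * (1 / K_freq J m)" .
  qed
  also have "... = (2 * D) * (\<Sum>m=1..J. 1 / K_freq J m)" by (simp only: sum_distrib_left)
  also have "... \<le> (2 * D) * (1/2)" using sum_inverse_K_le_1[OF J] c(1) by (intro mult_left_mono) auto
  finally show ?thesis using c(1) by simp
qed

end

section \<open>The variational solution\<close>

lemma (in seminormed) L2_time_cong:
  assumes w: "w \<in> L2_time X N" and z: "AE t in unit_time. z t \<in> X \<and> N (\<lambda>x. z t x - w t x) = 0"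
  shows "z \<in> L2_time X N"
proof -
  have wX: "AE t in unit_time. w t \<in> X" and wi: "(\<integral>\<^sup>+t. ennreal ((N (w t))\<^sup>2) \<partial>unit_time) < \<infinity>" using w by (auto simp: L2_time_def)
  obtain s where s: "\<And>n. simple_function unit_time (s n)" "\<And>n t. s n t \<in> X"
    and lim: "AE t in unit_time. (\<lambda>n. N (w t - s n t)) \<longlonglongrightarrow> 0" using w unfolding L2_time_def strongly_measurable_def by blast
  have "AE t in unit_time. (\<lambda>n. N (z t - s n t)) \<longlonglongrightarrow> 0" using z wX lim
  proof eventually_elim
    case (elim t)
    have "N (z t - s n t) \<le> N (w t - s n t)" for n
    proof -
      have "N (\<lambda>x. (z t x - w t x) + (w t x - s n t x)) \<le> N (\<lambda>x. z t x - w t x) + N (\<lambda>x. w t x - s n t x)"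
        using elim s(2) by (intro N_triangle diff_mem) auto
      then show ?thesis using elim by (simp add: fun_diff_def)
    qed
    then show ?case by (intro tendsto_sandwich[OF _ _ tendsto_const elim(3)] always_eventually allI) (simp_all add: N_nonneg)
  qed
  moreover have "(\<integral>\<^sup>+t. ennreal ((N (z t))\<^sup>2) \<partial>unit_time) = (\<integral>\<^sup>+t. ennreal ((N (w t))\<^sup>2) \<partial>unit_time)"
  proof (rule nn_integral_cong_AE, use z wX in eventually_elim)
    case (elim t)
    then have "N (z t) = N (w t)" using N_diff_ge[of "z t" "w t"] by simp
    then show ?case by simp
  qed
  moreover have "AE t in unit_time. z t \<in> X" using z by eventually_elim simp
  ultimately show ?thesis using s wi unfolding L2_time_def strongly_measurable_def by auto
qed

lemma L2_cong: assumes "\<And>x. x \<in> S \<Longrightarrow> v x = w x" "w \<in> L2 S" shows "v \<in> L2 S"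
proof -
  have "v \<in> borel_measurable (lebesgue_on S) \<longleftrightarrow> w \<in> borel_measurable (lebesgue_on S)" by (rule measurable_cong) (use assms(1) in simp)
  moreover have "integrable (lebesgue_on S) (\<lambda>x. (norm (v x))\<^sup>2) \<longleftrightarrow> integrable (lebesgue_on S) (\<lambda>x. (norm (w x))\<^sup>2)"
    by (rule Bochner_Integration.integrable_cong) (use assms(1) in simp_all)
  ultimately show ?thesis using assms(2) by (simp add: L2_def)
qed

lemma L2_inner_cong_left: "(\<And>x. x \<in> S \<Longrightarrow> v x = w x) \<Longrightarrow> L2_inner S v z = L2_inner S w z"
  unfolding L2_inner_def by (rule Bochner_Integration.integral_cong) simp_all

lemma dual_norm_cong: "(\<And>v. v \<in> X \<Longrightarrow> F v = G v) \<Longrightarrow> dual_norm X N F = dual_norm X N G"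
  unfolding dual_norm_def by (rule SUP_cong) auto

lemma (in seminormed) antidual_scaleR:
  assumes F: "F \<in> antidual X N" shows "(\<lambda>v. F v /\<^sub>R r) \<in> antidual X N"
proof -
  obtain C where C: "\<And>v. v \<in> X \<Longrightarrow> norm (F v) \<le> C * N v" using F unfolding antidual_def by blast
  have "norm (F v /\<^sub>R r) \<le> (\<bar>inverse r\<bar> * C) * N v" if "v \<in> X" for v using mult_left_mono[OF C[OF that], of "\<bar>inverse r\<bar>"] by simp
  moreover have "F (\<lambda>x. v x + w x) /\<^sub>R r = F v /\<^sub>R r + F w /\<^sub>R r" if "v \<in> X" "w \<in> X" for v w using F that by (simp add: antidual_def scaleR_add_right)
  moreover have "F (\<lambda>x. c * v x) /\<^sub>R r = cnj c * (F v /\<^sub>R r)" if "v \<in> X" for c v using F that by (simp add: antidual_def)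
  ultimately show ?thesis unfolding antidual_def by blast
qed

context smooth_bump
begin

lemma L2_inner_antidual:
  assumes g: "g \<in> L2 UNIV" shows "L2_inner UNIV g \<in> Hm1_line"
proof -
  have "norm (L2_inner UNIV g v) \<le> L2_norm UNIV g * H1_norm UNIV v" if "v \<in> H1_line" for v
    by (rule order_trans[OF L2_inner_norm_le[OF g H1_L2[OF that]] mult_left_mono[OF L2_norm_le_H1_norm]]) simp
  then show ?thesis unfolding antidual_def using L2_inner_add_right[OF H1_L2 H1_L2 g] L2_inner_scale_right by blast
qed

lemma Hm1_norm_L2_diff:
  assumes "g \<in> L2 UNIV" "h \<in> L2 UNIV"
  shows "Hm1_norm (L2_inner UNIV g - L2_inner UNIV h) \<le> L2_norm UNIV (\<lambda>x. g x - h x)"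
proof (rule seminormed.dual_norm_le[OF H1_seminormed[OF open_UNIV]])
  fix v assume v: "v \<in> H1_line"
  show "norm ((L2_inner UNIV g - L2_inner UNIV h) v) \<le> L2_norm UNIV (\<lambda>x. g x - h x) * H1_norm UNIV v"
    unfolding fun_diff_def L2_inner_diff_left[OF assms H1_L2[OF v], symmetric]
    by (rule order_trans[OF L2_inner_norm_le[OF L2_diff[OF assms] H1_L2[OF v]] mult_left_mono[OF L2_norm_le_H1_norm]]) simp
qed simp

lemma emb_weak_derivative:
  assumes h: "smooth h" "\<And>x. (h has_real_derivative h' x) (at x)" "h 0 = 0" "h pi = 0" and S: "S \<in> sets lebesgue" "\<I> \<subseteq> S"
  shows "has_weak_derivative S (emb h) (emb h')"
  using E0_weak_derivative[OF smooth_of_real[OF h(1)] _ _ S] h(3,4) vector_derivative_of_real[OF h(2)] by simp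

end

context construction
begin

definition sol :: "real \<Rightarrow> real \<Rightarrow> complex" where "sol t = emb (u (act t) t)"
definition sol' :: "real \<Rightarrow> functional" where "sol' t = L2_inner UNIV (emb (ut (act t) t))"
definition force :: "real \<Rightarrow> real \<Rightarrow> complex" where "force t = emb (f (act t) t)"

lemma u_sol_emb: "E0 (u_sol \<epsilon> \<eta> \<rho> t) = sol t" by (auto simp: E0_def sol_def u_sol_eq fun_eq_iff)

lemma u_sol_on: "x \<in> \<I> \<Longrightarrow> u_sol \<epsilon> \<eta> \<rho> t x = sol t x" by (simp add: E0_def sol_def u_sol_eq)

lemma near_good:
  assumes "t \<notin> bad"
  shows "eventually (\<lambda>s. u (act s) s = u (act t) s \<and> ut (act s) s = ut (act t) s \<and> f (act s) s = f (act t) s) (nhds t)"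
  using act_locally_constant[OF assms]
proof eventually_elim
  case (elim s)
  have in_J: "j \<ge> 1 \<Longrightarrow> j \<noteq> act t \<Longrightarrow> inactive j s" for j using elim by blast
  show ?case using switch_group[OF act(1) in_J] by (auto simp: fun_eq_iff)
qed

lemma sol_L2: "sol t \<in> L2 UNIV" unfolding sol_def by (rule emb_L2[OF smooth_u]) auto

lemma sol_H1: "sol t \<in> H1_line"
  unfolding sol_def by (rule E0_H1[OF smooth_of_real[OF smooth_u]]) (simp_all add: u_ends)

lemma sol_L2_time: "sol \<in> L2_time H1_line (H1_norm UNIV)"
proof (rule L2_timeI[OF H1_zero, where C = "sqrt (((R + 1) * 2)\<^sup>2 + ((R + 1) * 2)\<^sup>2)"])
  have norm_eq: "H1_norm UNIV (emb h) = sqrt ((L2_norm UNIV (emb h))\<^sup>2 + (L2_norm UNIV (emb h'))\<^sup>2)"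
    if "smooth h" "\<And>x. (h has_real_derivative h' x) (at x)" "h 0 = 0" "h pi = 0" "smooth h'" for h h'
    by (rule H1_norm_eq[OF _ emb_L2[OF that(1)] emb_L2[OF that(5)] emb_weak_derivative[OF that(1-4)]]) auto
  show "AE t in unit_time. 0 \<le> H1_norm UNIV (sol t) \<and> H1_norm UNIV (sol t) \<le> sqrt (((R + 1) * 2)\<^sup>2 + ((R + 1) * 2)\<^sup>2)"
  proof (rule AE_I2, intro conjI H1_norm_nonneg)
    fix t
    have "L2_norm UNIV (emb (u (act t) t)) \<le> (R + 1) * 2" "L2_norm UNIV (emb (ux (act t) t)) \<le> (R + 1) * 2"
      by (rule emb_norm_le[OF u_bound(1)[OF act(1)] _ _ smooth_u] emb_norm_le[OF u_bound(2)[OF act(1)] _ _ smooth_ux]; simp)+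
    then show "H1_norm UNIV (sol t) \<le> sqrt (((R + 1) * 2)\<^sup>2 + ((R + 1) * 2)\<^sup>2)"
      unfolding sol_def norm_eq[OF smooth_u u_x_deriv u_ends smooth_ux] by (intro real_sqrt_le_mono add_mono power_mono L2_norm_nonneg)
  qed
  show "AE t in unit_time. ((\<lambda>s. H1_norm UNIV (sol t - sol s)) \<longlongrightarrow> 0) (nhds t) \<and> (\<forall>\<^sub>F s in nhds t. sol s \<in> H1_line)" using AE_good
  proof eventually_elim
    case (elim t)
    let ?J = "act t"
    let ?a = "\<lambda>s. L2_norm UNIV (emb (\<lambda>x. u ?J t x - u ?J s x))" and ?b = "\<lambda>s. L2_norm UNIV (emb (\<lambda>x. ux ?J t x - ux ?J s x))"
    have "(?a \<longlongrightarrow> 0) (nhds t)" "(?b \<longlongrightarrow> 0) (nhds t)"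
      by (rule emb_continuous_in_time[OF jointly_continuous(1)[OF act(1)] smooth_u] emb_continuous_in_time[OF jointly_continuous(2)[OF act(1)] smooth_ux]; simp)+
    then have "((\<lambda>s. sqrt ((?a s)\<^sup>2 + (?b s)\<^sup>2)) \<longlongrightarrow> sqrt (0\<^sup>2 + 0\<^sup>2)) (nhds t)"
      by (rule tendsto_real_sqrt[OF tendsto_add[OF tendsto_power tendsto_power]])
    then have lim: "((\<lambda>s. sqrt ((?a s)\<^sup>2 + (?b s)\<^sup>2)) \<longlongrightarrow> 0) (nhds t)" by simp
    have "eventually (\<lambda>s. H1_norm UNIV (sol t - sol s) = sqrt ((?a s)\<^sup>2 + (?b s)\<^sup>2)) (nhds t)" using near_good[OF elim]
    proof eventually_elim
      case (elim s)
      have "sol t - sol s = emb (\<lambda>x. u ?J t x - u ?J s x)" using elim by (simp only: sol_def emb_diff fun_diff_def)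
      then show ?case using norm_eq[of "\<lambda>x. u ?J t x - u ?J s x" "\<lambda>x. ux ?J t x - ux ?J s x",
          OF smooth_diff[OF smooth_u smooth_u] DERIV_diff[OF u_x_deriv u_x_deriv] _ _ smooth_diff[OF smooth_ux smooth_ux]] by (simp add: u_ends)
    qed
    with lim have "((\<lambda>s. H1_norm UNIV (sol t - sol s)) \<longlongrightarrow> 0) (nhds t)" by (simp only: tendsto_cong)
    then show ?case using sol_H1 by simp
  qed
qed

lemma force_L2_time: "force \<in> L2_time (L2 UNIV) (L2_norm UNIV)"
proof (rule L2_timeI[OF L2_zero, where C = "(8 * R + 20) * 2"])
  show "AE t in unit_time. 0 \<le> L2_norm UNIV (force t) \<and> L2_norm UNIV (force t) \<le> (8 * R + 20) * 2"
    unfolding force_def by (rule AE_I2, intro conjI L2_norm_nonneg, rule emb_norm_le[OF f_bound[OF act(1)] _ _ smooth_f]) auto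
  have m: "force s \<in> L2 UNIV" for s unfolding force_def by (rule emb_L2[OF smooth_f]) auto
  show "AE t in unit_time. ((\<lambda>s. L2_norm UNIV (force t - force s)) \<longlongrightarrow> 0) (nhds t) \<and> (\<forall>\<^sub>F s in nhds t. force s \<in> L2 UNIV)" using AE_good
  proof eventually_elim
    case (elim t)
    let ?a = "\<lambda>s. L2_norm UNIV (emb (\<lambda>x. f (act t) t x - f (act t) s x))"
    have lim: "(?a \<longlongrightarrow> 0) (nhds t)" by (rule emb_continuous_in_time[OF jointly_continuous(4)[OF act(1)] smooth_f]) auto
    have "eventually (\<lambda>s. L2_norm UNIV (force t - force s) = ?a s) (nhds t)"
      using near_good[OF elim] by eventually_elim (simp only: force_def emb_diff fun_diff_def)
    with lim have "((\<lambda>s. L2_norm UNIV (force t - force s)) \<longlongrightarrow> 0) (nhds t)" by (simp only: tendsto_cong)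
    then show ?case using m by simp
  qed
qed

lemma dual_L2_time:
  assumes h: "\<And>J. J \<ge> 1 \<Longrightarrow> continuous_on UNIV (\<lambda>p. h J (fst p) (snd p))" "\<And>J s. smooth (h J s)"
    and near: "\<And>t. t \<notin> bad \<Longrightarrow> eventually (\<lambda>s. h (act s) s = h (act t) s) (nhds t)"
    and bound: "\<And>t v. v \<in> H1_line \<Longrightarrow> norm (L2_inner UNIV (emb (h (act t) t)) v) \<le> C * H1_norm UNIV v" and C: "0 \<le> C"
  shows "(\<lambda>t. L2_inner UNIV (emb (h (act t) t))) \<in> L2_time Hm1_line Hm1_norm"
proof -
  interpret H1: seminormed H1_line "H1_norm UNIV" by (rule H1_seminormed) simp
  have m: "emb (h J s) \<in> L2 UNIV" for J s by (rule emb_L2[OF h(2)]) auto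
  note a = L2_inner_antidual[OF m]
  show ?thesis
  proof (rule L2_timeI)
    show "L2_inner UNIV (emb (h 1 0)) \<in> Hm1_line" by (rule a)
    show "AE t in unit_time. 0 \<le> Hm1_norm (L2_inner UNIV (emb (h (act t) t))) \<and> Hm1_norm (L2_inner UNIV (emb (h (act t) t))) \<le> C"
      by (rule AE_I2, intro conjI H1.dual_norm_nonneg a H1.dual_norm_le bound C)
    show "AE t in unit_time. ((\<lambda>s. Hm1_norm (L2_inner UNIV (emb (h (act t) t)) - L2_inner UNIV (emb (h (act s) s)))) \<longlongrightarrow> 0) (nhds t)
        \<and> (\<forall>\<^sub>F s in nhds t. L2_inner UNIV (emb (h (act s) s)) \<in> Hm1_line)" using AE_good
    proof eventually_elim
      case (elim t)
      let ?a = "\<lambda>s. L2_norm UNIV (emb (\<lambda>x. h (act t) t x - h (act t) s x))"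
      have lim: "(?a \<longlongrightarrow> 0) (nhds t)" by (rule emb_continuous_in_time[OF h(1)[OF act(1)] h(2)]) auto
      have "((\<lambda>s. Hm1_norm (L2_inner UNIV (emb (h (act t) t)) - L2_inner UNIV (emb (h (act s) s)))) \<longlongrightarrow> 0) (nhds t)"
      proof (rule tendsto_sandwich[OF _ _ tendsto_const lim])
        show "\<forall>\<^sub>F s in nhds t. 0 \<le> Hm1_norm (L2_inner UNIV (emb (h (act t) t)) - L2_inner UNIV (emb (h (act s) s)))"
          by (intro always_eventually allI H1.dual_norm_nonneg H1.antidual_diff a)
        show "\<forall>\<^sub>F s in nhds t. Hm1_norm (L2_inner UNIV (emb (h (act t) t)) - L2_inner UNIV (emb (h (act s) s))) \<le> ?a s" using near[OF elim]
        proof eventually_elim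
          case (elim s)
          show ?case unfolding elim emb_diff by (rule Hm1_norm_L2_diff[OF m m])
        qed
      qed
      then show ?case using a by simp
    qed
  qed
qed

lemma sol_pairing_bound:
  assumes "v \<in> H1_line" shows "norm (L2_inner UNIV (sol t) v) \<le> (4 * (R + 1)) * H1_norm UNIV v"
proof -
  have y: "\<bar>y J m t\<bar> \<le> R + 1" if J: "J \<ge> 1" for J m
  proof -
    have "1 \<le> (K_freq J m)\<^sup>2" using K_freq_ge[OF J, of m] by (intro one_le_power) simp
    then have "1 / (K_freq J m)\<^sup>2 \<le> 1" using K_freq_pos[OF J, of m] by (simp add: pos_divide_le_eq del: one_le_power)
    then show ?thesis using y_bound[OF J, of m t] R(1) by linarith
  qed
  show ?thesis
    unfolding sol_def u_lin using R(2)[of t] R(1) y[OF act(1)]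
    by (intro order_trans[OF lin_line_pairing[OF act(1) assms] mult_right_mono[OF lin_coefficients_bound[OF act(1)]]] act(1)) (simp_all add: add_increasing2)
qed

lemma sol'_pairing_bound:
  assumes "v \<in> H1_line" shows "norm (sol' t v) \<le> (4 * (R + 1)) * H1_norm UNIV v"
  unfolding sol'_def ut_lin using R(3)[of t] R(1) y'_bound[OF act(1)]
  by (intro order_trans[OF lin_line_pairing[OF act(1) assms] mult_right_mono[OF lin_coefficients_bound[OF act(1)]]]) (simp_all add: add_increasing2)

lemma sol_dual_L2_time: "(\<lambda>t. L2_inner UNIV (sol t)) \<in> L2_time Hm1_line Hm1_norm"
  unfolding sol_def
proof (rule dual_L2_time[OF jointly_continuous(1) smooth_u])
  show "t \<notin> bad \<Longrightarrow> eventually (\<lambda>s. u (act s) s = u (act t) s) (nhds t)" for t by (rule eventually_mono[OF near_good]) auto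
qed (use sol_pairing_bound[unfolded sol_def] R(1) in auto)

lemma sol'_L2_time: "sol' \<in> L2_time Hm1_line Hm1_norm"
  unfolding sol'_def[abs_def]
proof (rule dual_L2_time[OF jointly_continuous(3) smooth_ut])
  show "t \<notin> bad \<Longrightarrow> eventually (\<lambda>s. ut (act s) s = ut (act t) s) (nhds t)" for t by (rule eventually_mono[OF near_good]) auto
qed (use sol'_pairing_bound[unfolded sol'_def] R(1) in auto)

text \<open>Two groups may be involved in a comparison of two times, but each of them is switched off
  at one of the two times.\<close>

lemma sol_lipschitz:
  assumes v: "v \<in> H1_line"
  shows "norm (L2_inner UNIV (sol s) v - L2_inner UNIV (sol t) v) \<le> (12 * (R + 1) * \<bar>s - t\<bar>) * H1_norm UNIV v"
proof -
  let ?D = "(R + 1) * \<bar>s - t\<bar>"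
  define P where "P h = L2_inner UNIV (emb h) v" for h
  have P_diff: "P h - P k = P (\<lambda>x. h x - k x)" if "smooth h" "smooth k" for h k
    unfolding P_def emb_diff by (rule L2_inner_diff_left[symmetric]) (use that H1_L2[OF v] in \<open>simp_all add: emb_L2\<close>)
  have D: "0 \<le> ?D" using R(1) by simp
  have lin_le: "norm (P (lin J c0 c)) \<le> (4 * ?D) * H1_norm UNIV v" if "J \<ge> 1" "\<bar>c0\<bar> \<le> ?D" "\<And>m. \<bar>c m\<bar> \<le> ?D" for J c0 c
    unfolding P_def by (rule order_trans[OF lin_line_pairing[OF that(1) v] mult_right_mono[OF lin_coefficients_bound[OF that]]]) simp
  have step: "norm (P (u J s) - P (u J t)) \<le> (4 * ?D) * H1_norm UNIV v" if "J \<ge> 1" for J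
    unfolding P_diff[OF smooth_u smooth_u] unfolding u_lin lin_diff by (rule lin_le[OF that \<rho>_lipschitz y_lipschitz[OF that]])
  show ?thesis
  proof (cases "act s = act t")
    case True
    have "4 * ?D \<le> 12 * (R + 1) * \<bar>s - t\<bar>" using mult_right_mono[of 4 12, OF _ D] by (simp only: mult.assoc[of 12])
    then have "(4 * ?D) * H1_norm UNIV v \<le> (12 * (R + 1) * \<bar>s - t\<bar>) * H1_norm UNIV v" by (rule mult_right_mono) simp
    then show ?thesis using step[OF act(1), of t] True unfolding sol_def P_def by simp
  next
    case False
    have i: "inactive (act s) t" "inactive (act t) s" using act(2) act(1) False by auto
    have off: "u (act s) t = lin 1 (\<rho> t) (\<lambda>m. 0)" "u (act t) s = lin 1 (\<rho> s) (\<lambda>m. 0)"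
      using inactive_modes(2)[OF act(1) i(1)] inactive_modes(2)[OF act(1) i(2)] by (simp_all add: u_def lin_def fun_eq_iff)
    have "norm (P (u (act s) t) - P (u (act t) s)) \<le> (4 * ?D) * H1_norm UNIV v"
      unfolding P_diff[OF smooth_u smooth_u] unfolding off lin_diff by (rule lin_le) (use \<rho>_lipschitz[of t s] D in \<open>simp_all add: abs_minus_commute\<close>)
    moreover note step[OF act(1), of s] step[OF act(1), of t]
    moreover have "P (u (act s) s) - P (u (act t) t) = (P (u (act s) s) - P (u (act s) t)) + (P (u (act s) t) - P (u (act t) s)) + (P (u (act t) s) - P (u (act t) t))"
      by simp
    then have "norm (P (u (act s) s) - P (u (act t) t)) \<le> norm (P (u (act s) s) - P (u (act s) t)) + norm (P (u (act s) t) - P (u (act t) s)) + norm (P (u (act t) s) - P (u (act t) t))"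
      by (metis (no_types, lifting) norm_triangle_ineq norm_triangle_mono order_refl)
    ultimately show ?thesis unfolding sol_def P_def by (simp add: algebra_simps)
  qed
qed

lemma sol_zero_initial_value: "zero_initial_value H1_line (H1_norm UNIV) (\<lambda>t. L2_inner UNIV (sol t))"
  unfolding zero_initial_value_def
proof (intro exI[of _ "\<lambda>t. L2_inner UNIV (sol t)"] conjI ballI)
  interpret H1: seminormed H1_line "H1_norm UNIV" by (rule H1_seminormed) simp
  show "L2_inner UNIV (sol t) \<in> Hm1_line" for t by (rule L2_inner_antidual[OF sol_L2])
  show "((\<lambda>s. Hm1_norm (L2_inner UNIV (sol s) - L2_inner UNIV (sol t))) \<longlongrightarrow> 0) (at t within {0..1})" for t
  proof (rule tendsto_sandwich[OF _ _ tendsto_const])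
    show "\<forall>\<^sub>F s in at t within {0..1}. 0 \<le> Hm1_norm (L2_inner UNIV (sol s) - L2_inner UNIV (sol t))"
      by (intro always_eventually allI H1.dual_norm_nonneg H1.antidual_diff L2_inner_antidual sol_L2)
    show "\<forall>\<^sub>F s in at t within {0..1}. Hm1_norm (L2_inner UNIV (sol s) - L2_inner UNIV (sol t)) \<le> 12 * (R + 1) * \<bar>s - t\<bar>"
    proof (intro always_eventually allI H1.dual_norm_le)
      show "norm ((L2_inner UNIV (sol s) - L2_inner UNIV (sol t)) v) \<le> 12 * (R + 1) * \<bar>s - t\<bar> * H1_norm UNIV v" if "v \<in> H1_line" for s v
        unfolding fun_diff_def by (rule sol_lipschitz[OF that])
    qed (use R(1) in simp)
    have "((\<lambda>s. 12 * (R + 1) * \<bar>s - t\<bar>) \<longlongrightarrow> 12 * (R + 1) * \<bar>t - t\<bar>) (at t within {0..1})" by (intro tendsto_intros)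
    then show "((\<lambda>s. 12 * (R + 1) * \<bar>s - t\<bar>) \<longlongrightarrow> 0) (at t within {0..1})" by simp
  qed
  have "inactive (act 0) 0" using tau_ge[OF act(1), of 0] by (simp add: inactive_def)
  then have "u (act 0) 0 = (\<lambda>x. 0)" using inactive_modes(2)[OF act(1)] by (simp add: u_def \<rho>_zero fun_eq_iff)
  then have "sol 0 = (\<lambda>x. 0)" by (simp add: sol_def E0_def fun_eq_iff)
  then show "L2_inner UNIV (sol 0) v = 0" for v by (simp add: L2_inner_def)
qed simp

lemma lin_inner:
  assumes v: "v \<in> L2 S" and S: "S \<in> sets lebesgue" "\<I> \<subseteq> S"
  shows "L2_inner S (emb (lin J c0 c)) v = complex_of_real c0 * L2_inner S (emb phi) v
    + (\<Sum>m=1..J. complex_of_real (c m) * L2_inner S (emb (p_mode (K_freq J m))) v)"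
proof -
  have e: "emb (lin J c0 c) = (\<lambda>x. complex_of_real c0 * emb phi x + (\<Sum>m=1..J. complex_of_real (c m) * emb (p_mode (K_freq J m)) x))"
    by (auto simp: fun_eq_iff E0_def lin_def)
  have L: "(\<lambda>x. complex_of_real c0 * emb phi x) \<in> L2 S" "(\<lambda>x. complex_of_real (c m) * emb (p_mode (K_freq J m)) x) \<in> L2 S" for m
    by (rule L2_scale[OF emb_L2[OF smooth_phi S]] L2_scale[OF emb_L2[OF smooth_p_mode S]])+
  show ?thesis unfolding e by (simp add: L2_inner_add_left[OF L(1) L2_sum[OF L(2)] v] L2_inner_sum_left[OF L(2) v] L2_inner_scale_left)
qed

lemma y'_continuous: assumes "J \<ge> 1" shows "continuous_on S (y' J m)"
proof -
  have "K_freq J m \<noteq> 0" using K_freq_pos[OF assms, of m] by simp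
  then show ?thesis unfolding y'_def[abs_def] theta_def by (intro continuous_intros e_continuous[OF assms] e'_continuous) auto
qed

text \<open>Integration by parts in time is carried out for finitely many groups, and the number of groups
  tends to infinity; at each time the truncated pairings are eventually constant.\<close>

lemma sol_weak_time_derivative: "has_weak_time_derivative H1_line (\<lambda>t. L2_inner UNIV (sol t)) sol'"
  unfolding has_weak_time_derivative_def
proof (intro ballI)
  fix \<psi> :: "real \<Rightarrow> complex" and v assume \<psi>: "\<psi> \<in> test_functions {0<..<1}" and v: "v \<in> H1_line"
  let ?\<psi>' = "\<lambda>t. vector_derivative \<psi> (at t)"
  define A where "A = L2_inner UNIV (emb phi) v"
  define B where "B j m = L2_inner UNIV (emb (p_mode (K_freq j m))) v" for j m
  define F where "F n t = complex_of_real (\<rho> t) * A + (\<Sum>j=1..n. \<Sum>m=1..j. complex_of_real (y j m t) * B j m)" for n t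
  define G where "G n t = complex_of_real (\<rho>' t) * A + (\<Sum>j=1..n. \<Sum>m=1..j. complex_of_real (y' j m t) * B j m)" for n t
  have inner: "L2_inner UNIV (emb (lin J c0 c)) v = complex_of_real c0 * A + (\<Sum>m=1..J. complex_of_real (c m) * B J m)" for J c0 c
    unfolding A_def B_def by (rule lin_inner[OF H1_L2[OF v]]) auto
  have FG: "F n t = (if act t \<le> n then L2_inner UNIV (sol t) v else L2_inner UNIV (emb (lin 1 (\<rho> t) (\<lambda>m. 0))) v)"
    "G n t = (if act t \<le> n then sol' t v else L2_inner UNIV (emb (lin 1 (\<rho>' t) (\<lambda>m. 0))) v)" for n t
  proof -
    have single: "(\<Sum>j=1..n. g j) = (if act t \<le> n then g (act t) else 0)" if "\<And>j. j \<ge> 1 \<Longrightarrow> j \<noteq> act t \<Longrightarrow> g j = 0" for g :: "nat \<Rightarrow> complex"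
    proof (cases "act t \<le> n")
      case True
      then have "sum g {1..n} = sum g {act t}" using that act(1)[of t] by (intro sum.mono_neutral_right) auto
      then show ?thesis using True by simp
    next
      case False
      then show ?thesis using that by (intro trans[OF sum.neutral]) auto
    qed
    show "F n t = (if act t \<le> n then L2_inner UNIV (sol t) v else L2_inner UNIV (emb (lin 1 (\<rho> t) (\<lambda>m. 0))) v)"
      unfolding F_def sol_def u_lin inner by (subst single) (use inactive_modes(2)[OF _ act(2)] in auto)
    show "G n t = (if act t \<le> n then sol' t v else L2_inner UNIV (emb (lin 1 (\<rho>' t) (\<lambda>m. 0))) v)"
      unfolding G_def sol'_def ut_lin inner by (subst single) (use inactive_modes(3)[OF _ act(2)] in auto)
  qed
  let ?C = "(4 * (R + 1)) * H1_norm UNIV v"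
  have bounds: "norm (F n t) \<le> ?C" "norm (G n t) \<le> ?C" for n t
  proof -
    have "norm (L2_inner UNIV (emb (lin 1 c (\<lambda>m. 0))) v) \<le> ?C" if "\<bar>c\<bar> \<le> R" for c
      by (rule order_trans[OF lin_line_pairing[OF _ v] mult_right_mono[OF lin_coefficients_bound]]) (use that R(1) in auto)
    then show "norm (F n t) \<le> ?C" "norm (G n t) \<le> ?C"
      unfolding FG using sol_pairing_bound[OF v, of t] sol'_pairing_bound[OF v, of t] R(2,3)[of t] by auto
  qed
  have lim: "(\<lambda>n. F n t) \<longlonglongrightarrow> L2_inner UNIV (sol t) v" "(\<lambda>n. G n t) \<longlonglongrightarrow> sol' t v" for t
    by (rule tendsto_eventually, rule eventually_mono[OF eventually_ge_at_top[of "act t"]], simp add: FG)+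
  have F_deriv: "(F n has_vector_derivative G n t) (at t)" for n t
  proof -
    have r: "((\<lambda>t. complex_of_real (g t) * c) has_vector_derivative complex_of_real g' * c) (at t)"
      if "(g has_real_derivative g') (at t)" for g g' c
      using bounded_linear.has_vector_derivative[OF bounded_linear_compose[OF bounded_linear_mult_left bounded_linear_of_real], of g g' "at t" c] that
      by (simp add: has_real_derivative_iff_has_vector_derivative)
    show ?thesis unfolding F_def[abs_def] G_def
    proof (rule has_vector_derivative_add[OF r[OF \<rho>_deriv]], rule has_vector_derivative_sum, rule has_vector_derivative_sum, rule r)
      show "j \<in> {1..n} \<Longrightarrow> (y j m has_real_derivative y' j m t) (at t)" for j m by (rule y_deriv) simp
    qed
  qed
  have s: "smooth \<psi>" using \<psi> by (simp add: test_functions_def)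
  have F_cont: "continuous_on UNIV (F n)" for n by (rule continuous_at_imp_continuous_on) (use F_deriv has_vector_derivative_continuous in blast)
  have G_cont: "continuous_on UNIV (G n)" for n
    unfolding G_def[abs_def]
    by (intro continuous_on_add continuous_on_mult_right continuous_on_sum continuous_on_of_real \<rho>'_continuous y'_continuous) simp
  have \<psi>_cont: "continuous_on UNIV \<psi>" "continuous_on UNIV ?\<psi>'"
    by (rule smooth_continuous_on[OF s] smooth_continuous_on[OF smooth_derivative(1)[OF s]])+
  have ends: "\<psi> 0 = 0" "\<psi> 1 = 0" using test_function_outside[OF \<psi>] by auto
  have ibp: "(\<integral>t. ?\<psi>' t * F n t \<partial>unit_time) = - (\<integral>t. \<psi> t * G n t \<partial>unit_time)" for n
  proof -
    have "(\<integral>t. \<psi> t * G n t \<partial>lebesgue_on {0..1}) = \<psi> 1 * F n 1 - \<psi> 0 * F n 0 - (\<integral>t. ?\<psi>' t * F n t \<partial>lebesgue_on {0..1})"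
      by (rule integration_by_parts_Icc[OF _ smooth_derivative(2)[OF s] F_deriv continuous_on_subset[OF \<psi>_cont(2)] continuous_on_subset[OF G_cont]]) auto
    then show ?thesis using integral_Ioo_eq_Icc[OF continuous_measurable_lebesgue_on[OF continuous_on_mult[OF \<psi>_cont(1) G_cont]], of 0 1 n]
        integral_Ioo_eq_Icc[OF continuous_measurable_lebesgue_on[OF continuous_on_mult[OF \<psi>_cont(2) F_cont]], of 0 1 n] ends by simp
  qed
  have dom: "(\<lambda>n. \<integral>t. k t * H n t \<partial>unit_time) \<longlonglongrightarrow> (\<integral>t. k t * h t \<partial>unit_time)"
    if k: "k \<in> test_functions {0<..<1}" and H: "\<And>n. continuous_on UNIV (H n)" "\<And>n t. norm (H n t) \<le> ?C" "\<And>t. (\<lambda>n. H n t) \<longlonglongrightarrow> h t"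
    for k h :: "real \<Rightarrow> complex" and H
  proof -
    obtain M where M: "\<And>t. norm (k t) \<le> M" using test_function_bounded[OF k] by metis
    have c: "continuous_on UNIV k" using k by (intro smooth_continuous_on) (simp add: test_functions_def)
    have meas: "(\<lambda>t. k t * H n t) \<in> borel_measurable unit_time" for n by (rule continuous_measurable_lebesgue_on[OF continuous_on_mult[OF c H(1)]])
    have l: "(\<lambda>n. k t * H n t) \<longlonglongrightarrow> k t * h t" for t by (rule tendsto_mult[OF tendsto_const H(3)])
    have lm: "(\<lambda>t. k t * h t) \<in> borel_measurable unit_time" by (rule borel_measurable_LIMSEQ_metric[OF meas l])
    show ?thesis
    proof (rule integral_dominated_convergence[OF lm meas, where w = "\<lambda>t. M * ?C"])
      show "integrable unit_time (\<lambda>t. M * ?C)" by (rule finite_measure.integrable_const, rule finite_measure_lebesgue_on) simp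
      show "AE t in unit_time. (\<lambda>n. k t * H n t) \<longlonglongrightarrow> k t * h t" using l by simp
      show "AE t in unit_time. norm (k t * H n t) \<le> M * ?C" for n
        unfolding norm_mult using mult_mono[OF M H(2) order_trans[OF norm_ge_zero M] norm_ge_zero] by simp
    qed
  qed
  show "(\<integral>t. ?\<psi>' t * L2_inner UNIV (sol t) v \<partial>unit_time) = - (\<integral>t. \<psi> t * sol' t v \<partial>unit_time)"
  proof (rule LIMSEQ_unique[OF dom[OF test_function_derivative[OF \<psi>] F_cont bounds(1) lim(1)]])
    show "(\<lambda>n. \<integral>t. ?\<psi>' t * F n t \<partial>unit_time) \<longlonglongrightarrow> - (\<integral>t. \<psi> t * sol' t v \<partial>unit_time)"
      unfolding ibp by (rule tendsto_minus[OF dom[OF \<psi> G_cont bounds(2) lim(2)]])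
  qed
qed

lemma coeff_measurable: "coeff_a \<epsilon> \<eta> t \<in> borel_measurable (lebesgue_on S)"
proof -
  have "smooth (\<lambda>x. 1 + \<epsilon> * bt (act t) t x)" by (rule smooth_add[OF smooth_const smooth_cmult[OF smooth_bt]])
  then show ?thesis unfolding coeff_eq[abs_def] by (rule smooth_measurable)
qed

lemma elliptic_flux:
  assumes S: "open S" "\<I> \<subseteq> S" and v: "v \<in> H1 S" and z: "\<And>x. x \<in> S \<Longrightarrow> z x = sol t x"
  shows "elliptic_op S (coeff_a \<epsilon> \<eta> t) z v = - L2_inner S (emb (fluxx (act t) t)) v"
proof -
  let ?J = "act t"
  have Sl: "S \<in> sets lebesgue" using S(1) by simp
  have W: "has_weak_derivative S (sol t) (emb (ux ?J t))"
    unfolding sol_def by (rule emb_weak_derivative[OF smooth_u u_x_deriv u_ends Sl S(2)])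
  have Wz: "has_weak_derivative S z (emb (ux ?J t))"
    unfolding has_weak_derivative_def
  proof
    fix \<phi> :: "real \<Rightarrow> complex" assume "\<phi> \<in> test_functions S"
    moreover have "(\<integral>x. z x * vector_derivative \<phi> (at x) \<partial>lebesgue_on S) = (\<integral>x. sol t x * vector_derivative \<phi> (at x) \<partial>lebesgue_on S)"
      by (rule Bochner_Integration.integral_cong) (use z in simp_all)
    ultimately show "(\<integral>x. z x * vector_derivative \<phi> (at x) \<partial>lebesgue_on S) = - (\<integral>x. emb (ux ?J t) x * \<phi> x \<partial>lebesgue_on S)"
      using W unfolding has_weak_derivative_def by simp
  qed
  have zL: "z \<in> L2 S" by (rule L2_cong[OF z]) (auto simp: sol_def intro!: emb_L2[OF smooth_u Sl S(2)])
  have ae: "AE x in lebesgue_on S. wderiv S z x = emb (ux ?J t) x" by (rule wderiv_AE[OF S(1) zL emb_L2[OF smooth_ux Sl S(2)] Wz])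
  have "elliptic_op S (coeff_a \<epsilon> \<eta> t) z v = (\<integral>x. emb (flux ?J t) x * cnj (wderiv S v x) \<partial>lebesgue_on S)"
    unfolding elliptic_op_def
  proof (rule integral_cong_AE_lebesgue_on[symmetric, OF _ _ Sl])
    show "(\<lambda>x. emb (flux ?J t) x * cnj (wderiv S v x)) \<in> borel_measurable (lebesgue_on S)"
      by (rule borel_measurable_integrable[OF L2_inner_integrable[OF emb_L2[OF smooth_flux Sl S(2)] wderiv_L2[OF v]]])
    show "AE x in lebesgue_on S. emb (flux ?J t) x * cnj (wderiv S v x) = complex_of_real (coeff_a \<epsilon> \<eta> t x) * wderiv S z x * cnj (wderiv S v x)"
      using ae by eventually_elim (simp add: E0_def flux_def coeff_eq)
  qed
  then have 1: "elliptic_op S (coeff_a \<epsilon> \<eta> t) z v = L2_inner S (emb (flux ?J t)) (wderiv S v)" by (simp add: L2_inner_def)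
  have d: "(\<lambda>x. vector_derivative (\<lambda>x. complex_of_real (flux ?J t x)) (at x)) = (\<lambda>x. complex_of_real (fluxx ?J t x))"
    using vector_derivative_of_real[of "flux ?J t" "fluxx ?J t", OF flux_x_deriv] by auto
  have "L2_inner S (emb (fluxx ?J t)) v = - L2_inner S (emb (flux ?J t)) (wderiv S v)"
    using H1_integration_by_parts_cnj[OF v Sl S(2) smooth_of_real[OF smooth_flux[of ?J t]]] flux_ends[OF act(1)] unfolding d by simp
  then show ?thesis unfolding 1 by simp
qed

text \<open>Stated for a general open set, since it is used both on \<open>(0,\<pi>)\<close>, where it determines the forcing, and on the line.\<close>

lemma evolution_identity:
  assumes S: "open S" "\<I> \<subseteq> S" and v: "v \<in> H1 S" and z: "\<And>x. x \<in> S \<Longrightarrow> z x = sol t x"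
  shows "L2_inner S (emb (ut (act t) t)) v + elliptic_op S (coeff_a \<epsilon> \<eta> t) z v = L2_inner S (force t) v"
proof -
  have Sl: "S \<in> sets lebesgue" using S(1) by simp
  show ?thesis using elliptic_flux[OF S v z] unfolding force_def f_def[abs_def] emb_diff
    using L2_inner_diff_left[OF emb_L2[OF smooth_ut Sl S(2)] emb_L2[OF smooth_fluxx Sl S(2)] H1_L2[OF v], of "act t" t "act t" t] by simp
qed

end

section \<open>Identification of the forcing\<close>

context construction
begin

lemma lin_antidual:
  assumes J: "J \<ge> 1" shows "L2_inner \<I> (emb (lin J c0 c)) \<in> antidual V_space V_norm"
proof -
  have L: "emb (lin J c0 c) \<in> L2 \<I>" by (rule emb_L2[OF smooth_lin]) auto
  show ?thesis
    unfolding antidual_def mem_Collect_eq by (intro conjI ballI allI exI[of _ "(\<bar>c0\<bar> * 3 + (\<Sum>m=1..J. \<bar>c m\<bar> * (2 / K_freq J m))) * 2"]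
      L2_inner_scale_right lin_V_pairing[OF J] L2_inner_add_right[OF H1_L2[OF V_H1] H1_L2[OF V_H1] L])
qed

lemma u_sol_antidual: "L2_inner \<I> (u_sol \<epsilon> \<eta> \<rho> t) \<in> antidual V_space V_norm"
proof -
  have "L2_inner \<I> (u_sol \<epsilon> \<eta> \<rho> t) = L2_inner \<I> (sol t)" by (rule ext, rule L2_inner_cong_left[OF u_sol_on])
  then show ?thesis unfolding sol_def u_lin using lin_antidual[OF act(1)] by simp
qed

text \<open>Near such a time \<open>u\<close> is a finite combination of fixed functions, and the difference quotients of the scalar coefficients converge.\<close>

lemma u_dual_derivative:
  assumes t: "t \<notin> bad"
  shows "has_dual_derivative V_space V_norm (\<lambda>s. L2_inner \<I> (u_sol \<epsilon> \<eta> \<rho> s)) (L2_inner \<I> (emb (ut (act t) t))) (at t within {0..1}) t"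
  unfolding has_dual_derivative_def
proof
  interpret V: seminormed V_space V_norm by (rule V_seminormed)
  let ?J = "act t" and ?W = "\<lambda>s. L2_inner \<I> (u_sol \<epsilon> \<eta> \<rho> s)" and ?D = "L2_inner \<I> (emb (ut (act t) t))"
  show D: "?D \<in> antidual V_space V_norm" unfolding ut_lin by (rule lin_antidual[OF act(1)])
  define q0 where "q0 s = (\<rho> s - \<rho> t) / (s - t) - \<rho>' t" for s
  define q where "q m s = (y ?J m s - y ?J m t) / (s - t) - y' ?J m t" for m s
  have q0_lim: "(q0 \<longlongrightarrow> 0) (at t within {0..1})"
    using tendsto_diff[OF has_field_derivative_at_within[OF \<rho>_deriv[of t], unfolded has_field_derivative_iff, of "{0..1}"] tendsto_const, of "\<rho>' t"]
    by (simp add: q0_def[abs_def])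
  have q_lim: "(q m \<longlongrightarrow> 0) (at t within {0..1})" for m
    using tendsto_diff[OF has_field_derivative_at_within[OF y_deriv[OF act(1), of t m t], unfolded has_field_derivative_iff, of "{0..1}"] tendsto_const, of "y' ?J m t"]
    by (simp add: q_def[abs_def])
  let ?b = "\<lambda>s. (\<bar>q0 s\<bar> * 3 + (\<Sum>m=1..?J. \<bar>q m s\<bar> * (2 / K_freq ?J m))) * 2"
  have "(?b \<longlongrightarrow> (\<bar>0\<bar> * 3 + (\<Sum>m=1..?J. \<bar>0\<bar> * (2 / K_freq ?J m))) * 2) (at t within {0..1})"
    by (rule tendsto_mult[OF tendsto_add[OF tendsto_mult[OF tendsto_rabs[OF q0_lim] tendsto_const]
      tendsto_sum[OF tendsto_mult[OF tendsto_rabs[OF q_lim] tendsto_const]]] tendsto_const])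
  then have b_lim: "(?b \<longlongrightarrow> 0) (at t within {0..1})" by simp
  show "((\<lambda>s. dual_norm V_space V_norm (\<lambda>v. (?W s v - ?W t v) /\<^sub>R (s - t) - ?D v)) \<longlongrightarrow> 0) (at t within {0..1})"
  proof (rule tendsto_sandwich[OF _ _ tendsto_const b_lim])
    have "(\<lambda>v. (?W s v - ?W t v) /\<^sub>R (s - t) - ?D v) \<in> antidual V_space V_norm" for s
      using V.antidual_diff[OF V.antidual_scaleR[OF V.antidual_diff[OF u_sol_antidual[of s] u_sol_antidual[of t]], of "s - t"] D]
      by (simp add: fun_diff_def)
    then show "\<forall>\<^sub>F s in at t within {0..1}. 0 \<le> dual_norm V_space V_norm (\<lambda>v. (?W s v - ?W t v) /\<^sub>R (s - t) - ?D v)"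
      by (intro always_eventually allI V.dual_norm_nonneg)
    have "eventually (\<lambda>s. s \<noteq> t) (at t within {0..1})" by (simp add: eventually_at_filter)
    moreover have "eventually (\<lambda>s. u (act s) s = u ?J s) (at t within {0..1})"
      using eventually_mono[OF near_good[OF t]] by (rule filter_leD[OF at_le[OF subset_UNIV], OF filter_leD[OF at_within_le_nhds]]) auto
    ultimately show "\<forall>\<^sub>F s in at t within {0..1}. dual_norm V_space V_norm (\<lambda>v. (?W s v - ?W t v) /\<^sub>R (s - t) - ?D v) \<le> ?b s"
    proof eventually_elim
      case (elim s)
      have W: "?W r = L2_inner \<I> (emb (u (act r) r))" for r by (rule ext, rule L2_inner_cong_left) (simp add: u_sol_on sol_def)
      have "(?W s v - ?W t v) /\<^sub>R (s - t) - ?D v = L2_inner \<I> (emb (lin ?J (q0 s) (\<lambda>m. q m s))) v" if v: "v \<in> V_space" for v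
      proof -
        have inner: "L2_inner \<I> (emb (lin J c0 c)) v = complex_of_real c0 * L2_inner \<I> (emb phi) v
          + (\<Sum>m=1..J. complex_of_real (c m) * L2_inner \<I> (emb (p_mode (K_freq J m))) v)" for J c0 c
          by (rule lin_inner[OF H1_L2[OF V_H1[OF v]]]) auto
        have "lin ?J (q0 s) (\<lambda>m. q m s) = (\<lambda>x. inverse (s - t) * (u ?J s x - u ?J t x) - ut ?J t x)"
          unfolding u_lin ut_lin lin_diff lin_cmult by (simp add: q0_def q_def divide_inverse mult.commute)
        then have e: "emb (lin ?J (q0 s) (\<lambda>m. q m s)) = (\<lambda>x. complex_of_real (inverse (s - t)) * (emb (u ?J s) x - emb (u ?J t) x) - emb (ut ?J t) x)"
          by (simp only: emb_diff emb_cmult)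
        have L: "emb (u ?J r) \<in> L2 \<I>" "emb (ut ?J r) \<in> L2 \<I>" for r by (rule emb_L2[OF smooth_u] emb_L2[OF smooth_ut]; simp)+
        note vL = H1_L2[OF V_H1[OF v]]
        show ?thesis
          unfolding e W elim L2_inner_diff_left[OF L2_scale[OF L2_diff[OF L(1) L(1)]] L(2) vL] L2_inner_scale_left
            L2_inner_diff_left[OF L(1) L(1) vL] by (simp add: scaleR_conv_of_real)
      qed
      then have "dual_norm V_space V_norm (\<lambda>v. (?W s v - ?W t v) /\<^sub>R (s - t) - ?D v)
        = dual_norm V_space V_norm (L2_inner \<I> (emb (lin ?J (q0 s) (\<lambda>m. q m s))))" by (rule dual_norm_cong)
      also have "... \<le> ?b s" by (rule V.dual_norm_le[OF lin_V_pairing[OF act(1)]]) (use K_freq_pos[OF act(1)] in \<open>simp_all add: sum_nonneg less_imp_le\<close>)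
      finally show ?case .
    qed
  qed
qed

lemma is_forcing_at_force: "t \<notin> bad \<Longrightarrow> is_forcing_at \<epsilon> \<eta> \<rho> t (force t)"
  unfolding is_forcing_at_def
proof (intro conjI exI[of _ "L2_inner \<I> (emb (ut (act t) t))"] ballI)
  show "force t \<in> L2 \<I>" unfolding force_def by (rule emb_L2[OF smooth_f]) auto
  show "L2_inner \<I> (force t) w = L2_inner \<I> (emb (ut (act t) t)) w + elliptic_op \<I> (coeff_a \<epsilon> \<eta> t) (u_sol \<epsilon> \<eta> \<rho> t) w"
    if "w \<in> V_space" for w by (rule evolution_identity[symmetric]) (use V_H1[OF that] u_sol_on in auto)
qed (rule u_dual_derivative)

lemma dual_derivative_unique:
  assumes t: "t \<in> {0<..<1}" and v: "v \<in> V_space"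
    and D: "has_dual_derivative V_space V_norm (\<lambda>s. L2_inner \<I> (u_sol \<epsilon> \<eta> \<rho> s)) D (at t within {0..1}) t"
      "has_dual_derivative V_space V_norm (\<lambda>s. L2_inner \<I> (u_sol \<epsilon> \<eta> \<rho> s)) D' (at t within {0..1}) t"
  shows "D v = D' v"
proof -
  interpret V: seminormed V_space V_norm by (rule V_seminormed)
  let ?W = "\<lambda>s. L2_inner \<I> (u_sol \<epsilon> \<eta> \<rho> s)"
  have lim: "((\<lambda>s. (?W s v - ?W t v) /\<^sub>R (s - t)) \<longlongrightarrow> E v) (at t)"
    if E: "has_dual_derivative V_space V_norm ?W E (at t within {0..1}) t" for E
  proof -
    have at: "at t within {0..1} = at t" using t by (intro at_within_interior) auto
    have EX: "E \<in> antidual V_space V_norm"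
      and l: "((\<lambda>s. dual_norm V_space V_norm (\<lambda>v. (?W s v - ?W t v) /\<^sub>R (s - t) - E v)) \<longlongrightarrow> 0) (at t)"
      using E unfolding has_dual_derivative_def at by auto
    have X: "(\<lambda>v. (?W s v - ?W t v) /\<^sub>R (s - t) - E v) \<in> antidual V_space V_norm" for s
      using V.antidual_diff[OF V.antidual_scaleR[OF V.antidual_diff[OF u_sol_antidual[of s] u_sol_antidual[of t]], of "s - t"] EX]
      by (simp add: fun_diff_def)
    have "((\<lambda>s. dual_norm V_space V_norm (\<lambda>v. (?W s v - ?W t v) /\<^sub>R (s - t) - E v) * V_norm v) \<longlongrightarrow> 0) (at t)" by (rule tendsto_mult_left_zero[OF l])
    then have "((\<lambda>s. (?W s v - ?W t v) /\<^sub>R (s - t) - E v) \<longlongrightarrow> 0) (at t)"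
      by (rule Lim_null_comparison[rotated]) (intro always_eventually allI V.antidual_le[OF X v])
    then show ?thesis by (simp only: LIM_zero_iff)
  qed
  show ?thesis by (rule tendsto_unique[OF trivial_limit_at lim[OF D(1)] lim[OF D(2)]])
qed

text \<open>Two functions that represent the forcing induce the same functional on test functions.\<close>

lemma forcing_eq:
  assumes t: "t \<in> {0<..<1}" "t \<notin> bad"
  shows "forcing \<epsilon> \<eta> \<rho> t \<in> L2 \<I>" "AE x in lebesgue_on \<I>. forcing \<epsilon> \<eta> \<rho> t x = force t x"
proof -
  let ?g = "forcing \<epsilon> \<eta> \<rho> t"
  have g: "is_forcing_at \<epsilon> \<eta> \<rho> t ?g" unfolding forcing_def by (rule someI[of _ "force t"], rule is_forcing_at_force[OF t(2)])
  have h: "is_forcing_at \<epsilon> \<eta> \<rho> t (force t)" by (rule is_forcing_at_force[OF t(2)])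
  show gL: "?g \<in> L2 \<I>" using g by (simp add: is_forcing_at_def)
  have hL: "force t \<in> L2 \<I>" using h by (simp add: is_forcing_at_def)
  have eq: "L2_inner \<I> ?g w = L2_inner \<I> (force t) w" if w: "w \<in> V_space" for w
  proof -
    obtain D where D: "has_dual_derivative V_space V_norm (\<lambda>s. L2_inner \<I> (u_sol \<epsilon> \<eta> \<rho> s)) D (at t within {0..1}) t"
      "L2_inner \<I> ?g w = D w + elliptic_op \<I> (coeff_a \<epsilon> \<eta> t) (u_sol \<epsilon> \<eta> \<rho> t) w" using g w unfolding is_forcing_at_def by blast
    obtain D' where D': "has_dual_derivative V_space V_norm (\<lambda>s. L2_inner \<I> (u_sol \<epsilon> \<eta> \<rho> s)) D' (at t within {0..1}) t"
      "L2_inner \<I> (force t) w = D' w + elliptic_op \<I> (coeff_a \<epsilon> \<eta> t) (u_sol \<epsilon> \<eta> \<rho> t) w" using h w unfolding is_forcing_at_def by blast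
    show ?thesis using dual_derivative_unique[OF t(1) w D(1) D'(1)] D(2) D'(2) by simp
  qed
  have dL: "(\<lambda>x. ?g x - force t x) \<in> L2 \<I>" by (rule L2_diff[OF gL hL])
  have "AE x in lebesgue_on \<I>. ?g x - force t x = 0"
  proof (rule fundamental_lemma)
    show "open \<I>" by simp
    show "integrable (lebesgue_on {a..b}) (\<lambda>x. ?g x - force t x)" if "{a..b} \<subseteq> \<I>" for a b by (rule L2_integrable_on_finite_measure[OF dL that]) auto
    fix \<phi> :: "real \<Rightarrow> complex" assume \<phi>: "\<phi> \<in> test_functions \<I>"
    have c: "(\<lambda>x. cnj (\<phi> x)) \<in> test_functions \<I>" by (rule test_function_bounded_linear[OF bounded_linear_cnj \<phi>])
    have "L2_inner \<I> (\<lambda>x. ?g x - force t x) (\<lambda>x. cnj (\<phi> x)) = 0"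
      using L2_inner_diff_left[OF gL hL test_function_L2[OF c]] eq[OF test_function_V[OF c]] by simp
    then show "(\<integral>x. (?g x - force t x) * \<phi> x \<partial>lebesgue_on \<I>) = 0" by (simp add: L2_inner_def)
  qed
  then show "AE x in lebesgue_on \<I>. ?g x = force t x" by eventually_elim simp
qed

lemma E0_forcing:
  assumes t: "t \<in> {0<..<1}" "t \<notin> bad"
  shows "E0 (forcing \<epsilon> \<eta> \<rho> t) \<in> L2 UNIV" "AE x in lebesgue. E0 (forcing \<epsilon> \<eta> \<rho> t) x = force t x"
proof -
  let ?g = "forcing \<epsilon> \<eta> \<rho> t"
  have fL: "force t \<in> L2 UNIV" unfolding force_def by (rule emb_L2[OF smooth_f]) auto
  have "AE x in lebesgue. x \<in> \<I> \<longrightarrow> ?g x = force t x" using forcing_eq(2)[OF t] by (simp add: AE_restrict_space_iff)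
  then show ae: "AE x in lebesgue. E0 ?g x = force t x" by eventually_elim (auto simp: E0_def force_def)
  have meas: "E0 ?g \<in> borel_measurable (lebesgue_on UNIV)" by (rule borel_measurable_AE_cong_lebesgue_on[OF L2_measurable[OF fL]])
      (rule AE_lebesgue_on[OF eventually_mono[OF ae]], simp_all)
  have "integrable (lebesgue_on UNIV) (\<lambda>x. (norm (E0 ?g x))\<^sup>2)" using L2_square_integrable[OF fL]
  proof (rule Bochner_Integration.integrable_cong_AE_imp)
    show "(\<lambda>x. (norm (E0 ?g x))\<^sup>2) \<in> borel_measurable (lebesgue_on UNIV)" using meas by measurable
    show "AE x in lebesgue_on UNIV. (norm (force t x))\<^sup>2 = (norm (E0 ?g x))\<^sup>2" using ae unfolding lebesgue_on_UNIV_eq by eventually_elim simp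
  qed
  then show "E0 ?g \<in> L2 UNIV" using meas by (simp add: L2_def)
qed

lemma AE_good_time: "AE t in unit_time. t \<in> {0<..<1} \<and> t \<notin> bad" using AE_good AE_space[of unit_time] by eventually_elim simp

theorem variational_solution_u: "variational_solution (coeff_a \<epsilon> \<eta>) (\<lambda>t. E0 (forcing \<epsilon> \<eta> \<rho> t)) (\<lambda>t. E0 (u_sol \<epsilon> \<eta> \<rho> t))"
  unfolding variational_solution_def u_sol_emb
proof (intro conjI bexI[of _ sol'])
  have force_L2: "force t \<in> L2 UNIV" for t unfolding force_def by (rule emb_L2[OF smooth_f]) auto
  show "(\<lambda>t. E0 (forcing \<epsilon> \<eta> \<rho> t)) \<in> L2_time (L2 UNIV) (L2_norm UNIV)"
  proof (rule seminormed.L2_time_cong[OF L2_seminormed force_L2_time], use AE_good_time in eventually_elim)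
    case (elim t)
    then have t: "t \<in> {0<..<1}" "t \<notin> bad" by auto
    have L: "E0 (forcing \<epsilon> \<eta> \<rho> t) \<in> L2 UNIV" by (rule E0_forcing(1)[OF t])
    have "L2_norm UNIV (\<lambda>x. E0 (forcing \<epsilon> \<eta> \<rho> t) x - force t x) = L2_norm UNIV (\<lambda>x. 0)"
    proof (rule L2_norm_cong_AE)
      show "AE x in lebesgue_on UNIV. E0 (forcing \<epsilon> \<eta> \<rho> t) x - force t x = 0"
        using E0_forcing(2)[OF t] unfolding lebesgue_on_UNIV_eq by eventually_elim simp
    qed (use L2_measurable[OF L2_diff[OF L force_L2]] in simp_all)
    then show ?case using L by simp
  qed
  show "AE t in unit_time. \<forall>v\<in>H1_line. sol' t v + elliptic_op UNIV (coeff_a \<epsilon> \<eta> t) (sol t) v = L2_inner UNIV (E0 (forcing \<epsilon> \<eta> \<rho> t)) v"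
    using AE_good_time
  proof eventually_elim
    case (elim t)
    then have t: "t \<in> {0<..<1}" "t \<notin> bad" by auto
    show ?case
    proof
      fix v assume v: "v \<in> H1_line"
      have "L2_inner UNIV (E0 (forcing \<epsilon> \<eta> \<rho> t)) v = L2_inner UNIV (force t) v"
        by (rule L2_inner_cong_AE[OF E0_forcing(1)[OF t] H1_L2[OF v] force_L2 H1_L2[OF v]])
          (rule AE_lebesgue_on[OF E0_forcing(2)[OF t]], simp_all)
      then show "sol' t v + elliptic_op UNIV (coeff_a \<epsilon> \<eta> t) (sol t) v = L2_inner UNIV (E0 (forcing \<epsilon> \<eta> \<rho> t)) v"
        unfolding sol'_def using evolution_identity[OF open_UNIV subset_UNIV v, of "sol t" t] by simp
    qed
  qed
qed (rule sol_L2_time sol_dual_L2_time sol'_L2_time sol_weak_time_derivative sol_zero_initial_value)+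

end

section \<open>Regularity of the coefficient and the Lions solution\<close>

text \<open>With \<open>h(z) = z / (1 + z)\<close> the bound is \<open>h(16 z) - h(z)\<close>, so the sum over \<open>z, 16 z, 16\<^sup>2 z, ...\<close> telescopes.\<close>

lemma geometric_telescope:
  fixes z :: real assumes z: "0 < z" shows "min z (1 / z) \<le> (34/15) * (16 * z / (1 + 16 * z) - z / (1 + z))"
proof -
  have pos: "0 < 1 + 16 * z" "0 < 1 + z" using z by simp_all
  have eq: "16 * z / (1 + 16 * z) - z / (1 + z) = 15 * z / ((1 + 16 * z) * (1 + z))" using pos by (subst diff_frac_eq) (simp_all add: algebra_simps)
  show ?thesis
  proof (cases "z \<le> 1")
    case True
    have "(1 + 16 * z) * (1 + z) \<le> 17 * 2" using True z by (intro mult_mono) auto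
    then have "z * ((1 + 16 * z) * (1 + z)) \<le> z * 34" using z by (intro mult_left_mono) auto
    then have "z \<le> 34 * z / ((1 + 16 * z) * (1 + z))" using pos by (simp add: pos_le_divide_eq mult.commute)
    then show ?thesis unfolding eq by (simp add: min_le_iff_disj)
  next
    case False
    have "0 \<le> (18 * z + 1) * (z - 1)" using False by (intro mult_nonneg_nonneg) auto
    then have "(1 + 16 * z) * (1 + z) \<le> 34 * z * z" by (simp add: algebra_simps)
    then have "1 / z \<le> 34 * z / ((1 + 16 * z) * (1 + z))" using pos z by (simp add: divide_le_eq pos_le_divide_eq)
    then show ?thesis unfolding eq by (simp add: min_le_iff_disj)
  qed
qed

context construction
begin

lemma coeff_range: "1/2 \<le> coeff_a \<epsilon> \<eta> t x" "coeff_a \<epsilon> \<eta> t x \<le> 3/2"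
proof -
  have "\<bar>bt (act t) t x\<bar> \<le> 1/2" using bt_bound[OF act(1), of t t x] sum_inverse_K_le_1[OF act(1), of t "act t"] by linarith
  then have "\<bar>\<epsilon>\<bar> * \<bar>bt (act t) t x\<bar> \<le> 1 * (1/2)" using \<epsilon> by (intro mult_mono) auto
  then have "\<bar>\<epsilon> * bt (act t) t x\<bar> \<le> 1/2" by (simp add: abs_mult)
  then show "1/2 \<le> coeff_a \<epsilon> \<eta> t x" "coeff_a \<epsilon> \<eta> t x \<le> 3/2" unfolding coeff_eq by linarith+
qed

lemma coeff_bounded: "bounded ((\<lambda>(t, x). coeff_a \<epsilon> \<eta> t x) ` A)"
proof (rule boundedI[where B = "3/2"])
  fix z assume "z \<in> (\<lambda>(t, x). coeff_a \<epsilon> \<eta> t x) ` A"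
  then obtain t x where "z = coeff_a \<epsilon> \<eta> t x" by auto
  then show "norm z \<le> 3/2" using coeff_range[of t x] by simp
qed

lemma coeff_elliptic: "uniformly_elliptic (coeff_a \<epsilon> \<eta>)"
  unfolding uniformly_elliptic_def by (intro exI[of _ "1/2"] conjI AE_I2) (auto simp: coeff_range[simplified])

text \<open>Mode \<open>m\<close> changes by at most \<open>min (1 / K) (K d)\<close> over a time \<open>d\<close>. The frequencies of a group
  grow geometrically, so these bounds decay geometrically away from \<open>K = d\<^sup>-\<^sup>1\<^sup>/\<^sup>2\<close> and
  add up to a multiple of \<open>\<surd>d\<close>, independently of the group.\<close>

lemma bt_Holder:
  assumes J: "J \<ge> 1" shows "\<bar>bt J t x - bt J s x\<bar> \<le> 3 * (R + 2) * sqrt \<bar>t - s\<bar>"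
proof (cases "t = s")
  case False
  define d where "d = sqrt \<bar>t - s\<bar>"
  have d: "d > 0" "\<bar>t - s\<bar> = d * d" using False by (simp_all add: d_def)
  define z where "z m = K_freq J m * d" for m
  define h where "h m = z m / (1 + z m)" for m
  have z: "0 < z m" "z (Suc m) = 16 * z m" for m using ell_pos[OF J] d(1) by (simp_all add: z_def K_freq_def)
  have mode: "\<bar>b J m t * cos (K_freq J m * x) - b J m s * cos (K_freq J m * x)\<bar> \<le> ((R + 2) * d) * ((34/15) * (h (Suc m) - h m))" for m
  proof -
    let ?K = "K_freq J m"
    have K: "0 < ?K" by (rule K_freq_pos[OF J])
    have small: "\<bar>b J m t - b J m s\<bar> \<le> (R + 2) * (1 / ?K)"
    proof -
      have "\<bar>b J m t - b J m s\<bar> \<le> 2 * (1 / ?K)" using b_bound[OF J, of m t] b_bound[OF J, of m s] by linarith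
      also have "... \<le> (R + 2) * (1 / ?K)" using R(1) K by (intro mult_right_mono) auto
      finally show ?thesis .
    qed
    have lip: "\<bar>b J m t - b J m s\<bar> \<le> (R + 2) * (?K * (d * d))"
    proof -
      have "\<bar>b J m t - b J m s\<bar> \<le> ((R + 1) * ?K) * \<bar>t - s\<bar>" by (rule lipschitz_of_derivative[OF b_deriv[OF J] b'_bound[OF J]])
      also have "... = (R + 1) * (?K * (d * d))" by (simp add: d(2) mult.assoc)
      also have "... \<le> (R + 2) * (?K * (d * d))" using K d by (intro mult_right_mono) auto
      finally show ?thesis .
    qed
    have "\<bar>b J m t - b J m s\<bar> \<le> ((R + 2) * d) * min (z m) (1 / z m)"
    proof (cases "z m \<le> 1 / z m")
      case True
      then show ?thesis using lip by (simp add: z_def min_def mult_ac)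
    next
      case False
      then show ?thesis using small d(1) by (simp add: z_def min_def)
    qed
    also have "... \<le> ((R + 2) * d) * ((34/15) * (h (Suc m) - h m))"
      using geometric_telescope[OF z(1), of m] R(1) d(1) unfolding h_def z(2) by (intro mult_left_mono) auto
    finally have *: "\<bar>b J m t - b J m s\<bar> \<le> ((R + 2) * d) * ((34/15) * (h (Suc m) - h m))" .
    have "\<bar>b J m t - b J m s\<bar> * \<bar>cos (?K * x)\<bar> \<le> \<bar>b J m t - b J m s\<bar> * 1" by (rule mult_left_mono) simp_all
    with * show ?thesis by (simp add: left_diff_distrib[symmetric] abs_mult)
  qed
  have "\<bar>bt J t x - bt J s x\<bar> \<le> (\<Sum>m=1..J. ((R + 2) * d) * ((34/15) * (h (Suc m) - h m)))"
    unfolding bt_def sum_subtractf[symmetric] by (rule order_trans[OF sum_abs sum_mono[OF mode]])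
  also have "... = ((R + 2) * d) * ((34/15) * (\<Sum>m=1..J. h (Suc m) - h m))" by (simp only: sum_distrib_left)
  also have "(\<Sum>m=1..J. h (Suc m) - h m) = h (Suc J) - h 1" using sum_Suc_diff[of 1 J h] J by simp
  also have "((R + 2) * d) * ((34/15) * (h (Suc J) - h 1)) \<le> ((R + 2) * d) * 3"
  proof (rule mult_left_mono)
    have "h (Suc J) \<le> 1" "0 \<le> h 1" using z(1)[of "Suc J"] z(1)[of 1] by (simp_all add: h_def)
    then show "(34/15) * (h (Suc J) - h 1) \<le> 3" by simp
    show "0 \<le> (R + 2) * d" using R(1) d(1) by simp
  qed
  finally show ?thesis unfolding d_def[symmetric] by (simp only: mult_ac)
qed simp

lemma coeff_Holder: "\<bar>coeff_a \<epsilon> \<eta> t x - coeff_a \<epsilon> \<eta> s x\<bar> \<le> 6 * (R + 2) * sqrt \<bar>t - s\<bar>"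
proof -
  have "\<bar>bt (act t) t x - bt (act s) s x\<bar> \<le> 6 * (R + 2) * sqrt \<bar>t - s\<bar>"
  proof (cases "act s = act t")
    case True
    have "0 \<le> 3 * (R + 2) * sqrt \<bar>t - s\<bar>" using R(1) by (intro mult_nonneg_nonneg) auto
    then show ?thesis using bt_Holder[OF act(1)[of t], of t x s] unfolding True by linarith
  next
    case False
    have "bt (act t) s x = 0" "bt (act s) t x = 0" using inactive_modes(1)[OF act(1) act(2)[OF act(1)]] False by (simp_all add: bt_def)
    then show ?thesis using bt_Holder[OF act(1)[of t], of t x s] bt_Holder[OF act(1)[of s], of t x s] by linarith
  qed
  then have "\<bar>\<epsilon>\<bar> * \<bar>bt (act t) t x - bt (act s) s x\<bar> \<le> 1 * (6 * (R + 2) * sqrt \<bar>t - s\<bar>)" using \<epsilon> by (intro mult_mono) auto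
  then show ?thesis by (simp add: coeff_eq right_diff_distrib[symmetric] abs_mult)
qed

lemma coeff_measurable_lebesgue: "coeff_a \<epsilon> \<eta> t \<in> borel_measurable lebesgue" using coeff_measurable[of t UNIV] by (simp only: lebesgue_on_UNIV_eq)

lemma Linf_norm_le:
  assumes "v \<in> borel_measurable lebesgue" "\<And>x. \<bar>v x\<bar> \<le> C" shows "Linf_norm v \<le> ereal C"
  unfolding Linf_norm_def using assms by (intro esssup_I AE_I2) auto

lemma coeff_Holder_Linf: "Holder_Linf (1/2) (coeff_a \<epsilon> \<eta>)"
  unfolding Holder_Linf_def
proof (intro conjI ballI exI)
  show "coeff_a \<epsilon> \<eta> t \<in> borel_measurable lebesgue" for t by (rule coeff_measurable_lebesgue)
  show "Linf_norm (coeff_a \<epsilon> \<eta> t) \<le> ereal (3/2)" for t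
  proof (rule Linf_norm_le[OF coeff_measurable_lebesgue])
    show "\<bar>coeff_a \<epsilon> \<eta> t x\<bar> \<le> 3/2" for x using coeff_range[of t x] by simp
  qed
  show "Linf_norm (\<lambda>x. coeff_a \<epsilon> \<eta> t x - coeff_a \<epsilon> \<eta> s x) \<le> ereal ((6 * (R + 2)) * \<bar>t - s\<bar> powr (1/2))" for s t
  proof (rule Linf_norm_le)
    show "(\<lambda>x. coeff_a \<epsilon> \<eta> t x - coeff_a \<epsilon> \<eta> s x) \<in> borel_measurable lebesgue" by (intro borel_measurable_diff coeff_measurable_lebesgue)
    show "\<bar>coeff_a \<epsilon> \<eta> t x - coeff_a \<epsilon> \<eta> s x\<bar> \<le> (6 * (R + 2)) * \<bar>t - s\<bar> powr (1/2)" for x using coeff_Holder[of t x s] by (simp add: powr_half_sqrt)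
  qed
qed

theorem Lions_solution_u: "is_Lions_solution (coeff_a \<epsilon> \<eta>) (\<lambda>t. E0 (forcing \<epsilon> \<eta> \<rho> t)) (\<lambda>t. E0 (u_sol \<epsilon> \<eta> \<rho> t))"
proof -
  interpret C: Holder_coefficient \<eta> "coeff_a \<epsilon> \<eta>" "3/2" "6 * (R + 2)"
  proof
    show "0 \<le> coeff_a \<epsilon> \<eta> t x" for t x using coeff_range(1)[of t x] by simp
    show "0 \<le> 6 * (R + 2)" using R(1) by simp
  qed (rule coeff_range coeff_measurable_lebesgue coeff_Holder)+
  show ?thesis unfolding is_Lions_solution_def using variational_solution_u C.variational_solution_unique by blast
qed

end

section \<open>Failure of square integrability of the time derivative\<close>

lemma derivative_zero_if_constant_on_open:
  fixes h :: "real \<Rightarrow> real"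
  assumes d: "(h has_real_derivative d) (at x)" and x: "x \<in> {a<..<b}" and c: "\<And>y. y \<in> {a<..<b} \<Longrightarrow> h y = c"
  shows "d = 0"
proof -
  have "(h has_real_derivative 0) (at x)" by (rule has_field_derivative_transform_within_open[where f = "\<lambda>_. c" and S = "{a<..<b}"]) (use x c in auto)
  then show ?thesis by (rule DERIV_unique[OF d])
qed

definition cos_primitive :: "real \<Rightarrow> real \<Rightarrow> real" where
  "cos_primitive a x = (if a = 0 then x else sin (a * x) / a)"

lemma cos_primitive_deriv: "(cos_primitive a has_real_derivative cos (a * x)) (at x)"
proof (cases "a = 0")
  case True then show ?thesis by (simp add: cos_primitive_def[abs_def])
next
  case False
  then show ?thesis unfolding cos_primitive_def[abs_def] by (auto intro!: derivative_eq_intros)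
qed

lemma mode_product:
  "p_mode k x * p_mode l x = (1/4) * cos ((k - l) * x) - (1/4) * cos ((k + l) * x)
     - (1/8) * (cos ((k - l - 4) * x) + cos ((k - l + 4) * x)) + (1/8) * (cos ((k + l - 4) * x) + cos ((k + l + 4) * x))"
proof -
  have h1: "sin (2 * x) * sin (2 * x) = (1 - cos (4 * x)) / 2" using sin_times_sin[of "2 * x" "2 * x"] by simp
  have h2: "sin (k * x) * sin (l * x) = (cos ((k - l) * x) - cos ((k + l) * x)) / 2"
    using sin_times_sin[of "k * x" "l * x"] by (simp add: algebra_simps)
  have shift: "cos (c * x) * cos (4 * x) = (cos ((c - 4) * x) + cos ((c + 4) * x)) / 2" for c
    using cos_times_cos[of "c * x" "4 * x"] by (simp add: algebra_simps)
  have h3: "p_mode k x * p_mode l x = (sin (k * x) * sin (l * x)) * (sin (2 * x) * sin (2 * x))" by (simp add: p_mode_def)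
  have "p_mode k x * p_mode l x = ((cos ((k - l) * x) - cos ((k + l) * x)) / 2) * ((1 - cos (4 * x)) / 2)" unfolding h3 h2 h1 ..
  also have "... = (1/4) * cos ((k - l) * x) - (1/4) * cos ((k + l) * x)
     - (1/4) * (cos ((k - l) * x) * cos (4 * x)) + (1/4) * (cos ((k + l) * x) * cos (4 * x))" by (simp add: field_simps)
  finally show ?thesis unfolding shift by simp
qed

lemma K_gap: assumes "j \<ge> 1" "n < m" shows "K_freq j n + 32 \<le> K_freq j m"
proof -
  have "(16::real) ^ m = 16 ^ n * 16 ^ (m - n)" using assms(2) by (simp add: power_add[symmetric])
  moreover have "(16::real) ^ 1 \<le> 16 ^ (m - n)" using assms(2) by (intro power_increasing) auto
  then have "(16::real) ^ n * 16 \<le> 16 ^ n * 16 ^ (m - n)" by (intro mult_left_mono) auto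
  ultimately have "(16::real) ^ n * 16 \<le> 16 ^ m" by simp
  then have "(16 ^ n * 16) / ell j \<le> 16 ^ m / ell j" using ell_pos[OF assms(1)] by (intro divide_right_mono) auto
  then have "16 * K_freq j n \<le> K_freq j m" by (simp add: K_freq_def mult.commute)
  then show ?thesis using K_freq_ge[OF assms(1), of n] by linarith
qed

context construction
begin

lemma modes_orthogonal:
  assumes J: "J \<ge> 1"
  shows "L2_inner UNIV (emb (p_mode (K_freq J n))) (emb (p_mode (K_freq J m))) = (if n = m then complex_of_real (pi / 4) else 0)"
proof -
  let ?k = "K_freq J n" and ?l = "K_freq J m"
  let ?h = "\<lambda>x. p_mode ?k x * p_mode ?l x"
  define P where "P x = (1/4) * cos_primitive (?k - ?l) x - (1/4) * cos_primitive (?k + ?l) x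
     - (1/8) * (cos_primitive (?k - ?l - 4) x + cos_primitive (?k - ?l + 4) x)
     + (1/8) * (cos_primitive (?k + ?l - 4) x + cos_primitive (?k + ?l + 4) x)" for x
  have deriv: "(P has_vector_derivative ?h x) (at x)" for x
    unfolding has_real_derivative_iff_has_vector_derivative[symmetric] mode_product P_def[abs_def]
    by (intro DERIV_add DERIV_diff DERIV_cmult cos_primitive_deriv)
  have sm: "smooth ?h" by (rule smooth_mult[OF smooth_p_mode smooth_p_mode])
  have "(\<integral>x. ?h x \<partial>lebesgue_on {0..pi}) = P pi - P 0" using integral_derivative_Icc[OF pi_ge_zero deriv smooth_continuous_on[OF sm]] by simp
  also have "... = (if n = m then pi / 4 else 0)"
  proof -
    have gap: "?k \<noteq> ?l + c" if "n \<noteq> m" "\<bar>c\<bar> \<le> 4" for c using K_gap[OF J, of n m] K_gap[OF J, of m n] that by (cases "n < m") auto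
    have big: "?k + ?l \<ge> 64" using K_freq_ge[OF J, of n] K_freq_ge[OF J, of m] by simp
    have s4: "sin (4 * pi) = 0" using sin_npi[of 4] by simp
    have s: "sin (?k * pi) = 0" "sin (?l * pi) = 0" by (rule sin_K_pi[OF J])+
    have z: "cos_primitive (?k + ?l) pi = 0" "cos_primitive (?k + ?l - 4) pi = 0" "cos_primitive (?k + ?l + 4) pi = 0"
      using big by (simp_all add: cos_primitive_def distrib_right left_diff_distrib sin_add sin_diff s s4)
    have z4: "cos_primitive (?k - ?l - 4) pi = 0" "cos_primitive (?k - ?l + 4) pi = 0" using gap[of 4] gap[of "-4"]
      by (cases "n = m"; simp add: cos_primitive_def distrib_right left_diff_distrib sin_add sin_diff s s4)+
    have z0: "cos_primitive (?k - ?l) pi = (if n = m then pi else 0)" using gap[of 0] by (simp add: cos_primitive_def left_diff_distrib sin_diff s)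
    have "P 0 = 0" by (simp add: P_def cos_primitive_def)
    then show ?thesis by (simp add: P_def z z4 z0)
  qed
  finally have eq: "(\<integral>x. ?h x \<partial>lebesgue_on {0..pi}) = (if n = m then pi / 4 else 0)" .
  have "L2_inner UNIV (emb (p_mode ?k)) (emb (p_mode ?l)) = (\<integral>x. emb (p_mode ?k) x * cnj (emb (p_mode ?l) x) \<partial>lebesgue_on \<I>)"
    unfolding L2_inner_def by (rule integral_support) (auto simp: E0_def)
  also have "... = (\<integral>x. complex_of_real (?h x) \<partial>lebesgue_on \<I>)" by (rule Bochner_Integration.integral_cong) (auto simp: E0_def)
  also have "... = complex_of_real (\<integral>x. ?h x \<partial>lebesgue_on \<I>)" by (rule integral_complex_of_real)
  also have "(\<integral>x. ?h x \<partial>lebesgue_on \<I>) = (\<integral>x. ?h x \<partial>lebesgue_on {0..pi})" by (rule integral_Ioo_eq_Icc[OF smooth_measurable[OF sm]])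
  finally show ?thesis unfolding eq by simp
qed

lemma lin_norm_square:
  assumes J: "J \<ge> 1"
  shows "(L2_norm UNIV (emb (lin J 0 c)))\<^sup>2 = (pi / 4) * (\<Sum>m=1..J. (c m)\<^sup>2)"
proof -
  let ?e = "\<lambda>m. emb (p_mode (K_freq J m))" and ?v = "emb (lin J 0 c)"
  have eL: "?e m \<in> L2 UNIV" for m by (rule emb_L2[OF smooth_p_mode]) auto
  have vL: "?v \<in> L2 UNIV" by (rule emb_L2[OF smooth_lin]) auto
  have ve: "L2_inner UNIV ?v (?e n) = complex_of_real (c n * (pi / 4))" if n: "n \<in> {1..J}" for n
  proof -
    have "L2_inner UNIV ?v (?e n) = (\<Sum>m=1..J. complex_of_real (c m) * (if m = n then complex_of_real (pi / 4) else 0))"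
      using lin_inner[OF eL[of n], of J 0 c] by (simp add: modes_orthogonal[OF J])
    also have "... = (\<Sum>m=1..J. if m = n then complex_of_real (c n * (pi / 4)) else 0)" by (rule sum.cong) auto
    also have "... = complex_of_real (c n * (pi / 4))" using n by simp
    finally show ?thesis .
  qed
  have ev: "L2_inner UNIV (?e n) ?v = complex_of_real (c n * (pi / 4))" if "n \<in> {1..J}" for n
    using arg_cong[OF ve[OF that], of cnj] by (simp only: L2_inner_cnj complex_cnj_complex_of_real)
  have "L2_inner UNIV ?v ?v = (\<Sum>n=1..J. complex_of_real (c n) * L2_inner UNIV (?e n) ?v)" using lin_inner[OF vL, of J 0 c] by simp
  also have "... = (\<Sum>n=1..J. complex_of_real (c n) * complex_of_real (c n * (pi / 4)))" by (rule sum.cong[OF refl]) (simp only: ev)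
  also have "... = complex_of_real ((pi / 4) * (\<Sum>m=1..J. (c m)\<^sup>2))" by (simp add: sum_distrib_left power2_eq_square mult_ac)
  finally show ?thesis unfolding L2_inner_self by (simp only: of_real_eq_iff)
qed

text \<open>The middle fifth of the interval of group \<open>j\<close>: the time cutoff of the group and \<open>\<rho>\<close> are constant there.\<close>

abbreviation left :: "nat \<Rightarrow> real" where "left j \<equiv> tau j + (2/5) * ell j"
abbreviation right :: "nat \<Rightarrow> real" where "right j \<equiv> tau j + (3/5) * ell j"

lemma middle:
  assumes j: "j \<ge> 1" and t: "t \<in> {left j..right j}"
  shows "e j t = 1" "e' j t = 0" "\<rho>' t = 0" "t \<in> {tau j<..<tau (j + 1)}" "t \<in> {0<..<1}"
proof -
  have l: "ell j > 0" by (rule ell_pos[OF j])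
  define s where "s = (t - tau j) / ell j"
  have s: "2/5 \<le> s" "s \<le> 3/5" using t l by (simp_all add: s_def pos_le_divide_eq pos_divide_le_eq)
  show "e j t = 1" using \<eta>_one[of s] s unfolding eta_resc_def s_def[symmetric] by simp
  have "\<eta>' s = 0" by (rule derivative_zero_if_constant_on_open[OF \<eta>_deriv, of _ "1/3" "2/3" 1]) (use s \<eta>_one in auto)
  then show "e' j t = 0" by (simp add: e'_def s_def)
  show i: "t \<in> {tau j<..<tau (j + 1)}" using t l tau_Suc[of j] by auto
  have b: "1/4 < t" "t < 5/16" using i tau_ge[OF j] tau_less[of "j + 1"] by auto
  show "\<rho>' t = 0" by (rule derivative_zero_if_constant_on_open[OF \<rho>_deriv, of _ "1/4" "1/2" 1]) (use b \<rho>_one in auto)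
  show "t \<in> {0<..<1}" using b by simp
qed

lemma y'_middle:
  assumes "j \<ge> 1" "t \<in> {left j..right j}"
  shows "(y' j m t)\<^sup>2 = (\<epsilon>\<^sup>2 / 4) * (1 + sin (2 * theta j m t))"
proof -
  have "K_freq j m \<noteq> 0" using K_freq_pos[OF assms(1), of m] by simp
  then have "y' j m t = - (\<epsilon> / 2) * (cos (theta j m t) + sin (theta j m t))" by (simp add: y'_def middle(1,2)[OF assms])
  moreover have "(cos x + sin x)\<^sup>2 = 1 + sin (2 * x)" for x :: real using sin_cos_squared_add[of x] by (simp add: power2_sum sin_double)
  ultimately show ?thesis by (simp only: power_mult_distrib) (simp add: power_divide)
qed

text \<open>On the middle fifth \<open>y'\<^sup>2 = (\<epsilon>\<^sup>2 / 4) (1 + sin 2\<theta>)\<close>; the oscillating part integrates to at most \<open>1 / K\<^sup>2\<close>, which is at most half of the length.\<close>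

lemma y'_middle_mass:
  assumes j: "j \<ge> 1"
  shows "(\<epsilon>\<^sup>2 / 40) * ell j \<le> (\<integral>t. (y' j m t)\<^sup>2 \<partial>lebesgue_on {left j..right j})"
proof -
  let ?k = "K_freq j m"
  have l: "ell j > 0" by (rule ell_pos[OF j])
  have k: "?k > 0" by (rule K_freq_pos[OF j])
  define P where "P t = (\<epsilon>\<^sup>2 / 4) * (t - cos (2 * theta j m t) / (2 * ?k\<^sup>2))" for t
  have "((\<lambda>t. cos (2 * theta j m t)) has_real_derivative - sin (2 * theta j m t) * (2 * ?k\<^sup>2)) (at t)" for t
    by (rule DERIV_fun_cos, rule DERIV_cmult, rule theta_deriv)
  from DERIV_cmult[OF DERIV_diff[OF DERIV_ident DERIV_cdivide[OF this, of "2 * ?k\<^sup>2"]], of "\<epsilon>\<^sup>2 / 4"]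
  have "(P has_real_derivative (\<epsilon>\<^sup>2 / 4) * (1 + sin (2 * theta j m t))) (at t)" for t
    unfolding P_def[abs_def] by (rule DERIV_cong) (use k in simp)
  then have d: "(P has_vector_derivative (y' j m t)\<^sup>2) (at t)" if "t \<in> {left j..right j}" for t
    unfolding has_real_derivative_iff_has_vector_derivative[symmetric] y'_middle[OF j that] .
  have "(\<integral>t. (y' j m t)\<^sup>2 \<partial>lebesgue_on {left j..right j}) = P (right j) - P (left j)"
    by (rule integral_derivative_Icc[OF _ d]) (use l in \<open>auto intro!: continuous_on_power y'_continuous[OF j]\<close>)
  moreover have "P (right j) - P (left j) \<ge> (\<epsilon>\<^sup>2 / 4) * (ell j / 10)"
  proof -
    have osc: "\<bar>cos a / (2 * ?k\<^sup>2)\<bar> \<le> 1 / (2 * ?k\<^sup>2)" for a using k by (simp add: divide_right_mono)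
    have "1 / ?k\<^sup>2 \<le> ell j / 10"
    proof -
      have "10 * 1 \<le> ?k * (ell j * ?k)"
      proof (rule mult_mono)
        show "10 \<le> ?k" using K_freq_ge[OF j, of m] by simp
        have "ell j * ?k = 16 ^ m" using l by (simp add: K_freq_def)
        then show "1 \<le> ell j * ?k" by simp
      qed (use k in simp_all)
      then show ?thesis using k by (simp add: divide_le_eq power2_eq_square mult_ac)
    qed
    then have "ell j / 10 \<le> (right j - left j) - (cos (2 * theta j m (right j)) / (2 * ?k\<^sup>2) - cos (2 * theta j m (left j)) / (2 * ?k\<^sup>2))"
    proof -
      have "1 / (2 * ?k\<^sup>2) = (1 / ?k\<^sup>2) / 2" by simp
      with \<open>1 / ?k\<^sup>2 \<le> ell j / 10\<close> have h: "1 / (2 * ?k\<^sup>2) \<le> ell j / 20" by linarith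
      have "\<bar>cos a / (2 * ?k\<^sup>2)\<bar> \<le> ell j / 20" for a by (rule order_trans[OF osc h])
      from this[of "2 * theta j m (right j)"] this[of "2 * theta j m (left j)"] show ?thesis by linarith
    qed
    then have "(\<epsilon>\<^sup>2 / 4) * (ell j / 10) \<le> (\<epsilon>\<^sup>2 / 4) * ((right j - left j) - (cos (2 * theta j m (right j)) / (2 * ?k\<^sup>2) - cos (2 * theta j m (left j)) / (2 * ?k\<^sup>2)))"
      by (rule mult_left_mono) simp
    also have "... = P (right j) - P (left j)" by (simp only: P_def right_diff_distrib)
    finally show ?thesis .
  qed
  ultimately show ?thesis by simp
qed

text \<open>Testing the weak derivative against the finitely many modes of the active group determines the
  pairing with \<open>\<partial>\<^sub>t u\<close> itself, so the Cauchy--Schwarz inequality bounds its norm from below.\<close>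

lemma time_derivative_lower_bound:
  assumes g: "g \<in> L2_time (L2 UNIV) (L2_norm UNIV)"
    and weak: "has_weak_time_derivative H1_line (\<lambda>t. L2_inner UNIV (sol t)) (\<lambda>t. L2_inner UNIV (g t))"
    and j: "j \<ge> 1"
  shows "AE t in unit_time. t \<in> {left j..right j} \<longrightarrow> (pi / 4) * (\<Sum>m=1..j. (y' j m t)\<^sup>2) \<le> (L2_norm UNIV (g t))\<^sup>2"
proof -
  let ?S = "{tau j<..<tau (j + 1)}"
  have S: "?S \<subseteq> {0<..<1}" using tau_ge[OF j] tau_less[of "j + 1"] by auto
  let ?e = "\<lambda>m. emb (p_mode (K_freq j m))"
  have eL: "?e m \<in> L2 UNIV" for m by (rule emb_L2[OF smooth_p_mode]) auto
  have eH: "?e m \<in> H1_line" for m by (rule E0_H1[OF smooth_of_real[OF smooth_p_mode]]) (auto simp: p_ends)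
  have act_j: "act t = j" if "t \<in> ?S" for t
  proof (rule ccontr)
    assume "act t \<noteq> j"
    then show False using act(2)[OF j] that by (auto simp: inactive_def)
  qed
  have pair: "AE t in lebesgue_on ?S. L2_inner UNIV (g t) (?e m) = L2_inner UNIV (emb (ut j t)) (?e m)" for m
  proof -
    let ?d = "\<lambda>t. L2_inner UNIV (g t) (?e m)" and ?h = "\<lambda>t. L2_inner UNIV (emb (ut j t)) (?e m)"
    have di: "integrable unit_time ?d" by (rule time_pairing_integrable[OF g eL])
    have hc: "continuous_on UNIV ?h"
    proof -
      have "?h = (\<lambda>t. complex_of_real (\<rho>' t) * L2_inner UNIV (emb phi) (?e m) + (\<Sum>n=1..j. complex_of_real (y' j n t) * L2_inner UNIV (?e n) (?e m)))"
        unfolding ut_lin by (rule ext, rule lin_inner[OF eL]) auto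
      then show ?thesis
        by (simp only:) (intro continuous_on_add continuous_on_mult_right continuous_on_sum continuous_on_of_real \<rho>'_continuous y'_continuous[OF j])
    qed
    have "AE t in lebesgue_on ?S. ?d t - ?h t = 0"
    proof (rule fundamental_lemma)
      show "open ?S" by simp
      show "integrable (lebesgue_on {a..b}) (\<lambda>t. ?d t - ?h t)" if "{a..b} \<subseteq> ?S" for a b
      proof (rule Bochner_Integration.integrable_diff)
        show "integrable (lebesgue_on {a..b}) ?d" by (rule integrable_lebesgue_on_subset[OF di]) (use that S in auto)
        show "integrable (lebesgue_on {a..b}) ?h" by (rule continuous_integrable_Icc[OF continuous_on_subset[OF hc]]) simp
      qed
      fix \<psi> :: "real \<Rightarrow> complex" assume \<psi>S: "\<psi> \<in> test_functions ?S"
      then have \<psi>: "\<psi> \<in> test_functions {0<..<1}" by (rule test_function_mono[OF _ S])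
      obtain M where M: "\<And>t. norm (\<psi> t) \<le> M" using test_function_bounded[OF \<psi>] by metis
      have \<psi>m: "\<psi> \<in> borel_measurable (lebesgue_on T)" for T using \<psi> by (intro smooth_measurable) (simp add: test_functions_def)
      have zero: "\<psi> t = 0" if "t \<notin> ?S" for t by (rule test_function_outside[OF \<psi>S that])
      have "(\<integral>t. \<psi> t * ?d t \<partial>unit_time) = (\<integral>t. \<psi> t * sol' t (?e m) \<partial>unit_time)"
        using weak[unfolded has_weak_time_derivative_def, rule_format, OF \<psi> eH[of m]]
          sol_weak_time_derivative[unfolded has_weak_time_derivative_def, rule_format, OF \<psi> eH[of m]] by simp
      moreover have "(\<integral>t. \<psi> t * ?d t \<partial>unit_time) = (\<integral>t. \<psi> t * ?d t \<partial>lebesgue_on ?S)" by (rule integral_support[OF S]) (use zero in auto)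
      moreover have "(\<integral>t. \<psi> t * sol' t (?e m) \<partial>unit_time) = (\<integral>t. \<psi> t * sol' t (?e m) \<partial>lebesgue_on ?S)"
        by (rule integral_support[OF S]) (use zero in auto)
      moreover have "(\<integral>t. \<psi> t * sol' t (?e m) \<partial>lebesgue_on ?S) = (\<integral>t. \<psi> t * ?h t \<partial>lebesgue_on ?S)"
        by (rule Bochner_Integration.integral_cong) (simp_all add: sol'_def act_j)
      moreover have "integrable (lebesgue_on ?S) (\<lambda>t. \<psi> t * ?d t)"
        by (rule bounded_measurable_mult_integrable[OF integrable_lebesgue_on_subset[OF di S] \<psi>m M]) auto
      moreover have "integrable (lebesgue_on ?S) (\<lambda>t. \<psi> t * ?h t)"
      proof (rule bounded_measurable_mult_integrable[OF _ \<psi>m M])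
        have "integrable (lebesgue_on {tau j..tau (j + 1)}) ?h" by (rule continuous_integrable_Icc[OF continuous_on_subset[OF hc]]) simp
        then show "integrable (lebesgue_on ?S) ?h" by (rule integrable_lebesgue_on_subset) auto
      qed
      ultimately have "(\<integral>t. \<psi> t * ?d t - \<psi> t * ?h t \<partial>lebesgue_on ?S) = 0" by simp
      moreover have "(?d t - ?h t) * \<psi> t = \<psi> t * ?d t - \<psi> t * ?h t" for t by (simp add: algebra_simps)
      ultimately show "(\<integral>t. (?d t - ?h t) * \<psi> t \<partial>lebesgue_on ?S) = 0" by simp
    qed
    then show ?thesis by eventually_elim simp
  qed
  have gL: "AE t in unit_time. g t \<in> L2 UNIV" using g by (simp add: L2_time_def)
  have "AE t in lebesgue_on ?S. \<forall>m. L2_inner UNIV (g t) (?e m) = L2_inner UNIV (emb (ut j t)) (?e m)"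
    unfolding AE_all_countable using pair by blast
  then have "AE t in lebesgue. t \<in> ?S \<longrightarrow> (\<forall>m. L2_inner UNIV (g t) (?e m) = L2_inner UNIV (emb (ut j t)) (?e m))" by (simp add: AE_restrict_space_iff)
  then have "AE t in unit_time. t \<in> ?S \<longrightarrow> (\<forall>m. L2_inner UNIV (g t) (?e m) = L2_inner UNIV (emb (ut j t)) (?e m))" by (rule AE_lebesgue_on) simp
  then show ?thesis using gL
  proof eventually_elim
    case (elim t)
    show ?case
    proof
      assume t: "t \<in> {left j..right j}"
      let ?c = "\<lambda>m. y' j m t"
      define U where "U = emb (lin j 0 ?c)"
      have UL: "U \<in> L2 UNIV" unfolding U_def by (rule emb_L2[OF smooth_lin]) auto
      have U: "emb (ut j t) = U" unfolding ut_lin U_def middle(3)[OF j t] ..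
      have modes: "L2_inner UNIV (?e m) (g t) = L2_inner UNIV (?e m) U" for m
      proof -
        have "L2_inner UNIV (g t) (?e m) = L2_inner UNIV U (?e m)" using elim middle(4)[OF j t] U by simp
        then show ?thesis by (metis L2_inner_cnj)
      qed
      have "L2_inner UNIV U (g t) = L2_inner UNIV U U"
        using lin_inner[OF elim(2), of j 0 ?c] lin_inner[OF UL, of j 0 ?c] modes unfolding U_def by simp
      then have "(L2_norm UNIV U)\<^sup>2 = norm (L2_inner UNIV U (g t))"
        unfolding L2_inner_self by (simp only: norm_of_real abs_of_nonneg[OF zero_le_power2])
      also have "... \<le> L2_norm UNIV U * L2_norm UNIV (g t)" by (rule L2_inner_norm_le[OF UL elim(2)])
      finally have "L2_norm UNIV U * L2_norm UNIV U \<le> L2_norm UNIV U * L2_norm UNIV (g t)" by (simp add: power2_eq_square)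
      then have "L2_norm UNIV U \<le> L2_norm UNIV (g t)" by (cases "L2_norm UNIV U = 0") (auto simp: order_less_le)
      then have "(L2_norm UNIV U)\<^sup>2 \<le> (L2_norm UNIV (g t))\<^sup>2" by (rule power_mono) simp
      then show "(pi / 4) * (\<Sum>m=1..j. (y' j m t)\<^sup>2) \<le> (L2_norm UNIV (g t))\<^sup>2"
        unfolding U_def lin_norm_square[OF j] .
    qed
  qed
qed

theorem time_derivative_not_L2:
  "\<not> (\<exists>g\<in>L2_time (L2 UNIV) (L2_norm UNIV).
     has_weak_time_derivative H1_line (\<lambda>t. L2_inner UNIV (sol t)) (\<lambda>t. L2_inner UNIV (g t)))"
proof
  assume "\<exists>g\<in>L2_time (L2 UNIV) (L2_norm UNIV).
     has_weak_time_derivative H1_line (\<lambda>t. L2_inner UNIV (sol t)) (\<lambda>t. L2_inner UNIV (g t))"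
  then obtain g where g: "g \<in> L2_time (L2 UNIV) (L2_norm UNIV)"
    and weak: "has_weak_time_derivative H1_line (\<lambda>t. L2_inner UNIV (sol t)) (\<lambda>t. L2_inner UNIV (g t))" by blast
  define Q where "Q = (\<integral>\<^sup>+t. ennreal ((L2_norm UNIV (g t))\<^sup>2) \<partial>unit_time)"
  have Q: "Q < \<infinity>" using g by (simp add: L2_time_def Q_def)
  define T where "T j = {left j..right j}" for j
  define E where "E j t = (pi / 4) * (\<Sum>m=1..j. (y' j m t)\<^sup>2)" for j t
  have E0: "0 \<le> E j t" for j t by (simp add: E_def sum_nonneg)
  have TS: "T j \<subseteq> {0<..<1}" if "j \<ge> 1" for j using middle(5)[OF that] by (auto simp: T_def)
  define L where "L n t = (\<Sum>j=1..n. indicator (T j) t * E j t)" for n t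
  have L_le: "AE t in unit_time. L n t \<le> (L2_norm UNIV (g t))\<^sup>2" for n
  proof -
    have "AE t in unit_time. \<forall>j. 1 \<le> j \<longrightarrow> t \<in> T j \<longrightarrow> E j t \<le> (L2_norm UNIV (g t))\<^sup>2"
      unfolding AE_all_countable
    proof
      fix j show "AE t in unit_time. 1 \<le> j \<longrightarrow> t \<in> T j \<longrightarrow> E j t \<le> (L2_norm UNIV (g t))\<^sup>2"
        using time_derivative_lower_bound[OF g weak, of j] by (cases "1 \<le> j") (simp_all add: T_def E_def)
    qed
    then show ?thesis
    proof eventually_elim
      case (elim t)
      have off: "indicator (T j) t = (0::real)" if "j \<ge> 1" "j \<noteq> act t" for j
      proof -
        have "t \<notin> T j" using act(2)[OF that] middle(4)[OF that(1), of t] by (auto simp: T_def inactive_def)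
        then show ?thesis by simp
      qed
      have single: "sum X {a} = X a" for X :: "nat \<Rightarrow> real" and a by simp
      have "L n t \<le> indicator (T (act t)) t * E (act t) t"
      proof (cases "act t \<le> n")
        case True
        have "L n t = (\<Sum>j\<in>{act t}. indicator (T j) t * E j t)"
          unfolding L_def using off act(1) True by (intro sum.mono_neutral_right) auto
        then show ?thesis unfolding single by simp
      next
        case False
        have "L n t = 0" unfolding L_def using off False by (intro sum.neutral) auto
        then show ?thesis using E0 by simp
      qed
      also have "... \<le> (L2_norm UNIV (g t))\<^sup>2" using elim act(1) by (cases "t \<in> T (act t)") simp_all
      finally show ?case .
    qed
  qed
  have part: "integrable unit_time (\<lambda>t. indicator (T j) t * E j t)" "(pi * \<epsilon>\<^sup>2 / 2560) * (1 / real (j + 1)) \<le> (\<integral>t. indicator (T j) t * E j t \<partial>unit_time)"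
    if j: "j \<ge> 1" for j
  proof -
    have yi: "integrable (lebesgue_on (T j)) (\<lambda>t. (y' j m t)\<^sup>2)" for m
      unfolding T_def by (rule continuous_integrable_Icc[OF continuous_on_power[OF y'_continuous[OF j]]])
    have Ei: "integrable (lebesgue_on (T j)) (E j)" unfolding E_def[abs_def] by (intro integrable_mult_right Bochner_Integration.integrable_sum yi)
    have same: "integrable (lebesgue_on (T j)) (\<lambda>t. indicator (T j) t * E j t) \<longleftrightarrow> integrable (lebesgue_on (T j)) (E j)"
      by (rule Bochner_Integration.integrable_cong) auto
    have Tl: "T j \<in> sets lebesgue" by (simp add: T_def)
    show "integrable unit_time (\<lambda>t. indicator (T j) t * E j t)"
      using integrable_support[OF TS[OF j], of "\<lambda>t. indicator (T j) t * E j t"] Ei same Tl by simp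
    have "(\<integral>t. indicator (T j) t * E j t \<partial>unit_time) = (\<integral>t. indicator (T j) t * E j t \<partial>lebesgue_on (T j))"
      by (rule integral_support[OF TS[OF j]]) (use Tl in auto)
    also have "... = (\<integral>t. E j t \<partial>lebesgue_on (T j))" by (rule Bochner_Integration.integral_cong) auto
    also have "... = (pi / 4) * (\<Sum>m=1..j. \<integral>t. (y' j m t)\<^sup>2 \<partial>lebesgue_on (T j))"
      unfolding E_def by (subst integral_mult_right_zero, subst Bochner_Integration.integral_sum[OF yi]) simp
    finally have eq: "(\<integral>t. indicator (T j) t * E j t \<partial>unit_time) = (pi / 4) * (\<Sum>m=1..j. \<integral>t. (y' j m t)\<^sup>2 \<partial>lebesgue_on (T j))" .
    have "(pi * \<epsilon>\<^sup>2 / 2560) * (1 / real (j + 1)) = (pi / 4) * (\<Sum>m=1..j. (\<epsilon>\<^sup>2 / 40) * ell j)"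
    proof -
      have "real j * ell j = (1 / 16) * (1 / real (j + 1))" using j by (simp add: ell_eq)
      then have eq: "(pi / 4) * ((\<epsilon>\<^sup>2 / 40) * (real j * ell j)) = (pi * \<epsilon>\<^sup>2 / 2560) * (1 / real (j + 1))" by simp
      have sum: "(\<Sum>m=1..j. (\<epsilon>\<^sup>2 / 40) * ell j) = (\<epsilon>\<^sup>2 / 40) * (real j * ell j)" by simp
      show ?thesis unfolding sum eq ..
    qed
    also have "... \<le> (pi / 4) * (\<Sum>m=1..j. \<integral>t. (y' j m t)\<^sup>2 \<partial>lebesgue_on (T j))"
      unfolding T_def by (intro mult_left_mono sum_mono y'_middle_mass j) simp
    finally show "(pi * \<epsilon>\<^sup>2 / 2560) * (1 / real (j + 1)) \<le> (\<integral>t. indicator (T j) t * E j t \<partial>unit_time)" unfolding eq .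
  qed
  have "(\<Sum>j=1..n. (pi * \<epsilon>\<^sup>2 / 2560) * (1 / real (j + 1))) \<le> enn2real Q" for n
  proof -
    have Li: "integrable unit_time (L n)" unfolding L_def[abs_def] by (rule Bochner_Integration.integrable_sum) (simp add: part(1))
    have Ln: "0 \<le> L n t" for t unfolding L_def by (intro sum_nonneg mult_nonneg_nonneg E0) simp
    have "(\<Sum>j=1..n. (pi * \<epsilon>\<^sup>2 / 2560) * (1 / real (j + 1))) \<le> (\<Sum>j=1..n. \<integral>t. indicator (T j) t * E j t \<partial>unit_time)" by (intro sum_mono part(2)) simp
    also have "... = (\<integral>t. L n t \<partial>unit_time)" unfolding L_def by (rule Bochner_Integration.integral_sum[symmetric]) (simp add: part(1))
    also have "... = enn2real (\<integral>\<^sup>+t. ennreal (L n t) \<partial>unit_time)" by (rule integral_eq_nn_integral) (use Li Ln in auto)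
    also have "... \<le> enn2real Q"
    proof (rule enn2real_mono)
      show "(\<integral>\<^sup>+t. ennreal (L n t) \<partial>unit_time) \<le> Q"
        unfolding Q_def by (rule nn_integral_mono_AE) (use L_le[of n] in eventually_elim, auto intro: ennreal_leI)
    qed (use Q in simp)
    finally show ?thesis .
  qed
  then have bound: "(\<Sum>j=1..n. 1 / real (j + 1)) \<le> enn2real Q / (pi * \<epsilon>\<^sup>2 / 2560)" for n
    unfolding sum_distrib_left[symmetric] using \<epsilon> by (subst pos_le_divide_eq) (simp_all add: mult.commute)
  have "summable (\<lambda>k. 1 / real (Suc (Suc k)))"
  proof (rule summableI_nonneg_bounded)
    fix n
    have "(\<Sum>k<n. 1 / real (Suc (Suc k))) = (\<Sum>j=1..n. 1 / real (j + 1))" by (rule sum.reindex_bij_witness[of _ "\<lambda>j. j - 1" Suc]) auto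
    then show "(\<Sum>k<n. 1 / real (Suc (Suc k))) \<le> enn2real Q / (pi * \<epsilon>\<^sup>2 / 2560)" using bound by simp
  qed simp
  then have "summable (\<lambda>n. inverse (real n))" by (subst summable_iff_shift[of _ 2, symmetric]) (simp add: inverse_eq_divide)
  then show False using not_summable_harmonic[where 'a = real] by simp
qed

end

theorem proposition6p2:
  fixes \<epsilon> :: real and \<eta> \<rho> :: "real \<Rightarrow> real"
  assumes "0 < \<epsilon>" and "\<epsilon> \<le> 1"
    and "\<eta> \<in> test_functions {0<..<1}"
    and "\<And>s. 0 \<le> \<eta> s \<and> \<eta> s \<le> 1"
    and "closure {s. \<eta> s \<noteq> 0} \<subseteq> {1/10..9/10}"
    and "\<And>s. s \<in> {1/3..2/3} \<Longrightarrow> \<eta> s = 1"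
    and "\<rho> \<in> test_functions {0<..<1}"
    and "\<And>s. s \<in> {1/4..1/2} \<Longrightarrow> \<rho> s = 1"
  shows "is_Lions_solution (coeff_a \<epsilon> \<eta>)
           (\<lambda>t. E0 (forcing \<epsilon> \<eta> \<rho> t)) (\<lambda>t. E0 (u_sol \<epsilon> \<eta> \<rho> t))
       \<and> bounded ((\<lambda>(t, x). coeff_a \<epsilon> \<eta> t x) ` ({0..1} \<times> UNIV))
       \<and> uniformly_elliptic (coeff_a \<epsilon> \<eta>)
       \<and> Holder_Linf (1/2) (coeff_a \<epsilon> \<eta>)
       \<and> \<not> (\<exists>g\<in>L2_time (L2 UNIV) (L2_norm UNIV).
              has_weak_time_derivative H1_line
                (\<lambda>t. L2_inner UNIV (E0 (u_sol \<epsilon> \<eta> \<rho> t))) (\<lambda>t. L2_inner UNIV (g t)))"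
proof -
  interpret construction \<eta> \<epsilon> \<rho> by unfold_locales (use assms in auto)
  show ?thesis using Lions_solution_u coeff_bounded coeff_elliptic coeff_Holder_Linf time_derivative_not_L2 unfolding u_sol_emb by blast
qed

end
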